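(* Let $H$ be a closed densely defined operator on a Banach space $\mathcal{B}$ with spectrum $\sigma(H)\subset[0,\infty)$, whose resolvent operators $(z-H)^{-1}$ are defined and bounded for all $z\in\mathbb{C}\setminus\mathbb{R}$ and satisfy $$\|(z-H)^{-1}\|\le c\,|\mathrm{Im}\, z|^{-1}\left(\frac{\langle z\rangle}{|\mathrm{Im}\, z|}\right)^{\alpha}$$ for some constants $c>0$, $\alpha\ge 0$ and all $z\notin\mathbb{R}$. Then there is a functional calculus $\gamma_H:\mathcal{A}^+\to \mathbf{B}(\mathcal{B})$ (in the sense specified in the context), where $\mathbf{B}(\mathcal{B})$ is the algebra of bounded linear operators on $\mathcal{B}$, such that for every $f\in\mathcal{A}$, with restriction $f|_{[0,\infty)}\in\mathcal{A}^+$, $$\gamma_H\big(f|_{[0,\infty)}\big)=-\frac1\pi\iint_{\mathbb{C}}\frac{\partial\tilde f}{\partial\bar z}\,(z-H)^{-1}\,dx\,dy .$$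
   Context: Notation: $\langle z\rangle:=(1+|z|^2)^{1/2}$ for $z\in\mathbb{C}$. For $\beta\in\mathbb{R}$, $S^\beta$ is the set of smooth $f:\mathbb{R}\to\mathbb{C}$ such that for every integer $n\ge0$ there is $c_n>0$ with $|f^{(n)}(x)|\le c_n\langle x\rangle^{\beta-n}$ for all $x\in\mathbb{R}$; $\mathcal{A}:=\bigcup_{\beta<0}S^\beta$. Similarly $S^\beta_+$ is the set of smooth $f:[0,\infty)\to\mathbb{C}$ (smooth up to the endpoint $0$) such that for every $n\ge 0$ there is $c_n>0$ with $|f^{(n)}(x)|\le c_n\langle x\rangle^{\beta-n}$ for all $x\ge0$; $\mathcal{A}^+:=\bigcup_{\beta<0}S^\beta_+$. Both are algebras under pointwise operations. On $\mathcal{A}^+$ define, for each integer $n\ge 0$, the norm $\|f\|_{\mathcal{A}^+_n}:=\sum_{r=0}^n\int_0^\infty|f^{(r)}(x)|\langle x\rangle^{r-1}dx$. Almost analytic extension: let $\psi$ be a smooth compactly supported function on $\mathbb{R}$ with $\psi(s)=1$ for $|s|\le1$ and $\psi(s)=0$ for $|s|\ge2$, and set $\sigma(x,y):=\psi(y/\langle x\rangle)$. For $f\in\mathcal{A}$ and an integer $n>\alpha$, $$\tilde f(x,y):=\Big(\sum_{r=0}^n f^{(r)}(x)\frac{(iy)^r}{r!}\Big)\sigma(x,y),\qquad \frac{\partial\tilde f}{\partial\bar z}:=\frac12\Big(\frac{\partial\tilde f}{\partial x}+i\frac{\partial\tilde f}{\partial y}\Big),\quad z=x+iy.$$ Under the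 resolvent hypothesis and $n>\alpha$ it is known (Davies) that the integral $-\frac1\pi\iint_{\mathbb{C}}\frac{\partial\tilde f}{\partial\bar z}(z-H)^{-1}dx\,dy$ is norm convergent and independent of $n>\alpha$ and of the cut-off $\sigma$. "Functional calculus" $\gamma_H:\mathcal{A}^+\to\mathbf{B}(\mathcal{B})$ means: $\gamma_H$ is linear; $\gamma_H(fg)=\gamma_H(f)\gamma_H(g)$ for all $f,g\in\mathcal{A}^+$; for each integer $n>\alpha$ there is a constant $C$ with $\|\gamma_H(f)\|\le C\|f\|_{\mathcal{A}^+_{n+1}}$ for all $f\in\mathcal{A}^+$; if $f\in\mathcal{A}^+$ has compact support disjoint from $\sigma(H)$ then $\gamma_H(f)=0$; and for $z\notin\mathbb{R}$ the function $g_z(x)=(z-x)^{-1}$ on $[0,\infty)$ satisfies $\gamma_H(g_z)=(z-H)^{-1}$. *)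

theory Defs
  imports "HOL-Analysis.Analysis"
begin

class scaleC =
  fixes scaleC :: "complex \<Rightarrow> 'a \<Rightarrow> 'a"  (infixr \<open>*\<^sub>C\<close> 75)

class complex_banach = banach + scaleC +
  assumes scaleC_add_right: "a *\<^sub>C (x + y) = a *\<^sub>C x + a *\<^sub>C y"
    and scaleC_add_left: "(a + b) *\<^sub>C x = a *\<^sub>C x + b *\<^sub>C x"
    and scaleC_scaleC: "a *\<^sub>C (b *\<^sub>C x) = (a * b) *\<^sub>C x"
    and scaleR_scaleC: "r *\<^sub>R x = complex_of_real r *\<^sub>C x"
    and norm_scaleC: "norm (a *\<^sub>C x) = cmod a * norm x"

instantiation complex :: complex_banach
begin

definition scaleC_complex :: "complex \<Rightarrow> complex \<Rightarrow> complex" where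
  "scaleC_complex a x = a * x"

instance
  by standard
     (simp_all add: scaleC_complex_def distrib_left distrib_right mult.assoc norm_mult
       scaleR_conv_of_real)

end

lemma bounded_linear_scaleC_right: "bounded_linear (\<lambda>x::'a::complex_banach. a *\<^sub>C x)"
proof (rule bounded_linear_intro[where K = "cmod a"])
  fix x y :: 'a and r :: real
  show "a *\<^sub>C (x + y) = a *\<^sub>C x + a *\<^sub>C y"
    by (rule scaleC_add_right)
  show "a *\<^sub>C (r *\<^sub>R x) = r *\<^sub>R (a *\<^sub>C x)"
    by (simp only: scaleR_scaleC scaleC_scaleC mult.commute)
  show "norm (a *\<^sub>C x) \<le> norm x * cmod a"
    by (simp add: norm_scaleC mult.commute)
qed

text \<open>
  The library type \<open>'a \<Rightarrow>\<^sub>L 'b\<close> consists of the real-linear bounded maps. It is itself a complex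
  Banach space when \<open>'b\<close> is one, and the algebra of bounded (complex-linear) operators on \<open>'b\<close>
  is the closed subalgebra \<open>bounded_ops\<close> of \<open>'b \<Rightarrow>\<^sub>L 'b\<close>, with the same norm.
\<close>

instantiation blinfun :: (real_normed_vector, complex_banach) complex_banach
begin

definition scaleC_blinfun :: "complex \<Rightarrow> ('a \<Rightarrow>\<^sub>L 'b) \<Rightarrow> 'a \<Rightarrow>\<^sub>L 'b" where
  "scaleC_blinfun a T = Blinfun (\<lambda>x. a *\<^sub>C blinfun_apply T x)"

lemma blinfun_apply_scaleC:
  "blinfun_apply (a *\<^sub>C T) x = a *\<^sub>C blinfun_apply T x" for T :: "'a \<Rightarrow>\<^sub>L 'b"
  unfolding scaleC_blinfun_def
  by (subst bounded_linear_Blinfun_apply)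
     (intro bounded_linear_compose[OF bounded_linear_scaleC_right] blinfun.bounded_linear_right refl)+

instance
proof
  fix a b :: complex and r :: real and T U :: "'a \<Rightarrow>\<^sub>L 'b"
  show "a *\<^sub>C (T + U) = a *\<^sub>C T + a *\<^sub>C U"
    by (rule blinfun_eqI) (simp add: blinfun_apply_scaleC blinfun.add_left scaleC_add_right)
  show "(a + b) *\<^sub>C T = a *\<^sub>C T + b *\<^sub>C T"
    by (rule blinfun_eqI) (simp add: blinfun_apply_scaleC blinfun.add_left scaleC_add_left)
  show "a *\<^sub>C (b *\<^sub>C T) = (a * b) *\<^sub>C T"
    by (rule blinfun_eqI) (simp add: blinfun_apply_scaleC scaleC_scaleC)
  show "r *\<^sub>R T = complex_of_real r *\<^sub>C T"
    by (rule blinfun_eqI) (simp add: blinfun_apply_scaleC blinfun.scaleR_left flip: scaleR_scaleC)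
  have le: "norm (c *\<^sub>C S) \<le> cmod c * norm S" for c and S :: "'a \<Rightarrow>\<^sub>L 'b"
    by (rule norm_blinfun_bound)
       (auto simp: blinfun_apply_scaleC norm_scaleC mult.assoc intro!: mult_left_mono norm_blinfun)
  show "norm (a *\<^sub>C T) = cmod a * norm T"
  proof (cases "a = 0")
    case True
    with le[of a T] show ?thesis by simp
  next
    case False
    have "norm (inverse a *\<^sub>C (a *\<^sub>C T)) \<le> cmod (inverse a) * norm (a *\<^sub>C T)"
      by (rule le)
    moreover have "inverse a *\<^sub>C (a *\<^sub>C T) = T"
    proof (rule blinfun_eqI)
      fix x
      have "1 *\<^sub>C blinfun_apply T x = blinfun_apply T x"
        using scaleR_scaleC[of 1 "blinfun_apply T x"] by simp
      with False show "blinfun_apply (inverse a *\<^sub>C (a *\<^sub>C T)) x = blinfun_apply T x"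
        by (simp add: blinfun_apply_scaleC scaleC_scaleC)
    qed
    ultimately have "cmod a * norm T \<le> norm (a *\<^sub>C T)"
      using False by (simp add: norm_inverse norm_divide field_simps)
    with le[of a T] show ?thesis by simp
  qed
qed

end

definition bounded_ops :: "('b::complex_banach \<Rightarrow>\<^sub>L 'b) set" where
  "bounded_ops = {T. \<forall>a x. blinfun_apply T (a *\<^sub>C x) = a *\<^sub>C blinfun_apply T x}"

text \<open>
  An unbounded operator is a pair of a domain \<open>D\<close> and a function \<open>H\<close> whose values outside \<open>D\<close>
  are irrelevant.
\<close>

definition linear_operator :: "'b set \<Rightarrow> ('b::complex_banach \<Rightarrow> 'b) \<Rightarrow> bool" where
  "linear_operator D H \<longleftrightarrow>
     0 \<in> D \<and>
     (\<forall>x\<in>D. \<forall>y\<in>D. x + y \<in> D \<and> H (x + y) = H x + H y) \<and>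
     (\<forall>a. \<forall>x\<in>D. a *\<^sub>C x \<in> D \<and> H (a *\<^sub>C x) = a *\<^sub>C H x)"

definition densely_defined :: "'b::complex_banach set \<Rightarrow> bool" where
  "densely_defined D \<longleftrightarrow> closure D = UNIV"

definition closed_operator :: "'b set \<Rightarrow> ('b::complex_banach \<Rightarrow> 'b) \<Rightarrow> bool" where
  "closed_operator D H \<longleftrightarrow> closed ((\<lambda>x. (x, H x)) ` D)"

definition resolvent_set :: "'b set \<Rightarrow> ('b::complex_banach \<Rightarrow> 'b) \<Rightarrow> complex set" where
  "resolvent_set D H =
     {z. bij_betw (\<lambda>x. z *\<^sub>C x - H x) D UNIV \<and>
         bounded_linear (inv_into D (\<lambda>x. z *\<^sub>C x - H x))}"

definition spectrum :: "'b set \<Rightarrow> ('b::complex_banach \<Rightarrow> 'b) \<Rightarrow> complex set" where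
  "spectrum D H = - resolvent_set D H"

text \<open>\<open>(z - H)\<^sup>-\<^sup>1\<close>; only meaningful for \<open>z \<in> resolvent_set D H\<close>.\<close>

definition resolvent :: "'b set \<Rightarrow> ('b::complex_banach \<Rightarrow> 'b) \<Rightarrow> complex \<Rightarrow> 'b \<Rightarrow>\<^sub>L 'b" where
  "resolvent D H z = Blinfun (inv_into D (\<lambda>x. z *\<^sub>C x - H x))"

definition jbracket :: "'a::real_normed_vector \<Rightarrow> real" where
  "jbracket z = sqrt (1 + (norm z)\<^sup>2)"

text \<open>
  Iterated derivatives within \<open>S\<close>. For \<open>S = {0..}\<close> the derivatives at \<open>0\<close> are one-sided, so
  \<open>smooth_on {0..}\<close> is smoothness up to the endpoint.
\<close>

primrec nderiv :: "real set \<Rightarrow> nat \<Rightarrow> (real \<Rightarrow> complex) \<Rightarrow> real \<Rightarrow> complex" where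
  "nderiv S 0 f = f"
| "nderiv S (Suc n) f = (\<lambda>x. vector_derivative (nderiv S n f) (at x within S))"

definition smooth_on :: "real set \<Rightarrow> (real \<Rightarrow> complex) \<Rightarrow> bool" where
  "smooth_on S f \<longleftrightarrow> (\<forall>n. \<forall>x\<in>S. nderiv S n f differentiable (at x within S))"

definition symb :: "real set \<Rightarrow> real \<Rightarrow> (real \<Rightarrow> complex) \<Rightarrow> bool" where
  "symb S \<beta> f \<longleftrightarrow>
     smooth_on S f \<and>
     (\<forall>n. \<exists>c>0. \<forall>x\<in>S. cmod (nderiv S n f x) \<le> c * jbracket x powr (\<beta> - real n))"

definition alg :: "(real \<Rightarrow> complex) set" where
  "alg = (\<Union>\<beta>\<in>{..<0}. {f. symb UNIV \<beta> f})"

text \<open>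
  Functions on \<open>[0,\<infinity>)\<close> are represented by their extensions by \<open>0\<close> to the whole line; this
  representation is unique and compatible with the pointwise operations.
\<close>

definition restr :: "(real \<Rightarrow> complex) \<Rightarrow> real \<Rightarrow> complex" where
  "restr f = (\<lambda>x. if 0 \<le> x then f x else 0)"

definition alg_plus :: "(real \<Rightarrow> complex) set" where
  "alg_plus = (\<Union>\<beta>\<in>{..<0}. {f. symb {0..} \<beta> f \<and> (\<forall>x<0. f x = 0)})"

definition alg_plus_norm :: "nat \<Rightarrow> (real \<Rightarrow> complex) \<Rightarrow> real" where
  "alg_plus_norm n f =
     (\<Sum>r\<le>n. integral {0..} (\<lambda>x. cmod (nderiv {0..} r f x) * jbracket x powr (real r - 1)))"

definition functional_calculus ::
  "'b set \<Rightarrow> ('b::complex_banach \<Rightarrow> 'b) \<Rightarrow> real \<Rightarrow> ((real \<Rightarrow> complex) \<Rightarrow> 'b \<Rightarrow>\<^sub>L 'b) \<Rightarrow> bool" where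
  "functional_calculus D H \<alpha> \<gamma> \<longleftrightarrow>
     (\<forall>f\<in>alg_plus. \<gamma> f \<in> bounded_ops) \<and>
     (\<forall>f\<in>alg_plus. \<forall>g\<in>alg_plus. \<gamma> (\<lambda>x. f x + g x) = \<gamma> f + \<gamma> g) \<and>
     (\<forall>a. \<forall>f\<in>alg_plus. \<gamma> (\<lambda>x. a * f x) = a *\<^sub>C \<gamma> f) \<and>
     (\<forall>f\<in>alg_plus. \<forall>g\<in>alg_plus. \<gamma> (\<lambda>x. f x * g x) = \<gamma> f o\<^sub>L \<gamma> g) \<and>
     (\<forall>n::nat. real n > \<alpha> \<longrightarrow>
        (\<exists>C. \<forall>f\<in>alg_plus. norm (\<gamma> f) \<le> C * alg_plus_norm (n + 1) f)) \<and>
     (\<forall>f\<in>alg_plus.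
        compact (closure {x. f x \<noteq> 0}) \<and>
        complex_of_real ` closure {x. f x \<noteq> 0} \<inter> spectrum D H = {} \<longrightarrow> \<gamma> f = 0) \<and>
     (\<forall>z. z \<notin> \<real> \<longrightarrow> \<gamma> (restr (\<lambda>x. 1 / (z - complex_of_real x))) = resolvent D H z)"

text \<open>The last clause entails that the support is compact.\<close>

definition cutoff :: "(real \<Rightarrow> complex) \<Rightarrow> bool" where
  "cutoff \<psi> \<longleftrightarrow>
     smooth_on UNIV \<psi> \<and> (\<forall>s. \<bar>s\<bar> \<le> 1 \<longrightarrow> \<psi> s = 1) \<and> (\<forall>s. \<bar>s\<bar> \<ge> 2 \<longrightarrow> \<psi> s = 0)"

definition aa_ext ::
  "(real \<Rightarrow> complex) \<Rightarrow> nat \<Rightarrow> (real \<Rightarrow> complex) \<Rightarrow> real \<Rightarrow> real \<Rightarrow> complex" where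
  "aa_ext \<psi> n f x y =
     (\<Sum>r\<le>n. nderiv UNIV r f x * (\<i> * complex_of_real y) ^ r / fact r) * \<psi> (y / jbracket x)"

definition dbar :: "(real \<Rightarrow> real \<Rightarrow> complex) \<Rightarrow> complex \<Rightarrow> complex" where
  "dbar F z =
     (1 / 2) * (vector_derivative (\<lambda>x. F x (Im z)) (at (Re z)) +
                \<i> * vector_derivative (\<lambda>y. F (Re z) y) (at (Im z)))"

text \<open>
  On the spectrum, part of the real axis, the value of \<open>resolvent\<close> is arbitrary; this does not
  affect the integral over the plane, since the axis is a null set.
\<close>

definition hs_integrand ::
  "'b set \<Rightarrow> ('b::complex_banach \<Rightarrow> 'b) \<Rightarrow> (real \<Rightarrow> complex) \<Rightarrow> nat \<Rightarrow> (real \<Rightarrow> complex)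
     \<Rightarrow> complex \<Rightarrow> 'b \<Rightarrow>\<^sub>L 'b" where
  "hs_integrand D H \<psi> n f z = dbar (aa_ext \<psi> n f) z *\<^sub>C resolvent D H z"

text \<open>
  The Bochner integral of the library needs a second countable range, which a space of operators
  is not in general. Integrals are therefore Henstock--Kurzweil integrals, together with
  integrability of the norm.
\<close>

definition norm_convergent :: "(complex \<Rightarrow> 'c::real_normed_vector) \<Rightarrow> bool" where
  "norm_convergent F \<longleftrightarrow> F integrable_on UNIV \<and> (\<lambda>z. norm (F z)) integrable_on UNIV"

end

theory Submission
  imports Defs
begin

text \<open>
  Replace \<open>f\<close> on \<open>[0,\<infinity>)\<close> by a reflected \<open>C\<^sup>n\<^sup>+\<^sup>1\<close> extension to the line, whose norm is controlled by
  the norm of \<open>f\<close>, and let \<open>\<gamma>(f)\<close> be the Helffer--Sjoestrand integral of this extension. For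
  compactly supported \<open>h\<close>, Green's theorem in the two half planes, applied with the shifted
  resolvents \<open>R(z \<plusminus> i\<epsilon>)\<close> of \<open>R(z) = (z - H)\<^sup>-\<^sup>1\<close>, turns that integral into the limit of the Stone integrals
  \<open>(2\<pi>i)\<^sup>-\<^sup>1 \<integral> h(t) (R(t - i\<epsilon>) - R(t + i\<epsilon>)) dt\<close>. This limit depends neither on \<open>n\<close> nor on the
  cut-off, and it vanishes if the support of \<open>h\<close> avoids the spectrum; hence \<open>\<gamma>(f)\<close> does not depend
  on the extension. With \<open>g\<^sub>w(x) = (w - x)\<^sup>-\<^sup>1\<close>, the resolvent identity gives \<open>R(w) \<gamma>(g) = \<gamma>(g\<^sub>w g)\<close>; integrating this
  against the Stone kernel of \<open>f\<close> gives \<open>\<gamma>(P\<^sub>\<epsilon> f \<cdot> g)\<close> with the Poisson mean \<open>P\<^sub>\<epsilon> f\<close>, and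
  \<open>\<epsilon> \<rightarrow> 0\<close> yields multiplicativity. For a cut-off \<open>\<chi>\<close>, rescaling gives \<open>\<gamma>(\<chi>(\<cdot>/k)) R(-1) \<rightarrow> R(-1)\<close>, which
  normalises \<open>\<gamma>(g\<^sub>w) = R(w)\<close>.
\<close>

section \<open>Integration in the plane\<close>

text \<open>The bound on R(z) blows up like |Im z|^(-1-\<alpha>), so boundary values need not exist,
  and the Stone integrals are not controlled by the sup norm of h uniformly in the shift. What helps
  is that dbar of the extension vanishes to order n > \<alpha> on the axis: all shifted integrands
  share one integrable majorant. \<open>stone_approx\<close> thus gives a rate that is linear in a
  bound on n+1 derivatives of h and otherwise independent of h. This uniformity justifies the
  exchange of limit and integral behind multiplicativity, where Fubini is applied only on the line,
  to continuous integrands. Reflections and cut-offs have finitely many derivatives, so functions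
  are handled as jets: finite lists of explicit derivatives. The cut-off \<psi>(y / sqrt(s^2 + x^2))
  has a scale s. For s = k+1 the dbar derivative of the extension of \<chi>(x/s) lives at |z| >= s,
  while its weighted mass stays bounded; so the error in the normalisation is O(1/k). Density of the
  domain enters there, to pass from the range of R(-1) to the whole space.\<close>

lemma has_integral_UNIV_twiddle:
  fixes f :: "'a::euclidean_space \<Rightarrow> 'c::banach" and g :: "'b::euclidean_space \<Rightarrow> 'a"
  assumes f: "(f has_integral i) UNIV"
    and hg: "\<And>x. h (g x) = x" and gh: "\<And>x. g (h x) = x"
    and nrm: "\<And>x. norm (g x) = norm x"
    and cont: "\<And>x. continuous (at x) g"
    and gbox: "\<And>u v. \<exists>w z. g ` cbox u v = cbox w z"
    and hbox: "\<And>u v. \<exists>w z. h ` cbox u v = cbox w z"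
    and cnt: "\<And>u v. measure lborel (g ` cbox u v) = measure lborel (cbox u v)"
  shows "((\<lambda>x. f (g x)) has_integral i) UNIV"
proof -
  have nb: "\<nexists>a b::'b. UNIV = cbox a b"
    by (metis bounded_cbox not_bounded_UNIV)
  have "\<forall>e>0. \<exists>B>0. \<forall>a b. ball 0 B \<subseteq> cbox a b \<longrightarrow>
        (\<exists>z. ((\<lambda>x. f (g x)) has_integral z) (cbox a b) \<and> norm (z - i) < e)"
  proof (intro impI allI)
    fix e :: real assume "e > 0"
    have nb': "\<nexists>a b::'a. UNIV = cbox a b"
      by (metis bounded_cbox not_bounded_UNIV)
    from has_integral_altD[OF f nb' \<open>e > 0\<close>] obtain B where B: "B > 0"
      "\<And>a b. ball 0 B \<subseteq> cbox a b \<Longrightarrow> \<exists>z. (f has_integral z) (cbox a b) \<and> norm (z - i) < e"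
      by auto
    show "\<exists>B>0. \<forall>a b. ball 0 B \<subseteq> cbox a b \<longrightarrow>
        (\<exists>z. ((\<lambda>x. f (g x)) has_integral z) (cbox a b) \<and> norm (z - i) < e)"
    proof (intro exI[of _ B] conjI allI impI B(1))
      fix a b :: 'b assume ab: "ball 0 B \<subseteq> cbox a b"
      obtain w z where wz: "g ` cbox a b = cbox w z" using gbox by blast
      \<comment> \<open>Both maps preserve norms, so a box around a ball has as image a box around
        the ball of the same radius, and the \<open>B\<close> found for \<open>f\<close> serves for
        the composition.\<close>
      have "ball 0 B \<subseteq> g ` cbox a b"
      proof
        fix x :: 'a assume "x \<in> ball 0 B"
        then have "h x \<in> ball 0 B" using nrm[of "h x"] gh by simp
        then show "x \<in> g ` cbox a b" using ab gh by (metis image_eqI subsetD)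
      qed
      then obtain zz where zz: "(f has_integral zz) (cbox w z)" "norm (zz - i) < e"
        using B(2) wz by blast
      have "h ` cbox w z = cbox a b"
        unfolding wz[symmetric] by (simp add: image_image hg)
      then have "((\<lambda>x. f (g x)) has_integral zz) (cbox a b)"
        using has_integral_twiddle[OF _ hg gh cont gbox hbox _ zz(1), of 1] cnt by simp
      then show "\<exists>z. ((\<lambda>x. f (g x)) has_integral z) (cbox a b) \<and> norm (z - i) < e"
        using zz by blast
    qed
  qed
  then show ?thesis by (subst has_integral_alt) (simp only: nb if_False UNIV_I if_True)
qed

section \<open>The complex plane as pairs of reals\<close>

lemma Complex_image_cbox: "(\<lambda>p. Complex (fst p) (snd p)) ` cbox u v = cbox (Complex (fst u) (snd u)) (Complex (fst v) (snd v))"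
proof -
  have "z \<in> (\<lambda>p. Complex (fst p) (snd p)) ` cbox u v"
    if "z \<in> cbox (Complex (fst u) (snd u)) (Complex (fst v) (snd v))" for z
    using that by (intro image_eqI[where x = "(Re z, Im z)"])
      (auto simp: in_cbox_complex_iff cbox_Pair_eq[of "fst u" "snd u" "fst v" "snd v", simplified])
  then show ?thesis
    by (auto simp: in_cbox_complex_iff cbox_Pair_eq[of "fst u" "snd u" "fst v" "snd v", simplified])
qed

lemma Re_Im_image_cbox: "(\<lambda>z. (Re z, Im z)) ` cbox u v = cbox (Re u, Im u) (Re v, Im v)"
proof -
  have "p \<in> (\<lambda>z. (Re z, Im z)) ` cbox u v" if "p \<in> cbox (Re u, Im u) (Re v, Im v)" for p
    using that by (intro image_eqI[where x = "Complex (fst p) (snd p)"])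
      (auto simp: in_cbox_complex_iff cbox_Pair_eq)
  then show ?thesis
    by (auto simp: in_cbox_complex_iff cbox_Pair_eq)
qed

lemma content_cbox_complex:
  "measure lborel (cbox u v :: complex set) = measure lborel (cbox (Re u, Im u) (Re v, Im v))"
proof (cases "Re u \<le> Re v \<and> Im u \<le> Im v")
  case True
  then show ?thesis
    by (simp add: content_Pair content_cbox_if[of u v] content_real Basis_complex_def box_eq_empty)
next
  case False
  then have "cbox u v = {}" "cbox (Re u, Im u) (Re v, Im v) = {}"
    by (auto simp: box_eq_empty Basis_complex_def Basis_prod_def)
  then show ?thesis by simp
qed

lemma isCont_Complex: "isCont (\<lambda>p. Complex (fst p) (snd p)) x"
  unfolding Complex_eq by (intro continuous_intros)

text \<open>The theorem integrates over \<open>complex\<close>, while the proof works on pairs of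
  reals, where iterated integrals are available. The coordinate maps are isometries that take boxes
  to boxes of the same content.\<close>

lemma has_integral_complex_iff:
  fixes f :: "complex \<Rightarrow> 'c::banach"
  shows "(f has_integral I) UNIV \<longleftrightarrow> ((\<lambda>p. f (Complex (fst p) (snd p))) has_integral I) UNIV"
proof
  assume f: "(f has_integral I) UNIV"
  show "((\<lambda>p. f (Complex (fst p) (snd p))) has_integral I) UNIV"
    by (rule has_integral_UNIV_twiddle[OF f, where h = "\<lambda>z. (Re z, Im z)"])
       (auto simp: Complex_image_cbox Re_Im_image_cbox content_cbox_complex norm_prod_def cmod_def
          isCont_Complex intro!: continuous_intros)
next
  assume f: "((\<lambda>p. f (Complex (fst p) (snd p))) has_integral I) UNIV"
  have "((\<lambda>z. f (Complex (fst (Re z, Im z)) (snd (Re z, Im z)))) has_integral I) UNIV"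
    by (rule has_integral_UNIV_twiddle[OF f, where h = "\<lambda>p. Complex (fst p) (snd p)"])
       (auto simp: Complex_image_cbox Re_Im_image_cbox content_cbox_complex norm_prod_def cmod_def
          isCont_Complex intro!: continuous_intros)
  then show "(f has_integral I) UNIV" by simp
qed

text \<open>Riemann sums of \<open>f\<close> and \<open>f'\<close> over the same tagged division
  differ by at most the Riemann sum of \<open>h\<close>, which is close to a small integral. So the
  Cauchy criterion passes from \<open>f'\<close> to \<open>f\<close>, for values in any Banach
  space.\<close>

lemma integrable_on_cbox_approx:
  fixes f :: "'a::euclidean_space \<Rightarrow> 'c::banach"
  assumes "\<And>e::real. e > 0 \<Longrightarrow> \<exists>f' h. f' integrable_on cbox a b \<and> h integrable_on cbox a b \<and>
      (\<forall>x\<in>cbox a b. norm (f x - f' x) \<le> h x) \<and> integral (cbox a b) h < e"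
  shows "f integrable_on cbox a b"
  unfolding integrable_Cauchy
proof (intro allI impI)
  fix e :: real assume "e > 0"
  then obtain f' h where f': "f' integrable_on cbox a b" and h: "h integrable_on cbox a b"
    and fh: "\<And>x. x \<in> cbox a b \<Longrightarrow> norm (f x - f' x) \<le> h x" and ih: "integral (cbox a b) h < e / 8"
    using assms[of "e/8"] by auto
  from f' obtain g1 where g1: "gauge g1"
    "\<And>p1 p2. p1 tagged_division_of cbox a b \<Longrightarrow> g1 fine p1 \<Longrightarrow>
       p2 tagged_division_of cbox a b \<Longrightarrow> g1 fine p2 \<Longrightarrow>
       norm ((\<Sum>(x,k)\<in>p1. measure lborel k *\<^sub>R f' x) - (\<Sum>(x,k)\<in>p2. measure lborel k *\<^sub>R f' x)) < e / 4"
    unfolding integrable_Cauchy using \<open>e > 0\<close> by (metis divide_pos_pos zero_less_numeral)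
  from integrable_integral[OF h] obtain g2 where g2: "gauge g2"
    "\<And>p. p tagged_division_of cbox a b \<Longrightarrow> g2 fine p \<Longrightarrow>
       norm ((\<Sum>(x,k)\<in>p. measure lborel k *\<^sub>R h x) - integral (cbox a b) h) < e / 8"
    unfolding has_integral using \<open>e > 0\<close> by (metis divide_pos_pos zero_less_numeral)
  have key: "norm ((\<Sum>(x,k)\<in>p. measure lborel k *\<^sub>R f x) - (\<Sum>(x,k)\<in>p. measure lborel k *\<^sub>R f' x)) < e / 4"
    if p: "p tagged_division_of cbox a b" "g2 fine p" for p
  proof -
    have "(\<Sum>(x,k)\<in>p. measure lborel k *\<^sub>R f x) - (\<Sum>(x,k)\<in>p. measure lborel k *\<^sub>R f' x)
        = (\<Sum>(x,k)\<in>p. measure lborel k *\<^sub>R (f x - f' x))"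
      by (simp add: sum_subtractf[symmetric] split_def scaleR_diff_right)
    also have "norm \<dots> \<le> (\<Sum>(x,k)\<in>p. measure lborel k *\<^sub>R h x)"
    proof (rule sum_norm_le, clarsimp)
      fix x k assume "(x, k) \<in> p"
      then have "x \<in> cbox a b" using p(1) by (meson tag_in_interval)
      then show "measure lborel k * norm (f x - f' x) \<le> measure lborel k * h x"
        using fh by (intro mult_left_mono) auto
    qed
    also have "\<dots> < e / 4" using g2(2)[OF p] ih by (auto simp: abs_real_def split: if_splits)
    finally show ?thesis .
  qed
  show "\<exists>\<gamma>. gauge \<gamma> \<and>
      (\<forall>p1 p2. p1 tagged_division_of cbox a b \<and> \<gamma> fine p1 \<and> p2 tagged_division_of cbox a b \<and> \<gamma> fine p2 \<longrightarrow>
        norm ((\<Sum>(x,k)\<in>p1. measure lborel k *\<^sub>R f x) - (\<Sum>(x,k)\<in>p2. measure lborel k *\<^sub>R f x)) < e)"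
  proof (intro exI conjI allI impI)
    show "gauge (\<lambda>x. g1 x \<inter> g2 x)" using g1(1) g2(1) by (rule gauge_Int)
    fix p1 p2 assume "p1 tagged_division_of cbox a b \<and> (\<lambda>x. g1 x \<inter> g2 x) fine p1 \<and>
      p2 tagged_division_of cbox a b \<and> (\<lambda>x. g1 x \<inter> g2 x) fine p2"
    then have p: "p1 tagged_division_of cbox a b" "g1 fine p1" "g2 fine p1"
       "p2 tagged_division_of cbox a b" "g1 fine p2" "g2 fine p2"
      by (auto simp: fine_Int)
    let ?S = "\<lambda>f p. (\<Sum>(x,k)\<in>p. measure lborel k *\<^sub>R f x)"
    have eq: "?S f p1 - ?S f p2 = (?S f p1 - ?S f' p1) + (?S f' p1 - ?S f' p2) - (?S f p2 - ?S f' p2)"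
      by simp
    have "norm (?S f p1 - ?S f p2) \<le> norm (?S f p1 - ?S f' p1) + norm (?S f' p1 - ?S f' p2) + norm (?S f p2 - ?S f' p2)"
      unfolding eq by (intro norm_triangle_le_diff norm_triangle_le add_mono order_refl)
    also have "\<dots> < e / 4 + e / 4 + e / 4"
      using key[OF p(1,3)] key[OF p(4,6)] g1(2)[OF p(1,2,4,5)] by linarith
    also have "\<dots> \<le> e" using \<open>e > 0\<close> by simp
    finally show "norm (?S f p1 - ?S f p2) < e" .
  qed
qed

text \<open>Boxes are covered by the previous lemma. Over every box the integrals of
  \<open>f\<close> and \<open>f'\<close> differ by at most the small integral of \<open>h\<close>,
  so the Cauchy property along growing boxes passes to \<open>f\<close> as well.\<close>

lemma integrable_on_UNIV_approx:
  fixes f :: "'a::euclidean_space \<Rightarrow> 'c::banach"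
  assumes ap: "\<And>e::real. e > 0 \<Longrightarrow> \<exists>f' h. f' integrable_on UNIV \<and> h integrable_on UNIV \<and>
      (\<forall>x. norm (f x - f' x) \<le> h x) \<and> integral UNIV h < e"
  shows "f integrable_on UNIV"
proof -
  have sub: "integral (cbox a b) h \<le> integral UNIV h"
    if "h integrable_on UNIV" "\<And>x. norm (f x - f' x) \<le> h x" for a b h and f' :: "'a \<Rightarrow> 'c"
    using that by (intro integral_subset_le)
      (auto intro: integrable_on_subcbox order_trans[OF norm_ge_zero])
  have box: "f integrable_on cbox a b" for a b
  proof (rule integrable_on_cbox_approx)
    fix e :: real assume "e > 0"
    then obtain f' h where fh: "f' integrable_on UNIV" "h integrable_on UNIV"
      "\<And>x. norm (f x - f' x) \<le> h x" "integral UNIV h < e" using ap by metis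
    then show "\<exists>f' h. f' integrable_on cbox a b \<and> h integrable_on cbox a b \<and>
      (\<forall>x\<in>cbox a b. norm (f x - f' x) \<le> h x) \<and> integral (cbox a b) h < e"
      using sub[OF fh(2,3), of a b] by (intro exI[of _ f'] exI[of _ h]) (auto intro: integrable_on_subcbox)
  qed
  show ?thesis
  proof (rule iffD2[OF integrable_alt], intro conjI allI impI)
    show "(\<lambda>x. if x \<in> UNIV then f x else 0) integrable_on cbox a b" for a b using box by simp
    fix e :: real assume "e > 0"
    then obtain f' h where fh: "f' integrable_on UNIV" "h integrable_on UNIV"
      "\<And>x. norm (f x - f' x) \<le> h x" "integral UNIV h < e/4" using ap[of "e/4"] by auto
    from integrable_altD(2)[OF fh(1), of "e/4"] \<open>e > 0\<close> obtain B where B: "B > 0"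
      "\<And>a b c d. ball 0 B \<subseteq> cbox a b \<Longrightarrow> ball 0 B \<subseteq> cbox c d \<Longrightarrow>
         norm (integral (cbox a b) f' - integral (cbox c d) f') < e / 4" by auto
    have dif: "norm (integral (cbox a b) f - integral (cbox a b) f') < e / 4" for a b
    proof -
      have i: "f' integrable_on cbox a b" "h integrable_on cbox a b"
        using fh by (auto intro: integrable_on_subcbox)
      have "norm (integral (cbox a b) (\<lambda>x. f x - f' x)) \<le> integral (cbox a b) h"
        using i box fh(3) by (intro integral_norm_bound_integral integrable_diff) auto
      then show ?thesis using sub[OF fh(2,3), of a b] fh(4) i box by (simp add: integral_diff)
    qed
    show "\<exists>B>0. \<forall>a b c d. ball 0 B \<subseteq> cbox a b \<and> ball 0 B \<subseteq> cbox c d \<longrightarrow>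
       norm (integral (cbox a b) (\<lambda>x. if x \<in> UNIV then f x else 0) -
             integral (cbox c d) (\<lambda>x. if x \<in> UNIV then f x else 0)) < e"
    proof (intro exI[of _ B] conjI allI impI B(1), elim conjE)
      fix a b c d :: 'a assume "ball 0 B \<subseteq> cbox a b" "ball 0 B \<subseteq> cbox c d"
      then have b: "norm (integral (cbox a b) f' - integral (cbox c d) f') < e / 4" by (rule B(2))
      have "integral (cbox a b) f - integral (cbox c d) f =
        (integral (cbox a b) f - integral (cbox a b) f') + (integral (cbox a b) f' - integral (cbox c d) f')
        - (integral (cbox c d) f - integral (cbox c d) f')" by simp
      also have "norm \<dots> \<le> norm (integral (cbox a b) f - integral (cbox a b) f') +
         norm (integral (cbox a b) f' - integral (cbox c d) f')
        + norm (integral (cbox c d) f - integral (cbox c d) f')"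
        by (intro norm_triangle_le_diff norm_triangle_le add_mono order_refl)
      also have "\<dots> < e" using dif[of a b] dif[of c d] b \<open>e > 0\<close> by linarith
      finally show "norm (integral (cbox a b) (\<lambda>x. if x \<in> UNIV then f x else 0) -
             integral (cbox c d) (\<lambda>x. if x \<in> UNIV then f x else 0)) < e" by simp
    qed
  qed
qed

text \<open>The dominating function makes up for the missing Bochner integral of functions with
  values in a non-separable space.\<close>

lemma integrable_on_UNIV_dominated:
  fixes f :: "real \<times> real \<Rightarrow> 'c::banach" and g :: "real \<times> real \<Rightarrow> real"
  assumes cont: "continuous_on {p. snd p \<noteq> 0} f"
    and g: "g integrable_on UNIV" and le: "\<And>p. norm (f p) \<le> g p"
  shows "f integrable_on UNIV"
proof (rule integrable_on_UNIV_approx)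
  fix e :: real assume "e > 0"
  \<comment> \<open>\<open>U k\<close> and \<open>L k\<close> are compact boxes that exhaust the
    open half planes. On them \<open>f\<close> is continuous, and by dominated convergence the part
    of \<open>g\<close> outside \<open>K k\<close> has integral below \<open>e\<close> for large
    \<open>k\<close>; the approximant is \<open>f\<close> restricted to \<open>K k\<close>.\<close>
  define U where "U k = cbox (- real k, 1 / real (Suc k)) (real k, real k)" for k
  define L where "L k = cbox (- real k, - real k) (real k, - 1 / real (Suc k))" for k
  define K where "K k = U k \<union> L k" for k
  have g0: "g p \<ge> 0" for p using le[of p] norm_ge_zero order_trans by blast
  have gK: "(\<lambda>p. if p \<in> K k then g p else 0) integrable_on UNIV" for k
  proof -
    have "g integrable_on U k" "g integrable_on L k"
      unfolding U_def L_def using g by (auto intro: integrable_on_subcbox)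
    moreover have "U k \<inter> L k = {}"
    proof -
      have "False" if "p \<in> U k" "p \<in> L k" for p
      proof -
        have "1 / real (Suc k) \<le> snd p" "snd p \<le> - 1 / real (Suc k)"
          using that by (auto simp: U_def L_def cbox_Pair_eq)
        moreover have "1 / real (Suc k) > 0" "- 1 / real (Suc k) < 0" by auto
        ultimately show False by linarith
      qed
      then show ?thesis by blast
    qed
    ultimately have "g integrable_on K k" unfolding K_def by (intro integrable_Un) auto
    then show ?thesis by (simp add: integrable_restrict_UNIV)
  qed
  have lim: "(\<lambda>k. if p \<in> K k then g p else 0) \<longlonglongrightarrow> (if snd p \<noteq> 0 then g p else 0)" for p
  proof (cases "snd p = 0")
    case True
    then have "p \<notin> K k" for k by (auto simp: K_def U_def L_def cbox_Pair_eq field_simps)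
    then show ?thesis using True by simp
  next
    case False
    have "eventually (\<lambda>k. \<bar>fst p\<bar> \<le> real k \<and> \<bar>snd p\<bar> \<le> real k \<and> 1 / real (Suc k) < \<bar>snd p\<bar>) sequentially"
    proof (intro eventually_conj)
      show "\<forall>\<^sub>F k in sequentially. \<bar>fst p\<bar> \<le> real k" "\<forall>\<^sub>F k in sequentially. \<bar>snd p\<bar> \<le> real k"
        by (simp_all add: eventually_at_top_linorderI[OF order_trans[OF real_nat_ceiling_ge]]
           filterlim_real_sequentially filterlim_at_top[THEN iffD1, rule_format])
      show "\<forall>\<^sub>F k in sequentially. 1 / real (Suc k) < \<bar>snd p\<bar>"
        using LIMSEQ_inverse_real_of_nat False
        by (auto dest!: order_tendstoD(2)[of _ _ _ "\<bar>snd p\<bar>"] simp: inverse_eq_divide)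
    qed
    then have "eventually (\<lambda>k. p \<in> K k) sequentially"
    proof eventually_elim
      case (elim k)
      then show ?case by (cases p; cases "snd p > 0") (auto simp: K_def U_def L_def cbox_Pair_eq field_simps)
    qed
    then have "eventually (\<lambda>k. (if p \<in> K k then g p else 0) = g p) sequentially"
      by eventually_elim simp
    then show ?thesis using False by (simp add: tendsto_eventually)
  qed
  have neg: "negligible {p::real\<times>real. snd p = 0}"
    using negligible_standard_hyperplane[of "(0,1)::real\<times>real" 0] by (simp add: inner_prod_def Basis_prod_def)
  have "(\<lambda>k. integral UNIV (\<lambda>p. if p \<in> K k then g p else 0)) \<longlonglongrightarrow> integral UNIV (\<lambda>p. if snd p \<noteq> 0 then g p else 0)"
    by (rule dominated_convergence(2)[OF gK g]) (use g0 lim in auto)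
  also have "integral UNIV (\<lambda>p. if snd p \<noteq> 0 then g p else 0) = integral UNIV g"
    by (rule integral_spike[OF neg]) auto
  finally have "eventually (\<lambda>k. integral UNIV g - e < integral UNIV (\<lambda>p. if p \<in> K k then g p else 0)) sequentially"
    using \<open>e > 0\<close> by (intro order_tendstoD) auto
  then obtain k where k: "integral UNIV g - e < integral UNIV (\<lambda>p. if p \<in> K k then g p else 0)"
    by (auto simp: eventually_sequentially)
  define f' where "f' p = (if p \<in> K k then f p else 0)" for p
  define h where "h p = (if snd p = 0 then 0 else g p) - (if p \<in> K k then g p else 0) + (if snd p = 0 then g p else 0)" for p
  have fi: "f integrable_on U k" "f integrable_on L k"
    unfolding U_def L_def
    by (rule integrable_continuous, rule continuous_on_subset[OF cont],
        force simp: cbox_Pair_eq field_simps)+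
  have UL: "U k \<inter> L k = {}"
  proof -
    have "False" if "p \<in> U k" "p \<in> L k" for p
    proof -
      have "1 / real (Suc k) \<le> snd p" "snd p \<le> - 1 / real (Suc k)"
        using that by (auto simp: U_def L_def cbox_Pair_eq)
      moreover have "1 / real (Suc k) > 0" "- 1 / real (Suc k) < 0" by auto
      ultimately show False by linarith
    qed
    then show ?thesis by blast
  qed
  have "f integrable_on K k" unfolding K_def using fi UL by (intro integrable_Un) auto
  then have "f' integrable_on UNIV" unfolding f'_def by (simp add: integrable_restrict_UNIV)
  moreover have heq: "h = (\<lambda>p. g p - (if p \<in> K k then g p else 0))" by (auto simp: h_def)
  moreover have "h integrable_on UNIV" unfolding heq by (rule integrable_diff[OF g gK])
  moreover have "integral UNIV h < e" unfolding heq using integral_diff[OF g gK[of k]] k by simp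
  moreover have "norm (f p - f' p) \<le> h p" for p using le[of p] by (auto simp: heq f'_def)
  ultimately show "\<exists>f' h. f' integrable_on UNIV \<and> h integrable_on UNIV \<and>
      (\<forall>x. norm (f x - f' x) \<le> h x) \<and> integral UNIV h < e" by blast
qed

text \<open>For \<open>s = 1\<close> this is the bracket of \<open>x\<close>. The scale
  \<open>s\<close> widens the region |y| < 2 tau s x in which the extension lives; the normalisation
  lets it grow in proportion to the support of the function.\<close>

definition tau :: "real \<Rightarrow> real \<Rightarrow> real" where
  "tau s x = sqrt (s\<^sup>2 + x\<^sup>2)"

lemma has_bochner_integral_nonneg:
  fixes f :: "'a::euclidean_space \<Rightarrow> real"
  assumes "f \<in> borel_measurable borel" "\<And>x. f x \<ge> 0" "(f has_integral I) UNIV"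
  shows "has_bochner_integral lborel f I"
  using assms nn_integral_has_integral_lborel[OF assms] has_integral_nonneg[OF assms(3)]
  by (intro has_bochner_integral_nn_integral) auto

lemma has_bochner_integral_powr_abs:
  fixes \<theta> a :: real
  assumes "\<theta> > 0" "a \<ge> 0"
  shows "has_bochner_integral lborel (\<lambda>y. if \<bar>y\<bar> \<le> a then \<bar>y\<bar> powr (\<theta> - 1) else 0) (2 * a powr \<theta> / \<theta>)"
proof -
  have pos: "((\<lambda>y. if y \<in> {0..a} then \<bar>y\<bar> powr (\<theta> - 1) else 0) has_integral (a powr \<theta> / \<theta>)) UNIV"
    unfolding has_integral_restrict_UNIV
    using has_integral_powr_from_0[of "\<theta> - 1" a] assms
    by (auto elim!: has_integral_eq[rotated])
  have neg: "((\<lambda>y. if y \<in> {-a..0} then \<bar>y\<bar> powr (\<theta> - 1) else 0) has_integral (a powr \<theta> / \<theta>)) UNIV"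
  proof -
    have "((\<lambda>y. \<bar>y\<bar> powr (\<theta> - 1)) has_integral (a powr \<theta> / \<theta>)) {0..a}"
      using pos unfolding has_integral_restrict_UNIV .
    then have "((\<lambda>y. \<bar>y\<bar> powr (\<theta> - 1)) has_integral (a powr \<theta> / \<theta>)) {-a..0}"
      using has_integral_reflect_real[where f = "\<lambda>y::real. \<bar>y\<bar> powr (\<theta> - 1)" and a = 0 and b = a]
      by simp
    then show ?thesis unfolding has_integral_restrict_UNIV by simp
  qed
  have "((\<lambda>y. (if y \<in> {0..a} then \<bar>y\<bar> powr (\<theta> - 1) else 0) + (if y \<in> {-a..0} then \<bar>y\<bar> powr (\<theta> - 1) else 0))
      has_integral (a powr \<theta> / \<theta> + a powr \<theta> / \<theta>)) UNIV"
    by (rule has_integral_add[OF pos neg])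
  then have hi: "((\<lambda>y. if \<bar>y\<bar> \<le> a then \<bar>y\<bar> powr (\<theta> - 1) else 0) has_integral (2 * a powr \<theta> / \<theta>)) UNIV"
    by (rule has_integral_eq_rhs[OF has_integral_eq[rotated]]) auto
  then show ?thesis
    by (intro has_bochner_integral_nonneg) auto
qed

lemma tau_pos: "s > 0 \<Longrightarrow> tau s x > 0"
  unfolding tau_def by (simp add: add_pos_nonneg)

lemma tau_ge: "s > 0 \<Longrightarrow> tau s x \<ge> s"
  unfolding tau_def by (rule real_le_rsqrt) simp

lemma tau_ge_abs: "tau s x \<ge> \<bar>x\<bar>"
  unfolding tau_def by (rule real_le_rsqrt) simp

lemma continuous_tau [continuous_intros]: "continuous_on A f \<Longrightarrow> continuous_on A (\<lambda>x. tau s (f x))"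
  unfolding tau_def by (intro continuous_intros)

lemma tau_one: "tau 1 x = jbracket x"
  by (simp add: tau_def jbracket_def)

text \<open>The majorant of the integrand. Put t = tau s x. On |y| <= 2t the dbar derivative is at
  most a multiple of W(x) (|y|/t)^n and the resolvent at most a multiple of t^\<alpha>
  |y|^(-1-\<alpha>); the product has this shape with \<theta> = n - \<alpha>.\<close>

definition wedge :: "real \<Rightarrow> real \<Rightarrow> (real \<Rightarrow> real) \<Rightarrow> real \<times> real \<Rightarrow> real" where
  "wedge \<theta> s W p = W (fst p) * tau s (fst p) powr (- \<theta>) *
     (if \<bar>snd p\<bar> \<le> 2 * tau s (fst p) then \<bar>snd p\<bar> powr (\<theta> - 1) else 0)"

text \<open>The inner integral of |y|^(\<theta>-1) over |y| <= 2t is 2 (2t)^\<theta> / \<theta>, and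
  the factor t^(-\<theta>) removes t. The result therefore does not depend on the scale
  \<open>s\<close>, and \<theta> > 0 is the condition n > \<alpha>.\<close>

lemma has_integral_wedge:
  assumes th: "\<theta> > 0" and s: "s > 0" and W: "integrable lborel W" "\<And>x. W x \<ge> 0"
  shows "(wedge \<theta> s W has_integral (2 powr (\<theta> + 1) / \<theta> * integral\<^sup>L lborel W)) UNIV"
proof -
  have [measurable]: "W \<in> borel_measurable borel" using W(1) by auto
  have [measurable]: "tau s \<in> borel_measurable borel" unfolding tau_def by measurable
  have inner: "has_bochner_integral lborel (\<lambda>y. wedge \<theta> s W (x, y)) (2 powr (\<theta> + 1) / \<theta> * W x)" for x
  proof -
    have t: "tau s x > 0" using s by (rule tau_pos)
    have "has_bochner_integral lborel (\<lambda>y. (W x * tau s x powr (- \<theta>)) *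
       (if \<bar>y\<bar> \<le> 2 * tau s x then \<bar>y\<bar> powr (\<theta> - 1) else 0)) ((W x * tau s x powr (- \<theta>)) * (2 * (2 * tau s x) powr \<theta> / \<theta>))"
      by (intro has_bochner_integral_mult_right has_bochner_integral_powr_abs th) (use t in auto)
    also have "(W x * tau s x powr (- \<theta>)) * (2 * (2 * tau s x) powr \<theta> / \<theta>) = 2 powr (\<theta> + 1) / \<theta> * W x"
      using t by (simp add: powr_mult powr_minus powr_add field_simps)
    finally show ?thesis by (simp only: wedge_def fst_conv snd_conv)
  qed
  have m: "wedge \<theta> s W \<in> borel_measurable (lborel \<Otimes>\<^sub>M lborel)"
    unfolding wedge_def by measurable
  have nn: "wedge \<theta> s W p \<ge> 0" for p using W(2) by (simp add: wedge_def)
  have int1: "integral\<^sup>L lborel (\<lambda>y. wedge \<theta> s W (x, y)) = 2 powr (\<theta> + 1) / \<theta> * W x" for x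
    using inner has_bochner_integral_integral_eq by blast
  have i: "integrable (lborel \<Otimes>\<^sub>M lborel) (wedge \<theta> s W)"
  proof (rule lborel_pair.Fubini_integrable[OF m])
    show "integrable lborel (\<lambda>x. LBINT y. norm (wedge \<theta> s W (x, y)))"
      using nn int1 W(1) by simp
    show "AE x in lborel. integrable lborel (\<lambda>y. wedge \<theta> s W (x, y))"
      using inner has_bochner_integral_iff by blast
  qed
  have "integral\<^sup>L (lborel \<Otimes>\<^sub>M lborel) (wedge \<theta> s W) = (LBINT x. LBINT y. wedge \<theta> s W (x, y))"
    using lborel_pair.integral_fst'[OF i] by simp
  also have "\<dots> = 2 powr (\<theta> + 1) / \<theta> * integral\<^sup>L lborel W"
    unfolding int1 by simp
  finally show ?thesis
    using has_integral_integral_lborel[of "wedge \<theta> s W"] i by (simp add: lborel_prod)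
qed

section \<open>Jets\<close>

text \<open>A C^N function given with its derivatives as data: entry 0 is the function, and entries
  beyond \<open>N\<close> are arbitrary. Products, rescalings and reflections then have explicit
  derivatives, and derivatives within \<open>S\<close> allow an endpoint.\<close>

definition jet :: "real set \<Rightarrow> nat \<Rightarrow> (nat \<Rightarrow> real \<Rightarrow> complex) \<Rightarrow> bool" where
  "jet S N h \<longleftrightarrow> (\<forall>r<N. \<forall>x\<in>S. (h r has_vector_derivative h (Suc r) x) (at x within S)) \<and> continuous_on S (h N)"

text \<open>Symbol estimates up to order \<open>N\<close> with one common constant, so that later
  bounds can be stated linearly in \<open>B\<close>.\<close>

definition dec :: "real set \<Rightarrow> nat \<Rightarrow> real \<Rightarrow> real \<Rightarrow> (nat \<Rightarrow> real \<Rightarrow> complex) \<Rightarrow> bool" where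
  "dec S N \<beta> B h \<longleftrightarrow> (\<forall>r\<le>N. \<forall>x\<in>S. cmod (h r x) \<le> B * jbracket x powr (\<beta> - real r))"

definition jmul :: "(nat \<Rightarrow> real \<Rightarrow> complex) \<Rightarrow> (nat \<Rightarrow> real \<Rightarrow> complex) \<Rightarrow> nat \<Rightarrow> real \<Rightarrow> complex" where
  "jmul h k r x = (\<Sum>j\<le>r. of_nat (r choose j) * h j x * k (r - j) x)"

lemma jetD: "jet S N h \<Longrightarrow> r < N \<Longrightarrow> x \<in> S \<Longrightarrow> (h r has_vector_derivative h (Suc r) x) (at x within S)"
  by (simp add: jet_def)

lemma jetD_UNIV: "jet UNIV N h \<Longrightarrow> r < N \<Longrightarrow> (h r has_vector_derivative h (Suc r) x) (at x)"
  by (simp add: jet_def)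

lemma jet_continuous: "jet S N h \<Longrightarrow> r \<le> N \<Longrightarrow> continuous_on S (h r)"
proof (cases "r = N")
  case False
  assume "jet S N h" "r \<le> N"
  with False have "\<And>x. x \<in> S \<Longrightarrow> (h r has_vector_derivative h (Suc r) x) (at x within S)"
    by (simp add: jet_def)
  then show ?thesis
    unfolding continuous_on_eq_continuous_within by (blast intro: has_vector_derivative_continuous)
qed (simp add: jet_def)

lemma jet_mono: "jet S N h \<Longrightarrow> M \<le> N \<Longrightarrow> jet S M h"
  using jet_continuous[of S N h M] by (auto simp: jet_def)

lemma jet_add: "jet S N h \<Longrightarrow> jet S N k \<Longrightarrow> jet S N (\<lambda>r x. h r x + k r x)"
  by (auto simp: jet_def intro!: derivative_intros continuous_intros)

lemma jet_diff: "jet S N h \<Longrightarrow> jet S N k \<Longrightarrow> jet S N (\<lambda>r x. h r x - k r x)"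
  by (auto simp: jet_def intro!: derivative_intros continuous_intros)

lemma jet_cmult: "jet S N h \<Longrightarrow> jet S N (\<lambda>r x. a * h r x)"
  by (auto simp: jet_def intro!: derivative_intros continuous_intros)

text \<open>Pascal's rule: after an index shift the two halves of the left side carry the binomials
  of \<open>r\<close> over \<open>j\<close> and over \<open>j - 1\<close>, which add up to
  \<open>Suc r choose j\<close>.\<close>

lemma leibniz_sum:
  fixes a b :: "nat \<Rightarrow> complex"
  shows "(\<Sum>j\<le>r. of_nat (r choose j) * a j * b (Suc (r - j)) + of_nat (r choose j) * a (Suc j) * b (r - j))
     = (\<Sum>j\<le>Suc r. of_nat (Suc r choose j) * a j * b (Suc r - j))"
proof -
  have "(\<Sum>j\<le>Suc r. of_nat (Suc r choose j) * a j * b (Suc r - j))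
      = a 0 * b (Suc r) + (\<Sum>j\<le>r. of_nat (Suc r choose Suc j) * a (Suc j) * b (r - j))"
    by (subst sum.atMost_Suc_shift) simp
  also have "(\<Sum>j\<le>r. of_nat (Suc r choose Suc j) * a (Suc j) * b (r - j)) =
     (\<Sum>j\<le>r. of_nat (r choose Suc j) * a (Suc j) * b (r - j)) + (\<Sum>j\<le>r. of_nat (r choose j) * a (Suc j) * b (r - j))"
    by (simp add: sum.distrib[symmetric] algebra_simps)
  also have "a 0 * b (Suc r) + ((\<Sum>j\<le>r. of_nat (r choose Suc j) * a (Suc j) * b (r - j)) + (\<Sum>j\<le>r. of_nat (r choose j) * a (Suc j) * b (r - j)))
    = (\<Sum>j\<le>Suc r. of_nat (r choose j) * a j * b (Suc r - j)) + (\<Sum>j\<le>r. of_nat (r choose j) * a (Suc j) * b (r - j))"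
    unfolding sum.atMost_Suc_shift[of _ r] by simp
  also have "(\<Sum>j\<le>Suc r. of_nat (r choose j) * a j * b (Suc r - j)) = (\<Sum>j\<le>r. of_nat (r choose j) * a j * b (Suc (r - j)))"
    by (simp add: Suc_diff_le)
  finally show ?thesis by (simp add: sum.distrib)
qed

lemma jet_mult:
  assumes h: "jet S N h" and k: "jet S N k"
  shows "jet S N (jmul h k)"
  unfolding jet_def
proof (intro conjI allI impI ballI)
  fix r x assume r: "r < N" and x: "x \<in> S"
  have "((\<lambda>x. \<Sum>j\<le>r. of_nat (r choose j) * h j x * k (r - j) x) has_vector_derivative
     (\<Sum>j\<le>r. of_nat (r choose j) * h j x * k (Suc (r - j)) x + of_nat (r choose j) * h (Suc j) x * k (r - j) x)) (at x within S)"
  proof (rule has_vector_derivative_sum)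
    fix j assume "j \<in> {..r}"
    then have hj: "(h j has_vector_derivative h (Suc j) x) (at x within S)"
      and kj: "(k (r - j) has_vector_derivative k (Suc (r - j)) x) (at x within S)"
      using r x by (auto intro!: jetD[OF h] jetD[OF k])
    show "((\<lambda>x. of_nat (r choose j) * h j x * k (r - j) x) has_vector_derivative
       of_nat (r choose j) * h j x * k (Suc (r - j)) x + of_nat (r choose j) * h (Suc j) x * k (r - j) x) (at x within S)"
      by (rule has_vector_derivative_eq_rhs, (rule has_vector_derivative_mult hj kj has_vector_derivative_mult_right)+) simp
  qed
  then show "(jmul h k r has_vector_derivative jmul h k (Suc r) x) (at x within S)"
    unfolding jmul_def leibniz_sum[of r "\<lambda>j. h j x" "\<lambda>j. k j x"] .
next
  show "continuous_on S (jmul h k N)"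
    unfolding jmul_def by (intro continuous_intros jet_continuous[OF h] jet_continuous[OF k]) auto
qed

lemma jet_affine:
  assumes "jet UNIV N h"
  shows "jet UNIV N (\<lambda>r x. of_real (b ^ r) * h r (a + b * x))"
  unfolding jet_def
proof (intro conjI allI impI ballI)
  fix r x assume r: "r < N"
  have "((\<lambda>x. h r (a + b * x)) has_vector_derivative b *\<^sub>R h (Suc r) (a + b * x)) (at x)"
    by (rule vector_diff_chain_at[where f = "\<lambda>x. a + b * x" and g = "h r", unfolded o_def])
       (auto intro!: derivative_eq_intros jetD_UNIV[OF assms r])
  then have "((\<lambda>x. of_real (b ^ r) * h r (a + b * x)) has_vector_derivative of_real (b ^ r) * (b *\<^sub>R h (Suc r) (a + b * x))) (at x)"
    by (rule has_vector_derivative_mult_right)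
  then show "((\<lambda>x. of_real (b ^ r) * h r (a + b * x)) has_vector_derivative of_real (b ^ Suc r) * h (Suc r) (a + b * x)) (at x within UNIV)"
    by (simp add: scaleR_conv_of_real mult_ac)
next
  have "continuous_on UNIV (h N)" using assms by (simp add: jet_def)
  then show "continuous_on UNIV (\<lambda>x. of_real (b ^ N) * h N (a + b * x))"
    by (intro continuous_intros) (auto intro!: continuous_intros intro: continuous_on_compose2)
qed

text \<open>Where \<open>at x within S\<close> is nontrivial, derivatives within \<open>S\<close>
  are unique, so the iterated derivatives of the statement can be read off from any jet of the
  function, including the one-sided ones at 0.\<close>

lemma nderiv_jet:
  assumes h: "jet S N h" and S: "\<And>x. x \<in> S \<Longrightarrow> at x within S \<noteq> bot" and f: "\<And>x. x \<in> S \<Longrightarrow> f x = h 0 x"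
  shows "r \<le> N \<Longrightarrow> x \<in> S \<Longrightarrow> nderiv S r f x = h r x"
proof (induction r arbitrary: x)
  case (Suc r)
  have "(nderiv S r f has_vector_derivative h (Suc r) x) (at x within S)"
    by (rule has_vector_derivative_transform[OF _ _ jetD[OF h, of r]]) (use Suc in auto)
  then show ?case using vector_derivative_within[OF S] Suc.prems by auto
qed (use f in auto)

lemma jet_nderiv: "smooth_on S f \<Longrightarrow> jet S N (\<lambda>r. nderiv S r f)"
  unfolding smooth_on_def jet_def
  by (auto simp: vector_derivative_works continuous_on_eq_continuous_within
      intro: differentiable_imp_continuous_within)

lemma at_within_atLeast_neq_bot: "x \<in> {0..} \<Longrightarrow> at (x::real) within {0..} \<noteq> bot"
proof -
  assume x: "x \<in> {0..}"
  have "at x within {x<..} \<le> at x within {0..}" using x by (intro at_le) auto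
  then show ?thesis using trivial_limit_at_right_real[of x] by (metis bot.extremum_uniqueI)
qed

lemma jbracket_real_ge: "jbracket (x::real) \<ge> 1" "jbracket x \<ge> \<bar>x\<bar>" "jbracket x > 0"
  by (auto simp: jbracket_def intro!: real_le_rsqrt add_pos_nonneg)

lemma decD: "dec S N \<beta> B h \<Longrightarrow> r \<le> N \<Longrightarrow> x \<in> S \<Longrightarrow> cmod (h r x) \<le> B * jbracket x powr (\<beta> - real r)"
  by (simp add: dec_def)

lemma dec_nonneg: "dec S N \<beta> B h \<Longrightarrow> S \<noteq> {} \<Longrightarrow> B \<ge> 0"
proof -
  assume d: "dec S N \<beta> B h" and "S \<noteq> {}"
  then obtain x where "x \<in> S" by auto
  then have "0 \<le> B * jbracket x powr (\<beta> - real 0)" using decD[OF d, of 0 x] norm_ge_zero order_trans by blast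
  moreover have "jbracket x powr (\<beta> - real 0) > 0" using jbracket_real_ge(3)[of x] by simp
  ultimately show "B \<ge> 0" by (metis zero_le_mult_iff not_le)
qed

lemma dec_weaken: "dec S N \<beta> B h \<Longrightarrow> \<beta> \<le> \<beta>' \<Longrightarrow> B \<le> B' \<Longrightarrow> M \<le> N \<Longrightarrow> S \<noteq> {} \<Longrightarrow> dec S M \<beta>' B' h"
  unfolding dec_def[of S M]
proof (intro allI impI ballI)
  fix r x assume d: "dec S N \<beta> B h" and *: "\<beta> \<le> \<beta>'" "B \<le> B'" "M \<le> N" "S \<noteq> {}" and r: "r \<le> M" and x: "x \<in> S"
  have "cmod (h r x) \<le> B * jbracket x powr (\<beta> - real r)"
    using decD[OF d, of r x] r x * by simp
  also have "\<dots> \<le> B' * jbracket x powr (\<beta>' - real r)"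
    using * dec_nonneg[OF d] jbracket_real_ge(1)[of x] by (intro mult_mono powr_mono) auto
  finally show "cmod (h r x) \<le> B' * jbracket x powr (\<beta>' - real r)" .
qed

lemma dec_add: "dec S N \<beta> B h \<Longrightarrow> dec S N \<beta> C k \<Longrightarrow> dec S N \<beta> (B + C) (\<lambda>r x. h r x + k r x)"
  unfolding dec_def by (auto intro!: order_trans[OF norm_triangle_ineq] add_mono simp: distrib_right)

lemma dec_diff: "dec S N \<beta> B h \<Longrightarrow> dec S N \<beta> C k \<Longrightarrow> dec S N \<beta> (B + C) (\<lambda>r x. h r x - k r x)"
  unfolding dec_def by (auto intro!: order_trans[OF norm_triangle_ineq4] add_mono simp: distrib_right)

lemma dec_cmult: "dec S N \<beta> B h \<Longrightarrow> dec S N \<beta> (cmod a * B) (\<lambda>r x. a * h r x)"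
  unfolding dec_def by (auto simp: norm_mult mult.assoc intro!: mult_left_mono)

text \<open>In each Leibniz term the two exponents add up to \<beta> + \<beta>' - r, and 2^N bounds
  the sum of the binomial coefficients.\<close>

lemma dec_jmul:
  assumes h: "dec S N \<beta> B h" and k: "dec S N \<beta>' B' k" and S: "S \<noteq> {}"
  shows "dec S N (\<beta> + \<beta>') (2 ^ N * B * B') (jmul h k)"
  unfolding dec_def
proof (intro allI impI ballI)
  fix r x assume r: "r \<le> N" and x: "x \<in> S"
  have B: "B \<ge> 0" "B' \<ge> 0" using dec_nonneg h k S by blast+
  have jx: "jbracket x > 0" by (rule jbracket_real_ge)
  have "cmod (jmul h k r x) \<le> (\<Sum>j\<le>r. real (r choose j) * (B * B' * jbracket x powr (\<beta> + \<beta>' - real r)))"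
    unfolding jmul_def
  proof (rule sum_norm_le)
    fix j assume j: "j \<in> {..r}"
    have "cmod (h j x) * cmod (k (r - j) x) \<le> (B * jbracket x powr (\<beta> - real j)) * (B' * jbracket x powr (\<beta>' - real (r - j)))"
      using j r x B by (intro mult_mono decD[OF h] decD[OF k]) auto
    also have "\<dots> = B * B' * jbracket x powr (\<beta> + \<beta>' - real r)"
      using j jx by (simp add: of_nat_diff powr_add[symmetric] algebra_simps)
    finally show "cmod (of_nat (r choose j) * h j x * k (r - j) x) \<le> real (r choose j) * (B * B' * jbracket x powr (\<beta> + \<beta>' - real r))"
      by (simp add: norm_mult mult.assoc mult_left_mono)
  qed
  also have "\<dots> = 2 ^ r * (B * B' * jbracket x powr (\<beta> + \<beta>' - real r))"
    unfolding sum_distrib_right[symmetric] using choose_row_sum[of r] by (metis of_nat_sum of_nat_numeral of_nat_power)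
  also have "\<dots> \<le> 2 ^ N * (B * B' * jbracket x powr (\<beta> + \<beta>' - real r))"
    using B r by (intro mult_right_mono power_increasing) auto
  finally show "cmod (jmul h k r x) \<le> 2 ^ N * B * B' * jbracket x powr (\<beta> + \<beta>' - real r)" by (simp add: mult.assoc)
qed

lemma symb_dec:
  assumes "symb S \<beta> f" "S \<noteq> {}"
  obtains B where "dec S N \<beta> B (\<lambda>r. nderiv S r f)"
proof -
  from assms have "\<forall>n. \<exists>c>0. \<forall>x\<in>S. cmod (nderiv S n f x) \<le> c * jbracket x powr (\<beta> - real n)"
    by (simp add: symb_def)
  then obtain c where c: "\<And>n. c n > 0" "\<And>n x. x \<in> S \<Longrightarrow> cmod (nderiv S n f x) \<le> c n * jbracket x powr (\<beta> - real n)"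
    by metis
  have "dec S N \<beta> (\<Sum>n\<le>N. c n) (\<lambda>r. nderiv S r f)"
    unfolding dec_def
  proof (intro allI impI ballI)
    fix r x assume "r \<le> N" "x \<in> S"
    then show "cmod (nderiv S r f x) \<le> (\<Sum>n\<le>N. c n) * jbracket x powr (\<beta> - real r)"
      using member_le_sum[of r "{..N}" c] c(1)
      by (intro order_trans[OF c(2)] mult_right_mono) (auto intro: less_imp_le)
  qed
  then show ?thesis using that by blast
qed

text \<open>Up to sign this is the \<open>K\<close>-th finite difference of a polynomial of degree
  \<open>r < K\<close>. The induction uses k (K choose k) = K (K-1 choose k-1), which lowers both
  \<open>K\<close> and the degree. It supplies the moment identities of the reflection.\<close>

lemma alternating_binomial_powers:
  fixes a b :: real
  shows "r < K \<Longrightarrow> (\<Sum>k\<le>K. (-1) ^ k * real (K choose k) * (a + b * real k) ^ r) = 0"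
proof (induction r arbitrary: K a)
  case 0
  then show ?case using choose_alternating_sum[of K, where 'a = real] by simp
next
  case (Suc r)
  then obtain L where L: "K = Suc L" "r < L" by (cases K) auto
  have "(\<Sum>k\<le>K. (-1) ^ k * real (K choose k) * (a + b * real k) ^ Suc r) =
     a * (\<Sum>k\<le>K. (-1) ^ k * real (K choose k) * (a + b * real k) ^ r)
     + b * (\<Sum>k\<le>K. (-1) ^ k * (real k * real (K choose k)) * (a + b * real k) ^ r)"
    by (simp add: sum_distrib_left sum.distrib[symmetric] algebra_simps)
  also have "(\<Sum>k\<le>K. (-1) ^ k * (real k * real (K choose k)) * (a + b * real k) ^ r)
     = (\<Sum>k\<le>L. (-1) ^ Suc k * (real (Suc k * (Suc L choose Suc k))) * (a + b * real (Suc k)) ^ r)"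
    unfolding L by (subst sum.atMost_Suc_shift) (simp del: binomial_Suc_Suc add: distrib_right)
  also have "\<dots> = - real (Suc L) * (\<Sum>k\<le>L. (-1) ^ k * real (L choose k) * ((a + b) + b * real k) ^ r)"
    unfolding Suc_times_binomial
    by (simp add: sum_distrib_left distrib_left mult_ac add_ac del: of_nat_Suc binomial_Suc_Suc)
       (simp add: algebra_simps del: binomial_Suc_Suc)
  finally show ?case using Suc.IH[of K a] Suc.IH[of L "a + b"] Suc.prems L by simp
qed

section \<open>Almost analytic extensions of jets\<close>

lemma bounded_bilinear_scaleC: "bounded_bilinear (\<lambda>a (x::'a::complex_banach). a *\<^sub>C x)"
proof
  fix a b :: complex and x y :: 'a and r :: real
  show "(a + b) *\<^sub>C x = a *\<^sub>C x + b *\<^sub>C x" by (rule scaleC_add_left)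
  show "a *\<^sub>C (x + y) = a *\<^sub>C x + a *\<^sub>C y" by (rule scaleC_add_right)
  show "(r *\<^sub>R a) *\<^sub>C x = r *\<^sub>R (a *\<^sub>C x)"
    by (metis scaleR_conv_of_real scaleR_scaleC scaleC_scaleC)
  show "a *\<^sub>C (r *\<^sub>R x) = r *\<^sub>R (a *\<^sub>C x)"
    by (simp add: scaleR_scaleC scaleC_scaleC mult.commute)
  show "\<exists>K. \<forall>a (x::'a). norm (a *\<^sub>C x) \<le> norm a * norm x * K"
    by (rule exI[of _ 1]) (simp add: norm_scaleC)
qed

lemmas continuous_on_scaleC [continuous_intros] = bounded_bilinear.continuous_on[OF bounded_bilinear_scaleC]
lemmas has_vector_derivative_scaleC = bounded_bilinear.has_vector_derivative[OF bounded_bilinear_scaleC]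
lemmas scaleC_zero_left [simp] = bounded_bilinear.zero_left[OF bounded_bilinear_scaleC]
lemmas scaleC_zero_right [simp] = bounded_bilinear.zero_right[OF bounded_bilinear_scaleC]
lemmas scaleC_minus_left = bounded_bilinear.minus_left[OF bounded_bilinear_scaleC]
lemmas scaleC_minus_right = bounded_bilinear.minus_right[OF bounded_bilinear_scaleC]
lemmas scaleC_diff_left = bounded_bilinear.diff_left[OF bounded_bilinear_scaleC]
lemmas scaleC_diff_right = bounded_bilinear.diff_right[OF bounded_bilinear_scaleC]

lemma scaleC_one [simp]: "1 *\<^sub>C (x::'a::complex_banach) = x"
  using scaleR_scaleC[of 1 x] by simp

lemma integral_scaleC: "f integrable_on S \<Longrightarrow> integral S (\<lambda>x. a *\<^sub>C f x) = a *\<^sub>C integral S f"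
  for f :: "'n::euclidean_space \<Rightarrow> 'a::complex_banach"
  using integral_linear[OF _ bounded_linear_scaleC_right[of a]] by (simp add: o_def)

lemma integrable_scaleC: "f integrable_on S \<Longrightarrow> (\<lambda>x. a *\<^sub>C f x) integrable_on S"
  for f :: "'n::euclidean_space \<Rightarrow> 'a::complex_banach"
  using integrable_linear[OF _ bounded_linear_scaleC_right[of a]] by (simp add: o_def)

text \<open>A cut-off together with its continuous derivative. Both the smooth cut-offs of the
  theorem and the ones built from polynomial pieces in \<open>cutjet_exists\<close> are of this
  form.\<close>

definition cutpair :: "(real \<Rightarrow> complex) \<Rightarrow> (real \<Rightarrow> complex) \<Rightarrow> bool" where
  "cutpair \<psi> \<psi>' \<longleftrightarrow> (\<forall>t. (\<psi> has_vector_derivative \<psi>' t) (at t)) \<and> continuous_on UNIV \<psi>' \<and>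
     (\<forall>t. \<bar>t\<bar> \<le> 1 \<longrightarrow> \<psi> t = 1) \<and> (\<forall>t. \<bar>t\<bar> \<ge> 2 \<longrightarrow> \<psi> t = 0)"

text \<open>In the open regions \<psi> is locally constant; the boundary values |t| = 1 and |t| = 2
  follow because the zero set of the continuous \<psi>' is closed.\<close>

lemma cutpair_deriv_0:
  assumes c: "cutpair \<psi> \<psi>'" and t: "\<bar>t\<bar> \<le> 1 \<or> \<bar>t\<bar> \<ge> 2"
  shows "\<psi>' t = 0"
proof -
  have *: "\<psi>' t = 0" if S: "open S" "t \<in> S" "\<And>u. u \<in> S \<Longrightarrow> \<psi> u = a" for S t a
  proof -
    have "(\<psi> has_vector_derivative \<psi>' t) (at t)" using c by (simp add: cutpair_def)
    moreover have "(\<psi> has_vector_derivative 0) (at t)"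
      by (rule has_vector_derivative_transform_within_open[OF has_vector_derivative_const[of a] S(1,2)])
         (simp add: S(3))
    ultimately show ?thesis by (rule vector_derivative_unique_at)
  qed
  have z1: "\<psi>' u = 0" if "\<bar>u\<bar> < 1" for u
    by (rule *[of "{-1<..<1}" _ 1]) (use c that in \<open>auto simp: cutpair_def\<close>)
  have z2: "\<psi>' u = 0" if "\<bar>u\<bar> > 2" for u
  proof (cases "u > 2")
    case True
    then show ?thesis by (intro *[of "{2<..}" _ 0]) (use c in \<open>auto simp: cutpair_def\<close>)
  next
    case False
    then show ?thesis using that by (intro *[of "{..< -2}" _ 0]) (use c in \<open>auto simp: cutpair_def\<close>)
  qed
  have cl: "closed {u. \<psi>' u = 0}"
    using c by (intro closed_Collect_eq) (auto simp: cutpair_def)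
  have "closure {-1<..<1::real} \<subseteq> {u. \<psi>' u = 0}" using z1 by (intro closure_minimal cl) auto
  moreover have "closure {2<..} \<subseteq> {u::real. \<psi>' u = 0}" using z2 by (intro closure_minimal cl) auto
  moreover have "closure {..< -2} \<subseteq> {u::real. \<psi>' u = 0}" using z2 by (intro closure_minimal cl) auto
  ultimately show ?thesis using t by (cases "t \<ge> 0") (auto simp: subset_iff abs_le_iff)
qed

lemma cutpair_bound:
  assumes c: "cutpair \<psi> \<psi>'"
  obtains C where "C > 0" "\<And>t. cmod (\<psi> t) \<le> C" "\<And>t. cmod (\<psi>' t) \<le> C"
proof -
  have cont: "continuous_on UNIV \<psi>" "continuous_on UNIV \<psi>'"
    using c by (auto simp: cutpair_def continuous_on_eq_continuous_within intro: has_vector_derivative_continuous)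
  have "bounded (\<psi> ` {-2..2})" "bounded (\<psi>' ` {-2..2})"
    by (intro compact_imp_bounded compact_continuous_image continuous_on_subset[OF cont(1)] continuous_on_subset[OF cont(2)]; simp)+
  then obtain B1 B2 where B: "\<And>t. t \<in> {-2..2} \<Longrightarrow> cmod (\<psi> t) \<le> B1" "\<And>t. t \<in> {-2..2} \<Longrightarrow> cmod (\<psi>' t) \<le> B2"
    unfolding bounded_iff by (metis imageI)
  have 1: "cmod (\<psi> t) \<le> max 1 (max B1 B2)" for t
  proof (cases "\<bar>t\<bar> \<ge> 2")
    case False
    then have "t \<in> {-2..2}" by auto
    then show ?thesis using B(1)[of t] by auto
  qed (use c in \<open>auto simp: cutpair_def\<close>)
  have 2: "cmod (\<psi>' t) \<le> max 1 (max B1 B2)" for t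
  proof (cases "\<bar>t\<bar> \<ge> 2")
    case False
    then have "t \<in> {-2..2}" by auto
    then show ?thesis using B(2)[of t] by auto
  qed (use cutpair_deriv_0[OF c, of t] in auto)
  show ?thesis using 1 2 by (intro that[of "max 1 (max B1 B2)"]) auto
qed

definition taylor :: "nat \<Rightarrow> (nat \<Rightarrow> real \<Rightarrow> complex) \<Rightarrow> real \<Rightarrow> real \<Rightarrow> complex" where
  "taylor n h x y = (\<Sum>r\<le>n. h r x * (\<i> * of_real y) ^ r / fact r)"

definition ext_dx :: "nat \<Rightarrow> (real \<Rightarrow> complex) \<Rightarrow> (real \<Rightarrow> complex) \<Rightarrow> real \<Rightarrow> (nat \<Rightarrow> real \<Rightarrow> complex) \<Rightarrow> real \<Rightarrow> real \<Rightarrow> complex" where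
  "ext_dx n \<psi> \<psi>' s h x y = taylor n (\<lambda>r. h (Suc r)) x y * \<psi> (y / tau s x)
      + taylor n h x y * (of_real (- y * x / tau s x ^ 3) * \<psi>' (y / tau s x))"

definition ext_dy :: "nat \<Rightarrow> (real \<Rightarrow> complex) \<Rightarrow> (real \<Rightarrow> complex) \<Rightarrow> real \<Rightarrow> (nat \<Rightarrow> real \<Rightarrow> complex) \<Rightarrow> real \<Rightarrow> real \<Rightarrow> complex" where
  "ext_dy n \<psi> \<psi>' s h x y = \<i> * (\<Sum>r<n. h (Suc r) x * (\<i> * of_real y) ^ r / fact r) * \<psi> (y / tau s x)
      + taylor n h x y * (of_real (1 / tau s x) * \<psi>' (y / tau s x))"

definition edbar :: "nat \<Rightarrow> (real \<Rightarrow> complex) \<Rightarrow> (real \<Rightarrow> complex) \<Rightarrow> real \<Rightarrow> (nat \<Rightarrow> real \<Rightarrow> complex) \<Rightarrow> real \<times> real \<Rightarrow> complex" where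
  "edbar n \<psi> \<psi>' s h p = 1 / 2 * (ext_dx n \<psi> \<psi>' s h (fst p) (snd p) + \<i> * ext_dy n \<psi> \<psi>' s h (fst p) (snd p))"

text \<open>The Taylor sums telescope: the x-derivative of the term of degree r cancels i times the
  y-derivative of the term of degree r+1. Only the top term, of order y^n, and terms with \<psi>'
  remain, and the latter live at tau s x <= |y| <= 2 tau s x.\<close>

lemma edbar_eq:
  "edbar n \<psi> \<psi>' s h (x, y) = 1 / 2 * (h (Suc n) x * (\<i> * of_real y) ^ n / fact n * \<psi> (y / tau s x)
     + taylor n h x y * ((of_real (- y * x / tau s x ^ 3) + \<i> * of_real (1 / tau s x)) * \<psi>' (y / tau s x)))"
  unfolding edbar_def ext_dx_def ext_dy_def taylor_def lessThan_Suc_atMost[symmetric]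
  by (simp add: algebra_simps)

lemma taylor_dx:
  assumes "jet UNIV (Suc n) h"
  shows "((\<lambda>x. taylor n h x y) has_vector_derivative taylor n (\<lambda>r. h (Suc r)) x y) (at x)"
proof -
  have "((\<lambda>x. h r x * ((\<i> * of_real y) ^ r / fact r)) has_vector_derivative
     h (Suc r) x * ((\<i> * of_real y) ^ r / fact r)) (at x)" if "r \<in> {..n}" for r
    using that by (intro has_vector_derivative_mult_left jetD_UNIV[OF assms]) auto
  then have "((\<lambda>x. \<Sum>r\<le>n. h r x * ((\<i> * of_real y) ^ r / fact r)) has_vector_derivative
     (\<Sum>r\<le>n. h (Suc r) x * ((\<i> * of_real y) ^ r / fact r))) (at x)"
    by (rule has_vector_derivative_sum)
  then show ?thesis by (simp add: taylor_def)
qed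

lemma taylor_dy:
  "((\<lambda>y. taylor n h x y) has_vector_derivative \<i> * (\<Sum>r<n. h (Suc r) x * (\<i> * of_real y) ^ r / fact r)) (at y)"
proof -
  have d: "((\<lambda>y. h r x * (\<i> * of_real y) ^ r / fact r) has_vector_derivative
      of_nat r * (h r x * \<i> * (\<i> * of_real y) ^ (r - 1) / fact r)) (at y)" for r
  proof -
    have "((\<lambda>z. h r x * (\<i> * z) ^ r / fact r) has_field_derivative
      of_nat r * (h r x * \<i> * (\<i> * of_real y) ^ (r - 1) / fact r)) (at (of_real y))"
      by (rule derivative_eq_intros | simp)+
    then show ?thesis by (rule has_vector_derivative_real_field)
  qed
  have "((\<lambda>y. \<Sum>r\<le>n. h r x * (\<i> * of_real y) ^ r / fact r) has_vector_derivative
     (\<Sum>r\<le>n. of_nat r * (h r x * \<i> * (\<i> * of_real y) ^ (r - 1) / fact r))) (at y)"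
    by (rule has_vector_derivative_sum) (rule d)
  also have "(\<Sum>r\<le>n. of_nat r * (h r x * \<i> * (\<i> * of_real y) ^ (r - 1) / fact r))
    = (\<Sum>r<n. of_nat (Suc r) * (h (Suc r) x * \<i> * (\<i> * of_real y) ^ r / fact (Suc r)))"
    unfolding sum.atMost_shift by simp
  also have "\<dots> = \<i> * (\<Sum>r<n. h (Suc r) x * (\<i> * of_real y) ^ r / fact r)"
    by (simp add: sum_distrib_left divide_simps del: of_nat_Suc) (simp add: mult_ac)
  finally show ?thesis by (simp add: taylor_def)
qed

lemma tau_has_derivative: "s > 0 \<Longrightarrow> (tau s has_real_derivative (x / tau s x)) (at x)"
proof -
  assume "s > 0"
  then have "0 < s\<^sup>2 + x\<^sup>2" by (simp add: add_pos_nonneg)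
  then show ?thesis
    unfolding tau_def by (auto intro!: derivative_eq_intros simp: field_simps)
qed

lemma cut_tau_dx:
  assumes c: "cutpair \<psi> \<psi>'" and s: "s > 0"
  shows "((\<lambda>x. \<psi> (y / tau s x)) has_vector_derivative of_real (- y * x / tau s x ^ 3) * \<psi>' (y / tau s x)) (at x)"
proof -
  have t: "tau s x > 0" by (rule tau_pos[OF s])
  have "((\<lambda>x. y / tau s x) has_real_derivative (- y * x / tau s x ^ 3)) (at x)"
    using t by (auto intro!: derivative_eq_intros tau_has_derivative[OF s] simp: power3_eq_cube power2_eq_square)
  then have "((\<psi> o (\<lambda>x. y / tau s x)) has_vector_derivative (- y * x / tau s x ^ 3) *\<^sub>R \<psi>' (y / tau s x)) (at x)"
    using c by (intro vector_diff_chain_at) (auto simp: cutpair_def has_real_derivative_iff_has_vector_derivative)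
  then show ?thesis by (simp add: o_def scaleR_conv_of_real)
qed

lemma cut_tau_dy:
  assumes c: "cutpair \<psi> \<psi>'" and s: "s > 0"
  shows "((\<lambda>y. \<psi> (y / tau s x)) has_vector_derivative of_real (1 / tau s x) * \<psi>' (y / tau s x)) (at y)"
proof -
  have "((\<lambda>y. y / tau s x) has_real_derivative (1 / tau s x)) (at y)"
    using tau_pos[OF s, of x] by (auto intro!: derivative_eq_intros)
  then have "((\<psi> o (\<lambda>y. y / tau s x)) has_vector_derivative (1 / tau s x) *\<^sub>R \<psi>' (y / tau s x)) (at y)"
    using c by (intro vector_diff_chain_at) (auto simp: cutpair_def has_real_derivative_iff_has_vector_derivative)
  then show ?thesis by (simp add: o_def scaleR_conv_of_real)
qed

definition ext :: "nat \<Rightarrow> (real \<Rightarrow> complex) \<Rightarrow> real \<Rightarrow> (nat \<Rightarrow> real \<Rightarrow> complex) \<Rightarrow> real \<Rightarrow> real \<Rightarrow> complex" where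
  "ext n \<psi> s h x y = taylor n h x y * \<psi> (y / tau s x)"

lemma ext_has_dx:
  assumes "jet UNIV (Suc n) h" "cutpair \<psi> \<psi>'" "s > 0"
  shows "((\<lambda>x. ext n \<psi> s h x y) has_vector_derivative ext_dx n \<psi> \<psi>' s h x y) (at x)"
  unfolding ext_def ext_dx_def
  by (rule has_vector_derivative_eq_rhs[OF has_vector_derivative_mult[OF taylor_dx[OF assms(1)] cut_tau_dx[OF assms(2,3)]]])
     (simp add: add.commute)

lemma ext_has_dy:
  assumes "cutpair \<psi> \<psi>'" "s > 0"
  shows "((\<lambda>y. ext n \<psi> s h x y) has_vector_derivative ext_dy n \<psi> \<psi>' s h x y) (at y)"
  unfolding ext_def ext_dy_def
  by (rule has_vector_derivative_eq_rhs[OF has_vector_derivative_mult[OF taylor_dy cut_tau_dy[OF assms]]])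
     (simp add: add.commute)

lemma
  assumes h: "jet UNIV (Suc n) h" and c: "cutpair \<psi> \<psi>'" and s: "s > 0"
  shows continuous_ext: "continuous_on A (\<lambda>p. ext n \<psi> s h (fst p) (snd p))"
    and continuous_ext_dx: "continuous_on A (\<lambda>p. ext_dx n \<psi> \<psi>' s h (fst p) (snd p))"
    and continuous_ext_dy: "continuous_on A (\<lambda>p. ext_dy n \<psi> \<psi>' s h (fst p) (snd p))"
    and continuous_edbar: "continuous_on A (edbar n \<psi> \<psi>' s h)"
proof -
  have hc: "continuous_on A (\<lambda>p. h r (fst p))" if "r \<le> Suc n" for r and A :: "(real \<times> real) set"
    by (rule continuous_on_compose2[OF jet_continuous[OF h that]]) (auto intro!: continuous_intros)
  have t: "tau s x \<noteq> 0" for x using tau_pos[OF s, of x] by simp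
  have pc: "continuous_on A (\<lambda>p. \<psi> (snd p / tau s (fst p)))" for A
  proof (rule continuous_on_compose2[of UNIV \<psi>])
    show "continuous_on UNIV \<psi>"
      using c by (auto simp: cutpair_def continuous_on_eq_continuous_within intro: has_vector_derivative_continuous)
  qed (auto intro!: continuous_intros simp: t)
  have pc': "continuous_on A (\<lambda>p. \<psi>' (snd p / tau s (fst p)))" for A
    by (rule continuous_on_compose2[of UNIV \<psi>']) (use c in \<open>auto intro!: continuous_intros simp: t cutpair_def\<close>)
  show "continuous_on A (\<lambda>p. ext n \<psi> s h (fst p) (snd p))"
    unfolding ext_def taylor_def by (intro continuous_intros hc pc) auto
  show 1: "continuous_on A (\<lambda>p. ext_dx n \<psi> \<psi>' s h (fst p) (snd p))"
    unfolding ext_dx_def taylor_def by (intro continuous_intros hc pc pc') (auto simp: t)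
  show 2: "continuous_on A (\<lambda>p. ext_dy n \<psi> \<psi>' s h (fst p) (snd p))"
    unfolding ext_dy_def taylor_def by (intro continuous_intros hc pc pc') (auto simp: t)
  show "continuous_on A (edbar n \<psi> \<psi>' s h)"
    unfolding edbar_def using 1 2 by (intro continuous_intros)
qed

text \<open>The integrand of the norm with index n+1, taken on the whole line and with
  \<open>tau s\<close> in place of the bracket.\<close>

definition wt :: "nat \<Rightarrow> real \<Rightarrow> (nat \<Rightarrow> real \<Rightarrow> complex) \<Rightarrow> real \<Rightarrow> real" where
  "wt n s h x = (\<Sum>r\<le>Suc n. cmod (h r x) * tau s x powr (real r - 1))"

lemma wt_nonneg: "wt n s h x \<ge> 0"
  unfolding wt_def by (intro sum_nonneg) auto

lemma wt_ge: "r \<le> Suc n \<Longrightarrow> cmod (h r x) * tau s x powr (real r - 1) \<le> wt n s h x"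
  unfolding wt_def by (rule member_le_sum) auto

lemma edbar_outside:
  assumes c: "cutpair \<psi> \<psi>'" and s: "s > 0" and y: "\<bar>y\<bar> \<ge> 2 * tau s x"
  shows "edbar n \<psi> \<psi>' s h (x, y) = 0"
proof -
  have "\<bar>y / tau s x\<bar> \<ge> 2" using y tau_pos[OF s, of x] by (simp add: field_simps)
  then show ?thesis using cutpair_deriv_0[OF c] c by (auto simp: edbar_eq cutpair_def)
qed

text \<open>The resolvent has an arbitrary value on the spectrum, so pointwise bounds on the axis
  are possible only because the scalar factor vanishes there.\<close>

lemma edbar_axis:
  assumes c: "cutpair \<psi> \<psi>'" and n: "n > 0"
  shows "edbar n \<psi> \<psi>' s h (x, 0) = 0"
  using cutpair_deriv_0[OF c, of 0] n by (auto simp: edbar_eq)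

lemma divide_fact_le: "a \<ge> 0 \<Longrightarrow> a / fact n \<le> (a::real)"
  using fact_ge_1[of n, where 'a = real] mult_left_mono[of 1 "fact n" a] by (simp add: divide_le_eq)

text \<open>The top Taylor term has the factor y^n. In the terms with \<psi>' one has 1 <= |y|/t <=
  2 with t = tau s x, so the factor (|y|/t)^n may be inserted for free. The constant depends only on
  \<open>n\<close> and the cut-off, not on \<open>h\<close> or \<open>s\<close>.\<close>

lemma edbar_bound:
  assumes c: "cutpair \<psi> \<psi>'"
  obtains K where "K > 0"
    "\<And>h s x y. s > 0 \<Longrightarrow> cmod (edbar n \<psi> \<psi>' s h (x, y)) \<le> K * wt n s h x * (\<bar>y\<bar> / tau s x) ^ n"
proof -
  obtain C where C: "C > 0" "\<And>t. cmod (\<psi> t) \<le> C" "\<And>t. cmod (\<psi>' t) \<le> C" using cutpair_bound[OF c] by blast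
  have main: "cmod (edbar n \<psi> \<psi>' s h (x, y)) \<le> (C + 3 * 2 ^ n * C) * wt n s h x * (\<bar>y\<bar> / tau s x) ^ n"
    if s: "s > 0" for h s x y
  proof -
    define t where "t = tau s x"
    have t: "t > 0" "\<bar>x\<bar> \<le> t" unfolding t_def using tau_pos[OF s] tau_ge_abs by auto
    have W: "wt n s h x \<ge> 0" by (rule wt_nonneg)
    have A: "cmod (h (Suc n) x * (\<i> * of_real y) ^ n / fact n * \<psi> (y / t)) \<le> C * wt n s h x * (\<bar>y\<bar> / t) ^ n"
    proof -
      have "cmod (h (Suc n) x * (\<i> * of_real y) ^ n / fact n * \<psi> (y / t)) = cmod (h (Suc n) x) * \<bar>y\<bar> ^ n / fact n * cmod (\<psi> (y / t))"
        by (simp add: norm_mult norm_divide norm_power)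
      also have "\<dots> \<le> (cmod (h (Suc n) x) * \<bar>y\<bar> ^ n) * C"
        by (intro mult_mono C divide_fact_le) auto
      also have "cmod (h (Suc n) x) * \<bar>y\<bar> ^ n = (cmod (h (Suc n) x) * t powr (real (Suc n) - 1)) * (\<bar>y\<bar> / t) ^ n"
        using t by (simp add: powr_realpow power_divide)
      also have "\<dots> * C \<le> wt n s h x * (\<bar>y\<bar> / t) ^ n * C"
        unfolding t_def using C(1) tau_pos[OF s, of x] by (intro mult_right_mono wt_ge) auto
      finally show ?thesis by (simp add: mult_ac)
    qed
    have B: "cmod (taylor n h x y * ((of_real (- y * x / t ^ 3) + \<i> * of_real (1 / t)) * \<psi>' (y / t)))
       \<le> (3 * 2 ^ n * C) * wt n s h x * (\<bar>y\<bar> / t) ^ n"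
    proof (cases "\<bar>y\<bar> / t \<le> 1 \<or> \<bar>y\<bar> / t \<ge> 2")
      case True
      then have "\<psi>' (y / t) = 0" using t by (intro cutpair_deriv_0[OF c]) auto
      then show ?thesis using W C t by simp
    next
      case False
      then have y: "\<bar>y\<bar> \<ge> t" "\<bar>y\<bar> \<le> 2 * t" "\<bar>y\<bar> / t \<ge> 1" using t by (auto simp: field_simps)
      have "cmod (taylor n h x y) \<le> (\<Sum>r\<le>n. 2 ^ n * t * (cmod (h r x) * t powr (real r - 1)))"
        unfolding taylor_def
      proof (rule sum_norm_le)
        fix r assume r: "r \<in> {..n}"
        have "cmod (h r x * (\<i> * of_real y) ^ r / fact r) = cmod (h r x) * \<bar>y\<bar> ^ r / fact r"
          by (simp add: norm_mult norm_divide norm_power)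
        also have "\<dots> \<le> cmod (h r x) * \<bar>y\<bar> ^ r"
          by (intro divide_fact_le) auto
        also have "\<dots> \<le> cmod (h r x) * (2 * t) ^ r" using y by (intro mult_left_mono power_mono) auto
        also have "\<dots> = 2 ^ r * (cmod (h r x) * t ^ r)" by (simp add: power_mult_distrib)
        also have "\<dots> \<le> 2 ^ n * (cmod (h r x) * t ^ r)" using r t by (intro mult_right_mono power_increasing) auto
        also have "t ^ r = t * t powr (real r - 1)" using t by (simp add: powr_diff powr_realpow)
        finally show "cmod (h r x * (\<i> * of_real y) ^ r / fact r) \<le> 2 ^ n * t * (cmod (h r x) * t powr (real r - 1))"
          by (simp add: mult_ac)
      qed
      also have "\<dots> = 2 ^ n * t * (\<Sum>r\<le>n. cmod (h r x) * t powr (real r - 1))" by (simp add: sum_distrib_left)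
      also have "\<dots> \<le> 2 ^ n * t * wt n s h x"
        unfolding wt_def t_def[symmetric] using t by (intro mult_left_mono sum_mono2) auto
      finally have 1: "cmod (taylor n h x y) \<le> 2 ^ n * t * wt n s h x" .
      have "cmod (of_real (- y * x / t ^ 3) + \<i> * of_real (1 / t)) \<le> \<bar>y\<bar> * \<bar>x\<bar> / t ^ 3 + 1 / t"
        by (rule norm_triangle_le) (use t in \<open>simp add: norm_mult norm_divide abs_mult norm_power\<close>)
      also have "\<bar>y\<bar> * \<bar>x\<bar> / t ^ 3 \<le> (2 * t) * t / t ^ 3" using y t by (intro divide_right_mono mult_mono) auto
      also have "(2 * t) * t / t ^ 3 + 1 / t = 3 / t" using t by (simp add: power3_eq_cube field_simps)
      finally have 2: "cmod (of_real (- y * x / t ^ 3) + \<i> * of_real (1 / t)) \<le> 3 / t" by simp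
      have "cmod (taylor n h x y * ((of_real (- y * x / t ^ 3) + \<i> * of_real (1 / t)) * \<psi>' (y / t)))
         \<le> (2 ^ n * t * wt n s h x) * ((3 / t) * C)"
        unfolding norm_mult using t W by (intro mult_mono 1 2 C) auto
      also have "\<dots> = 3 * 2 ^ n * C * wt n s h x * 1" using t by simp
      also have "\<dots> \<le> 3 * 2 ^ n * C * wt n s h x * (\<bar>y\<bar> / t) ^ n"
        using C(1) W y(3) by (intro mult_left_mono one_le_power) auto
      finally show ?thesis by (simp add: mult_ac)
    qed
    have "cmod (edbar n \<psi> \<psi>' s h (x, y)) \<le> 1 / 2 * (C * wt n s h x * (\<bar>y\<bar> / t) ^ n + (3 * 2 ^ n * C) * wt n s h x * (\<bar>y\<bar> / t) ^ n)"
      unfolding edbar_eq t_def[symmetric] norm_mult by (intro mult_mono norm_triangle_le add_mono A B) auto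
    also have "\<dots> \<le> (C + 3 * 2 ^ n * C) * wt n s h x * (\<bar>y\<bar> / t) ^ n"
    proof -
      define X Y where "X = C * wt n s h x * (\<bar>y\<bar> / t) ^ n" and "Y = 3 * 2 ^ n * C * wt n s h x * (\<bar>y\<bar> / t) ^ n"
      have "X \<ge> 0" "Y \<ge> 0" unfolding X_def Y_def using W C t by auto
      then have "1 / 2 * (X + Y) \<le> X + Y" by simp
      then show ?thesis unfolding X_def Y_def by (simp add: distrib_right)
    qed
    finally show ?thesis by (simp add: t_def)
  qed
  show ?thesis by (rule that[of "C + 3 * 2 ^ n * C"]) (use C main in \<open>auto intro: add_pos_nonneg\<close>)
qed

section \<open>Compactly supported jets and kernels that are singular on the axis\<close>

definition eta :: "nat \<Rightarrow> real" where "eta k = 1 / real (Suc k)"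

lemma eta_pos: "eta k > 0" and eta_le1: "eta k \<le> 1"
  by (auto simp: eta_def)

lemma eta_tendsto: "eta \<longlonglongrightarrow> 0"
  unfolding eta_def using LIMSEQ_inverse_real_of_nat by (simp add: inverse_eq_divide)

definition jsupp :: "nat \<Rightarrow> real \<Rightarrow> (nat \<Rightarrow> real \<Rightarrow> complex) \<Rightarrow> bool" where
  "jsupp N M h \<longleftrightarrow> (\<forall>r\<le>N. \<forall>x. \<bar>x\<bar> \<ge> M \<longrightarrow> h r x = 0)"

definition jbnd :: "nat \<Rightarrow> real \<Rightarrow> (nat \<Rightarrow> real \<Rightarrow> complex) \<Rightarrow> bool" where
  "jbnd N B h \<longleftrightarrow> (\<forall>r\<le>N. \<forall>x. cmod (h r x) \<le> B)"

text \<open>A continuous substitute for the indicator of [-M, M], so that the majorants built from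
  it remain continuous off the axis, as \<open>integrable_on_UNIV_dominated\<close> asks.\<close>

definition bump :: "real \<Rightarrow> real \<Rightarrow> real" where
  "bump M x = max 0 (min 1 (M + 1 - \<bar>x\<bar>))"

lemma bump_props: "0 \<le> bump M x" "bump M x \<le> 1" "\<bar>x\<bar> \<le> M \<Longrightarrow> bump M x = 1" "\<bar>x\<bar> \<ge> M + 1 \<Longrightarrow> bump M x = 0"
  by (auto simp: bump_def)

lemma continuous_bump: "continuous_on A f \<Longrightarrow> continuous_on A (\<lambda>x. bump M (f x))"
  unfolding bump_def by (intro continuous_intros)

lemma tau_mono: "\<bar>x\<bar> \<le> \<bar>y\<bar> \<Longrightarrow> tau s x \<le> tau s y"
  unfolding tau_def by (simp add: abs_le_square_iff)

text \<open>For support in [-M, M] the weight is at most a multiple of \<open>B\<close>, and the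
  extension lives in |x| <= M, |y| <= 2 tau s M. Since tau s x >= 1, the quotient |y| / tau s x may
  be replaced by |y|. Linearity in \<open>B\<close> is what makes the rate of
  \<open>stone_approx\<close> uniform.\<close>

lemma edbar_compact:
  assumes c: "cutpair \<psi> \<psi>'" and s: "s \<ge> 1"
  obtains K where "K > 0" "\<And>h B p. jsupp (Suc n) M h \<Longrightarrow> jbnd (Suc n) B h \<Longrightarrow>
     cmod (edbar n \<psi> \<psi>' s h p) \<le> K * B * (bump M (fst p) * bump (2 * tau s M) (snd p)) * \<bar>snd p\<bar> ^ n"
proof -
  obtain K0 where K0: "K0 > 0" "\<And>h s x y. s > 0 \<Longrightarrow> cmod (edbar n \<psi> \<psi>' s h (x, y)) \<le> K0 * wt n s h x * (\<bar>y\<bar> / tau s x) ^ n"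
    using edbar_bound[OF c] by blast
  define K where "K = K0 * (real (n + 2) * tau s M ^ n)"
  have tM: "tau s M > 0" using s by (intro tau_pos) auto
  have s0: "s > 0" using s by simp
  have "cmod (edbar n \<psi> \<psi>' s h p) \<le> K * B * (bump M (fst p) * bump (2 * tau s M) (snd p)) * \<bar>snd p\<bar> ^ n"
    if h: "jsupp (Suc n) M h" and B: "jbnd (Suc n) B h" for h B p
  proof -
    obtain x y where p: "p = (x, y)" by force
    have "cmod (h 0 0) \<le> B" using B by (auto simp: jbnd_def)
    then have B0: "B \<ge> 0" using norm_ge_zero order_trans by blast
    have rhs: "0 \<le> K * B * (bump M x * bump (2 * tau s M) y) * \<bar>y\<bar> ^ n"
      using K0(1) B0 tM by (auto simp: K_def bump_props)
    consider "\<bar>x\<bar> \<ge> M" | "\<bar>y\<bar> \<ge> 2 * tau s x" | "\<bar>x\<bar> < M" "\<bar>y\<bar> < 2 * tau s x" by linarith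
    then show ?thesis
    proof cases
      case 1
      then have "wt n s h x = 0" using h by (auto simp: wt_def jsupp_def intro!: sum.neutral)
      then show ?thesis using K0(2)[OF s0, of h x y] rhs by (simp add: p)
    next
      case 2
      then show ?thesis using edbar_outside[OF c s0] rhs by (simp add: p)
    next
      case 3
      define t where "t = tau s x"
      have t: "1 \<le> t" "t \<le> tau s M" unfolding t_def using s tau_ge[OF s0, of x] 3 by (auto intro!: tau_mono)
      have "wt n s h x \<le> (\<Sum>r\<le>Suc n. B * tau s M ^ n)"
        unfolding wt_def t_def[symmetric]
      proof (rule sum_mono)
        fix r assume r: "r \<in> {..Suc n}"
        have "t powr (real r - 1) \<le> t powr (real n)" using t r by (intro powr_mono) auto
        also have "\<dots> = t ^ n" using t by (simp add: powr_realpow)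
        also have "\<dots> \<le> tau s M ^ n" using t by (intro power_mono) auto
        finally show "cmod (h r x) * t powr (real r - 1) \<le> B * tau s M ^ n"
          using B r B0 by (intro mult_mono) (auto simp: jbnd_def)
      qed
      also have "\<dots> = real (n + 2) * tau s M ^ n * B" by simp
      finally have W: "wt n s h x \<le> real (n + 2) * tau s M ^ n * B" .
      have Y: "(\<bar>y\<bar> / t) ^ n \<le> \<bar>y\<bar> ^ n"
        using t by (intro power_mono) (auto simp: divide_le_eq mult_le_cancel_left1)
      have "cmod (edbar n \<psi> \<psi>' s h (x, y)) \<le> K0 * wt n s h x * (\<bar>y\<bar> / t) ^ n"
        using K0(2)[OF s0] by (simp add: t_def)
      also have "\<dots> \<le> K0 * (real (n + 2) * tau s M ^ n * B) * \<bar>y\<bar> ^ n"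
        using K0(1) t tM B0 wt_nonneg[of n s h x] by (intro mult_mono W Y) auto
      also have "\<dots> = K * B * (bump M x * bump (2 * tau s M) y) * \<bar>y\<bar> ^ n"
        using 3 t by (simp add: K_def bump_props t_def)
      finally show ?thesis by (simp add: p)
    qed
  qed
  moreover have "K > 0" using K0(1) tM by (simp add: K_def)
  ultimately show ?thesis using that by blast
qed

lemma integrable_bump_powr:
  "integrable lborel (\<lambda>x. C * bump M x * tau s x powr \<theta>)" if "s > 0"
proof -
  have "integrable lborel (\<lambda>x. indicator {-\<bar>M\<bar>-1..\<bar>M\<bar>+1} x *\<^sub>R (C * bump M x * tau s x powr \<theta>))"
    using tau_pos[OF that] by (intro borel_integrable_compact) (auto intro!: continuous_intros continuous_bump simp: less_imp_neq[symmetric])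
  also have "(\<lambda>x. indicator {-\<bar>M\<bar>-1..\<bar>M\<bar>+1} x *\<^sub>R (C * bump M x * tau s x powr \<theta>)) = (\<lambda>x. C * bump M x * tau s x powr \<theta>)"
    by (auto simp: fun_eq_iff indicator_def bump_def)
  finally show ?thesis .
qed

text \<open>Covers at once the resolvent, its two shifted half plane versions and the difference of
  these kernels; all of them satisfy the same power bound near the axis.\<close>

locale axis_singular =
  fixes Q :: "real \<times> real \<Rightarrow> 'c::complex_banach" and M Y C \<alpha> :: real
  assumes contQ: "continuous_on {p. snd p \<noteq> 0} Q"
    and boundQ: "\<And>x y. y \<noteq> 0 \<Longrightarrow> \<bar>x\<bar> \<le> M + 1 \<Longrightarrow> \<bar>y\<bar> \<le> Y + 1 \<Longrightarrow> norm (Q (x, y)) \<le> C * \<bar>y\<bar> powr (- 1 - \<alpha>)"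
    and M: "M > 0" and Y: "Y > 0" and C: "C > 0"
begin

definition gcut :: "nat \<Rightarrow> real \<times> real \<Rightarrow> real" where
  "gcut n p = bump M (fst p) * bump Y (snd p) * \<bar>snd p\<bar> ^ n * norm (Q p)"

text \<open>The power of tau inside the weight cancels the one in \<open>wedge\<close>. What remains
  is C bump(x) |y|^(n-\<alpha>-1) on a region containing |y| <= Y + 1, because tau (Y + 1) x >= Y +
  1. It does not mention \<open>Q\<close>, so it dominates a whole family of kernels.\<close>

definition gdom :: "nat \<Rightarrow> real \<times> real \<Rightarrow> real" where
  "gdom n = wedge (real n - \<alpha>) (Y + 1) (\<lambda>x. C * bump M x * tau (Y + 1) x powr (real n - \<alpha>))"

lemma gcut_nonneg: "gcut n p \<ge> 0"
  by (simp add: gcut_def bump_props)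

lemma gdom_integrable: "real n > \<alpha> \<Longrightarrow> gdom n integrable_on UNIV"
  unfolding gdom_def using Y C
  by (intro has_integral_integrable[OF has_integral_wedge] integrable_bump_powr) (auto simp: bump_props)

lemma gcut_le_gdom:
  assumes n: "n > 0"
  shows "gcut n p \<le> gdom n p"
proof -
  obtain x y where p: "p = (x, y)" by force
  have t: "tau (Y + 1) x \<ge> Y + 1" using Y by (intro tau_ge) auto
  have nn: "gdom n p \<ge> 0" using C by (simp add: gdom_def wedge_def bump_props)
  consider "y = 0" | "\<bar>x\<bar> > M + 1" | "\<bar>y\<bar> > Y + 1" | "y \<noteq> 0" "\<bar>x\<bar> \<le> M + 1" "\<bar>y\<bar> \<le> Y + 1" by linarith
  then show ?thesis
  proof cases
    case 4
    have "gcut n p \<le> bump M x * 1 * \<bar>y\<bar> ^ n * (C * \<bar>y\<bar> powr (- 1 - \<alpha>))"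
      unfolding gcut_def p fst_conv snd_conv
      using 4 C by (intro mult_mono boundQ) (auto simp: bump_props)
    also have "\<dots> = C * bump M x * (\<bar>y\<bar> powr (real n) * \<bar>y\<bar> powr (- 1 - \<alpha>))"
      using 4 by (simp add: powr_realpow)
    also have "\<dots> = gdom n p"
      using 4 t Y by (simp add: gdom_def wedge_def p powr_add[symmetric] powr_minus field_simps)
    finally show ?thesis .
  qed (use nn n in \<open>auto simp: gcut_def p bump_props zero_power\<close>)
qed

lemma continuous_gcut: "continuous_on {p. snd p \<noteq> 0} (gcut n)"
  unfolding gcut_def by (intro continuous_intros continuous_bump contQ)

lemma gcut_integrable: "real n > \<alpha> \<Longrightarrow> n > 0 \<Longrightarrow> gcut n integrable_on UNIV"
  by (rule integrable_on_UNIV_dominated[OF continuous_gcut gdom_integrable])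
     (use gcut_le_gdom gcut_nonneg in auto)

lemma integral_bound:
  assumes n: "real n > \<alpha>" "n > 0" and f: "continuous_on UNIV f"
    and le: "\<And>p. cmod (f p) \<le> K * (bump M (fst p) * bump Y (snd p)) * \<bar>snd p\<bar> ^ n"
  shows "(\<lambda>p. f p *\<^sub>C Q p) integrable_on UNIV"
    and "norm (integral UNIV (\<lambda>p. f p *\<^sub>C Q p)) \<le> K * integral UNIV (gcut n)"
proof -
  have d: "norm (f p *\<^sub>C Q p) \<le> K * gcut n p" for p
    using mult_right_mono[OF le[of p] norm_ge_zero[of "Q p"]] by (simp add: gcut_def norm_scaleC mult_ac)
  have i: "(\<lambda>p. K * gcut n p) integrable_on UNIV" using gcut_integrable[OF n] by (rule integrable_on_mult_right)
  show 1: "(\<lambda>p. f p *\<^sub>C Q p) integrable_on UNIV"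
    by (rule integrable_on_UNIV_dominated[OF _ i d])
       (intro continuous_intros contQ continuous_on_subset[OF f] subset_UNIV)
  have "norm (integral UNIV (\<lambda>p. f p *\<^sub>C Q p)) \<le> integral UNIV (\<lambda>p. K * gcut n p)"
    by (rule integral_norm_bound_integral[OF 1 i]) (rule d)
  then show "norm (integral UNIV (\<lambda>p. f p *\<^sub>C Q p)) \<le> K * integral UNIV (gcut n)" by simp
qed

lemma gcut_integral_le: "real n > \<alpha> \<Longrightarrow> n > 0 \<Longrightarrow> integral UNIV (gcut n) \<le> integral UNIV (gdom n)"
  by (intro integral_le gcut_integrable gdom_integrable gcut_le_gdom)

end

section \<open>Stone type boundary formula\<close>

text \<open>Holomorphic functions off the real axis with the growth of the theorem;
  \<open>Rx\<close> and \<open>Ry\<close> together are the Cauchy-Riemann equation. The abstraction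
  has two instances: the resolvent, and the scalar function 1/(z+1) that the normalisation compares
  it with.\<close>

locale hol_off_real =
  fixes R R' :: "complex \<Rightarrow> 'c::complex_banach" and c \<alpha> :: real
  assumes Rx: "\<And>x y. y \<noteq> 0 \<Longrightarrow> ((\<lambda>x. R (Complex x y)) has_vector_derivative R' (Complex x y)) (at x)"
    and Ry: "\<And>x y. y \<noteq> 0 \<Longrightarrow> ((\<lambda>y. R (Complex x y)) has_vector_derivative \<i> *\<^sub>C R' (Complex x y)) (at y)"
    and contR: "continuous_on {z. Im z \<noteq> 0} R" and contR': "continuous_on {z. Im z \<noteq> 0} R'"
    and boundR: "\<And>z. Im z \<noteq> 0 \<Longrightarrow> norm (R z) \<le> c * inverse \<bar>Im z\<bar> * (jbracket z / \<bar>Im z\<bar>) powr \<alpha>"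
    and c_pos: "c > 0" and alpha_nonneg: "\<alpha> \<ge> 0"
begin

lemma continuous_R_comp:
  assumes "continuous_on A f" "continuous_on A g" "\<And>p. p \<in> A \<Longrightarrow> g p \<noteq> 0"
  shows "continuous_on A (\<lambda>p. R (Complex (f p) (g p)))" and "continuous_on A (\<lambda>p. R' (Complex (f p) (g p)))"
proof -
  have "continuous_on A (\<lambda>p. Complex (f p) (g p))"
    unfolding Complex_eq using assms by (intro continuous_intros)
  then show "continuous_on A (\<lambda>p. R (Complex (f p) (g p)))" "continuous_on A (\<lambda>p. R' (Complex (f p) (g p)))"
    using assms by (auto intro: continuous_on_compose2[OF contR] continuous_on_compose2[OF contR'])
qed

lemma boundR_le:
  assumes y: "y \<noteq> 0" "\<bar>y\<bar> \<le> \<bar>v\<bar>" and Z: "jbracket (Complex x v) \<le> Z"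
  shows "norm (R (Complex x v)) \<le> c * Z powr \<alpha> * \<bar>y\<bar> powr (- 1 - \<alpha>)"
proof -
  have j: "jbracket (Complex x v) \<ge> 0" by (simp add: jbracket_def)
  have v: "v \<noteq> 0" using y by auto
  have "norm (R (Complex x v)) \<le> c * (inverse \<bar>v\<bar> * (jbracket (Complex x v) / \<bar>v\<bar>) powr \<alpha>)"
    using boundR[of "Complex x v"] v by (simp add: mult.assoc)
  also have "\<dots> \<le> c * (inverse \<bar>y\<bar> * (Z / \<bar>y\<bar>) powr \<alpha>)"
    using c_pos alpha_nonneg y Z j
    by (intro mult_left_mono mult_mono powr_mono2 frac_le le_imp_inverse_le) auto
  also have "\<dots> = c * Z powr \<alpha> * \<bar>y\<bar> powr (- 1 - \<alpha>)"
    using y Z j by (simp add: powr_divide powr_diff powr_minus field_simps)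
  finally show ?thesis .
qed

definition hs :: "nat \<Rightarrow> (real \<Rightarrow> complex) \<Rightarrow> (real \<Rightarrow> complex) \<Rightarrow> real \<Rightarrow> (nat \<Rightarrow> real \<Rightarrow> complex) \<Rightarrow> 'c" where
  "hs n \<psi> \<psi>' s h = - (1 / pi) *\<^sub>R integral UNIV (\<lambda>p. edbar n \<psi> \<psi>' s h p *\<^sub>C R (Complex (fst p) (snd p)))"

lemma jbracket_Complex_le:
  assumes "s \<ge> 1" "\<bar>y\<bar> \<le> 2 * tau s x"
  shows "jbracket (Complex x y) \<le> 3 * tau s x"
proof -
  have "tau s x ^ 2 = s\<^sup>2 + x\<^sup>2" by (simp add: tau_def)
  moreover have "s\<^sup>2 \<ge> 1" using assms by simp
  moreover have "y\<^sup>2 \<le> 4 * tau s x ^ 2"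
  proof -
    have "\<bar>y\<bar> ^ 2 \<le> (2 * tau s x) ^ 2" using assms by (intro power_mono) auto
    then show ?thesis by (simp add: power_mult_distrib)
  qed
  ultimately have "1 + (x\<^sup>2 + y\<^sup>2) \<le> 9 * tau s x ^ 2"
    using zero_le_power2[of x] by linarith
  also have "\<dots> = (3 * tau s x) ^ 2" by (simp add: power_mult_distrib)
  finally have "1 + (x\<^sup>2 + y\<^sup>2) \<le> (3 * tau s x) ^ 2" .
  then show ?thesis
    using tau_pos[of s x] assms unfolding jbracket_def by (intro real_le_lsqrt) (auto simp: cmod_def)
qed

text \<open>The product of \<open>edbar_bound\<close> and the growth of \<open>R\<close>, using that
  the bracket of z is at most 3 tau s x on the support. The constant is uniform in the scale, which
  the normalisation sends to infinity.\<close>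

lemma edbar_R_bound:
  assumes cp: "cutpair \<psi> \<psi>'" and n: "real n > \<alpha>"
  obtains K where "K > 0" "\<And>h s p. s \<ge> 1 \<Longrightarrow>
     norm (edbar n \<psi> \<psi>' s h p *\<^sub>C R (Complex (fst p) (snd p))) \<le> K * wedge (real n - \<alpha>) s (wt n s h) p"
proof -
  obtain K0 where K0: "K0 > 0" "\<And>h s x y. s > 0 \<Longrightarrow> cmod (edbar n \<psi> \<psi>' s h (x, y)) \<le> K0 * wt n s h x * (\<bar>y\<bar> / tau s x) ^ n"
    using edbar_bound[OF cp] by blast
  define K where "K = K0 * (c * 3 powr \<alpha>)"
  have Kp: "K > 0" using K0 c_pos by (simp add: K_def)
  have n0: "n > 0" using n alpha_nonneg by (cases n) auto
  have "norm (edbar n \<psi> \<psi>' s h p *\<^sub>C R (Complex (fst p) (snd p))) \<le> K * wedge (real n - \<alpha>) s (wt n s h) p"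
    if s: "s \<ge> 1" for h s p
  proof -
    obtain x y where p: "p = (x, y)" by force
    have s0: "s > 0" using s by simp
    define t where "t = tau s x"
    have t: "t > 0" unfolding t_def using s0 by (rule tau_pos)
    have nn: "0 \<le> K * wedge (real n - \<alpha>) s (wt n s h) p"
      using Kp by (simp add: wedge_def wt_nonneg)
    consider "y = 0" | "\<bar>y\<bar> \<ge> 2 * t" | "y \<noteq> 0" "\<bar>y\<bar> \<le> 2 * t" by linarith
    then show ?thesis
    proof cases
      case 1
      then show ?thesis using nn by (simp add: p edbar_axis[OF cp n0])
    next
      case 2
      then show ?thesis using nn by (simp add: p edbar_outside[OF cp s0] t_def)
    next
      case 3
      have "norm (edbar n \<psi> \<psi>' s h (x, y) *\<^sub>C R (Complex x y)) \<le> (K0 * wt n s h x * (\<bar>y\<bar> / t) ^ n) * (c * (3 * t) powr \<alpha> * \<bar>y\<bar> powr (- 1 - \<alpha>))"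
        unfolding norm_scaleC t_def using 3 s t K0 wt_nonneg[of n s h x]
        by (intro mult_mono K0(2) boundR_le jbracket_Complex_le) (auto simp: t_def)
      also have "(\<bar>y\<bar> / t) ^ n = \<bar>y\<bar> powr real n * t powr (- real n)"
        using 3 t by (simp add: powr_realpow powr_minus power_divide field_simps)
      also have "(K0 * wt n s h x * (\<bar>y\<bar> powr real n * t powr (- real n))) * (c * (3 * t) powr \<alpha> * \<bar>y\<bar> powr (- 1 - \<alpha>))
         = K * (wt n s h x * (t powr (- real n) * t powr \<alpha>) * (\<bar>y\<bar> powr real n * \<bar>y\<bar> powr (- 1 - \<alpha>)))"
        using t by (simp add: K_def powr_mult mult_ac)
      also have "\<dots> = K * wedge (real n - \<alpha>) s (wt n s h) p"
        using 3 by (simp add: wedge_def p t_def[symmetric] powr_add[symmetric] algebra_simps)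
      finally show ?thesis by (simp add: p)
    qed
  qed
  then show ?thesis using that Kp by blast
qed

lemma
  assumes cp: "cutpair \<psi> \<psi>'" and n: "real n > \<alpha>" and h: "jet UNIV (Suc n) h" and s: "s \<ge> 1"
    and W: "integrable lborel (wt n s h)"
  shows edbar_R_integrable: "(\<lambda>p. edbar n \<psi> \<psi>' s h p *\<^sub>C R (Complex (fst p) (snd p))) integrable_on UNIV"
    and norm_edbar_R_integrable: "(\<lambda>p. norm (edbar n \<psi> \<psi>' s h p *\<^sub>C R (Complex (fst p) (snd p)))) integrable_on UNIV"
proof -
  obtain K where K: "K > 0" "\<And>h s p. s \<ge> 1 \<Longrightarrow>
     norm (edbar n \<psi> \<psi>' s h p *\<^sub>C R (Complex (fst p) (snd p))) \<le> K * wedge (real n - \<alpha>) s (wt n s h) p"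
    using edbar_R_bound[OF cp n] by blast
  have s0: "s > 0" using s by simp
  have i: "(\<lambda>p. K * wedge (real n - \<alpha>) s (wt n s h) p) integrable_on UNIV"
    using has_integral_wedge[OF _ s0 W wt_nonneg, of "real n - \<alpha>"] n
    by (intro integrable_on_mult_right) (auto intro: has_integral_integrable)
  have co: "continuous_on {p. snd p \<noteq> 0} (\<lambda>p. edbar n \<psi> \<psi>' s h p *\<^sub>C R (Complex (fst p) (snd p)))"
    by (intro continuous_intros continuous_edbar[OF h cp s0] continuous_R_comp) auto
  show "(\<lambda>p. edbar n \<psi> \<psi>' s h p *\<^sub>C R (Complex (fst p) (snd p))) integrable_on UNIV"
    by (rule integrable_on_UNIV_dominated[OF co i]) (rule K(2)[OF s])
  show "(\<lambda>p. norm (edbar n \<psi> \<psi>' s h p *\<^sub>C R (Complex (fst p) (snd p)))) integrable_on UNIV"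
    by (rule integrable_on_UNIV_dominated[OF continuous_on_norm[OF co] i]) (use K(2)[OF s] in auto)
qed

text \<open>The bound with the norm inside the integral is stated separately because the
  normalisation multiplies the integrand by a further small scalar before integrating.\<close>

lemma hs_bound:
  assumes cp: "cutpair \<psi> \<psi>'" and n: "real n > \<alpha>"
  obtains K where "K > 0"
    "\<And>h s. jet UNIV (Suc n) h \<Longrightarrow> s \<ge> 1 \<Longrightarrow> integrable lborel (wt n s h) \<Longrightarrow>
       integral UNIV (\<lambda>p. norm (edbar n \<psi> \<psi>' s h p *\<^sub>C R (Complex (fst p) (snd p)))) \<le> K * integral\<^sup>L lborel (wt n s h)"
    "\<And>h s. jet UNIV (Suc n) h \<Longrightarrow> s \<ge> 1 \<Longrightarrow> integrable lborel (wt n s h) \<Longrightarrow>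
       norm (hs n \<psi> \<psi>' s h) \<le> K * integral\<^sup>L lborel (wt n s h)"
proof -
  obtain K where K: "K > 0" "\<And>h s p. s \<ge> 1 \<Longrightarrow>
     norm (edbar n \<psi> \<psi>' s h p *\<^sub>C R (Complex (fst p) (snd p))) \<le> K * wedge (real n - \<alpha>) s (wt n s h) p"
    using edbar_R_bound[OF cp n] by blast
  define \<theta> where "\<theta> = real n - \<alpha>"
  have th: "\<theta> > 0" using n by (simp add: \<theta>_def)
  define L where "L = K * (2 powr (\<theta> + 1) / \<theta>)"
  have L: "L > 0" using th K(1) by (simp add: L_def)
  have 1: "integral UNIV (\<lambda>p. norm (edbar n \<psi> \<psi>' s h p *\<^sub>C R (Complex (fst p) (snd p)))) \<le> L * integral\<^sup>L lborel (wt n s h)"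
    if h: "jet UNIV (Suc n) h" and s: "s \<ge> 1" and W: "integrable lborel (wt n s h)" for h s
  proof -
    have s0: "s > 0" using s by simp
    have w: "(wedge \<theta> s (wt n s h) has_integral (2 powr (\<theta> + 1) / \<theta> * integral\<^sup>L lborel (wt n s h))) UNIV"
      by (rule has_integral_wedge[OF th s0 W wt_nonneg])
    have "integral UNIV (\<lambda>p. norm (edbar n \<psi> \<psi>' s h p *\<^sub>C R (Complex (fst p) (snd p)))) \<le> integral UNIV (\<lambda>p. K * wedge \<theta> s (wt n s h) p)"
      using w K(2)[OF s] unfolding \<theta>_def
      by (intro integral_le norm_edbar_R_integrable[OF cp n h s W] integrable_on_mult_right) (auto intro: has_integral_integrable)
    also have "\<dots> = L * integral\<^sup>L lborel (wt n s h)"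
      using integral_unique[OF w] by (simp add: L_def)
    finally show ?thesis .
  qed
  have 2: "norm (hs n \<psi> \<psi>' s h) \<le> L * integral\<^sup>L lborel (wt n s h)"
    if h: "jet UNIV (Suc n) h" and s: "s \<ge> 1" and W: "integrable lborel (wt n s h)" for h s
  proof -
    let ?F = "\<lambda>p. edbar n \<psi> \<psi>' s h p *\<^sub>C R (Complex (fst p) (snd p))"
    have "norm (hs n \<psi> \<psi>' s h) = (1 / pi) * norm (integral UNIV ?F)" by (simp add: hs_def)
    also have "\<dots> \<le> 1 * norm (integral UNIV ?F)" using pi_gt3 by (intro mult_right_mono) auto
    also have "norm (integral UNIV ?F) \<le> integral UNIV (\<lambda>p. norm (?F p))"
      by (intro integral_norm_bound_integral edbar_R_integrable[OF cp n h s W] norm_edbar_R_integrable[OF cp n h s W]) auto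
    also have "\<dots> \<le> L * integral\<^sup>L lborel (wt n s h)" by (rule 1[OF h s W])
    finally show ?thesis by simp
  qed
  show ?thesis by (rule that[OF L 1 2])
qed

text \<open>Integrates both partial derivatives of the extension times the shifted \<open>R\<close>
  over a box on which \<open>R\<close> is holomorphic. The x-derivative integrates to 0 since
  \<open>h\<close> vanishes at the ends -M and M; the y-derivative leaves the two horizontal
  edges.\<close>

lemma green_box:
  assumes h: "jet UNIV (Suc n) h" and cp: "cutpair \<psi> \<psi>'" and s: "s \<ge> 1" and M: "M > 0" and supp: "jsupp (Suc n) M h"
    and pq: "p \<le> q" and \<zeta>: "\<And>y. p \<le> y \<Longrightarrow> y \<le> q \<Longrightarrow> y + \<zeta> \<noteq> 0"
  shows "2 *\<^sub>C integral (cbox (-M, p) (M, q)) (\<lambda>u. edbar n \<psi> \<psi>' s h u *\<^sub>C R (Complex (fst u) (snd u + \<zeta>)))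
    = \<i> *\<^sub>C integral {-M..M} (\<lambda>x. ext n \<psi> s h x q *\<^sub>C R (Complex x (q + \<zeta>)) - ext n \<psi> s h x p *\<^sub>C R (Complex x (p + \<zeta>)))"
proof -
  have s0: "s > 0" using s by simp
  let ?B = "cbox (-M, p) (M, q)"
  define Vx where "Vx = (\<lambda>u. ext_dx n \<psi> \<psi>' s h (fst u) (snd u) *\<^sub>C R (Complex (fst u) (snd u + \<zeta>))
      + ext n \<psi> s h (fst u) (snd u) *\<^sub>C R' (Complex (fst u) (snd u + \<zeta>)))"
  define Vy where "Vy = (\<lambda>u. ext_dy n \<psi> \<psi>' s h (fst u) (snd u) *\<^sub>C R (Complex (fst u) (snd u + \<zeta>))
      + ext n \<psi> s h (fst u) (snd u) *\<^sub>C (\<i> *\<^sub>C R' (Complex (fst u) (snd u + \<zeta>))))"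
  define V where "V x y = ext n \<psi> s h x y *\<^sub>C R (Complex x (y + \<zeta>))" for x y
  have nz: "snd u + \<zeta> \<noteq> 0" if "u \<in> ?B" for u
    using that by (intro \<zeta>) (auto simp: cbox_Pair_eq)
  have cR: "continuous_on ?B (\<lambda>u. R (Complex (fst u) (snd u + \<zeta>)))" "continuous_on ?B (\<lambda>u. R' (Complex (fst u) (snd u + \<zeta>)))"
    by (intro continuous_R_comp continuous_intros nz; assumption)+
  note cE = continuous_ext[OF h cp s0] continuous_ext_dx[OF h cp s0] continuous_ext_dy[OF h cp s0]
  have cVx: "continuous_on ?B Vx" unfolding Vx_def by (intro continuous_intros cE cR)
  have cVy: "continuous_on ?B Vy" unfolding Vy_def by (intro continuous_intros cE cR bounded_linear.continuous_on[OF bounded_linear_scaleC_right])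
  have dVx: "((\<lambda>x. V x y) has_vector_derivative Vx (x, y)) (at x)" if "p \<le> y" "y \<le> q" for x y
    unfolding V_def Vx_def
    by (rule has_vector_derivative_eq_rhs[OF has_vector_derivative_scaleC[OF ext_has_dx[OF h cp s0] Rx[OF \<zeta>[OF that]]]])
       (simp add: add.commute)
  have dVy: "((\<lambda>y. V x y) has_vector_derivative Vy (x, y)) (at y)" if "p \<le> y" "y \<le> q" for x y
  proof -
    have "(((\<lambda>y. R (Complex x y)) o (\<lambda>y. y + \<zeta>)) has_vector_derivative 1 *\<^sub>R (\<i> *\<^sub>C R' (Complex x (y + \<zeta>)))) (at y)"
      by (rule vector_diff_chain_at) (auto intro!: derivative_eq_intros Ry[OF \<zeta>[OF that]])
    then have d: "((\<lambda>y. R (Complex x (y + \<zeta>))) has_vector_derivative \<i> *\<^sub>C R' (Complex x (y + \<zeta>))) (at y)"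
      by (simp add: o_def)
    show ?thesis
      unfolding V_def Vy_def
      by (rule has_vector_derivative_eq_rhs[OF has_vector_derivative_scaleC[OF ext_has_dy[OF cp s0] d]])
         (simp add: add.commute)
  qed
  have V0: "V M y = 0" "V (-M) y = 0" for y
    using supp M by (auto simp: V_def ext_def taylor_def jsupp_def)
  have "integral ?B Vx = integral (cbox (-M) M) (\<lambda>x. integral (cbox p q) (\<lambda>y. Vx (x, y)))"
    by (rule integral_prod_continuous[OF cVx])
  also have "\<dots> = integral (cbox p q) (\<lambda>y. integral (cbox (-M) M) (\<lambda>x. Vx (x, y)))"
    using cVx by (intro integral_swap_continuous) (simp add: case_prod_unfold)
  also have "\<dots> = integral (cbox p q) (\<lambda>y. 0)"
  proof (rule integral_cong)
    fix y assume "y \<in> cbox p q"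
    then have "((\<lambda>x. Vx (x, y)) has_integral (V M y - V (-M) y)) {-M..M}"
      using M dVx by (intro fundamental_theorem_of_calculus) (auto intro: has_vector_derivative_at_within)
    then show "integral (cbox (-M) M) (\<lambda>x. Vx (x, y)) = 0"
      by (simp add: V0 integral_unique)
  qed
  finally have X: "integral ?B Vx = 0" by simp
  have "integral ?B Vy = integral (cbox (-M) M) (\<lambda>x. integral (cbox p q) (\<lambda>y. Vy (x, y)))"
    by (rule integral_prod_continuous[OF cVy])
  also have "\<dots> = integral (cbox (-M) M) (\<lambda>x. V x q - V x p)"
  proof (rule integral_cong)
    fix x assume "x \<in> cbox (-M) M"
    have "((\<lambda>y. Vy (x, y)) has_integral (V x q - V x p)) {p..q}"
      using pq dVy by (intro fundamental_theorem_of_calculus) (auto intro: has_vector_derivative_at_within)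
    then show "integral (cbox p q) (\<lambda>y. Vy (x, y)) = V x q - V x p"
      by (simp add: integral_unique)
  qed
  finally have Y: "integral ?B Vy = integral {-M..M} (\<lambda>x. V x q - V x p)" by simp
  \<comment> \<open>Cauchy-Riemann: the term with \<open>R'\<close> from the x-derivative cancels
    the one from i times the y-derivative, since i times i is -1.\<close>
  have "2 *\<^sub>C (edbar n \<psi> \<psi>' s h u *\<^sub>C R (Complex (fst u) (snd u + \<zeta>))) = Vx u + \<i> *\<^sub>C Vy u" for u
    unfolding edbar_def Vx_def Vy_def
    by (simp add: scaleC_scaleC scaleC_add_left scaleC_add_right scaleC_minus_left algebra_simps)
  then have eq: "(\<lambda>u. 2 *\<^sub>C (edbar n \<psi> \<psi>' s h u *\<^sub>C R (Complex (fst u) (snd u + \<zeta>)))) = (\<lambda>u. Vx u + \<i> *\<^sub>C Vy u)" by auto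
  have "2 *\<^sub>C integral ?B (\<lambda>u. edbar n \<psi> \<psi>' s h u *\<^sub>C R (Complex (fst u) (snd u + \<zeta>)))
    = integral ?B (\<lambda>u. 2 *\<^sub>C (edbar n \<psi> \<psi>' s h u *\<^sub>C R (Complex (fst u) (snd u + \<zeta>))))"
    by (intro integral_scaleC[symmetric] integrable_continuous continuous_intros continuous_edbar[OF h cp s0] cR)
  also have "\<dots> = integral ?B Vx + integral ?B (\<lambda>u. \<i> *\<^sub>C Vy u)"
    unfolding eq by (intro integral_add integrable_scaleC integrable_continuous cVx cVy)
  also have "\<dots> = \<i> *\<^sub>C integral ?B Vy"
    unfolding X by (simp add: integral_scaleC integrable_continuous cVy)
  finally show ?thesis unfolding Y V_def .
qed

section \<open>Integrals along lines parallel to the axis\<close>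

definition trace :: "real \<Rightarrow> real \<Rightarrow> (nat \<Rightarrow> real \<Rightarrow> complex) \<Rightarrow> 'c" where
  "trace M \<zeta> h = integral {-M..M} (\<lambda>x. h 0 x *\<^sub>C R (Complex x \<zeta>))"

definition stone :: "real \<Rightarrow> real \<Rightarrow> (nat \<Rightarrow> real \<Rightarrow> complex) \<Rightarrow> 'c" where
  "stone M \<epsilon> h = (1 / (2 * pi * \<i>)) *\<^sub>C (trace M (- \<epsilon>) h - trace M \<epsilon> h)"

text \<open>\<open>R\<close> on the upper half plane, moved away from the axis by \<epsilon> and
  continued by 0. Together with \<open>QL\<close> it tends to \<open>R\<close> off the axis, while
  for \<epsilon> > 0 each half can be treated by Green's theorem up to the axis itself.\<close>

definition QU :: "real \<Rightarrow> real \<times> real \<Rightarrow> 'c" where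
  "QU \<epsilon> p = (if snd p > 0 then R (Complex (fst p) (snd p + \<epsilon>)) else 0)"

definition QL :: "real \<Rightarrow> real \<times> real \<Rightarrow> 'c" where
  "QL \<epsilon> p = (if snd p < 0 then R (Complex (fst p) (snd p - \<epsilon>)) else 0)"

lemma edbar_supp:
  assumes "jsupp (Suc n) M h" "\<bar>x\<bar> \<ge> M" shows "edbar n \<psi> \<psi>' s h (x, y) = 0"
  using assms by (simp add: edbar_eq jsupp_def taylor_def)

text \<open>Green's theorem on the box from the axis up to Y = 2 tau s M. On the upper edge the
  cut-off vanishes; on the axis the extension is \<open>h\<close> itself, because only the Taylor
  term of degree 0 survives and \<psi>(0) = 1.\<close>

lemma edbar_trace_upper:
  assumes h: "jet UNIV (Suc n) h" and cp: "cutpair \<psi> \<psi>'" and s: "s \<ge> 1" and M: "M > 0" and supp: "jsupp (Suc n) M h"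
    and n: "n > 0" and e: "\<epsilon> > 0"
  shows "integral UNIV (\<lambda>p. edbar n \<psi> \<psi>' s h p *\<^sub>C QU \<epsilon> p) = (- \<i> / 2) *\<^sub>C trace M \<epsilon> h"
proof -
  define Y where "Y = 2 * tau s M"
  have s0: "s > 0" using s by simp
  have Y: "Y > 0" using tau_pos[OF s0] by (simp add: Y_def)
  have Yx: "2 * tau s x \<le> Y" if "\<bar>x\<bar> \<le> M" for x unfolding Y_def using tau_mono[of x M s] that by simp
  have eq: "edbar n \<psi> \<psi>' s h p *\<^sub>C QU \<epsilon> p =
     (if p \<in> cbox (-M, 0) (M, Y) then edbar n \<psi> \<psi>' s h p *\<^sub>C R (Complex (fst p) (snd p + \<epsilon>)) else 0)" for p
  proof -
    obtain x y where p: "p = (x, y)" by force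
    consider "y = 0" | "y < 0" | "y > 0" "\<bar>x\<bar> > M" | "y > 0" "\<bar>x\<bar> \<le> M" "y \<le> Y" | "y > 0" "\<bar>x\<bar> \<le> M" "y > Y" by linarith
    then show ?thesis
    proof cases
      case 3
      then show ?thesis using edbar_supp[OF supp] by (simp add: p)
    next
      case 5
      then have "edbar n \<psi> \<psi>' s h p = 0" unfolding p using Yx[of x] by (intro edbar_outside[OF cp s0]) auto
      then show ?thesis by simp
    qed (auto simp: p QU_def edbar_axis[OF cp n] cbox_Pair_eq)
  qed
  have "2 *\<^sub>C integral UNIV (\<lambda>p. edbar n \<psi> \<psi>' s h p *\<^sub>C QU \<epsilon> p)
     = 2 *\<^sub>C integral (cbox (-M, 0) (M, Y)) (\<lambda>p. edbar n \<psi> \<psi>' s h p *\<^sub>C R (Complex (fst p) (snd p + \<epsilon>)))"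
    unfolding eq integral_restrict_UNIV ..
  also have "\<dots> = \<i> *\<^sub>C integral {-M..M} (\<lambda>x. ext n \<psi> s h x Y *\<^sub>C R (Complex x (Y + \<epsilon>)) - ext n \<psi> s h x 0 *\<^sub>C R (Complex x (0 + \<epsilon>)))"
    using e Y by (intro green_box[OF h cp s M supp]) auto
  also have "integral {-M..M} (\<lambda>x. ext n \<psi> s h x Y *\<^sub>C R (Complex x (Y + \<epsilon>)) - ext n \<psi> s h x 0 *\<^sub>C R (Complex x (0 + \<epsilon>)))
     = integral {-M..M} (\<lambda>x. - (h 0 x *\<^sub>C R (Complex x \<epsilon>)))"
  proof (rule integral_cong)
    fix x assume "x \<in> {-M..M}"
    then have "\<bar>x\<bar> \<le> M" by auto
    then have "\<bar>Y / tau s x\<bar> \<ge> 2" using Yx[of x] tau_pos[OF s0, of x] Y by (simp add: field_simps)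
    then have "ext n \<psi> s h x Y = 0" using cp by (simp add: ext_def cutpair_def)
    moreover have "ext n \<psi> s h x 0 = h 0 x" using cp by (simp add: ext_def taylor_def cutpair_def power_0_left sum.delta' if_distrib if_distribR cong: if_cong)
    ultimately show "ext n \<psi> s h x Y *\<^sub>C R (Complex x (Y + \<epsilon>)) - ext n \<psi> s h x 0 *\<^sub>C R (Complex x (0 + \<epsilon>)) = - (h 0 x *\<^sub>C R (Complex x \<epsilon>))"
      by simp
  qed
  also have "\<i> *\<^sub>C \<dots> = 2 *\<^sub>C ((- \<i> / 2) *\<^sub>C trace M \<epsilon> h)"
    by (simp add: trace_def scaleC_scaleC scaleC_minus_left scaleC_minus_right)
  finally have "(1/2) *\<^sub>C (2 *\<^sub>C integral UNIV (\<lambda>p. edbar n \<psi> \<psi>' s h p *\<^sub>C QU \<epsilon> p)) = (1/2) *\<^sub>C (2 *\<^sub>C ((- \<i> / 2) *\<^sub>C trace M \<epsilon> h))"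
    by simp
  then show ?thesis by (simp add: scaleC_scaleC)
qed

lemma edbar_trace_lower:
  assumes h: "jet UNIV (Suc n) h" and cp: "cutpair \<psi> \<psi>'" and s: "s \<ge> 1" and M: "M > 0" and supp: "jsupp (Suc n) M h"
    and n: "n > 0" and e: "\<epsilon> > 0"
  shows "integral UNIV (\<lambda>p. edbar n \<psi> \<psi>' s h p *\<^sub>C QL \<epsilon> p) = (\<i> / 2) *\<^sub>C trace M (- \<epsilon>) h"
proof -
  define Y where "Y = 2 * tau s M"
  have s0: "s > 0" using s by simp
  have Y: "Y > 0" using tau_pos[OF s0] by (simp add: Y_def)
  have Yx: "2 * tau s x \<le> Y" if "\<bar>x\<bar> \<le> M" for x unfolding Y_def using tau_mono[of x M s] that by simp
  have eq: "edbar n \<psi> \<psi>' s h p *\<^sub>C QL \<epsilon> p =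
     (if p \<in> cbox (-M, -Y) (M, 0) then edbar n \<psi> \<psi>' s h p *\<^sub>C R (Complex (fst p) (snd p + - \<epsilon>)) else 0)" for p
  proof -
    obtain x y where p: "p = (x, y)" by force
    consider "y = 0" | "y > 0" | "y < 0" "\<bar>x\<bar> > M" | "y < 0" "\<bar>x\<bar> \<le> M" "y \<ge> -Y" | "y < 0" "\<bar>x\<bar> \<le> M" "y < -Y" by linarith
    then show ?thesis
    proof cases
      case 3
      then show ?thesis using edbar_supp[OF supp] by (simp add: p)
    next
      case 5
      then have "edbar n \<psi> \<psi>' s h p = 0" unfolding p using Yx[of x] by (intro edbar_outside[OF cp s0]) auto
      then show ?thesis by simp
    qed (auto simp: p QL_def edbar_axis[OF cp n] cbox_Pair_eq)
  qed
  have "2 *\<^sub>C integral UNIV (\<lambda>p. edbar n \<psi> \<psi>' s h p *\<^sub>C QL \<epsilon> p)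
     = 2 *\<^sub>C integral (cbox (-M, -Y) (M, 0)) (\<lambda>p. edbar n \<psi> \<psi>' s h p *\<^sub>C R (Complex (fst p) (snd p + - \<epsilon>)))"
    unfolding eq integral_restrict_UNIV ..
  also have "\<dots> = \<i> *\<^sub>C integral {-M..M} (\<lambda>x. ext n \<psi> s h x 0 *\<^sub>C R (Complex x (0 + - \<epsilon>)) - ext n \<psi> s h x (-Y) *\<^sub>C R (Complex x (-Y + - \<epsilon>)))"
    using e Y by (intro green_box[OF h cp s M supp]) auto
  also have "integral {-M..M} (\<lambda>x. ext n \<psi> s h x 0 *\<^sub>C R (Complex x (0 + - \<epsilon>)) - ext n \<psi> s h x (-Y) *\<^sub>C R (Complex x (-Y + - \<epsilon>)))
     = integral {-M..M} (\<lambda>x. h 0 x *\<^sub>C R (Complex x (- \<epsilon>)))"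
  proof (rule integral_cong)
    fix x assume "x \<in> {-M..M}"
    then have "\<bar>x\<bar> \<le> M" by auto
    then have "\<bar>- Y / tau s x\<bar> \<ge> 2" using Yx[of x] tau_pos[OF s0, of x] Y by (simp add: field_simps)
    then have "ext n \<psi> s h x (-Y) = 0" using cp by (simp add: ext_def cutpair_def)
    moreover have "ext n \<psi> s h x 0 = h 0 x" using cp by (simp add: ext_def taylor_def cutpair_def power_0_left sum.delta' if_distrib if_distribR cong: if_cong)
    ultimately show "ext n \<psi> s h x 0 *\<^sub>C R (Complex x (0 + - \<epsilon>)) - ext n \<psi> s h x (-Y) *\<^sub>C R (Complex x (-Y + - \<epsilon>)) = h 0 x *\<^sub>C R (Complex x (- \<epsilon>))"
      by simp
  qed
  also have "\<i> *\<^sub>C \<dots> = 2 *\<^sub>C ((\<i> / 2) *\<^sub>C trace M (- \<epsilon>) h)"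
    by (simp add: trace_def scaleC_scaleC)
  finally have "(1/2) *\<^sub>C (2 *\<^sub>C integral UNIV (\<lambda>p. edbar n \<psi> \<psi>' s h p *\<^sub>C QL \<epsilon> p)) = (1/2) *\<^sub>C (2 *\<^sub>C ((\<i> / 2) *\<^sub>C trace M (- \<epsilon>) h))"
    by simp
  then show ?thesis by (simp add: scaleC_scaleC)
qed

lemma jbracket_Complex_le_sum: "jbracket (Complex x y) \<le> 1 + \<bar>x\<bar> + \<bar>y\<bar>"
proof -
  have "1 + (x\<^sup>2 + y\<^sup>2) \<le> (1 + \<bar>x\<bar> + \<bar>y\<bar>)\<^sup>2"
    by (simp add: power2_eq_square algebra_simps)
  then show ?thesis unfolding jbracket_def by (intro real_le_lsqrt) (auto simp: cmod_def)
qed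

lemma continuous_on_halfplanes:
  assumes "continuous_on {p::real\<times>real. snd p > 0} f" "continuous_on {p. snd p < 0} f"
  shows "continuous_on {p. snd p \<noteq> 0} f"
proof -
  have "{p::real\<times>real. snd p \<noteq> 0} = {p. snd p > 0} \<union> {p. snd p < 0}" by auto
  moreover have "open {p::real\<times>real. snd p > 0}" "open {p::real\<times>real. snd p < 0}"
    by (intro open_Collect_less continuous_intros)+
  ultimately show ?thesis using assms by (auto intro: continuous_on_open_Un)
qed

lemma continuous_QU: "\<epsilon> \<ge> 0 \<Longrightarrow> continuous_on {p. snd p \<noteq> 0} (QU \<epsilon>)"
proof (rule continuous_on_halfplanes)
  assume "\<epsilon> \<ge> 0"
  then have "continuous_on {p. snd p > 0} (\<lambda>p. R (Complex (fst p) (snd p + \<epsilon>)))"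
    by (intro continuous_R_comp continuous_intros) auto
  then show "continuous_on {p. snd p > 0} (QU \<epsilon>)" by (rule continuous_on_eq) (simp add: QU_def)
  show "continuous_on {p. snd p < 0} (QU \<epsilon>)"
    by (rule continuous_on_eq[OF continuous_on_const[of _ 0]]) (simp add: QU_def)
qed

lemma continuous_QL: "\<epsilon> \<ge> 0 \<Longrightarrow> continuous_on {p. snd p \<noteq> 0} (QL \<epsilon>)"
proof (rule continuous_on_halfplanes)
  assume "\<epsilon> \<ge> 0"
  then have "continuous_on {p. snd p < 0} (\<lambda>p. R (Complex (fst p) (snd p - \<epsilon>)))"
    by (intro continuous_R_comp continuous_intros) auto
  then show "continuous_on {p. snd p < 0} (QL \<epsilon>)" by (rule continuous_on_eq) (simp add: QL_def)
  show "continuous_on {p. snd p > 0} (QL \<epsilon>)"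
    by (rule continuous_on_eq[OF continuous_on_const[of _ 0]]) (simp add: QL_def)
qed

definition Qdiff :: "real \<Rightarrow> real \<times> real \<Rightarrow> 'c" where
  "Qdiff \<epsilon> p = QU \<epsilon> p + QL \<epsilon> p - R (Complex (fst p) (snd p))"

text \<open>The difference of the two sides is, up to the factor -\<pi>, the integral of the dbar
  derivative against \<open>Qdiff\<close>, which tends to 0 pointwise off the axis under one
  integrable majorant. The rate \<omega> is found before \<open>h\<close> and enters multiplied by
  \<open>B\<close>; later the limit is taken inside an integral over a parameter of
  \<open>h\<close>. The trace bounds come from the same majorant.\<close>

lemma stone_approx:
  assumes cp: "cutpair \<psi> \<psi>'" and n: "real n > \<alpha>" and s: "s \<ge> 1" and M: "M > 0"
  obtains \<omega> K where "\<omega> \<longlonglongrightarrow> 0" "K > 0"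
    "\<And>h B k. jet UNIV (Suc n) h \<Longrightarrow> jsupp (Suc n) M h \<Longrightarrow> jbnd (Suc n) B h \<Longrightarrow>
       norm (stone M (eta k) h - hs n \<psi> \<psi>' s h) \<le> \<omega> k * B"
    "\<And>h B k. jet UNIV (Suc n) h \<Longrightarrow> jsupp (Suc n) M h \<Longrightarrow> jbnd (Suc n) B h \<Longrightarrow>
       norm (trace M (eta k) h) \<le> K * B \<and> norm (trace M (- eta k) h) \<le> K * B"
proof -
  define Y where "Y = 2 * tau s M"
  have s0: "s > 0" using s by simp
  have Y: "Y > 0" using tau_pos[OF s0] by (simp add: Y_def)
  have n0: "n > 0" using n alpha_nonneg by (cases n) auto
  \<comment> \<open>Bounds 1 + |x| + |v| for |x| <= M + 1 and |v| <= |y| + 1 <= (Y + 1) + 1, where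
    the last summand 1 is the largest shift.\<close>
  define Z where "Z = 1 + (M + 1) + (Y + 1) + 1"
  have Z: "Z > 0" using M Y by (simp add: Z_def)
  define C where "C = c * Z powr \<alpha>"
  have C: "C > 0" using c_pos Z by (simp add: C_def)
  have bR: "norm (R (Complex x v)) \<le> C * \<bar>y\<bar> powr (- 1 - \<alpha>)"
    if "y \<noteq> 0" "\<bar>x\<bar> \<le> M + 1" "\<bar>y\<bar> \<le> Y + 1" "\<bar>y\<bar> \<le> \<bar>v\<bar>" "\<bar>v\<bar> \<le> \<bar>y\<bar> + 1" for x y v
    unfolding C_def using that jbracket_Complex_le_sum[of x v] by (intro boundR_le) (auto simp: Z_def)
  have bU: "norm (QU \<epsilon> (x, y)) \<le> C * \<bar>y\<bar> powr (- 1 - \<alpha>)"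
    if "y \<noteq> 0" "\<bar>x\<bar> \<le> M + 1" "\<bar>y\<bar> \<le> Y + 1" "\<epsilon> \<ge> 0" "\<epsilon> \<le> 1" for x y \<epsilon>
    using that C bR[of y x "y + \<epsilon>"] by (auto simp: QU_def)
  have bL: "norm (QL \<epsilon> (x, y)) \<le> C * \<bar>y\<bar> powr (- 1 - \<alpha>)"
    if "y \<noteq> 0" "\<bar>x\<bar> \<le> M + 1" "\<bar>y\<bar> \<le> Y + 1" "\<epsilon> \<ge> 0" "\<epsilon> \<le> 1" for x y \<epsilon>
    using that C bR[of y x "y - \<epsilon>"] by (auto simp: QL_def)
  have bD: "norm (Qdiff \<epsilon> (x, y)) \<le> 3 * C * \<bar>y\<bar> powr (- 1 - \<alpha>)"
    if "y \<noteq> 0" "\<bar>x\<bar> \<le> M + 1" "\<bar>y\<bar> \<le> Y + 1" "\<epsilon> \<ge> 0" "\<epsilon> \<le> 1" for x y \<epsilon>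
  proof -
    have "norm (Qdiff \<epsilon> (x, y)) \<le> norm (QU \<epsilon> (x, y)) + norm (QL \<epsilon> (x, y)) + norm (R (Complex x y))"
      unfolding Qdiff_def fst_conv snd_conv by (intro norm_triangle_le_diff norm_triangle_le add_mono order_refl)
    also have "\<dots> \<le> C * \<bar>y\<bar> powr (- 1 - \<alpha>) + C * \<bar>y\<bar> powr (- 1 - \<alpha>) + C * \<bar>y\<bar> powr (- 1 - \<alpha>)"
      using that by (intro add_mono bU bL bR) auto
    finally show ?thesis by simp
  qed
  have cD: "continuous_on {p. snd p \<noteq> 0} (Qdiff \<epsilon>)" if "\<epsilon> \<ge> 0" for \<epsilon>
    unfolding Qdiff_def using that by (intro continuous_intros continuous_QU continuous_QL continuous_R_comp) auto
  have AU: "axis_singular (QU \<epsilon>) M Y C \<alpha>" if "\<epsilon> \<ge> 0" "\<epsilon> \<le> 1" for \<epsilon>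
    by unfold_locales (use continuous_QU bU M Y C that in auto)
  have AL: "axis_singular (QL \<epsilon>) M Y C \<alpha>" if "\<epsilon> \<ge> 0" "\<epsilon> \<le> 1" for \<epsilon>
    by unfold_locales (use continuous_QL bL M Y C that in auto)
  have AD: "axis_singular (Qdiff \<epsilon>) M Y (3 * C) \<alpha>" if "\<epsilon> \<ge> 0" "\<epsilon> \<le> 1" for \<epsilon>
    by unfold_locales (use cD bD M Y C that in auto)
  have AR: "axis_singular (\<lambda>p. R (Complex (fst p) (snd p))) M Y C \<alpha>"
    by unfold_locales (use M Y C bR in \<open>auto intro!: continuous_R_comp continuous_intros\<close>)
  note e01 = less_imp_le[OF eta_pos] eta_le1
  obtain L where L: "L > 0" "\<And>h B p. jsupp (Suc n) M h \<Longrightarrow> jbnd (Suc n) B h \<Longrightarrow>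
     cmod (edbar n \<psi> \<psi>' s h p) \<le> L * B * (bump M (fst p) * bump Y (snd p)) * \<bar>snd p\<bar> ^ n"
    unfolding Y_def using edbar_compact[OF cp s, of n M] by blast
  define g where "g k = axis_singular.gcut (Qdiff (eta k)) M Y n" for k
  define G where "G = axis_singular.gdom M Y (3 * C) \<alpha> n"
  define G1 where "G1 = axis_singular.gdom M Y C \<alpha> n"
  define \<omega> where "\<omega> k = L * integral UNIV (g k)" for k
  have gi: "g k integrable_on UNIV" for k
    unfolding g_def by (rule axis_singular.gcut_integrable[OF AD[OF e01] n n0])
  have Gi: "G integrable_on UNIV" unfolding G_def by (rule axis_singular.gdom_integrable[OF AD[OF e01] n])
  have glim: "(\<lambda>k. g k p) \<longlonglongrightarrow> 0" for p
  proof -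
    obtain x y where p: "p = (x, y)" by force
    show ?thesis
    proof (cases "y = 0")
      case True
      then show ?thesis using n0 by (simp add: g_def axis_singular.gcut_def[OF AD[OF e01]] p zero_power)
    next
      case False
      have cy: "isCont (\<lambda>v. R (Complex x v)) y" using Ry[OF False] has_vector_derivative_continuous by blast
      have "(\<lambda>k. y + eta k) \<longlonglongrightarrow> y" "(\<lambda>k. y - eta k) \<longlonglongrightarrow> y"
        using tendsto_add[OF tendsto_const eta_tendsto, of y] tendsto_diff[OF tendsto_const eta_tendsto, of y] by auto
      then have "(\<lambda>k. R (Complex x (y + eta k))) \<longlonglongrightarrow> R (Complex x y)" "(\<lambda>k. R (Complex x (y - eta k))) \<longlonglongrightarrow> R (Complex x y)"
        by (auto intro: isCont_tendsto_compose[OF cy])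
      then have "(\<lambda>k. (if y > 0 then R (Complex x (y + eta k)) else R (Complex x (y - eta k))) - R (Complex x y)) \<longlonglongrightarrow> 0"
        by (cases "y > 0") (simp_all add: LIM_zero)
      moreover have "Qdiff (eta k) p = (if y > 0 then R (Complex x (y + eta k)) else R (Complex x (y - eta k))) - R (Complex x y)" for k
        using False by (auto simp: Qdiff_def QU_def QL_def p)
      ultimately have "(\<lambda>k. Qdiff (eta k) p) \<longlonglongrightarrow> 0" by simp
      then have "(\<lambda>k. bump M (fst p) * bump Y (snd p) * \<bar>snd p\<bar> ^ n * norm (Qdiff (eta k) p)) \<longlonglongrightarrow> bump M (fst p) * bump Y (snd p) * \<bar>snd p\<bar> ^ n * norm (0::'c)"
        by (intro tendsto_intros)
      then show ?thesis by (simp add: g_def axis_singular.gcut_def[OF AD[OF e01]])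
    qed
  qed
  \<comment> \<open>Dominated convergence is applied along a sequence, which is why the shifts run
    through \<open>eta\<close> and not through all small \<epsilon>.\<close>
  have "(\<lambda>k. integral UNIV (g k)) \<longlonglongrightarrow> integral UNIV (\<lambda>p::real\<times>real. 0::real)"
  proof (rule dominated_convergence(2)[where f = g and h = G])
    show "g k integrable_on UNIV" for k by (rule gi)
    show "G integrable_on UNIV" by (rule Gi)
    show "\<And>x. x \<in> UNIV \<Longrightarrow> (\<lambda>k. g k x) \<longlonglongrightarrow> 0" by (rule glim)
    show "norm (g k x) \<le> G x" for k x
      using axis_singular.gcut_le_gdom[OF AD[OF e01] n0] axis_singular.gcut_nonneg[OF AD[OF e01]]
      by (simp add: g_def G_def)
  qed
  then have om: "\<omega> \<longlonglongrightarrow> 0" unfolding \<omega>_def by (auto intro: tendsto_mult_right_zero)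
  have st: "norm (stone M (eta k) h - hs n \<psi> \<psi>' s h) \<le> \<omega> k * B"
    and tr: "norm (trace M (eta k) h) \<le> (2 * L * integral UNIV G1) * B \<and> norm (trace M (- eta k) h) \<le> (2 * L * integral UNIV G1) * B"
    if h: "jet UNIV (Suc n) h" and supp: "jsupp (Suc n) M h" and B: "jbnd (Suc n) B h" for h B k
  proof -
    let ?D = "edbar n \<psi> \<psi>' s h"
    note cE = continuous_edbar[OF h cp s0]
    note le = L(2)[OF supp B]
    note U = axis_singular.integral_bound[OF AU[OF e01] n n0 cE le]
    note Lo = axis_singular.integral_bound[OF AL[OF e01] n n0 cE le]
    note Di = axis_singular.integral_bound[OF AD[OF e01] n n0 cE le]
    note Ri = axis_singular.integral_bound[OF AR n n0 cE le]
    have tU: "integral UNIV (\<lambda>p. ?D p *\<^sub>C QU (eta k) p) = (- \<i> / 2) *\<^sub>C trace M (eta k) h"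
      by (rule edbar_trace_upper[OF h cp s M supp n0 eta_pos])
    have tL: "integral UNIV (\<lambda>p. ?D p *\<^sub>C QL (eta k) p) = (\<i> / 2) *\<^sub>C trace M (- eta k) h"
      by (rule edbar_trace_lower[OF h cp s M supp n0 eta_pos])
    have "integral UNIV (\<lambda>p. ?D p *\<^sub>C Qdiff (eta k) p) = (- \<i> / 2) *\<^sub>C trace M (eta k) h + (\<i> / 2) *\<^sub>C trace M (- eta k) h
       - integral UNIV (\<lambda>p. ?D p *\<^sub>C R (Complex (fst p) (snd p)))"
      unfolding Qdiff_def scaleC_diff_right scaleC_add_right tU[symmetric] tL[symmetric]
      using U(1) Lo(1) Ri(1) by (simp add: integral_add integral_diff integrable_add)
    also have "\<dots> = (- pi) *\<^sub>R (stone M (eta k) h - hs n \<psi> \<psi>' s h)"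
    proof -
      have "(- pi) *\<^sub>R stone M (eta k) h = (- \<i> / 2) *\<^sub>C trace M (eta k) h + (\<i> / 2) *\<^sub>C trace M (- eta k) h"
      proof -
        have q: "complex_of_real (- pi) * (1 / (2 * pi * \<i>)) = \<i> / 2" by (simp add: field_simps)
        show ?thesis
          unfolding stone_def scaleR_scaleC scaleC_scaleC q by (simp add: scaleC_diff_right scaleC_minus_left)
      qed
      then show ?thesis by (simp add: hs_def scaleR_diff_right scaleR_add_right)
    qed
    finally have "norm ((- pi) *\<^sub>R (stone M (eta k) h - hs n \<psi> \<psi>' s h)) \<le> L * B * integral UNIV (g k)"
      using Di(2)[of k] by (simp add: g_def)
    then have "pi * norm (stone M (eta k) h - hs n \<psi> \<psi>' s h) \<le> \<omega> k * B" by (simp add: \<omega>_def mult_ac)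
    moreover have "1 * norm (stone M (eta k) h - hs n \<psi> \<psi>' s h) \<le> pi * norm (stone M (eta k) h - hs n \<psi> \<psi>' s h)"
      using pi_gt3 by (intro mult_right_mono) auto
    ultimately show "norm (stone M (eta k) h - hs n \<psi> \<psi>' s h) \<le> \<omega> k * B" by simp
    have "cmod (h 0 0) \<le> B" using B by (auto simp: jbnd_def)
    then have B0: "B \<ge> 0" using norm_ge_zero order_trans by blast
    have "norm ((- \<i> / 2) *\<^sub>C trace M (eta k) h) \<le> L * B * integral UNIV G1"
      unfolding tU[symmetric] G1_def using L(1) B0
      by (intro order_trans[OF U(2)] mult_left_mono axis_singular.gcut_integral_le[OF AU[OF e01] n n0]) auto
    moreover have "norm ((\<i> / 2) *\<^sub>C trace M (- eta k) h) \<le> L * B * integral UNIV G1"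
      unfolding tL[symmetric] G1_def using L(1) B0
      by (intro order_trans[OF Lo(2)] mult_left_mono axis_singular.gcut_integral_le[OF AL[OF e01] n n0]) auto
    ultimately show "norm (trace M (eta k) h) \<le> (2 * L * integral UNIV G1) * B \<and> norm (trace M (- eta k) h) \<le> (2 * L * integral UNIV G1) * B"
      by (simp add: norm_scaleC norm_divide mult_ac)
  qed
  have G1: "integral UNIV G1 \<ge> 0"
  proof -
    have "0 \<le> G1 p" for p using axis_singular.gcut_le_gdom[OF AR n0, of p] axis_singular.gcut_nonneg[OF AR, of n p]
      unfolding G1_def by linarith
    then show ?thesis by (intro integral_nonneg) (auto simp: G1_def axis_singular.gdom_integrable[OF AR n])
  qed
  have tr': "norm (trace M (eta k) h) \<le> (2 * L * integral UNIV G1 + 1) * B \<and> norm (trace M (- eta k) h) \<le> (2 * L * integral UNIV G1 + 1) * B"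
    if h: "jet UNIV (Suc n) h" and supp: "jsupp (Suc n) M h" and B: "jbnd (Suc n) B h" for h B k
  proof -
    have "cmod (h 0 0) \<le> B" using B by (auto simp: jbnd_def)
    then have "B \<ge> 0" using norm_ge_zero order_trans by blast
    then show ?thesis using tr[OF h supp B, of k] by (auto simp: distrib_right)
  qed
  show ?thesis
    by (rule that[OF om _ st tr']) (use L(1) G1 in \<open>auto intro!: add_nonneg_pos\<close>)
qed

end

section \<open>Resolvents\<close>

locale operator_off_real =
  fixes D :: "'b::complex_banach set" and H :: "'b \<Rightarrow> 'b"
  assumes lin: "linear_operator D H"
begin

abbreviation "\<rho> \<equiv> resolvent_set D H"
abbreviation "Res \<equiv> resolvent D H"

lemma resolvent_apply:
  assumes "z \<in> \<rho>"
  shows "blinfun_apply (Res z) x = inv_into D (\<lambda>x. z *\<^sub>C x - H x) x"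
  using assms unfolding resolvent_set_def resolvent_def by (simp add: bounded_linear_Blinfun_apply)

lemma resolvent_in_D: "z \<in> \<rho> \<Longrightarrow> Res z x \<in> D"
  by (subst resolvent_apply) (auto simp: resolvent_set_def bij_betw_def intro!: inv_into_into)

lemma resolvent_right: "z \<in> \<rho> \<Longrightarrow> z *\<^sub>C Res z x - H (Res z x) = x"
  by (subst (1 2) resolvent_apply) (auto simp: resolvent_set_def bij_betw_def intro!: f_inv_into_f[where f = "\<lambda>x. z *\<^sub>C x - H x"])

lemma resolvent_left: "z \<in> \<rho> \<Longrightarrow> x \<in> D \<Longrightarrow> Res z (z *\<^sub>C x - H x) = x"
  by (subst resolvent_apply) (auto simp: resolvent_set_def bij_betw_def intro!: inv_into_f_f[where f = "\<lambda>x. z *\<^sub>C x - H x"])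

lemma resolvent_bounded_op: "z \<in> \<rho> \<Longrightarrow> Res z \<in> bounded_ops"
proof -
  assume z: "z \<in> \<rho>"
  have "Res z (a *\<^sub>C x) = a *\<^sub>C Res z x" for a x
  proof -
    have d: "Res z x \<in> D" using z by (rule resolvent_in_D)
    have "a *\<^sub>C Res z x \<in> D" "H (a *\<^sub>C Res z x) = a *\<^sub>C H (Res z x)"
      using lin d by (auto simp: linear_operator_def)
    moreover have "a *\<^sub>C x = z *\<^sub>C (a *\<^sub>C Res z x) - a *\<^sub>C H (Res z x)"
      by (subst resolvent_right[OF z, of x, symmetric])
         (simp add: scaleC_diff_right scaleC_scaleC mult.commute)
    ultimately show ?thesis using resolvent_left[OF z, of "a *\<^sub>C Res z x"] by simp
  qed
  then show ?thesis by (simp add: bounded_ops_def)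
qed

lemma resolvent_identity:
  assumes z: "z \<in> \<rho>" and w: "w \<in> \<rho>"
  shows "Res z - Res w = (w - z) *\<^sub>C (Res z o\<^sub>L Res w)"
proof (rule blinfun_eqI)
  fix x
  let ?y = "Res w x"
  have y: "?y \<in> D" using w by (rule resolvent_in_D)
  have "z *\<^sub>C ?y - H ?y = (z - w) *\<^sub>C ?y + x"
    by (subst (4) resolvent_right[OF w, of x, symmetric]) (simp add: scaleC_diff_left)
  then have "?y = Res z ((z - w) *\<^sub>C ?y + x)" using resolvent_left[OF z y] by simp
  also have "\<dots> = (z - w) *\<^sub>C Res z ?y + Res z x"
    using resolvent_bounded_op[OF z] by (simp add: blinfun.add_right bounded_ops_def)
  finally show "blinfun_apply (Res z - Res w) x = blinfun_apply ((w - z) *\<^sub>C (Res z o\<^sub>L Res w)) x"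
    by (simp add: blinfun.diff_left blinfun_apply_scaleC scaleC_diff_left algebra_simps)
qed

text \<open>Absorption: by the resolvent identity the difference of the two resolvents is at most
  half the norm of \<open>Res z\<close>. It is applied with \<open>w\<close> real, to bound the
  resolvent just above and below a real point of the resolvent set.\<close>

lemma resolvent_near_bound:
  assumes z: "z \<in> \<rho>" and w: "w \<in> \<rho>" and d: "cmod (w - z) * norm (Res w) \<le> 1 / 2"
  shows "norm (Res z) \<le> 2 * norm (Res w)"
proof -
  have "norm (Res z) \<le> norm (Res w) + norm (Res z - Res w)"
    using norm_triangle_sub[of "Res z" "Res w"] by simp
  also have "norm (Res z - Res w) \<le> cmod (w - z) * (norm (Res z) * norm (Res w))"
    unfolding resolvent_identity[OF z w] norm_scaleC by (intro mult_left_mono norm_blinfun_compose) auto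
  also have "\<dots> = norm (Res z) * (cmod (w - z) * norm (Res w))" by simp
  also have "\<dots> \<le> norm (Res z) * (1 / 2)" using d by (intro mult_left_mono) auto
  finally show ?thesis by simp
qed

lemma continuous_on_resolvent: "continuous_on \<rho> Res"
  unfolding continuous_on_def
proof
  fix w assume w: "w \<in> \<rho>"
  have "((\<lambda>z. cmod (w - z) * norm (Res w)) \<longlongrightarrow> cmod (w - w) * norm (Res w)) (at w within \<rho>)"
    by (intro tendsto_intros)
  then have "eventually (\<lambda>z. cmod (w - z) * norm (Res w) < 1 / 2) (at w within \<rho>)"
    by (rule order_tendstoD) simp
  moreover have "eventually (\<lambda>z. z \<in> \<rho>) (at w within \<rho>)" by (simp add: eventually_at_filter)
  ultimately have ev: "eventually (\<lambda>z. norm (Res z - Res w) \<le> cmod (w - z) * (2 * norm (Res w) * norm (Res w))) (at w within \<rho>)"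
  proof eventually_elim
    case (elim z)
    then have b: "norm (Res z) \<le> 2 * norm (Res w)" by (intro resolvent_near_bound w) auto
    have "norm (Res z - Res w) \<le> cmod (w - z) * (norm (Res z) * norm (Res w))"
      unfolding resolvent_identity[OF \<open>z \<in> \<rho>\<close> w] norm_scaleC by (intro mult_left_mono norm_blinfun_compose) auto
    also have "\<dots> \<le> cmod (w - z) * (2 * norm (Res w) * norm (Res w))"
      using b by (intro mult_left_mono mult_right_mono) auto
    finally show ?case .
  qed
  have "((\<lambda>z. cmod (w - z) * (2 * norm (Res w) * norm (Res w))) \<longlongrightarrow> cmod (w - w) * (2 * norm (Res w) * norm (Res w))) (at w within \<rho>)"
    by (intro tendsto_intros)
  then have "((\<lambda>z. Res z - Res w) \<longlongrightarrow> 0) (at w within \<rho>)"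
    by (intro Lim_null_comparison[OF ev]) simp
  then show "(Res \<longlongrightarrow> Res w) (at w within \<rho>)" by (simp add: LIM_zero_iff)
qed

end

text \<open>Caratheodory's form of differentiability suits resolvents: the resolvent identity
  already displays the difference quotient as a product that is continuous in the moving
  point.\<close>

lemma has_vector_derivative_caratheodory:
  fixes f g :: "real \<Rightarrow> 'a::real_normed_vector"
  assumes "\<And>u. f u - f x = (u - x) *\<^sub>R g u" "isCont g x"
  shows "(f has_vector_derivative g x) (at x)"
proof -
  have "((\<lambda>u. g u - g x) \<longlongrightarrow> 0) (at x)" using assms(2) by (simp add: isCont_def LIM_zero)
  then have l: "((\<lambda>u. norm (g u - g x)) \<longlongrightarrow> 0) (at x)" by (rule tendsto_norm_zero)
  have "((\<lambda>u. norm ((f u - f x) - (u - x) *\<^sub>R g x) / norm (u - x)) \<longlongrightarrow> 0) (at x)"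
  proof (rule Lim_transform_eventually[OF l])
    have "norm (g u - g x) = norm ((f u - f x) - (u - x) *\<^sub>R g x) / norm (u - x)" if "u \<noteq> x" for u
      using that unfolding assms(1)[of u] scaleR_diff_right[symmetric] by simp
    then show "\<forall>\<^sub>F u in at x. norm (g u - g x) = norm ((f u - f x) - (u - x) *\<^sub>R g x) / norm (u - x)"
      by (auto simp: eventually_at_filter)
  qed
  then show ?thesis
    unfolding has_vector_derivative_def has_derivative_at_within[symmetric] has_derivative_iff_norm
    by (auto intro: bounded_linear_scaleR_left)
qed

locale resolvent_growth = operator_off_real D H
  for D :: "'b::complex_banach set" and H :: "'b \<Rightarrow> 'b" +
  fixes c \<alpha> :: real
  assumes off_real: "\<And>z. z \<notin> \<real> \<Longrightarrow> z \<in> \<rho>"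
    and c: "c > 0" and alpha: "\<alpha> \<ge> 0"
    and growth: "\<And>z. z \<notin> \<real> \<Longrightarrow>
           norm (Res z) \<le> c * inverse \<bar>Im z\<bar> * (jbracket z / \<bar>Im z\<bar>) powr \<alpha>"
begin

lemma Im_off_real: "Im z \<noteq> 0 \<Longrightarrow> z \<in> \<rho>"
  by (rule off_real) (auto simp: complex_is_Real_iff)

sublocale hol_off_real Res "\<lambda>z. - (Res z o\<^sub>L Res z)" c \<alpha>
proof
  have sub: "{z. Im z \<noteq> 0} \<subseteq> \<rho>" using Im_off_real by auto
  show contR: "continuous_on {z. Im z \<noteq> 0} Res" by (rule continuous_on_subset[OF continuous_on_resolvent sub])
  show "continuous_on {z. Im z \<noteq> 0} (\<lambda>z. - (Res z o\<^sub>L Res z))"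
    by (intro continuous_on_minus bounded_bilinear.continuous_on[OF bounded_bilinear_blinfun_compose] contR)
  have opn: "open {z. Im z \<noteq> 0}" by (intro open_Collect_neq continuous_intros)
  have cont: "isCont Res z" if "Im z \<noteq> 0" for z
    using contR opn that continuous_on_eq_continuous_at by blast
  have comp: "isCont (\<lambda>u. Res u o\<^sub>L T) z" if "Im z \<noteq> 0" for z T
    using cont[OF that] by (intro bounded_bilinear.isCont[OF bounded_bilinear_blinfun_compose]) auto
  show "((\<lambda>x. Res (Complex x y)) has_vector_derivative - (Res (Complex x y) o\<^sub>L Res (Complex x y))) (at x)"
    if y: "y \<noteq> 0" for x y
  proof (rule has_vector_derivative_caratheodory[where g = "\<lambda>u. - (Res (Complex u y) o\<^sub>L Res (Complex x y))"])
    fix u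
    have e: "Complex x y - Complex u y = complex_of_real (x - u)" by (simp add: complex_eq_iff)
    show "Res (Complex u y) - Res (Complex x y) = (u - x) *\<^sub>R - (Res (Complex u y) o\<^sub>L Res (Complex x y))"
      using resolvent_identity[of "Complex u y" "Complex x y"] Im_off_real y unfolding e scaleR_scaleC[symmetric]
      by (simp add: scaleR_diff_left)
  next
    have "isCont (\<lambda>u. Complex u y) x" unfolding Complex_eq by (intro continuous_intros)
    then show "isCont (\<lambda>u. - (Res (Complex u y) o\<^sub>L Res (Complex x y))) x"
      using y by (intro isCont_minus isCont_o2[OF _ comp]) auto
  qed
  show "((\<lambda>y. Res (Complex x y)) has_vector_derivative \<i> *\<^sub>C - (Res (Complex x y) o\<^sub>L Res (Complex x y))) (at y)"
    if y: "y \<noteq> 0" for x y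
  proof -
    \<comment> \<open>The identity is only available off the axis, so it is used on a neighbourhood of \<open>y\<close>.\<close>
    define g where "g v = (if v = 0 then (1 / (v - y)) *\<^sub>R (Res (Complex x v) - Res (Complex x y))
        else \<i> *\<^sub>C - (Res (Complex x v) o\<^sub>L Res (Complex x y)))" for v
    have "((\<lambda>y. Res (Complex x y)) has_vector_derivative g y) (at y)"
    proof (rule has_vector_derivative_caratheodory)
      fix v
      show "Res (Complex x v) - Res (Complex x y) = (v - y) *\<^sub>R g v"
      proof (cases "v = 0")
        case True
        then show ?thesis using y by (simp add: g_def)
      next
        case False
        have e: "Complex x y - Complex x v = complex_of_real (y - v) * \<i>" by (simp add: complex_eq_iff)
        have "Res (Complex x v) - Res (Complex x y) = (y - v) *\<^sub>R (\<i> *\<^sub>C (Res (Complex x v) o\<^sub>L Res (Complex x y)))"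
          using resolvent_identity[of "Complex x v" "Complex x y"] Im_off_real y False
          unfolding e scaleR_scaleC scaleC_scaleC by simp
        then show ?thesis using False by (simp add: g_def scaleC_minus_right scaleR_diff_left)
      qed
    next
      have "isCont (\<lambda>u. Complex x u) y" unfolding Complex_eq by (intro continuous_intros)
      then have "isCont (\<lambda>v. \<i> *\<^sub>C - (Res (Complex x v) o\<^sub>L Res (Complex x y))) y"
        using y by (intro bounded_linear.isCont[OF bounded_linear_scaleC_right] isCont_minus isCont_o2[OF _ comp]) auto
      moreover have "eventually (\<lambda>v. \<i> *\<^sub>C - (Res (Complex x v) o\<^sub>L Res (Complex x y)) = g v) (nhds y)"
        by (rule eventually_mono[OF eventually_nhds_in_open[of "- {0}"]]) (use y in \<open>auto simp: g_def\<close>)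
      ultimately show "isCont g y" by (rule isCont_cong[THEN iffD1, rotated])
    qed
    then show ?thesis using y by (simp add: g_def)
  qed
  show "norm (Res z) \<le> c * inverse \<bar>Im z\<bar> * (jbracket z / \<bar>Im z\<bar>) powr \<alpha>" if "Im z \<noteq> 0" for z
    using that by (intro growth) (auto simp: complex_is_Real_iff)
  show "c > 0" "\<alpha> \<ge> 0" by (rule c alpha)+
qed

text \<open>The defect T(ax) - aT(x) is bounded and linear in T over the reals, and it vanishes at
  every value of the integrand, hence also at the integral.\<close>

lemma hs_bounded_op:
  assumes cp: "cutpair \<psi> \<psi>'" and n: "real n > \<alpha>" and h: "jet UNIV (Suc n) h" and s: "s \<ge> 1"
    and W: "integrable lborel (wt n s h)"
  shows "hs n \<psi> \<psi>' s h \<in> bounded_ops"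
proof -
  let ?F = "\<lambda>p. edbar n \<psi> \<psi>' s h p *\<^sub>C Res (Complex (fst p) (snd p))"
  have n0: "n > 0" using n alpha by (cases n) auto
  have i: "?F integrable_on UNIV" by (rule edbar_R_integrable[OF cp n h s W])
  have "blinfun_apply (integral UNIV ?F) (a *\<^sub>C x) = a *\<^sub>C blinfun_apply (integral UNIV ?F) x" for a x
  proof -
    have b: "bounded_linear (\<lambda>T::'b \<Rightarrow>\<^sub>L 'b. blinfun_apply T (a *\<^sub>C x) - a *\<^sub>C blinfun_apply T x)"
      by (intro bounded_linear_sub blinfun.bounded_linear_left bounded_linear_compose[OF bounded_linear_scaleC_right])
    have z: "blinfun_apply (?F p) (a *\<^sub>C x) - a *\<^sub>C blinfun_apply (?F p) x = 0" for p
    proof (cases "snd p = 0")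
      case True
      then have "?F p = 0" using edbar_axis[OF cp n0, of s h "fst p"] by (cases p) simp
      then show ?thesis by simp
    next
      case False
      then have "Res (Complex (fst p) (snd p)) \<in> bounded_ops" by (intro resolvent_bounded_op Im_off_real) simp
      then show ?thesis by (simp add: bounded_ops_def blinfun_apply_scaleC scaleC_scaleC mult.commute)
    qed
    have "blinfun_apply (integral UNIV ?F) (a *\<^sub>C x) - a *\<^sub>C blinfun_apply (integral UNIV ?F) x =
       integral UNIV ((\<lambda>T. blinfun_apply T (a *\<^sub>C x) - a *\<^sub>C blinfun_apply T x) o ?F)"
      by (rule integral_linear[OF i b, symmetric])
    also have "\<dots> = 0" using z by (simp add: o_def)
    finally show ?thesis by simp
  qed
  then show ?thesis
    by (simp add: hs_def bounded_ops_def blinfun.scaleR_left blinfun_apply_scaleC scaleR_scaleC scaleC_scaleC mult.commute)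
qed

text \<open>Over a compact part of the real resolvent set the norms of R(t - i\<epsilon>) and R(t +
  i\<epsilon>) are at most 2 B0 as soon as \<epsilon> B0 <= 1/2. By the resolvent identity their
  difference is then O(\<epsilon>), uniformly in t.\<close>

lemma stone_tendsto_0:
  assumes M: "M > 0" and h: "continuous_on UNIV (h 0)" and K: "compact K" "of_real ` K \<subseteq> \<rho>"
    and supp: "\<And>x. x \<notin> K \<Longrightarrow> h 0 x = 0"
  shows "(\<lambda>k. stone M (eta k) h) \<longlonglongrightarrow> 0"
proof -
  have "bounded ((\<lambda>t. Res (complex_of_real t)) ` K)"
    using K by (intro compact_imp_bounded compact_continuous_image continuous_on_compose2[OF continuous_on_resolvent]) (auto intro!: continuous_intros)
  then obtain B0 where B0: "B0 > 0" "\<And>t. t \<in> K \<Longrightarrow> norm (Res (of_real t)) \<le> B0" unfolding bounded_pos by auto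
  have "bounded (h 0 ` K)"
    using K h by (intro compact_imp_bounded compact_continuous_image) (auto intro: continuous_on_subset)
  then obtain B1 where B1: "B1 > 0" "\<And>t. t \<in> K \<Longrightarrow> cmod (h 0 t) \<le> B1" unfolding bounded_pos by auto
  have near: "norm (Res (Complex t v)) \<le> 2 * B0" if t: "t \<in> K" and v: "v \<noteq> 0" "\<bar>v\<bar> * B0 \<le> 1 / 2" for t v
  proof -
    have "cmod (of_real t - Complex t v) = \<bar>v\<bar>" by (simp add: cmod_def)
    moreover have "\<bar>v\<bar> * norm (Res (of_real t)) \<le> 1 / 2"
      using B0(2)[OF t] v(2) by (intro order_trans[OF mult_left_mono v(2)]) auto
    ultimately have "cmod (of_real t - Complex t v) * norm (Res (of_real t)) \<le> 1 / 2" by simp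
    then have "norm (Res (Complex t v)) \<le> 2 * norm (Res (of_real t))"
      using v K(2) t by (intro resolvent_near_bound[OF Im_off_real]) auto
    then show ?thesis using B0(2)[OF t] by linarith
  qed
  have est: "norm (stone M (eta k) h) \<le> 2 * M * (B1 * (2 * eta k * (2 * B0) * (2 * B0)))" if k: "eta k * B0 \<le> 1 / 2" for k
  proof -
    let ?G = "\<lambda>t. h 0 t *\<^sub>C Res (Complex t (- eta k)) - h 0 t *\<^sub>C Res (Complex t (eta k))"
    have e: "eta k > 0" by (rule eta_pos)
    have i: "(\<lambda>t. h 0 t *\<^sub>C Res (Complex t v)) integrable_on {-M..M}" if "v \<noteq> 0" for v
      using that by (intro integrable_continuous_interval continuous_intros continuous_R_comp continuous_on_subset[OF h]) auto
    have "trace M (- eta k) h - trace M (eta k) h = integral {-M..M} ?G"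
      unfolding trace_def using i e by (subst integral_diff) auto
    also have "norm \<dots> \<le> (B1 * (2 * eta k * (2 * B0) * (2 * B0))) * (M - (-M))"
    proof (rule integral_bound)
      show "-M \<le> M" using M by simp
      show "continuous_on {-M..M} ?G"
        using e by (intro continuous_intros continuous_R_comp continuous_on_subset[OF h]) auto
      fix t assume "t \<in> {-M..M}"
      show "norm (?G t) \<le> B1 * (2 * eta k * (2 * B0) * (2 * B0))"
      proof (cases "t \<in> K")
        case True
        have eq: "Complex t (eta k) - Complex t (- eta k) = 2 * eta k * \<i>" by (simp add: complex_eq_iff)
        have "norm (Res (Complex t (- eta k)) - Res (Complex t (eta k))) \<le> cmod (2 * eta k * \<i>) * (norm (Res (Complex t (- eta k))) * norm (Res (Complex t (eta k))))"
          using e unfolding eq[symmetric]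
          by (subst resolvent_identity) (auto intro!: Im_off_real mult_left_mono norm_blinfun_compose simp: norm_scaleC)
        also have "\<dots> \<le> (2 * eta k) * ((2 * B0) * (2 * B0))"
          using e B0(1) k True by (intro mult_mono near) (auto simp: norm_mult)
        finally have "norm (Res (Complex t (- eta k)) - Res (Complex t (eta k))) \<le> 2 * eta k * (2 * B0) * (2 * B0)" by (simp add: mult_ac)
        then show ?thesis unfolding scaleC_diff_right[symmetric] norm_scaleC
          using B1 True by (intro mult_mono) auto
      next
        case False
        then show ?thesis using supp B0(1) B1(1) e by simp
      qed
    qed
    finally have "norm (trace M (- eta k) h - trace M (eta k) h) \<le> 2 * M * (B1 * (2 * eta k * (2 * B0) * (2 * B0)))" by (simp add: mult_ac)
    moreover have "norm (stone M (eta k) h) \<le> 1 * norm (trace M (- eta k) h - trace M (eta k) h)"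
      unfolding stone_def norm_scaleC using pi_gt3 by (intro mult_right_mono) (auto simp: norm_divide norm_mult)
    ultimately show ?thesis by simp
  qed
  have l: "(\<lambda>k. 2 * M * (B1 * (2 * eta k * (2 * B0) * (2 * B0)))) \<longlonglongrightarrow> 2 * M * (B1 * (2 * 0 * (2 * B0) * (2 * B0)))"
    by (intro tendsto_intros eta_tendsto)
  have "(\<lambda>k. eta k * B0) \<longlonglongrightarrow> 0 * B0" by (intro tendsto_intros eta_tendsto)
  then have "eventually (\<lambda>k. eta k * B0 < 1 / 2) sequentially" by (rule order_tendstoD) simp
  then have "eventually (\<lambda>k. norm (stone M (eta k) h) \<le> 2 * M * (B1 * (2 * eta k * (2 * B0) * (2 * B0)))) sequentially"
    by eventually_elim (rule est, simp)
  moreover have "(\<lambda>k. 2 * M * (B1 * (2 * eta k * (2 * B0) * (2 * B0)))) \<longlonglongrightarrow> 0" using l by simp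
  ultimately show ?thesis by (rule Lim_null_comparison)
qed

end

section \<open>Cut-offs\<close>

lemma has_vector_derivative_glue:
  fixes f g :: "real \<Rightarrow> complex"
  assumes f: "\<And>x. x \<ge> 0 \<Longrightarrow> (f has_vector_derivative f' x) (at x within {0..})"
    and g: "\<And>x. x \<le> 0 \<Longrightarrow> (g has_vector_derivative g' x) (at x within {..0})"
    and eq: "f 0 = g 0" "f' 0 = g' 0"
  shows "((\<lambda>x. if 0 \<le> x then f x else g x) has_vector_derivative (if 0 \<le> x then f' x else g' x)) (at x)"
proof -
  let ?h = "\<lambda>x. if 0 \<le> x then f x else g x"
  have P: "(?h has_vector_derivative f' x) (at x within {0..})" if "x \<ge> 0" for x
    by (rule has_vector_derivative_transform[OF _ _ f[OF that]]) (use that in auto)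
  have N: "(?h has_vector_derivative g' x) (at x within {..0})" if "x \<le> 0" for x
    by (rule has_vector_derivative_transform[OF _ _ g[OF that]]) (use that eq in auto)
  consider "x > 0" | "x < 0" | "x = 0" by linarith
  then show ?thesis
  proof cases
    case 1
    then have "at x within {0..} = at x" by (intro at_within_interior) simp
    then show ?thesis using P[of x] 1 by simp
  next
    case 2
    then have "at x within {..0} = at x" by (intro at_within_interior) simp
    then show ?thesis using N[of x] 2 by simp
  next
    case 3
    have "(?h has_vector_derivative f' x) (at x within {0..} \<union> {..0})"
      using P[of x] N[of x] 3 eq unfolding has_vector_derivative_def has_derivative_within
      by (auto intro: Lim_Un)
    moreover have "{0..} \<union> {..0::real} = UNIV" by auto
    ultimately show ?thesis using 3 by simp
  qed
qed

lemma continuous_on_glue: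
  fixes f g :: "real \<Rightarrow> complex"
  assumes "continuous_on {0..} f" "continuous_on {..0} g" "f 0 = g 0"
  shows "continuous_on UNIV (\<lambda>x. if 0 \<le> x then f x else g x)"
proof -
  have U: "UNIV = {0..} \<union> {..0::real}" by auto
  show ?thesis unfolding U by (rule continuous_on_cases) (use assms in \<open>auto intro: antisym\<close>)
qed

text \<open>The r-th derivative of the truncated power x^K for x >= 0 and 0 for x < 0, which is of
  class C^(K-1).\<close>

definition pospow :: "nat \<Rightarrow> nat \<Rightarrow> real \<Rightarrow> complex" where
  "pospow K r x = (if 0 \<le> x then of_real (fact K / fact (K - r) * x ^ (K - r)) else 0)"

lemma jet_pospow: "jet UNIV N (pospow (Suc N))"
  unfolding jet_def
proof (intro conjI allI impI ballI)
  fix r x assume r: "r < N"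
  then obtain m where m: "Suc N - r = Suc m" "Suc N - Suc r = m" "m > 0"
    by (intro that[of "N - r"]) auto
  have "((\<lambda>x. complex_of_real (fact (Suc N) / fact (Suc m) * x ^ Suc m)) has_vector_derivative of_real (fact (Suc N) / fact m * x ^ m)) (at x within {0..})" for x
  proof (rule has_vector_derivative_of_real)
    have "((\<lambda>x. fact (Suc N) / fact (Suc m) * x ^ Suc m) has_real_derivative (fact (Suc N) / fact (Suc m) * (real (Suc m) * x ^ m))) (at x within {0..})"
      by (intro DERIV_cmult) (auto intro!: derivative_eq_intros simp del: power_Suc)
    also have "(fact (Suc N) / fact (Suc m) * (real (Suc m) * x ^ m)) = fact (Suc N) / fact m * x ^ m"
      by (simp add: divide_simps del: of_nat_Suc)
    finally show "((\<lambda>x. fact (Suc N) / fact (Suc m) * x ^ Suc m) has_real_derivative fact (Suc N) / fact m * x ^ m) (at x within {0..})" .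
  qed
  then have "((\<lambda>x. if 0 \<le> x then complex_of_real (fact (Suc N) / fact (Suc m) * x ^ Suc m) else 0) has_vector_derivative
     (if 0 \<le> x then complex_of_real (fact (Suc N) / fact m * x ^ m) else 0)) (at x)"
    using m(3) by (intro has_vector_derivative_glue) auto
  then show "(pospow (Suc N) r has_vector_derivative pospow (Suc N) (Suc r) x) (at x within UNIV)"
    unfolding pospow_def m by simp
next
  show "continuous_on UNIV (pospow (Suc N) N)"
    unfolding pospow_def by (intro continuous_on_glue) (auto intro!: continuous_intros)
qed

lemma jet_zero_on_open:
  assumes h: "jet UNIV N h" and S: "open S" and z: "\<And>x. x \<in> S \<Longrightarrow> h 0 x = a"
  shows "0 < r \<Longrightarrow> r \<le> N \<Longrightarrow> x \<in> S \<Longrightarrow> h r x = 0"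
proof (induction r arbitrary: x)
  case (Suc r)
  have "(h r has_vector_derivative 0) (at x)"
  proof (rule has_vector_derivative_transform_within_open[OF has_vector_derivative_const[of "if r = 0 then a else 0"] S Suc.prems(3)])
    show "(if r = 0 then a else 0) = h r y" if "y \<in> S" for y
      using Suc.IH[OF _ _ that] Suc.prems(2) z[OF that] by auto
  qed
  moreover have "(h r has_vector_derivative h (Suc r) x) (at x)"
    using Suc.prems by (intro jetD_UNIV[OF h]) auto
  ultimately show ?case by (metis vector_derivative_unique_at)
qed simp

lemma jet_zero_on_closure:
  assumes h: "jet UNIV N h" and S: "open S" and z: "\<And>x. x \<in> S \<Longrightarrow> h 0 x = a" and r: "0 < r" "r \<le> N" and x: "x \<in> closure S"
  shows "h r x = 0"
proof -
  have "closed {u. h r u = 0}"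
    using jet_continuous[OF h r(2)] by (intro closed_Collect_eq) auto
  then have "closure S \<subseteq> {u. h r u = 0}"
    using jet_zero_on_open[OF h S z r] by (intro closure_minimal) auto
  then show ?thesis using x by auto
qed

text \<open>The primitive of the bump (x (1 - x))^(N+1) on [0,1], divided by its total mass
  \<open>J\<close>. As a product of two truncated powers the bump is of class C^N, so its primitive
  is of class C^(N+1).\<close>

lemma smooth_step_exists:
  obtains S where "jet UNIV (Suc N) S" "\<And>x. x \<le> 0 \<Longrightarrow> S 0 x = 0" "\<And>x. x \<ge> 1 \<Longrightarrow> S 0 x = 1"
proof -
  define b where "b = jmul (pospow (Suc N)) (\<lambda>r x. of_real ((-1) ^ r) * pospow (Suc N) r (1 + (-1) * x))"
  have jb: "jet UNIV N b"
    unfolding b_def by (intro jet_mult jet_pospow jet_affine)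
  have b0: "b 0 x = (if 0 \<le> x \<and> x \<le> 1 then of_real ((x * (1 - x)) ^ Suc N) else 0)" for x
    by (auto simp: b_def jmul_def pospow_def power_mult_distrib)
  have cb: "continuous_on UNIV (b 0)" using jet_continuous[OF jb] by simp
  have cbA: "continuous_on A (b 0)" for A using cb continuous_on_subset by blast
  define J where "J = integral {0..1} (b 0)"
  have J: "J \<noteq> 0"
  proof
    assume J0: "J = 0"
    let ?\<beta> = "\<lambda>x::real. (x * (1 - x)) ^ Suc N"
    have ci: "continuous_on {0..1} ?\<beta>" by (intro continuous_intros)
    have "J = integral {0..1} (\<lambda>x. complex_of_real (?\<beta> x))"
      unfolding J_def by (rule integral_cong) (simp add: b0)
    also have "\<dots> = of_real (integral {0..1} ?\<beta>)"
      using integral_linear[OF integrable_continuous_interval[OF ci] bounded_linear_of_real[where 'a = complex]] by (simp add: o_def)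
    finally have "(?\<beta> has_integral 0) (cbox 0 1)"
      using J0 integrable_integral[OF integrable_continuous_interval[OF ci]] by simp
    then have "?\<beta> (1/2) = 0"
      using ci by (intro has_integral_0_cbox_imp_0[of 0 1 ?\<beta> "1/2"]) auto
    then show False by simp
  qed
  \<comment> \<open>The base point -1 lies to the left of the support of the bump, so
    \<open>C\<close> vanishes for x <= 0, also where the interval of integration is empty, and x = 0
    is an interior point of {-1..x+1}.\<close>
  define C where "C x = integral {-1..x} (b 0)" for x
  have Cneg: "C x = 0" if "x \<le> 0" for x
  proof -
    have "C x = integral {-1..x} (\<lambda>x. 0)" unfolding C_def by (rule integral_cong) (use that in \<open>auto simp: b0\<close>)
    then show ?thesis by simp
  qed
  have Cpos: "C x = J" if "x \<ge> 1" for x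
  proof -
    have i: "b 0 integrable_on {u..v}" for u v by (rule integrable_continuous_interval[OF cbA])
    have "C x = integral {-1..0} (b 0) + integral {0..x} (b 0)"
      unfolding C_def using that by (intro Henstock_Kurzweil_Integration.integral_combine[symmetric] i) auto
    also have "integral {0..x} (b 0) = J + integral {1..x} (b 0)"
      unfolding J_def using that by (intro Henstock_Kurzweil_Integration.integral_combine[symmetric] i) auto
    also have "integral {1..x} (b 0) = integral {1..x} (\<lambda>x. 0)" by (rule integral_cong) (auto simp: b0)
    also have "integral {-1..0} (b 0) = 0" using Cneg[of 0] by (simp add: C_def)
    finally show ?thesis by simp
  qed
  have dC: "(C has_vector_derivative b 0 x) (at x)" for x
  proof (cases "x < 0")
    case True
    have "b 0 x = 0" using True by (simp add: b0)
    moreover have "(C has_vector_derivative 0) (at x)"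
      by (rule has_vector_derivative_transform_within_open[OF has_vector_derivative_const[of 0], where S = "{..<0}"])
         (use True Cneg in auto)
    ultimately show ?thesis by simp
  next
    case False
    have "(C has_vector_derivative b 0 x) (at x within {-1..x+1})"
      unfolding C_def by (rule integral_has_vector_derivative[OF cbA]) (use False in auto)
    then show ?thesis using False by (simp add: at_within_Icc_at)
  qed
  define S where "S r x = (if r = 0 then C x / J else b (r - 1) x / J)" for r x
  have S0: "S 0 = (\<lambda>x. C x / J)" and SS: "\<And>q. S (Suc q) = (\<lambda>x. b q x / J)" by (auto simp: S_def)
  have "jet UNIV (Suc N) S"
    unfolding jet_def
  proof (intro conjI allI impI ballI)
    fix r x assume r: "r < Suc N"
    show "(S r has_vector_derivative S (Suc r) x) (at x within UNIV)"
    proof (cases r)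
      case 0
      have "((\<lambda>x. C x / J) has_vector_derivative b 0 x / J) (at x)" by (rule has_vector_derivative_divide[OF dC])
      then show ?thesis by (simp add: S0 SS 0)
    next
      case (Suc q)
      have "((\<lambda>x. b q x / J) has_vector_derivative b (Suc q) x / J) (at x)"
        using r Suc by (intro has_vector_derivative_divide jetD_UNIV[OF jb]) auto
      then show ?thesis by (simp add: SS Suc)
    qed
  next
    show "continuous_on UNIV (S (Suc N))"
      unfolding SS using J by (intro continuous_intros jet_continuous[OF jb]) auto
  qed
  moreover have "S 0 x = 0" if "x \<le> 0" for x using Cneg that by (simp add: S_def)
  moreover have "S 0 x = 1" if "x \<ge> 1" for x using Cpos that J by (simp add: S_def)
  ultimately show ?thesis using that by blast
qed

text \<open>The product of the steps S(2 - x) and S(2 + x): for |x| <= 1 both arguments are at least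
  1, and for |x| >= 2 one of them is at most 0. The derivatives vanish at |x| = 1 and |x| = 2 by
  continuity.\<close>

lemma cutjet_exists:
  obtains \<kappa> where "jet UNIV N \<kappa>" "\<And>x. \<bar>x\<bar> \<le> 1 \<Longrightarrow> \<kappa> 0 x = 1" "\<And>x. \<bar>x\<bar> \<ge> 2 \<Longrightarrow> \<kappa> 0 x = 0"
     "\<And>r x. 0 < r \<Longrightarrow> r \<le> N \<Longrightarrow> \<bar>x\<bar> \<le> 1 \<or> \<bar>x\<bar> \<ge> 2 \<Longrightarrow> \<kappa> r x = 0"
proof -
  obtain S where S: "jet UNIV (Suc N) S" "\<And>x. x \<le> 0 \<Longrightarrow> S 0 x = 0" "\<And>x. x \<ge> 1 \<Longrightarrow> S 0 x = 1"
    using smooth_step_exists by blast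
  define \<kappa> where "\<kappa> = jmul (\<lambda>r x. of_real ((-1) ^ r) * S r (2 + (-1) * x)) (\<lambda>r x. of_real (1 ^ r) * S r (2 + 1 * x))"
  have j: "jet UNIV N \<kappa>"
    unfolding \<kappa>_def by (intro jet_mult jet_affine jet_mono[OF S(1)]) auto
  have v: "\<kappa> 0 x = S 0 (2 - x) * S 0 (2 + x)" for x by (simp add: \<kappa>_def jmul_def)
  have 1: "\<kappa> 0 x = 1" if "\<bar>x\<bar> \<le> 1" for x using that by (simp add: v S(3))
  have 2: "\<kappa> 0 x = 0" if "\<bar>x\<bar> \<ge> 2" for x using that by (cases "x \<ge> 0") (auto simp: v S(2))
  have 3: "\<kappa> r x = 0" if rr: "0 < r" "r \<le> N" "\<bar>x\<bar> \<le> 1 \<or> \<bar>x\<bar> \<ge> 2" for r x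
  proof -
    consider "x \<in> closure {-1<..<1}" | "x \<in> closure {2<..}" | "x \<in> closure {..< -2}"
      using rr(3) by (cases "x \<ge> 0") (auto simp: abs_if)
    then show ?thesis
    proof cases
      case 1
      then show ?thesis using \<open>\<And>x. \<bar>x\<bar> \<le> 1 \<Longrightarrow> \<kappa> 0 x = 1\<close>
        by (intro jet_zero_on_closure[OF j _ _ rr(1,2), of "{-1<..<1}" 1]) auto
    next
      case 2
      then show ?thesis using \<open>\<And>x. \<bar>x\<bar> \<ge> 2 \<Longrightarrow> \<kappa> 0 x = 0\<close>
        by (intro jet_zero_on_closure[OF j _ _ rr(1,2), of "{2<..}" 0]) auto
    next
      case 3
      then show ?thesis using \<open>\<And>x. \<bar>x\<bar> \<ge> 2 \<Longrightarrow> \<kappa> 0 x = 0\<close>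
        by (intro jet_zero_on_closure[OF j _ _ rr(1,2), of "{..< -2}" 0]) auto
    qed
  qed
  show ?thesis by (rule that[OF j 1 2 3])
qed

definition jscale :: "real \<Rightarrow> (nat \<Rightarrow> real \<Rightarrow> complex) \<Rightarrow> nat \<Rightarrow> real \<Rightarrow> complex" where
  "jscale k h r x = of_real ((1 / k) ^ r) * h r (x / k)"

lemma jet_jscale: "jet UNIV N h \<Longrightarrow> jet UNIV N (jscale k h)"
  unfolding jscale_def using jet_affine[of N h "1 / k" 0] by simp

lemma jet_bounded_of_compact_support:
  assumes h: "jet UNIV N h" and s: "\<And>r x. r \<le> N \<Longrightarrow> \<bar>x\<bar> \<ge> M \<Longrightarrow> h r x = 0"
  obtains B where "B > 0" "jbnd N B h"
proof -
  have "\<exists>B>0. \<forall>x. cmod (h r x) \<le> B" if "r \<le> N" for r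
  proof -
    have "bounded (h r ` {-\<bar>M\<bar>..\<bar>M\<bar>})"
      by (intro compact_imp_bounded compact_continuous_image continuous_on_subset[OF jet_continuous[OF h that]]) auto
    then obtain B where B: "B > 0" "\<And>x. x \<in> {-\<bar>M\<bar>..\<bar>M\<bar>} \<Longrightarrow> cmod (h r x) \<le> B" unfolding bounded_pos by auto
    have "cmod (h r x) \<le> B" for x
    proof (cases "\<bar>x\<bar> \<le> \<bar>M\<bar>")
      case True
      then show ?thesis by (intro B(2)) auto
    next
      case False
      then show ?thesis using s[OF that, of x] B(1) by auto
    qed
    then show ?thesis using B(1) by blast
  qed
  then obtain B where B: "\<And>r. r \<le> N \<Longrightarrow> B r > 0 \<and> (\<forall>x. cmod (h r x) \<le> B r)" by metis
  have "jbnd N (\<Sum>r\<le>N. B r) h"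
    unfolding jbnd_def
  proof (intro allI impI)
    fix r x assume r: "r \<le> N"
    then have "B r \<le> (\<Sum>r\<le>N. B r)" by (intro member_le_sum) (auto intro: less_imp_le[OF conjunct1[OF B]])
    then show "cmod (h r x) \<le> (\<Sum>r\<le>N. B r)" using B[OF r] order_trans by blast
  qed
  moreover have "(\<Sum>r\<le>N. B r) > 0" using B by (intro sum_pos) auto
  ultimately show ?thesis using that by blast
qed

lemma jbracket_le: "jbracket (x::real) \<le> 1 + \<bar>x\<bar>"
proof -
  have "1 + x\<^sup>2 \<le> (1 + \<bar>x\<bar>)\<^sup>2" by (simp add: power2_eq_square algebra_simps)
  then show ?thesis unfolding jbracket_def by (intro real_le_lsqrt) auto
qed

text \<open>On the support of h(x/k) the bracket of x is at most 1 + 2k <= 3k, so the factor k^(-r)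
  of the r-th derivative is at most 3^r times the bracket to the power -r. The rescaled cut-offs are
  thus symbols of order 0 uniformly in \<open>k\<close>.\<close>

lemma dec_jscale:
  assumes h: "jet UNIV N h" and s: "\<And>r x. r \<le> N \<Longrightarrow> \<bar>x\<bar> \<ge> 2 \<Longrightarrow> h r x = 0"
  obtains C where "C > 0" "\<And>k. k \<ge> 1 \<Longrightarrow> dec UNIV N 0 C (jscale k h)"
proof -
  obtain B where B: "B > 0" "jbnd N B h" using jet_bounded_of_compact_support[OF h s] by blast
  have "cmod (jscale k h r x) \<le> (B * 3 ^ N) * jbracket x powr (0 - real r)" if k: "k \<ge> 1" and r: "r \<le> N" for k r x
  proof (cases "\<bar>x / k\<bar> \<ge> 2")
    case True
    then show ?thesis using s[OF r True] B(1) by (simp add: jscale_def)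
  next
    case False
    have j: "jbracket x > 0" by (rule jbracket_real_ge)
    have "jbracket x \<le> 1 + \<bar>x\<bar>" by (rule jbracket_le)
    also have "\<dots> \<le> 3 * k" using False k by (simp add: field_simps)
    finally have jk: "jbracket x \<le> 3 * k" .
    have "(1 / k) ^ r \<le> (3 / jbracket x) ^ r" using jk j k by (intro power_mono) (auto simp: field_simps)
    also have "\<dots> = 3 ^ r * jbracket x powr (0 - real r)"
      using j by (simp add: power_divide powr_minus powr_realpow field_simps)
    also have "\<dots> \<le> 3 ^ N * jbracket x powr (0 - real r)" using r by (intro mult_right_mono power_increasing) auto
    finally have "(1 / k) ^ r * cmod (h r (x / k)) \<le> (3 ^ N * jbracket x powr (0 - real r)) * B"
      using B k r by (intro mult_mono) (auto simp: jbnd_def)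
    moreover have "cmod (jscale k h r x) = (1 / k) ^ r * cmod (h r (x / k))"
      using k by (simp add: jscale_def norm_mult norm_divide norm_power)
    ultimately show ?thesis by (simp add: mult_ac)
  qed
  then have "\<And>k. k \<ge> 1 \<Longrightarrow> dec UNIV N 0 (B * 3 ^ N) (jscale k h)" by (simp add: dec_def)
  then show ?thesis using that[of "B * 3 ^ N"] B(1) by simp
qed

section \<open>Integrability of the weights\<close>

lemma integrable_jbracket_powr:
  assumes "\<beta> < 0"
  shows "integrable lborel (\<lambda>x::real. jbracket x powr (\<beta> - 1))"
proof -
  let ?P = "\<lambda>x::real. if x \<in> {1..} then x powr (\<beta> - 1) else 0"
  have "(?P has_integral - (1 powr (\<beta> - 1 + 1)) / (\<beta> - 1 + 1)) UNIV"
    unfolding has_integral_restrict_UNIV using assms by (intro has_integral_powr_to_inf) auto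
  then have P: "integrable lborel ?P"
    by (intro integrable.intros[OF has_bochner_integral_nonneg]) auto
  have N: "integrable lborel (\<lambda>x. ?P (0 + (-1) * x))" by (rule lborel_integrable_real_affine[OF P]) simp
  have I: "integrable lborel (\<lambda>x::real. indicator {-1..1} x *\<^sub>R (1::real))"
    by (intro borel_integrable_compact) auto
  have S: "integrable lborel (\<lambda>x::real. ?P x + ?P (0 + (-1) * x) + indicator {-1..1} x *\<^sub>R (1::real))"
    by (intro Bochner_Integration.integrable_add P N I)
  show ?thesis
  proof (rule Bochner_Integration.integrable_bound[OF S])
    show "(\<lambda>x::real. jbracket x powr (\<beta> - 1)) \<in> borel_measurable lborel"
      unfolding jbracket_def by measurable
    show "AE x in lborel. norm (jbracket x powr (\<beta> - 1)) \<le> norm (?P x + ?P (0 + (-1) * x) + indicator {-1..1} x *\<^sub>R (1::real))"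
    proof (rule AE_I2)
      fix x :: real
      have j: "jbracket x \<ge> 1" "jbracket x \<ge> \<bar>x\<bar>" by (rule jbracket_real_ge)+
      show "norm (jbracket x powr (\<beta> - 1)) \<le> norm (?P x + ?P (0 + (-1) * x) + indicator {-1..1} x *\<^sub>R (1::real))"
      proof (cases "\<bar>x\<bar> \<le> 1")
        case True
        have "jbracket x powr (\<beta> - 1) \<le> jbracket x powr 0" using j assms by (intro powr_mono) auto
        then show ?thesis using True j by (auto simp: abs_le_iff indicator_def)
      next
        case False
        have "jbracket x powr (\<beta> - 1) \<le> \<bar>x\<bar> powr (\<beta> - 1)" using j assms False by (intro powr_mono2') auto
        then show ?thesis using False by (auto simp: indicator_def abs_if split: if_splits)
      qed
    qed
  qed
qed

lemma measurable_wt: "jet UNIV (Suc n) h \<Longrightarrow> s > 0 \<Longrightarrow> wt n s h \<in> borel_measurable borel"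
  unfolding wt_def
  by (intro borel_measurable_continuous_onI continuous_intros jet_continuous[of UNIV "Suc n" h])
     (auto simp: tau_pos less_imp_neq[symmetric])

lemma wt_dec:
  assumes d: "dec UNIV (Suc n) \<beta> B h"
  shows "wt n 1 h x \<le> real (n + 2) * B * jbracket x powr (\<beta> - 1)"
proof -
  have "wt n 1 h x \<le> (\<Sum>r\<le>Suc n. B * jbracket x powr (\<beta> - 1))"
    unfolding wt_def tau_one
  proof (rule sum_mono)
    fix r assume r: "r \<in> {..Suc n}"
    have "cmod (h r x) * jbracket x powr (real r - 1) \<le> (B * jbracket x powr (\<beta> - real r)) * jbracket x powr (real r - 1)"
      using decD[OF d, of r x] r by (intro mult_right_mono) auto
    also have "\<dots> = B * jbracket x powr (\<beta> - 1)"
      using jbracket_real_ge(3)[of x] by (simp add: powr_add[symmetric])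
    finally show "cmod (h r x) * jbracket x powr (real r - 1) \<le> B * jbracket x powr (\<beta> - 1)" .
  qed
  then show ?thesis by simp
qed

lemma
  assumes j: "jet UNIV (Suc n) h" and d: "dec UNIV (Suc n) \<beta> B h" and b: "\<beta> < 0"
  shows integrable_wt_dec: "integrable lborel (wt n 1 h)"
    and integral_wt_dec: "integral\<^sup>L lborel (wt n 1 h) \<le> real (n + 2) * integral\<^sup>L lborel (\<lambda>x::real. jbracket x powr (\<beta> - 1)) * B"
proof -
  have i: "integrable lborel (\<lambda>x::real. real (n + 2) * B * jbracket x powr (\<beta> - 1))"
    by (intro integrable_mult_right integrable_jbracket_powr b)
  show 1: "integrable lborel (wt n 1 h)"
  proof (rule Bochner_Integration.integrable_bound[OF i])
    show "wt n 1 h \<in> borel_measurable lborel" using measurable_wt[OF j] by simp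
    show "AE x in lborel. norm (wt n 1 h x) \<le> norm (real (n + 2) * B * jbracket x powr (\<beta> - 1))"
      using wt_dec[OF d] wt_nonneg[of n 1 h] by (intro AE_I2) (smt (verit) real_norm_def)
  qed
  have "integral\<^sup>L lborel (wt n 1 h) \<le> integral\<^sup>L lborel (\<lambda>x::real. real (n + 2) * B * jbracket x powr (\<beta> - 1))"
    by (intro integral_mono 1 i wt_dec[OF d])
  then show "integral\<^sup>L lborel (wt n 1 h) \<le> real (n + 2) * integral\<^sup>L lborel (\<lambda>x::real. jbracket x powr (\<beta> - 1)) * B"
    by (simp add: mult_ac)
qed

lemma integrable_wt_jsupp:
  assumes j: "jet UNIV (Suc n) h" and s: "jsupp (Suc n) M h" "a > 0"
  shows "integrable lborel (wt n a h)"
proof -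
  have "integrable lborel (\<lambda>x. indicator {-\<bar>M\<bar>..\<bar>M\<bar>} x *\<^sub>R wt n a h x)"
    unfolding wt_def using s(2)
    by (intro borel_integrable_compact continuous_intros continuous_on_subset[OF jet_continuous[OF j]])
       (auto simp: tau_pos less_imp_neq[symmetric])
  also have "(\<lambda>x. indicator {-\<bar>M\<bar>..\<bar>M\<bar>} x *\<^sub>R wt n a h x) = wt n a h"
  proof
    fix x
    show "indicator {-\<bar>M\<bar>..\<bar>M\<bar>} x *\<^sub>R wt n a h x = wt n a h x"
    proof (cases "\<bar>x\<bar> \<le> \<bar>M\<bar>")
      case True
      then show ?thesis by (auto simp: indicator_def)
    next
      case False
      then have "\<bar>x\<bar> \<ge> M" by linarith
      then have "wt n a h x = 0" using s(1) by (simp add: wt_def jsupp_def)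
      then show ?thesis by simp
    qed
  qed
  finally show ?thesis .
qed

section \<open>Poisson kernel\<close>

text \<open>The jet of the resolvent function x -> 1/(w - x): the r-th entry is its r-th derivative
  in x.\<close>

definition gj :: "complex \<Rightarrow> nat \<Rightarrow> real \<Rightarrow> complex" where
  "gj w r x = fact r / (w - of_real x) ^ Suc r"

lemma gj_0: "gj w 0 x = 1 / (w - of_real x)"
  by (simp add: gj_def)

lemma off_axis_neq: "Im w \<noteq> 0 \<Longrightarrow> w - of_real x \<noteq> 0"
  by (auto simp: complex_eq_iff)

lemma gj_complex_derivative:
  assumes "z \<noteq> (0::complex)"
  shows "((\<lambda>z. fact r / z ^ Suc r) has_field_derivative - (fact (Suc r) / z ^ Suc (Suc r))) (at z)"
proof -
  have "((\<lambda>z. fact r * inverse (z ^ Suc r)) has_field_derivative fact r * - (inverse (z ^ Suc r) * (of_nat (Suc r) * z ^ r) * inverse (z ^ Suc r))) (at z)"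
    using assms by (intro DERIV_cmult DERIV_inverse_fun) (auto intro!: derivative_eq_intros simp del: power_Suc of_nat_Suc)
  also have "fact r * - (inverse (z ^ Suc r) * (of_nat (Suc r) * z ^ r) * inverse (z ^ Suc r)) = - (fact (Suc r) / z ^ Suc (Suc r))"
    using assms by (simp add: field_simps)
  finally show ?thesis by (simp add: divide_inverse)
qed

lemma has_vector_derivative_of_complex_derivative:
  assumes "(f has_field_derivative f') (at (a + b * of_real x))"
  shows "((\<lambda>x. f (a + b * of_real x)) has_vector_derivative b * f') (at x)"
proof -
  have "((\<lambda>z. f (a + b * z)) has_field_derivative f' * b) (at (of_real x))"
    by (rule DERIV_chain2[where f = f and g = "\<lambda>z. a + b * z", OF assms]) (auto intro!: derivative_eq_intros)
  from has_vector_derivative_real_field[OF this] show ?thesis by (simp add: mult.commute)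
qed

lemma gj_derivative: "Im w \<noteq> 0 \<Longrightarrow> (gj w r has_vector_derivative gj w (Suc r) x) (at x)"
  using has_vector_derivative_of_complex_derivative[OF gj_complex_derivative, of w "-1" x r] off_axis_neq[of w x]
  by (simp add: gj_def[abs_def])

lemma gj_shift_derivative:
  "y \<noteq> 0 \<Longrightarrow> ((\<lambda>s. gj (Complex s y) r x) has_vector_derivative - gj (Complex s y) (Suc r) x) (at s)"
proof -
  assume y: "y \<noteq> 0"
  have e: "Complex s y - of_real x = Complex (- x) y + 1 * of_real s" for s by (simp add: complex_eq_iff)
  have nz: "Complex (- x) y + 1 * of_real s \<noteq> 0" using y by (simp add: complex_eq_iff)
  show ?thesis
    using has_vector_derivative_of_complex_derivative[OF gj_complex_derivative[OF nz, of r]]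
    unfolding gj_def e by simp
qed

lemma jet_gj: "Im w \<noteq> 0 \<Longrightarrow> jet UNIV N (gj w)"
  unfolding jet_def
  by (auto intro: gj_derivative has_vector_derivative_continuous simp: continuous_on_eq_continuous_within)

lemma gj_norm_le:
  assumes "\<bar>Im w\<bar> \<ge> b" "b > 0" shows "cmod (gj w r x) \<le> fact r / b ^ Suc r"
proof -
  have "b \<le> cmod (w - of_real x)" using assms abs_Im_le_cmod[of "w - of_real x"] by simp
  then show ?thesis
    using assms by (auto simp: gj_def norm_divide norm_power intro!: divide_left_mono power_mono mult_pos_pos zero_less_power simp del: power_Suc)
qed

lemma jbnd_gj:
  assumes "\<bar>Im w\<bar> \<ge> b" "b > 0" shows "jbnd N (\<Sum>r\<le>N. fact r / b ^ Suc r) (gj w)"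
  unfolding jbnd_def
proof (intro allI impI)
  fix r x assume "r \<le> N"
  then have "fact r / b ^ Suc r \<le> (\<Sum>r\<le>N. fact r / b ^ Suc r)"
    using assms(2) by (intro member_le_sum) auto
  then show "cmod (gj w r x) \<le> (\<Sum>r\<le>N. fact r / b ^ Suc r)" using gj_norm_le[OF assms, of r x] by linarith
qed

lemma dec_gj:
  assumes w: "Im w \<noteq> 0"
  obtains B where "dec UNIV N (-1) B (gj w)"
proof -
  \<comment> \<open>Chosen so that the bracket of x is at most C |w - x| for every real x.\<close>
  define C where "C = (1 + cmod w) / \<bar>Im w\<bar> + 1"
  have C: "C \<ge> 1" by (simp add: C_def)
  have "cmod (gj w r x) \<le> (fact N * C ^ Suc N) * jbracket x powr (- 1 - real r)" if r: "r \<le> N" for r x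
  proof -
    let ?d = "cmod (w - of_real x)"
    have d: "\<bar>Im w\<bar> \<le> ?d" using abs_Im_le_cmod[of "w - of_real x"] by simp
    have d0: "?d > 0" using off_axis_neq[OF w] by simp
    have "jbracket x \<le> 1 + \<bar>x\<bar>" by (rule jbracket_le)
    also have "\<bar>x\<bar> \<le> cmod w + ?d" using norm_triangle_ineq4[of w "w - of_real x"] by simp
    also have "1 + (cmod w + ?d) \<le> (1 + cmod w) * (?d / \<bar>Im w\<bar>) + ?d"
    proof -
      have "1 \<le> ?d / \<bar>Im w\<bar>" using d w by (simp add: field_simps)
      then have "(1 + cmod w) * 1 \<le> (1 + cmod w) * (?d / \<bar>Im w\<bar>)" by (intro mult_left_mono) auto
      then show ?thesis by simp
    qed
    also have "\<dots> = C * ?d" by (simp add: C_def field_simps)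
    finally have jd: "jbracket x / C \<le> ?d" using C by (simp add: field_simps)
    have j: "jbracket x > 0" by (rule jbracket_real_ge)
    have "cmod (gj w r x) = fact r / ?d ^ Suc r" by (simp add: gj_def norm_divide norm_power norm_mult del: power_Suc)
    also have "\<dots> \<le> fact r / (jbracket x / C) ^ Suc r"
      using jd j C d0 by (intro divide_left_mono power_mono mult_pos_pos zero_less_power) auto
    also have "\<dots> = fact r * C ^ Suc r * jbracket x powr (- 1 - real r)"
    proof -
      have "jbracket x powr (- 1 - real r) = inverse (jbracket x ^ Suc r)"
        using j powr_minus[of "jbracket x" "real (Suc r)"] powr_realpow[of "jbracket x" "Suc r"] by (simp add: algebra_simps)
      then show ?thesis using j C by (simp add: power_divide field_simps del: power_Suc)
    qed
    also have "\<dots> \<le> fact N * C ^ Suc N * jbracket x powr (- 1 - real r)"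
      using r C by (intro mult_right_mono mult_mono fact_mono power_increasing) auto
    finally show ?thesis .
  qed
  then have "dec UNIV N (-1) (fact N * C ^ Suc N) (gj w)" by (simp add: dec_def)
  then show ?thesis by (rule that)
qed

text \<open>After multiplication by \<open>b\<close> the quotients b/U and b/V have modulus at most
  1, so the difference of their (r+1)-st powers is at most r+1 times the difference of the
  quotients.\<close>

lemma gj_lipschitz:
  assumes "\<bar>Im u\<bar> \<ge> b" "\<bar>Im v\<bar> \<ge> b" "b > 0"
  shows "cmod (gj u r x - gj v r x) \<le> fact (Suc r) / b ^ Suc (Suc r) * cmod (u - v)"
proof -
  define U V where "U = u - of_real x" and "V = v - of_real x"
  have U: "cmod U \<ge> b" and V: "cmod V \<ge> b"
    using assms abs_Im_le_cmod[of U] abs_Im_le_cmod[of V] by (auto simp: U_def V_def)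
  then have nz: "U \<noteq> 0" "V \<noteq> 0" using assms(3) by auto
  have le1: "norm (of_real b / U) \<le> 1" "norm (of_real b / V) \<le> 1" using U V assms(3) nz by (auto simp: norm_divide)
  have "gj u r x - gj v r x = of_real (fact r / b ^ Suc r) * ((of_real b / U) ^ Suc r - (of_real b / V) ^ Suc r)"
    using assms(3) by (simp add: gj_def U_def V_def power_divide right_diff_distrib del: power_Suc)
  also have "cmod \<dots> \<le> fact r / b ^ Suc r * (real (Suc r) * cmod (of_real b / U - of_real b / V))"
    unfolding norm_mult using assms(3) by (intro mult_mono norm_power_diff le1) (auto simp: norm_mult norm_divide norm_power)
  also have "\<dots> \<le> fact r / b ^ Suc r * (real (Suc r) * (b * cmod (u - v) / (b * b)))"
  proof -
    have "of_real b / U - of_real b / V = of_real b * (V - U) / (U * V)" using nz by (simp add: field_simps)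
    then have "cmod (of_real b / U - of_real b / V) = b * cmod (u - v) / (cmod U * cmod V)" using assms(3)
      by (simp add: norm_divide norm_mult U_def V_def norm_minus_commute)
    also have "\<dots> \<le> b * cmod (u - v) / (b * b)" using U V assms(3) by (intro divide_left_mono mult_mono mult_pos_pos) auto
    finally show ?thesis using assms(3) by (intro mult_left_mono) auto
  qed
  also have "\<dots> = fact (Suc r) / b ^ Suc (Suc r) * cmod (u - v)" using assms(3) by (simp add: field_simps)
  finally show ?thesis .
qed

text \<open>The jet in x of the Poisson kernel at s - x. It is written through \<open>gj\<close> at
  s - i\<epsilon> and s + i\<epsilon> because this is the scalar counterpart of the Stone kernel:
  composition with a resolvent at w becomes multiplication by \<open>gj w\<close>.\<close>

definition pj :: "real \<Rightarrow> real \<Rightarrow> nat \<Rightarrow> real \<Rightarrow> complex" where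
  "pj \<epsilon> s r x = 1 / (2 * pi * \<i>) * (gj (Complex s (- \<epsilon>)) r x - gj (Complex s \<epsilon>) r x)"

definition poisson :: "real \<Rightarrow> real \<Rightarrow> real" where
  "poisson \<epsilon> u = \<epsilon> / (pi * (u\<^sup>2 + \<epsilon>\<^sup>2))"

lemma pj_0: "\<epsilon> > 0 \<Longrightarrow> pj \<epsilon> s 0 x = of_real (poisson \<epsilon> (s - x))"
proof -
  assume e: "\<epsilon> > 0"
  define u where "u = s - x"
  have n: "complex_of_real (u\<^sup>2 + \<epsilon>\<^sup>2) \<noteq> 0" using e by (metis add_nonneg_pos of_real_eq_0_iff less_irrefl zero_le_power2 zero_less_power)
  have nz: "Complex u (- \<epsilon>) \<noteq> 0" "Complex u \<epsilon> \<noteq> 0" using e by (auto simp: complex_eq_iff)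
  have "1 / Complex u (- \<epsilon>) - 1 / Complex u \<epsilon> = (Complex u \<epsilon> - Complex u (- \<epsilon>)) / (Complex u (- \<epsilon>) * Complex u \<epsilon>)"
    using nz by (simp add: field_simps)
  also have "Complex u \<epsilon> - Complex u (- \<epsilon>) = 2 * \<i> * of_real \<epsilon>" by (simp add: complex_eq_iff)
  also have "Complex u (- \<epsilon>) * Complex u \<epsilon> = of_real (u\<^sup>2 + \<epsilon>\<^sup>2)" by (simp add: complex_eq_iff power2_eq_square)
  finally have "1 / Complex u (- \<epsilon>) - 1 / Complex u \<epsilon> = 2 * \<i> * of_real \<epsilon> / of_real (u\<^sup>2 + \<epsilon>\<^sup>2)" .
  moreover have "Complex s v - of_real x = Complex u v" for v by (simp add: complex_eq_iff u_def)
  ultimately have "pj \<epsilon> s 0 x = 1 / (2 * pi * \<i>) * (2 * \<i> * of_real \<epsilon> / of_real (u\<^sup>2 + \<epsilon>\<^sup>2))"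
    by (simp add: pj_def gj_0)
  also have "\<dots> = of_real (poisson \<epsilon> u)" using n by (simp add: poisson_def field_simps)
  finally show ?thesis by (simp add: u_def)
qed

lemma poisson_nonneg: "\<epsilon> > 0 \<Longrightarrow> poisson \<epsilon> u \<ge> 0"
  by (simp add: poisson_def)

lemma continuous_poisson: "\<epsilon> > 0 \<Longrightarrow> continuous_on A f \<Longrightarrow> continuous_on A (\<lambda>x. poisson \<epsilon> (f x))"
proof -
  assume e: "\<epsilon> > 0" and f: "continuous_on A f"
  have "pi * ((f x)\<^sup>2 + \<epsilon>\<^sup>2) \<noteq> 0" for x using e by (simp add: add_nonneg_eq_0_iff)
  then show ?thesis unfolding poisson_def using f by (intro continuous_intros) auto
qed

lemma has_integral_poisson:
  assumes e: "\<epsilon> > 0" and L: "L \<ge> 0"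
  shows "((\<lambda>s. poisson \<epsilon> (s - x)) has_integral (arctan ((L - x) / \<epsilon>) - arctan ((- L - x) / \<epsilon>)) / pi) {-L..L}"
proof -
  have "((\<lambda>s. arctan ((s - x) / \<epsilon>) / pi) has_real_derivative poisson \<epsilon> (s - x)) (at s within {-L..L})" for s
  proof -
    have p: "(s - x)\<^sup>2 + \<epsilon>\<^sup>2 > 0" using e by (simp add: add_nonneg_pos)
    have p': "1 + ((s - x) / \<epsilon>)\<^sup>2 = ((s - x)\<^sup>2 + \<epsilon>\<^sup>2) / \<epsilon>\<^sup>2" using e by (simp add: power_divide field_simps)
    have "((\<lambda>s. arctan ((s - x) / \<epsilon>) / pi) has_real_derivative inverse (1 + ((s - x) / \<epsilon>)\<^sup>2) * (1 / \<epsilon>) / pi) (at s within {-L..L})"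
      by (rule derivative_eq_intros refl | use e in simp)+
    also have "inverse (1 + ((s - x) / \<epsilon>)\<^sup>2) * (1 / \<epsilon>) / pi = poisson \<epsilon> (s - x)"
      unfolding p' poisson_def using e p by (simp add: power2_eq_square field_simps)
    finally show ?thesis .
  qed
  then have "((\<lambda>s. poisson \<epsilon> (s - x)) has_integral (arctan ((L - x) / \<epsilon>) / pi - arctan ((- L - x) / \<epsilon>) / pi)) {-L..L}"
    using L by (intro fundamental_theorem_of_calculus) (auto simp: has_real_derivative_iff_has_vector_derivative)
  then show ?thesis by (simp add: diff_divide_distrib)
qed

text \<open>For |x| <= M both ends of the interval are at distance at least 1 from x; hence the
  lower bound does not depend on x. This is the reason for the margin M + 1 below.\<close>

lemma poisson_mass:
  assumes e: "\<epsilon> > 0" and M: "M > 0" and x: "\<bar>x\<bar> \<le> M"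
  shows "integral {-(M+1)..M+1} (\<lambda>s. poisson \<epsilon> (s - x)) \<le> 1"
    and "integral {-(M+1)..M+1} (\<lambda>s. poisson \<epsilon> (s - x)) \<ge> 2 / pi * arctan (1 / \<epsilon>)"
proof -
  have i: "integral {-(M+1)..M+1} (\<lambda>s. poisson \<epsilon> (s - x)) = (arctan ((M + 1 - x) / \<epsilon>) - arctan ((- (M + 1) - x) / \<epsilon>)) / pi"
    using M by (intro integral_unique has_integral_poisson e) simp
  have "arctan ((M + 1 - x) / \<epsilon>) - arctan ((- (M + 1) - x) / \<epsilon>) \<le> pi"
    using arctan_ubound[of "(M + 1 - x) / \<epsilon>"] arctan_lbound[of "(- (M + 1) - x) / \<epsilon>"] by linarith
  then show "integral {-(M+1)..M+1} (\<lambda>s. poisson \<epsilon> (s - x)) \<le> 1" unfolding i by simp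
  have "arctan (1 / \<epsilon>) \<le> arctan ((M + 1 - x) / \<epsilon>)"
    using x e by (intro arctan_monotone' divide_right_mono) auto
  moreover have "arctan ((- (M + 1) - x) / \<epsilon>) \<le> arctan (- 1 / \<epsilon>)"
    using x e by (intro arctan_monotone' divide_right_mono) auto
  ultimately have "2 * arctan (1 / \<epsilon>) \<le> arctan ((M + 1 - x) / \<epsilon>) - arctan ((- (M + 1) - x) / \<epsilon>)"
    by (simp add: arctan_minus)
  then show "integral {-(M+1)..M+1} (\<lambda>s. poisson \<epsilon> (s - x)) \<ge> 2 / pi * arctan (1 / \<epsilon>)"
    unfolding i by (simp add: field_simps)
qed

text \<open>Uniform continuity and boundedness combine into |f(s) - f(x)| <= e/3 + (2B/d^2) (s -
  x)^2. The kernel times (s - x)^2 is at most \<epsilon>/\<pi>, so the quadratic part integrates to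
  O(\<epsilon>). The last e/3 pays for the mass missing from the bounded interval.\<close>

lemma poisson_approx:
  assumes M: "M > 0" and f: "continuous_on {-(M+1)..M+1} f" and B: "\<And>x. x \<in> {-(M+1)..M+1} \<Longrightarrow> cmod (f x) \<le> B"
    and e: "e > 0"
  shows "eventually (\<lambda>k. \<forall>x. \<bar>x\<bar> \<le> M \<longrightarrow>
     cmod (integral {-(M+1)..M+1} (\<lambda>s. f s * of_real (poisson (eta k) (s - x))) - f x) \<le> e) sequentially"
proof -
  let ?I = "{-(M+1)..M+1}"
  have "cmod (f 0) \<le> B" using M by (intro B) auto
  then have B0: "B \<ge> 0" using norm_ge_zero order_trans by blast
  have "uniformly_continuous_on ?I f" by (intro compact_uniformly_continuous f) simp
  then obtain d where d: "d > 0" "\<And>x y. x \<in> ?I \<Longrightarrow> y \<in> ?I \<Longrightarrow> dist y x < d \<Longrightarrow> dist (f y) (f x) < e / 3"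
    unfolding uniformly_continuous_on_def using e by (metis divide_pos_pos zero_less_numeral)
  have close: "cmod (f s - f x) \<le> e / 3 + (2 * B / d\<^sup>2) * (s - x)\<^sup>2" if "s \<in> ?I" "x \<in> ?I" for s x
  proof (cases "\<bar>s - x\<bar> < d")
    case True
    then have "cmod (f s - f x) < e / 3" using d(2)[OF that(2,1)] by (simp add: dist_norm)
    moreover have "(2 * B / d\<^sup>2) * (s - x)\<^sup>2 \<ge> 0" using B0 by simp
    ultimately show ?thesis by linarith
  next
    case False
    then have "d\<^sup>2 \<le> (s - x)\<^sup>2" using d(1) by (metis abs_ge_zero abs_le_square_iff abs_of_pos not_less)
    then have "2 * B * 1 \<le> 2 * B * ((s - x)\<^sup>2 / d\<^sup>2)" using d(1) B0 by (intro mult_left_mono) auto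
    moreover have "cmod (f s - f x) \<le> 2 * B"
      using norm_triangle_ineq4[of "f s" "f x"] B[OF that(1)] B[OF that(2)] by linarith
    ultimately show ?thesis using e by simp
  qed
  have l1: "(\<lambda>k. (2 * B / d\<^sup>2) * (eta k / pi) * (2 * (M + 1))) \<longlonglongrightarrow> (2 * B / d\<^sup>2) * (0 / pi) * (2 * (M + 1))"
    by (intro tendsto_intros eta_tendsto) auto
  have inv: "filterlim (\<lambda>k. 1 / eta k) at_top sequentially"
    unfolding eta_def by (simp add: filterlim_compose[OF filterlim_real_sequentially filterlim_Suc, simplified])
  have l2: "(\<lambda>k. B * (1 - 2 / pi * arctan (1 / eta k))) \<longlonglongrightarrow> B * (1 - 2 / pi * (pi / 2))"
    by (intro tendsto_intros filterlim_compose[OF tendsto_arctan_at_top inv])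
  have ev1: "eventually (\<lambda>k. (2 * B / d\<^sup>2) * (eta k / pi) * (2 * (M + 1)) < e / 3) sequentially"
    using e by (intro order_tendstoD(2)[OF l1]) simp
  have ev2: "eventually (\<lambda>k. B * (1 - 2 / pi * arctan (1 / eta k)) < e / 3) sequentially"
    using e by (intro order_tendstoD(2)[OF l2]) simp
  show ?thesis
    using ev1 ev2
  proof eventually_elim
    case (elim k)
    show ?case
    proof (intro allI impI)
      fix x assume x: "\<bar>x\<bar> \<le> M"
      then have xI: "x \<in> ?I" by auto
      let ?p = "\<lambda>s. poisson (eta k) (s - x)"
      have ep: "eta k > 0" by (rule eta_pos)
      have pc: "continuous_on ?I ?p" by (intro continuous_poisson ep continuous_intros)
      have pi1: "?p integrable_on ?I" by (rule integrable_continuous_interval[OF pc])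
      have i1: "(\<lambda>s. f s * of_real (?p s)) integrable_on ?I"
        by (intro integrable_continuous_interval continuous_intros f pc)
      have i2: "(\<lambda>s. f x * of_real (?p s)) integrable_on ?I"
        by (intro integrable_continuous_interval continuous_intros pc)
      have m: "integral ?I (\<lambda>s. f x * of_real (?p s)) = f x * of_real (integral ?I ?p)"
        using integral_linear[OF pi1 bounded_linear_of_real[where 'a = complex]]
        by (simp add: o_def)
      have "cmod (integral ?I (\<lambda>s. f s * of_real (?p s) - f x * of_real (?p s))) \<le> integral ?I (\<lambda>s. e / 3 * ?p s + (2 * B / d\<^sup>2) * (eta k / pi))"
      proof (rule integral_norm_bound_integral)
        show "(\<lambda>s. f s * of_real (?p s) - f x * of_real (?p s)) integrable_on ?I" by (rule integrable_diff[OF i1 i2])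
        show "(\<lambda>s. e / 3 * ?p s + (2 * B / d\<^sup>2) * (eta k / pi)) integrable_on ?I"
          by (intro integrable_continuous_interval continuous_intros pc)
        fix s assume s: "s \<in> ?I"
        have "cmod (f s * of_real (?p s) - f x * of_real (?p s)) = cmod (f s - f x) * ?p s"
          using poisson_nonneg[OF ep] by (simp add: left_diff_distrib[symmetric] norm_mult)
        also have "\<dots> \<le> (e / 3 + (2 * B / d\<^sup>2) * (s - x)\<^sup>2) * ?p s"
          by (intro mult_right_mono close s xI poisson_nonneg ep)
        also have "\<dots> = e / 3 * ?p s + (2 * B / d\<^sup>2) * ((s - x)\<^sup>2 * ?p s)" by (simp add: algebra_simps)
        also have "\<dots> \<le> e / 3 * ?p s + (2 * B / d\<^sup>2) * (eta k / pi)"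
        proof -
          have "(s - x)\<^sup>2 / ((s - x)\<^sup>2 + (eta k)\<^sup>2) \<le> 1" using ep by (simp add: divide_le_eq_1 add_nonneg_pos)
          then have "(eta k / pi) * ((s - x)\<^sup>2 / ((s - x)\<^sup>2 + (eta k)\<^sup>2)) \<le> (eta k / pi) * 1"
            using ep by (intro mult_left_mono) auto
          then have "(s - x)\<^sup>2 * ?p s \<le> eta k / pi" by (simp add: poisson_def mult_ac)
          then show ?thesis using B0 by (intro add_left_mono mult_left_mono) auto
        qed
        finally show "cmod (f s * of_real (?p s) - f x * of_real (?p s)) \<le> e / 3 * ?p s + (2 * B / d\<^sup>2) * (eta k / pi)" .
      qed
      also have "\<dots> = e / 3 * integral ?I ?p + (2 * B / d\<^sup>2) * (eta k / pi) * (2 * (M + 1))"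
        using M pi1 by (subst integral_add) (auto simp: integrable_on_mult_right mult_ac)
      also have "\<dots> \<le> e / 3 * 1 + e / 3"
        using elim(1) e poisson_mass(1)[OF ep M x] by (intro add_mono mult_left_mono) auto
      finally have 1: "cmod (integral ?I (\<lambda>s. f s * of_real (?p s)) - f x * of_real (integral ?I ?p)) \<le> 2 * e / 3"
        unfolding m[symmetric] using integral_diff[OF i1 i2] by simp
      have "cmod (f x * of_real (integral ?I ?p) - f x) = cmod (f x) * (1 - integral ?I ?p)"
      proof -
        have "f x * of_real (integral ?I ?p) - f x = f x * of_real (integral ?I ?p - 1)" by (simp add: algebra_simps)
        then show ?thesis using poisson_mass(1)[OF ep M x] by (simp add: norm_mult del: of_real_diff)
      qed
      also have "\<dots> \<le> B * (1 - 2 / pi * arctan (1 / eta k))"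
        using B[OF xI] B0 poisson_mass[OF ep M x] by (intro mult_mono) auto
      also have "\<dots> \<le> e / 3" using elim(2) by simp
      finally have 2: "cmod (f x * of_real (integral ?I ?p) - f x) \<le> e / 3" .
      show "cmod (integral ?I (\<lambda>s. f s * of_real (?p s)) - f x) \<le> e"
        using norm_triangle_ineq[of "integral ?I (\<lambda>s. f s * of_real (?p s)) - f x * of_real (integral ?I ?p)" "f x * of_real (integral ?I ?p) - f x"] 1 2
        by simp
    qed
  qed
qed

section \<open>Independence of choices\<close>

lemma edbar_add: "edbar n \<psi> \<psi>' s (\<lambda>r x. h r x + k r x) p = edbar n \<psi> \<psi>' s h p + edbar n \<psi> \<psi>' s k p"
  by (cases p) (simp add: edbar_eq taylor_def sum.distrib algebra_simps add_divide_distrib)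

lemma edbar_cmult: "edbar n \<psi> \<psi>' s (\<lambda>r x. a * h r x) p = a * edbar n \<psi> \<psi>' s h p"
  by (cases p) (simp add: edbar_eq taylor_def sum_distrib_left algebra_simps)

text \<open>On the support the bracket is at most 1 + M, so the power -1 - r with r <= N costs at
  most (1 + M)^(N+1). Through this the bounds for decaying jets apply to compactly supported
  ones.\<close>

lemma jsupp_jbnd_dec:
  assumes s: "jsupp N M h" and b: "jbnd N B h" and M: "M > 0"
  shows "dec UNIV N (-1) (B * (1 + M) ^ (N + 1)) h"
  unfolding dec_def
proof (intro allI impI ballI)
  fix r x assume r: "r \<le> N"
  have B: "B \<ge> 0" using b by (auto simp: jbnd_def intro: order_trans[OF norm_ge_zero])
  show "cmod (h r x) \<le> B * (1 + M) ^ (N + 1) * jbracket x powr (- 1 - real r)"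
  proof (cases "\<bar>x\<bar> \<ge> M")
    case True
    then show ?thesis using s r B M by (simp add: jsupp_def)
  next
    case False
    have j: "jbracket x \<ge> 1" "jbracket x \<le> 1 + M" using jbracket_real_ge(1)[of x] jbracket_le[of x] False by auto
    have "jbracket x powr (1 + real r) = jbracket x ^ (r + 1)" using j powr_realpow[of "jbracket x" "r + 1"] by (simp add: add_ac)
    also have "\<dots> \<le> jbracket x ^ (N + 1)" using j r by (intro power_increasing) auto
    also have "\<dots> \<le> (1 + M) ^ (N + 1)" using j by (intro power_mono) auto
    finally have "1 \<le> (1 + M) ^ (N + 1) * jbracket x powr (- 1 - real r)"
      using j by (simp add: powr_minus powr_diff powr_add field_simps)
    then have "B * 1 \<le> B * ((1 + M) ^ (N + 1) * jbracket x powr (- 1 - real r))" using B by (rule mult_left_mono)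
    moreover have "cmod (h r x) \<le> B" using b r by (simp add: jbnd_def)
    ultimately show ?thesis by (simp add: mult_ac)
  qed
qed

lemma jmul_jscale_supp:
  assumes c: "\<And>r x. r \<le> N \<Longrightarrow> \<bar>x\<bar> \<ge> 2 \<Longrightarrow> \<kappa> r x = 0" and k: "k > 0"
  shows "jsupp N (2 * k) (jmul (jscale k \<kappa>) h)"
  unfolding jsupp_def jmul_def jscale_def
  using c k by (auto intro!: sum.neutral simp: field_simps)

locale cut_family =
  fixes N :: nat and \<kappa> :: "nat \<Rightarrow> real \<Rightarrow> complex"
  assumes jet_cut: "jet UNIV N \<kappa>" and cut_1: "\<And>x. \<bar>x\<bar> \<le> 1 \<Longrightarrow> \<kappa> 0 x = 1" and cut_0: "\<And>x. \<bar>x\<bar> \<ge> 2 \<Longrightarrow> \<kappa> 0 x = 0"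
    and cut_deriv: "\<And>r x. 0 < r \<Longrightarrow> r \<le> N \<Longrightarrow> \<bar>x\<bar> \<le> 1 \<or> \<bar>x\<bar> \<ge> 2 \<Longrightarrow> \<kappa> r x = 0"
begin

lemma cut_outside: "r \<le> N \<Longrightarrow> \<bar>x\<bar> \<ge> 2 \<Longrightarrow> \<kappa> r x = 0"
  using cut_0 cut_deriv by (cases "r = 0") auto

text \<open>The scale is k + 1, so that no division by 0 occurs at the first index and
  \<open>dec_jscale\<close> applies for every \<open>k\<close>.\<close>

definition cutk :: "nat \<Rightarrow> (nat \<Rightarrow> real \<Rightarrow> complex) \<Rightarrow> nat \<Rightarrow> real \<Rightarrow> complex" where
  "cutk k h = jmul (jscale (real (Suc k)) \<kappa>) h"

lemma jsupp_cutk: "jsupp N (2 * real (Suc k)) (cutk k h)"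
  unfolding cutk_def by (rule jmul_jscale_supp[OF cut_outside]) auto

lemma jet_cutk: "jet UNIV N h \<Longrightarrow> jet UNIV N (cutk k h)"
  unfolding cutk_def by (intro jet_mult jet_jscale jet_cut)

lemma cutk_0: "cutk k h 0 x = \<kappa> 0 (x / real (Suc k)) * h 0 x"
  by (simp add: cutk_def jmul_def jscale_def)

text \<open>The remainder lives at |x| >= k + 1. Half of the decay \<beta> is spent there on the
  factor (k+1)^(\<beta>/2), which tends to 0, and the other half keeps the remainder
  integrable.\<close>

lemma cutk_dec:
  obtains C where "C > 0" "\<And>h \<beta> B k. dec UNIV N \<beta> B h \<Longrightarrow> dec UNIV N \<beta> (C * B) (cutk k h)"
    "\<And>h \<beta> B k. dec UNIV N \<beta> B h \<Longrightarrow> \<beta> < 0 \<Longrightarrow> dec UNIV N (\<beta> / 2) (C * B * real (Suc k) powr (\<beta> / 2)) (\<lambda>r x. h r x - cutk k h r x)"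
proof -
  obtain C0 where C0: "C0 > 0" "\<And>k. k \<ge> 1 \<Longrightarrow> dec UNIV N 0 C0 (jscale k \<kappa>)"
    using dec_jscale[OF jet_cut cut_outside] by blast
  have 1: "dec UNIV N \<beta> (2 ^ N * (C0 + 1) * B) (cutk k h)" if d: "dec UNIV N \<beta> B h" for h \<beta> B k
  proof -
    have d': "dec UNIV N (0 + \<beta>) (2 ^ N * C0 * B) (cutk k h)"
      unfolding cutk_def by (rule dec_jmul[OF C0(2) d]) auto
    have "B \<ge> 0" using dec_nonneg[OF d] by simp
    then have le: "2 ^ N * C0 * B \<le> 2 ^ N * (C0 + 1) * B" by (intro mult_right_mono mult_left_mono) auto
    show ?thesis by (rule dec_weaken[OF d' _ le order_refl]) simp_all
  qed
  have 2: "dec UNIV N (\<beta> / 2) (2 ^ N * (C0 + 1) * B * real (Suc k) powr (\<beta> / 2)) (\<lambda>r x. h r x - cutk k h r x)"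
    if d: "dec UNIV N \<beta> B h" and b: "\<beta> < 0" for h \<beta> B k
    unfolding dec_def
  proof (intro allI impI ballI)
    fix r x assume r: "r \<le> N"
    have B: "B \<ge> 0" using dec_nonneg[OF d] by simp
    let ?K = "real (Suc k)"
    \<comment> \<open>The jet of 1 minus the rescaled cut-off; the remainder is its Leibniz product
      with \<open>h\<close>.\<close>
    define co where "co r x = (if r = 0 then 1 else 0) - jscale ?K \<kappa> r x" for r x
    have "(\<Sum>j\<le>r. of_nat (r choose j) * (if j = 0 then 1 else 0) * h (r - j) x) = h r x"
      by (subst sum.remove[of _ 0]) (auto intro!: sum.neutral)
    then have eq: "h r x - cutk k h r x = jmul co h r x"
      unfolding cutk_def jmul_def co_def by (simp add: algebra_simps sum_subtractf)
    show "cmod (h r x - cutk k h r x) \<le> 2 ^ N * (C0 + 1) * B * ?K powr (\<beta> / 2) * jbracket x powr (\<beta> / 2 - real r)"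
    proof (cases "\<bar>x\<bar> \<le> ?K")
      case True
      then have "\<bar>x / ?K\<bar> \<le> 1" by simp
      then have "co j x = 0" if "j \<le> r" for j
        using cut_1 cut_deriv[of j "x / ?K"] that r by (cases "j = 0") (auto simp: co_def jscale_def)
      then have "jmul co h r x = 0" unfolding jmul_def by (intro sum.neutral) auto
      then show ?thesis unfolding eq using B C0(1) by simp
    next
      case False
      have "dec UNIV N 0 (1 + C0) co"
      proof -
        have "dec UNIV N 0 1 (\<lambda>r x. if r = 0 then 1 else 0)"
          by (simp add: dec_def less_imp_neq[OF jbracket_real_ge(3), symmetric])
        then show ?thesis unfolding co_def by (intro dec_diff C0) auto
      qed
      then have "dec UNIV N (0 + \<beta>) (2 ^ N * (1 + C0) * B) (jmul co h)" by (rule dec_jmul[OF _ d]) simp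
      then have "cmod (jmul co h r x) \<le> 2 ^ N * (1 + C0) * B * jbracket x powr (\<beta> - real r)"
        using r by (simp add: dec_def)
      also have "\<dots> \<le> 2 ^ N * (1 + C0) * B * (?K powr (\<beta> / 2) * jbracket x powr (\<beta> / 2 - real r))"
      proof (rule mult_left_mono)
        have "jbracket x powr (\<beta> - real r) = jbracket x powr (\<beta> / 2) * jbracket x powr (\<beta> / 2 - real r)"
          by (simp add: powr_add[symmetric])
        also have "\<dots> \<le> ?K powr (\<beta> / 2) * jbracket x powr (\<beta> / 2 - real r)"
          using False b jbracket_real_ge(2)[of x] by (intro mult_right_mono powr_mono2') auto
        finally show "jbracket x powr (\<beta> - real r) \<le> ?K powr (\<beta> / 2) * jbracket x powr (\<beta> / 2 - real r)" .
      qed (use B C0(1) in simp)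
      finally show ?thesis unfolding eq by (simp only: mult.assoc add.commute)
    qed
  qed
  show ?thesis by (rule that[OF _ 1 2]) (use C0 in \<open>auto intro: add_pos_pos\<close>)
qed

end

lemma cut_family_exists: "\<exists>\<kappa>. cut_family N \<kappa>"
proof -
  obtain \<kappa> where \<kappa>: "jet UNIV N \<kappa>" "\<And>x. \<bar>x\<bar> \<le> 1 \<Longrightarrow> \<kappa> 0 x = 1" "\<And>x. \<bar>x\<bar> \<ge> 2 \<Longrightarrow> \<kappa> 0 x = 0"
     "\<And>r x. 0 < r \<Longrightarrow> r \<le> N \<Longrightarrow> \<bar>x\<bar> \<le> 1 \<or> \<bar>x\<bar> \<ge> 2 \<Longrightarrow> \<kappa> r x = 0"
    by (rule cutjet_exists[of N]) (rule that; assumption)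
  then have "cut_family N \<kappa>" by unfold_locales
  then show ?thesis by blast
qed

lemma Suc_powr_tendsto_0: "\<beta> < 0 \<Longrightarrow> (\<lambda>k. real (Suc k) powr \<beta>) \<longlonglongrightarrow> 0"
  by (rule tendsto_neg_powr[OF _ filterlim_compose[OF filterlim_real_sequentially filterlim_Suc]])

section \<open>Linearity, continuity and independence of the integral\<close>

context hol_off_real
begin

lemma hs_add:
  assumes "cutpair \<psi> \<psi>'" "real n > \<alpha>" "s \<ge> 1" "jet UNIV (Suc n) h" "integrable lborel (wt n s h)"
    "jet UNIV (Suc n) k" "integrable lborel (wt n s k)"
  shows "hs n \<psi> \<psi>' s (\<lambda>r x. h r x + k r x) = hs n \<psi> \<psi>' s h + hs n \<psi> \<psi>' s k"
  unfolding hs_def edbar_add scaleC_add_left using assms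
  by (subst integral_add) (auto intro: edbar_R_integrable simp: scaleR_add_right)

lemma hs_cmult:
  assumes "cutpair \<psi> \<psi>'" "real n > \<alpha>" "s \<ge> 1" "jet UNIV (Suc n) h" "integrable lborel (wt n s h)"
  shows "hs n \<psi> \<psi>' s (\<lambda>r x. a * h r x) = a *\<^sub>C hs n \<psi> \<psi>' s h"
proof -
  have "hs n \<psi> \<psi>' s (\<lambda>r x. a * h r x) = - (1 / pi) *\<^sub>R (a *\<^sub>C integral UNIV (\<lambda>p. edbar n \<psi> \<psi>' s h p *\<^sub>C R (Complex (fst p) (snd p))))"
    unfolding hs_def edbar_cmult scaleC_scaleC[symmetric]
    using edbar_R_integrable[OF assms(1,2,4,3,5)] by (simp add: integral_scaleC)
  then show ?thesis by (simp add: hs_def scaleR_scaleC scaleC_scaleC mult.commute)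
qed

lemma hs_diff:
  assumes "cutpair \<psi> \<psi>'" "real n > \<alpha>" "s \<ge> 1" "jet UNIV (Suc n) h" "integrable lborel (wt n s h)"
    "jet UNIV (Suc n) k" "integrable lborel (wt n s k)"
  shows "hs n \<psi> \<psi>' s (\<lambda>r x. h r x - k r x) = hs n \<psi> \<psi>' s h - hs n \<psi> \<psi>' s k"
proof -
  have w: "wt n s (\<lambda>r x. (-1) * k r x) = wt n s k" by (simp add: wt_def fun_eq_iff)
  have "hs n \<psi> \<psi>' s (\<lambda>r x. h r x + (-1) * k r x) = hs n \<psi> \<psi>' s h + hs n \<psi> \<psi>' s (\<lambda>r x. (-1) * k r x)"
    by (intro hs_add assms jet_cmult) (simp only: w assms)
  also have "hs n \<psi> \<psi>' s (\<lambda>r x. (-1) * k r x) = (-1) *\<^sub>C hs n \<psi> \<psi>' s k"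
    by (intro hs_cmult assms)
  finally show ?thesis by (simp add: scaleC_minus_left)
qed

lemma hs_dec_bound:
  assumes cp: "cutpair \<psi> \<psi>'" and n: "real n > \<alpha>" and b: "\<beta> < 0"
  obtains K where "K > 0" "\<And>h B. jet UNIV (Suc n) h \<Longrightarrow> dec UNIV (Suc n) \<beta> B h \<Longrightarrow> norm (hs n \<psi> \<psi>' 1 h) \<le> K * B"
proof -
  obtain K0 where K0: "K0 > 0"
    "\<And>h s. jet UNIV (Suc n) h \<Longrightarrow> s \<ge> 1 \<Longrightarrow> integrable lborel (wt n s h) \<Longrightarrow>
       norm (hs n \<psi> \<psi>' s h) \<le> K0 * integral\<^sup>L lborel (wt n s h)"
    using hs_bound[OF cp n] by metis
  define L where "L = real (n + 2) * integral\<^sup>L lborel (\<lambda>x::real. jbracket x powr (\<beta> - 1))"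
  have L: "L \<ge> 0" unfolding L_def by (intro mult_nonneg_nonneg Bochner_Integration.integral_nonneg) auto
  have "norm (hs n \<psi> \<psi>' 1 h) \<le> (K0 * (L + 1)) * B" if j: "jet UNIV (Suc n) h" and d: "dec UNIV (Suc n) \<beta> B h" for h B
  proof -
    have B: "B \<ge> 0" using dec_nonneg[OF d] by simp
    have "norm (hs n \<psi> \<psi>' 1 h) \<le> K0 * integral\<^sup>L lborel (wt n 1 h)"
      by (intro K0 j integrable_wt_dec[OF j d b]) auto
    also have "\<dots> \<le> K0 * (L * B)" unfolding L_def using K0(1) by (intro mult_left_mono integral_wt_dec[OF j d b]) auto
    also have "\<dots> \<le> K0 * ((L + 1) * B)" using K0(1) B by (intro mult_left_mono mult_right_mono) auto
    finally show ?thesis by (simp add: mult.assoc)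
  qed
  then show ?thesis using K0(1) L by (intro that[of "K0 * (L + 1)"]) auto
qed

text \<open>The separate decay of \<open>h\<close> and \<open>k\<close>, of whatever negative order,
  makes both integrals converge; the estimate involves only the bound of the difference. Used for
  truncations and for translations.\<close>

lemma hs_diff_bound:
  assumes cp: "cutpair \<psi> \<psi>'" and n: "real n > \<alpha>" and b: "\<beta> < 0"
  obtains K where "K > 0" "\<And>h k \<beta>1 B1 \<beta>2 B2 B. jet UNIV (Suc n) h \<Longrightarrow> jet UNIV (Suc n) k \<Longrightarrow>
     \<beta>1 < 0 \<Longrightarrow> dec UNIV (Suc n) \<beta>1 B1 h \<Longrightarrow> \<beta>2 < 0 \<Longrightarrow> dec UNIV (Suc n) \<beta>2 B2 k \<Longrightarrow>
     dec UNIV (Suc n) \<beta> B (\<lambda>r x. h r x - k r x) \<Longrightarrow> norm (hs n \<psi> \<psi>' 1 h - hs n \<psi> \<psi>' 1 k) \<le> K * B"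
proof -
  obtain K where K: "K > 0" "\<And>h B. jet UNIV (Suc n) h \<Longrightarrow> dec UNIV (Suc n) \<beta> B h \<Longrightarrow> norm (hs n \<psi> \<psi>' 1 h) \<le> K * B"
    using hs_dec_bound[OF cp n b] by blast
  have *: "norm (hs n \<psi> \<psi>' 1 h - hs n \<psi> \<psi>' 1 k) \<le> K * B"
    if "jet UNIV (Suc n) h" "jet UNIV (Suc n) k" "\<beta>1 < 0" "dec UNIV (Suc n) \<beta>1 B1 h" "\<beta>2 < 0" "dec UNIV (Suc n) \<beta>2 B2 k"
     "dec UNIV (Suc n) \<beta> B (\<lambda>r x. h r x - k r x)" for h k \<beta>1 B1 \<beta>2 B2 B
  proof -
    have "hs n \<psi> \<psi>' 1 h - hs n \<psi> \<psi>' 1 k = hs n \<psi> \<psi>' 1 (\<lambda>r x. h r x - k r x)"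
      by (rule hs_diff[OF cp n _ that(1) integrable_wt_dec[OF that(1,4,3)] that(2) integrable_wt_dec[OF that(2,6,5)], symmetric]) simp
    then show ?thesis using K(2)[OF jet_diff[OF that(1,2)] that(7)] by simp
  qed
  show ?thesis by (rule that[OF K(1) *])
qed

lemma hs_cutk_tendsto:
  assumes cp: "cutpair \<psi> \<psi>'" and n: "real n > \<alpha>" and cf: "cut_family N \<kappa>" and N: "Suc n \<le> N"
    and h: "jet UNIV N h" and d: "dec UNIV N \<beta> B h" and b: "\<beta> < 0"
  shows "(\<lambda>k. hs n \<psi> \<psi>' 1 (cut_family.cutk \<kappa> k h)) \<longlonglongrightarrow> hs n \<psi> \<psi>' 1 h"
proof -
  interpret cut_family N \<kappa> by (rule cf)
  obtain C where C: "C > 0" "\<And>h \<beta> B k. dec UNIV N \<beta> B h \<Longrightarrow> dec UNIV N \<beta> (C * B) (cutk k h)"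
    "\<And>h \<beta> B k. dec UNIV N \<beta> B h \<Longrightarrow> \<beta> < 0 \<Longrightarrow> dec UNIV N (\<beta> / 2) (C * B * real (Suc k) powr (\<beta> / 2)) (\<lambda>r x. h r x - cutk k h r x)"
    by (rule cutk_dec) (rule that; assumption)
  have b2: "\<beta> / 2 < 0" using b by simp
  obtain K where K: "K > 0" "\<And>h k \<beta>1 B1 \<beta>2 B2 B. jet UNIV (Suc n) h \<Longrightarrow> jet UNIV (Suc n) k \<Longrightarrow>
     \<beta>1 < 0 \<Longrightarrow> dec UNIV (Suc n) \<beta>1 B1 h \<Longrightarrow> \<beta>2 < 0 \<Longrightarrow> dec UNIV (Suc n) \<beta>2 B2 k \<Longrightarrow>
     dec UNIV (Suc n) (\<beta> / 2) B (\<lambda>r x. h r x - k r x) \<Longrightarrow> norm (hs n \<psi> \<psi>' 1 h - hs n \<psi> \<psi>' 1 k) \<le> K * B"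
    by (rule hs_diff_bound[OF cp n b2]) (rule that; assumption)
  have le: "norm (hs n \<psi> \<psi>' 1 h - hs n \<psi> \<psi>' 1 (cutk k h)) \<le> K * (C * B * real (Suc k) powr (\<beta> / 2))" for k
  proof (rule K(2)[OF _ _ b _ b])
    show "jet UNIV (Suc n) h" "jet UNIV (Suc n) (cutk k h)"
      using jet_mono[OF h N] jet_mono[OF jet_cutk[OF h] N] by auto
    show "dec UNIV (Suc n) \<beta> B h" "dec UNIV (Suc n) \<beta> (C * B) (cutk k h)"
      using dec_weaken[OF d order_refl order_refl N] dec_weaken[OF C(2)[OF d, of k] order_refl order_refl N] by auto
    show "dec UNIV (Suc n) (\<beta> / 2) (C * B * real (Suc k) powr (\<beta> / 2)) (\<lambda>r x. h r x - cutk k h r x)"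
      using dec_weaken[OF C(3)[OF d b, of k] order_refl order_refl N] by auto
  qed
  have "(\<lambda>k. K * (C * B * real (Suc k) powr (\<beta> / 2))) \<longlonglongrightarrow> K * (C * B * 0)"
    by (intro tendsto_intros Suc_powr_tendsto_0 b2)
  then have "(\<lambda>k. hs n \<psi> \<psi>' 1 h - hs n \<psi> \<psi>' 1 (cutk k h)) \<longlonglongrightarrow> 0"
    by (intro Lim_null_comparison[OF always_eventually[OF allI[OF le]]]) simp
  from tendsto_diff[OF tendsto_const[of "hs n \<psi> \<psi>' 1 h"] this] show ?thesis by simp
qed

lemma stone_tendsto_hs:
  assumes cp: "cutpair \<psi> \<psi>'" and n: "real n > \<alpha>" and s: "s \<ge> 1" and M: "M > 0"
    and h: "jet UNIV (Suc n) h" and supp: "jsupp (Suc n) M h"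
  shows "(\<lambda>k. stone M (eta k) h) \<longlonglongrightarrow> hs n \<psi> \<psi>' s h"
proof -
  obtain \<omega> K where o: "\<omega> \<longlonglongrightarrow> 0"
    "\<And>h B k. jet UNIV (Suc n) h \<Longrightarrow> jsupp (Suc n) M h \<Longrightarrow> jbnd (Suc n) B h \<Longrightarrow>
       norm (stone M (eta k) h - hs n \<psi> \<psi>' s h) \<le> \<omega> k * B"
    by (rule stone_approx[OF cp n s M]) (rule that; assumption)
  obtain B where B: "jbnd (Suc n) B h"
    using jet_bounded_of_compact_support[OF h, of M] supp unfolding jsupp_def by metis
  have "(\<lambda>k. \<omega> k * B) \<longlonglongrightarrow> 0" using o(1) by (rule tendsto_mult_left_zero)
  then have "(\<lambda>k. stone M (eta k) h - hs n \<psi> \<psi>' s h) \<longlonglongrightarrow> 0"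
    by (rule Lim_null_comparison[OF always_eventually[OF allI[OF o(2)[OF h supp B]]]])
  then show ?thesis by (simp add: LIM_zero_iff)
qed

text \<open>One and the same sequence of Stone integrals converges to both sides. The scale is free
  too, and the normalisation uses this to replace scale 1 by one adapted to the support.\<close>

lemma hs_independent_compact:
  assumes "cutpair \<psi>1 \<psi>1'" "real n1 > \<alpha>" "s1 \<ge> 1" "cutpair \<psi>2 \<psi>2'" "real n2 > \<alpha>" "s2 \<ge> 1"
    and h: "jet UNIV N h" and supp: "jsupp N M h" and N: "Suc n1 \<le> N" "Suc n2 \<le> N" and M: "M > 0"
  shows "hs n1 \<psi>1 \<psi>1' s1 h = hs n2 \<psi>2 \<psi>2' s2 h"
proof -
  have "jsupp (Suc n1) M h" "jsupp (Suc n2) M h" using supp N by (auto simp: jsupp_def)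
  then show ?thesis
    using stone_tendsto_hs[OF assms(1-3) M jet_mono[OF h N(1)]] stone_tendsto_hs[OF assms(4-6) M jet_mono[OF h N(2)]]
    by (metis LIMSEQ_unique)
qed

lemma hs_independent:
  assumes "cutpair \<psi>1 \<psi>1'" "real n1 > \<alpha>" "cutpair \<psi>2 \<psi>2'" "real n2 > \<alpha>"
    and h: "jet UNIV N h" and d: "dec UNIV N \<beta> B h" and b: "\<beta> < 0" and N: "Suc n1 \<le> N" "Suc n2 \<le> N"
  shows "hs n1 \<psi>1 \<psi>1' 1 h = hs n2 \<psi>2 \<psi>2' 1 h"
proof -
  obtain \<kappa> where cf: "cut_family N \<kappa>" using cut_family_exists by blast
  interpret cf: cut_family N \<kappa> by (rule cf)
  have "hs n1 \<psi>1 \<psi>1' 1 (cf.cutk k h) = hs n2 \<psi>2 \<psi>2' 1 (cf.cutk k h)" for k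
    by (rule hs_independent_compact[OF assms(1,2) _ assms(3,4) _ cf.jet_cutk[OF h] cf.jsupp_cutk N]) auto
  then show ?thesis
    using hs_cutk_tendsto[OF assms(1,2) cf N(1) h d b] hs_cutk_tendsto[OF assms(3,4) cf N(2) h d b]
    by (metis (no_types, lifting) LIMSEQ_unique ext)
qed

end

section \<open>Jets that vanish on the half line\<close>

context resolvent_growth
begin

text \<open>The support of \<open>h\<close> may reach 0, which may lie in the spectrum. The
  translate h(\<delta> + x) is supported in x <= -\<delta>, inside the resolvent set, so its
  integral is 0 by the Stone formula. As \<delta> tends to 0 the translates converge to
  \<open>h\<close> with all derivatives by uniform continuity.\<close>

lemma hs_zero_compact:
  assumes sp: "\<And>t. t < 0 \<Longrightarrow> complex_of_real t \<in> \<rho>"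
    and cp: "cutpair \<psi> \<psi>'" and n: "real n > \<alpha>" and h: "jet UNIV (Suc n) h" and supp: "jsupp (Suc n) M h" and M: "M > 0"
    and z: "\<And>r x. r \<le> Suc n \<Longrightarrow> x \<ge> 0 \<Longrightarrow> h r x = 0"
  shows "hs n \<psi> \<psi>' 1 h = 0"
proof -
  define sh where "sh \<delta> r x = h r (\<delta> + x)" for \<delta> r x
  have jsh: "jet UNIV (Suc n) (sh \<delta>)" for \<delta>
    using jet_affine[OF h, of 1 \<delta>] by (simp add: sh_def[abs_def])
  have ssh: "jsupp (Suc n) (M + 1) (sh \<delta>)" if "0 \<le> \<delta>" "\<delta> \<le> 1" for \<delta>
    using supp that by (auto simp: jsupp_def sh_def)
  have sh0: "hs n \<psi> \<psi>' 1 (sh \<delta>) = 0" if \<delta>: "0 < \<delta>" "\<delta> \<le> 1" for \<delta>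
  proof -
    have "(\<lambda>k. stone (M + 1) (eta k) (sh \<delta>)) \<longlonglongrightarrow> hs n \<psi> \<psi>' 1 (sh \<delta>)"
      using M \<delta> by (intro stone_tendsto_hs[OF cp n _ _ jsh ssh]) auto
    moreover have "(\<lambda>k. stone (M + 1) (eta k) (sh \<delta>)) \<longlonglongrightarrow> 0"
    proof (rule stone_tendsto_0[where K = "{- (M + 1)..- \<delta>}"])
      show "complex_of_real ` {- (M + 1)..- \<delta>} \<subseteq> \<rho>" using sp \<delta> by auto
      show "sh \<delta> 0 x = 0" if "x \<notin> {- (M + 1)..- \<delta>}" for x
        using that z[of 0 "\<delta> + x"] supp \<delta> by (auto simp: sh_def jsupp_def)
      show "continuous_on UNIV (sh \<delta> 0)" using jet_continuous[OF jsh] by simp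
    qed (use M in auto)
    ultimately show ?thesis using LIMSEQ_unique by blast
  qed
  have m1: "(-1::real) < 0" by simp
  obtain K where K: "K > 0" "\<And>h k \<beta>1 B1 \<beta>2 B2 B. jet UNIV (Suc n) h \<Longrightarrow> jet UNIV (Suc n) k \<Longrightarrow>
     \<beta>1 < 0 \<Longrightarrow> dec UNIV (Suc n) \<beta>1 B1 h \<Longrightarrow> \<beta>2 < 0 \<Longrightarrow> dec UNIV (Suc n) \<beta>2 B2 k \<Longrightarrow>
     dec UNIV (Suc n) (-1) B (\<lambda>r x. h r x - k r x) \<Longrightarrow> norm (hs n \<psi> \<psi>' 1 h - hs n \<psi> \<psi>' 1 k) \<le> K * B"
    by (rule hs_diff_bound[OF cp n m1]) (rule that; assumption)
  define L where "L = (1 + (M + 1)) ^ (Suc n + 1)"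
  have L: "L > 0" using M by (simp add: L_def)
  have db: "\<exists>B. dec UNIV (Suc n) (-1) B (sh \<delta>)" if "0 \<le> \<delta>" "\<delta> \<le> 1" for \<delta>
  proof -
    note ss = ssh[OF that]
    obtain B where "jbnd (Suc n) B (sh \<delta>)"
      using jet_bounded_of_compact_support[OF jsh[of \<delta>], of "M + 1"] ss unfolding jsupp_def by metis
    then have "dec UNIV (Suc n) (-1) (B * (1 + (M + 1)) ^ (Suc n + 1)) (sh \<delta>)" using M by (intro jsupp_jbnd_dec[OF ss]) auto
    then show ?thesis by blast
  qed
  have "norm (hs n \<psi> \<psi>' 1 h) \<le> e" if e: "e > 0" for e
  proof -
    define e' where "e' = e / (K * L)"
    have e': "e' > 0" using e K L by (simp add: e'_def)
    have "\<exists>d>0. \<forall>x \<delta>. 0 \<le> \<delta> \<and> \<delta> < d \<longrightarrow> cmod (h r x - h r (\<delta> + x)) \<le> e'" if r: "r \<le> Suc n" for r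
    proof -
      have "uniformly_continuous_on {-M-1..M+1} (h r)"
        by (intro compact_uniformly_continuous continuous_on_subset[OF jet_continuous[OF h r]]) auto
      then obtain d where d: "d > 0" "\<And>x y. x \<in> {-M-1..M+1} \<Longrightarrow> y \<in> {-M-1..M+1} \<Longrightarrow> dist y x < d \<Longrightarrow> dist (h r y) (h r x) < e'"
        unfolding uniformly_continuous_on_def using e' by metis
      show ?thesis
      proof (intro exI[of _ "min d 1"] conjI allI impI)
        fix x \<delta> assume \<delta>: "0 \<le> \<delta> \<and> \<delta> < min d 1"
        show "cmod (h r x - h r (\<delta> + x)) \<le> e'"
        proof (cases "x \<in> {-M-1..M} ")
          case True
          then have "dist (h r (\<delta> + x)) (h r x) < e'" using \<delta> by (intro d(2)) (auto simp: dist_real_def)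
          then show ?thesis by (simp add: dist_norm norm_minus_commute)
        next
          case False
          then have "h r x = 0" "h r (\<delta> + x) = 0" using supp r \<delta> M by (auto simp: jsupp_def)
          then show ?thesis using e' by simp
        qed
      qed (use d in auto)
    qed
    then obtain d where d: "\<And>r. r \<le> Suc n \<Longrightarrow> d r > 0 \<and> (\<forall>x \<delta>. 0 \<le> \<delta> \<and> \<delta> < d r \<longrightarrow> cmod (h r x - h r (\<delta> + x)) \<le> e')"
      by metis
    define \<delta> where "\<delta> = min 1 (Min (d ` {..Suc n}) / 2)"
    have mp: "Min (d ` {..Suc n}) > 0" using d by (subst Min_gr_iff) auto
    have \<delta>: "0 < \<delta>" "\<delta> \<le> 1" using mp by (auto simp: \<delta>_def)
    have "\<delta> < d r" if "r \<le> Suc n" for r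
    proof -
      have "Min (d ` {..Suc n}) \<le> d r" using that by (intro Min_le) auto
      moreover have "\<delta> \<le> Min (d ` {..Suc n}) / 2" unfolding \<delta>_def by (rule min.cobounded2)
      ultimately show ?thesis using mp by linarith
    qed
    then have bn: "jbnd (Suc n) e' (\<lambda>r x. sh 0 r x - sh \<delta> r x)"
      using d \<delta> by (auto simp: jbnd_def sh_def)
    have sn: "jsupp (Suc n) (M + 1) (\<lambda>r x. sh 0 r x - sh \<delta> r x)"
      using ssh[of 0] ssh[of \<delta>] \<delta> by (auto simp: jsupp_def)
    have d3: "dec UNIV (Suc n) (-1) (e' * L) (\<lambda>r x. sh 0 r x - sh \<delta> r x)"
      unfolding L_def using M by (intro jsupp_jbnd_dec[OF sn bn]) auto
    obtain B0 where d1: "dec UNIV (Suc n) (-1) B0 (sh 0)" using db[of 0] by auto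
    obtain B1 where d2: "dec UNIV (Suc n) (-1) B1 (sh \<delta>)" using db[of \<delta>] \<delta> by auto
    have "norm (hs n \<psi> \<psi>' 1 (sh 0) - hs n \<psi> \<psi>' 1 (sh \<delta>)) \<le> K * (e' * L)"
      by (rule K(2)[OF jsh[of 0] jsh[of \<delta>] m1 d1 m1 d2 d3])
    moreover have "sh 0 = h" by (simp add: sh_def[abs_def])
    ultimately show ?thesis using sh0[OF \<delta>] K(1) L by (simp add: e'_def)
  qed
  then have "norm (hs n \<psi> \<psi>' 1 h) \<le> 0" by (rule field_le_epsilon) simp
  then show ?thesis by simp
qed

lemma hs_zero:
  assumes sp: "\<And>t. t < 0 \<Longrightarrow> complex_of_real t \<in> \<rho>"
    and cp: "cutpair \<psi> \<psi>'" and n: "real n > \<alpha>" and h: "jet UNIV (Suc n) h" and d: "dec UNIV (Suc n) \<beta> B h" and b: "\<beta> < 0"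
    and z: "\<And>r x. r \<le> Suc n \<Longrightarrow> x \<ge> 0 \<Longrightarrow> h r x = 0"
  shows "hs n \<psi> \<psi>' 1 h = 0"
proof -
  obtain \<kappa> where cf: "cut_family (Suc n) \<kappa>" using cut_family_exists by blast
  interpret cf: cut_family "Suc n" \<kappa> by (rule cf)
  have "hs n \<psi> \<psi>' 1 (cf.cutk k h) = 0" for k
  proof (rule hs_zero_compact[OF sp cp n cf.jet_cutk[OF h] cf.jsupp_cutk])
    show "cf.cutk k h r x = 0" if "r \<le> Suc n" "x \<ge> 0" for r x
      unfolding cf.cutk_def jmul_def using z that by (intro sum.neutral) auto
  qed auto
  then have "(\<lambda>k. 0) \<longlonglongrightarrow> hs n \<psi> \<psi>' 1 h"
    using hs_cutk_tendsto[OF cp n cf order_refl h d b] by simp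
  then show ?thesis using LIMSEQ_const_iff by metis
qed

end

lemma jmul_norm_le:
  assumes "\<And>j. j \<le> N \<Longrightarrow> cmod (h j x) \<le> B" "\<And>j. j \<le> N \<Longrightarrow> cmod (k j x) \<le> C" and r: "r \<le> N"
  shows "cmod (jmul h k r x) \<le> 2 ^ N * B * C"
proof -
  have BC: "B \<ge> 0" "C \<ge> 0" using assms(1)[of 0] assms(2)[of 0] norm_ge_zero order_trans by blast+
  have "cmod (jmul h k r x) \<le> (\<Sum>j\<le>r. real (r choose j) * (B * C))"
    unfolding jmul_def
  proof (rule sum_norm_le)
    fix j assume j: "j \<in> {..r}"
    have "cmod (h j x) * cmod (k (r - j) x) \<le> B * C"
      using j r BC by (intro mult_mono assms) auto
    then show "cmod (of_nat (r choose j) * h j x * k (r - j) x) \<le> real (r choose j) * (B * C)"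
      by (simp add: norm_mult mult.assoc mult_left_mono)
  qed
  also have "\<dots> = 2 ^ r * (B * C)"
    unfolding sum_distrib_right[symmetric] using choose_row_sum[of r] by (metis of_nat_sum of_nat_numeral of_nat_power)
  also have "\<dots> \<le> 2 ^ N * (B * C)" using BC r by (intro mult_right_mono power_increasing) auto
  finally show ?thesis by (simp add: mult.assoc)
qed

lemma jbnd_jmul: "jbnd N B h \<Longrightarrow> jbnd N C k \<Longrightarrow> jbnd N (2 ^ N * B * C) (jmul h k)"
  using jmul_norm_le[of N h _ B k C] by (simp add: jbnd_def)

lemma jsupp_jmul: "jsupp N M k \<Longrightarrow> jsupp N M (jmul h k)"
  unfolding jsupp_def jmul_def by (auto intro!: sum.neutral)

lemma jmul_diff_left: "jmul (\<lambda>r x. h r x - k r x) g = (\<lambda>r x. jmul h g r x - jmul k g r x)"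
  by (simp add: jmul_def fun_eq_iff algebra_simps sum_subtractf)

lemma jmul_cmult_left: "jmul (\<lambda>r x. a * h r x) g = (\<lambda>r x. a * jmul h g r x)"
  by (simp add: jmul_def fun_eq_iff sum_distrib_left mult_ac)

lemma jmul_0: "jmul h k 0 x = h 0 x * k 0 x"
  by (simp add: jmul_def)

lemma jsupp_mono: "jsupp N M h \<Longrightarrow> M \<le> M' \<Longrightarrow> jsupp N M' h"
  by (auto simp: jsupp_def)

lemma norm_diff_diff_le: "norm (a - b - c) \<le> norm a + norm b + norm (c::'a::real_normed_vector)"
  using norm_triangle_ineq4[of a b] norm_triangle_ineq4[of "a - b" c] by linarith

lemma cmod_stone_factor: "cmod (1 / (2 * pi * \<i>)) \<le> 1"
  using pi_gt3 by (simp add: norm_divide norm_mult)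

lemma compact_jet_bounded:
  assumes "jet UNIV N h" "jsupp N M h"
  obtains B where "B > 0" "jbnd N B h"
  using jet_bounded_of_compact_support[OF assms(1), of M] assms(2) unfolding jsupp_def by metis

lemma scaleC_blinfun_compose: "(a *\<^sub>C S) o\<^sub>L T = a *\<^sub>C (S o\<^sub>L T)"
  for S T :: "'b::complex_banach \<Rightarrow>\<^sub>L 'b"
  by (rule blinfun_eqI) (simp add: blinfun_apply_scaleC)

lemma blinfun_compose_scaleC: "S \<in> bounded_ops \<Longrightarrow> S o\<^sub>L (a *\<^sub>C T) = a *\<^sub>C (S o\<^sub>L T)"
  for S T :: "'b::complex_banach \<Rightarrow>\<^sub>L 'b"
  by (rule blinfun_eqI) (simp add: blinfun_apply_scaleC bounded_ops_def)

lemmas blinfun_compose_diff_right = bounded_bilinear.diff_right[OF bounded_bilinear_blinfun_compose]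
lemmas blinfun_compose_diff_left = bounded_bilinear.diff_left[OF bounded_bilinear_blinfun_compose]

lemma integral_scaleC_right:
  fixes T :: "'c::complex_banach"
  assumes "f integrable_on S"
  shows "integral S (\<lambda>x. f x *\<^sub>C T) = integral S f *\<^sub>C T"
  using integral_linear[OF assms bounded_bilinear.bounded_linear_left[OF bounded_bilinear_scaleC, of T]] by (simp add: o_def)

context hol_off_real
begin

lemma hs_jbnd_bound:
  assumes cp: "cutpair \<psi> \<psi>'" and n: "real n > \<alpha>" and M: "M > 0"
  obtains K where "K > 0" "\<And>h B. jet UNIV (Suc n) h \<Longrightarrow> jsupp (Suc n) M h \<Longrightarrow> jbnd (Suc n) B h \<Longrightarrow> norm (hs n \<psi> \<psi>' 1 h) \<le> K * B"
proof -
  have m1: "(-1::real) < 0" by simp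
  obtain K0 where K0: "K0 > 0" "\<And>h B. jet UNIV (Suc n) h \<Longrightarrow> dec UNIV (Suc n) (-1) B h \<Longrightarrow> norm (hs n \<psi> \<psi>' 1 h) \<le> K0 * B"
    by (rule hs_dec_bound[OF cp n m1]) (rule that; assumption)
  define L where "L = (1 + M) ^ (Suc n + 1)"
  have L: "L > 0" using M by (simp add: L_def)
  have *: "norm (hs n \<psi> \<psi>' 1 h) \<le> (K0 * L) * B" if "jet UNIV (Suc n) h" "jsupp (Suc n) M h" "jbnd (Suc n) B h" for h B
    using K0(2)[OF that(1) jsupp_jbnd_dec[OF that(2,3) M]] by (simp add: L_def mult_ac)
  have "K0 * L > 0" using K0(1) L by simp
  then show ?thesis by (rule that[OF _ *])
qed

lemma integrable_trace: "continuous_on UNIV f \<Longrightarrow> \<zeta> \<noteq> 0 \<Longrightarrow> (\<lambda>x. f x *\<^sub>C R (Complex x \<zeta>)) integrable_on {-M..M}"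
proof -
  assume f: "continuous_on UNIV f" and z: "\<zeta> \<noteq> 0"
  have "continuous_on {-M..M} f" by (rule continuous_on_subset[OF f]) simp
  moreover have "continuous_on {-M..M} (\<lambda>x. R (Complex x \<zeta>))" using z by (intro continuous_R_comp continuous_intros) simp
  ultimately show ?thesis by (intro integrable_continuous_interval continuous_on_scaleC)
qed

lemma trace_diff:
  assumes "continuous_on UNIV (h 0)" "continuous_on UNIV (k 0)" "\<zeta> \<noteq> 0"
  shows "trace M \<zeta> (\<lambda>r x. h r x - k r x) = trace M \<zeta> h - trace M \<zeta> k"
  unfolding trace_def scaleC_diff_left using integrable_trace[OF assms(1,3)] integrable_trace[OF assms(2,3)]
  by (rule integral_diff)

end

section \<open>Composition with a single resolvent\<close>

context resolvent_growth
begin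

lemma resolvent_compose:
  assumes "w \<in> \<rho>" "z \<in> \<rho>" "w \<noteq> z"
  shows "Res w o\<^sub>L Res z = (1 / (w - z)) *\<^sub>C (Res z - Res w)"
proof -
  have "Res w - Res z = (z - w) *\<^sub>C (Res w o\<^sub>L Res z)" by (rule resolvent_identity[OF assms(1,2)])
  then have "(1 / (w - z)) *\<^sub>C (Res z - Res w) = (1 / (w - z)) *\<^sub>C (- ((z - w) *\<^sub>C (Res w o\<^sub>L Res z)))"
    by (metis minus_diff_eq)
  also have "\<dots> = ((1 / (w - z)) * (w - z)) *\<^sub>C (Res w o\<^sub>L Res z)"
    by (simp add: scaleC_minus_left[symmetric] scaleC_scaleC)
  also have "\<dots> = Res w o\<^sub>L Res z" using assms(3) by simp
  finally show ?thesis ..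
qed

text \<open>Under the integral R(w) R(x + i\<zeta>) = (R(x + i\<zeta>) - R(w)) / (w - x - i\<zeta>),
  and the scalar factor is \<open>gj\<close> at w - i\<zeta>. The multiple of R(w) is split off; in
  a Stone integral the two such multiples nearly cancel.\<close>

lemma resolvent_compose_trace:
  assumes w: "Im w \<noteq> 0" and z: "\<zeta> \<noteq> 0" "Im w \<noteq> \<zeta>" and G: "continuous_on UNIV (G 0)"
  shows "Res w o\<^sub>L trace M \<zeta> G = trace M \<zeta> (jmul (gj (w - \<i> * of_real \<zeta>)) G)
     - integral {-M..M} (\<lambda>x. gj (w - \<i> * of_real \<zeta>) 0 x * G 0 x) *\<^sub>C Res w"
proof -
  define u where "u = w - \<i> * of_real \<zeta>"
  have u: "Im u \<noteq> 0" using z by (simp add: u_def)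
  have gc: "continuous_on UNIV (\<lambda>x. gj u 0 x * G 0 x)"
    by (intro continuous_intros G jet_continuous[OF jet_gj[OF u, of 0]]) simp
  have gi: "(\<lambda>x. gj u 0 x * G 0 x) integrable_on {-M..M}"
    by (rule integrable_continuous_interval[OF continuous_on_subset[OF gc]]) simp
  have "Res w o\<^sub>L trace M \<zeta> G = integral {-M..M} ((\<lambda>T. Res w o\<^sub>L T) o (\<lambda>x. G 0 x *\<^sub>C Res (Complex x \<zeta>)))"
    unfolding trace_def
    by (rule integral_linear[symmetric, OF integrable_trace[OF G z(1)] bounded_bilinear.bounded_linear_right[OF bounded_bilinear_blinfun_compose]])
  also have "\<dots> = integral {-M..M} (\<lambda>x. (gj u 0 x * G 0 x) *\<^sub>C Res (Complex x \<zeta>) - (gj u 0 x * G 0 x) *\<^sub>C Res w)"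
  proof (rule integral_cong)
    fix x
    have ne: "w \<noteq> Complex x \<zeta>" using z(2) by (auto simp: complex_eq_iff)
    have e: "w - Complex x \<zeta> = u - of_real x" by (simp add: u_def complex_eq_iff)
    have "Res w o\<^sub>L (G 0 x *\<^sub>C Res (Complex x \<zeta>)) = G 0 x *\<^sub>C (Res w o\<^sub>L Res (Complex x \<zeta>))"
      by (rule blinfun_compose_scaleC[OF resolvent_bounded_op[OF Im_off_real[OF w]]])
    also have "Res w o\<^sub>L Res (Complex x \<zeta>) = (1 / (w - Complex x \<zeta>)) *\<^sub>C (Res (Complex x \<zeta>) - Res w)"
      using w z ne by (intro resolvent_compose Im_off_real) simp_all
    finally show "((\<lambda>T. Res w o\<^sub>L T) o (\<lambda>x. G 0 x *\<^sub>C Res (Complex x \<zeta>))) x = (gj u 0 x * G 0 x) *\<^sub>C Res (Complex x \<zeta>) - (gj u 0 x * G 0 x) *\<^sub>C Res w"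
      unfolding e by (simp add: gj_0 scaleC_scaleC scaleC_diff_right)
  qed
  also have "\<dots> = integral {-M..M} (\<lambda>x. (gj u 0 x * G 0 x) *\<^sub>C Res (Complex x \<zeta>)) - integral {-M..M} (\<lambda>x. (gj u 0 x * G 0 x) *\<^sub>C Res w)"
    by (intro integral_diff integrable_trace[OF gc z(1)] integrable_continuous_interval continuous_intros continuous_on_subset[OF gc]) simp
  finally show ?thesis
    unfolding integral_scaleC_right[OF gi] by (simp add: trace_def jmul_0 u_def)
qed

text \<open>In the formula for the traces the function g is taken at the shifted points up and um,
  not at w, and multiples of R(w) are left over. By the Lipschitz bound for \<open>gj\<close> and
  the uniform trace bound both discrepancies are O(\<epsilon>), although the traces themselves need
  not converge.\<close>

lemma resolvent_compose_hs:
  assumes cp: "cutpair \<psi> \<psi>'" and n: "real n > \<alpha>" and M: "M > 0" and w: "Im w \<noteq> 0"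
    and G: "jet UNIV (Suc n) G" and supp: "jsupp (Suc n) M G"
  shows "Res w o\<^sub>L hs n \<psi> \<psi>' 1 G = hs n \<psi> \<psi>' 1 (jmul (gj w) G)"
proof -
  \<comment> \<open>For shifts up to \<open>b\<close> the points w, \<open>up\<close> and
    \<open>um\<close> all keep distance at least \<open>b\<close> from the axis, so one Lipschitz
    constant serves.\<close>
  define b where "b = \<bar>Im w\<bar> / 2"
  have b: "b > 0" using w by (simp add: b_def)
  obtain BG where BG: "BG > 0" "jbnd (Suc n) BG G" using compact_jet_bounded[OF G supp] by metis
  have one: "(1::real) \<le> 1" by simp
  obtain \<omega> K where K: "\<omega> \<longlonglongrightarrow> 0" "K > 0"
    "\<And>h B k. jet UNIV (Suc n) h \<Longrightarrow> jsupp (Suc n) M h \<Longrightarrow> jbnd (Suc n) B h \<Longrightarrow>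
       norm (stone M (eta k) h - hs n \<psi> \<psi>' 1 h) \<le> \<omega> k * B"
    "\<And>h B k. jet UNIV (Suc n) h \<Longrightarrow> jsupp (Suc n) M h \<Longrightarrow> jbnd (Suc n) B h \<Longrightarrow>
       norm (trace M (eta k) h) \<le> K * B \<and> norm (trace M (- eta k) h) \<le> K * B"
    by (rule stone_approx[OF cp n one M]) (rule that; assumption)
  define gw where "gw = jmul (gj w) G"
  have jgw: "jet UNIV (Suc n) gw" unfolding gw_def by (intro jet_mult jet_gj w G)
  have sgw: "jsupp (Suc n) M gw" unfolding gw_def by (rule jsupp_jmul[OF supp])
  have cG: "continuous_on UNIV (G 0)" using jet_continuous[OF G, of 0] by simp
  define L where "L = (\<Sum>r\<le>Suc n. fact (Suc r) / b ^ Suc (Suc r))"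
  have L0: "L \<ge> 0" unfolding L_def using b by (intro sum_nonneg) simp
  have lip: "jbnd (Suc n) (L * cmod (u - v)) (\<lambda>r x. gj u r x - gj v r x)" if "\<bar>Im u\<bar> \<ge> b" "\<bar>Im v\<bar> \<ge> b" for u v
    unfolding jbnd_def
  proof (intro allI impI)
    fix r x assume "r \<le> Suc n"
    then have "fact (Suc r) / b ^ Suc (Suc r) \<le> L" unfolding L_def using b by (intro member_le_sum) auto
    then have "fact (Suc r) / b ^ Suc (Suc r) * cmod (u - v) \<le> L * cmod (u - v)" by (intro mult_right_mono) auto
    then show "cmod (gj u r x - gj v r x) \<le> L * cmod (u - v)" using gj_lipschitz[OF that b, of r x] by linarith
  qed
  \<comment> \<open>Two traces, each of a jet of size O(\<epsilon>), and the difference of the two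
    scalar integrals in front of R(w): there the points differ by 2\<epsilon> and the interval has
    length 2M.\<close>
  define E where "E = 2 * (K * (2 ^ Suc n * L * BG)) + 2 * M * (2 * L * BG) * norm (Res w)"
  have est: "norm ((Res w o\<^sub>L stone M (eta k) G) - stone M (eta k) gw) \<le> E * eta k" if k: "eta k \<le> b" for k
  proof -
    define e where "e = eta k"
    have e: "e > 0" "e \<le> b" unfolding e_def using eta_pos k by auto
    define up where "up = w - \<i> * of_real (- e)"
    define um where "um = w - \<i> * of_real e"
    have I: "\<bar>Im up\<bar> \<ge> b" "\<bar>Im um\<bar> \<ge> b" "\<bar>Im w\<bar> \<ge> b"
    proof -
      have "Im up = Im w + e" "Im um = Im w - e" by (simp_all add: up_def um_def)
      then show "\<bar>Im up\<bar> \<ge> b" "\<bar>Im um\<bar> \<ge> b" "\<bar>Im w\<bar> \<ge> b" using e unfolding b_def by linarith+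
    qed
    have nz: "Im w \<noteq> e" "Im w \<noteq> - e" "Im up \<noteq> 0" "Im um \<noteq> 0" using e b I by (auto simp: b_def)
    have jup: "jet UNIV (Suc n) (jmul (gj up) G)" "jet UNIV (Suc n) (jmul (gj um) G)"
      by (intro jet_mult jet_gj nz G)+
    have c0: "continuous_on UNIV (jmul (gj up) G 0)" "continuous_on UNIV (jmul (gj um) G 0)" "continuous_on UNIV (gw 0)"
      using jet_continuous[OF jup(1), of 0] jet_continuous[OF jup(2), of 0] jet_continuous[OF jgw, of 0] by simp_all
    define cp' cm where "cp' = integral {-M..M} (\<lambda>x. gj up 0 x * G 0 x)" and "cm = integral {-M..M} (\<lambda>x. gj um 0 x * G 0 x)"
    have t1: "Res w o\<^sub>L trace M (- e) G = trace M (- e) (jmul (gj up) G) - cp' *\<^sub>C Res w"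
      unfolding up_def cp'_def using e nz w by (intro resolvent_compose_trace cG) simp_all
    have t2: "Res w o\<^sub>L trace M e G = trace M e (jmul (gj um) G) - cm *\<^sub>C Res w"
      unfolding um_def cm_def using e nz w by (intro resolvent_compose_trace cG) simp_all
    let ?dp = "jmul (\<lambda>r x. gj up r x - gj w r x) G"
    let ?dm = "jmul (\<lambda>r x. gj um r x - gj w r x) G"
    have d1: "trace M (- e) ?dp = trace M (- e) (jmul (gj up) G) - trace M (- e) gw"
      unfolding jmul_diff_left gw_def[symmetric] using e by (intro trace_diff c0) simp
    have d2: "trace M e ?dm = trace M e (jmul (gj um) G) - trace M e gw"
      unfolding jmul_diff_left gw_def[symmetric] using e by (intro trace_diff c0) simp
    have nuw: "cmod (up - w) = e" "cmod (um - w) = e" using e by (simp_all add: up_def um_def norm_mult)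
    have jd: "jet UNIV (Suc n) ?dp" "jet UNIV (Suc n) ?dm"
      by (intro jet_mult jet_diff jet_gj nz w G)+
    have b1: "norm (trace M (- e) ?dp) \<le> K * (2 ^ Suc n * (L * e) * BG)"
      using K(4)[OF jd(1) jsupp_jmul[OF supp] jbnd_jmul[OF lip[OF I(1,3)] BG(2)], of k] unfolding nuw e_def by blast
    have b2: "norm (trace M e ?dm) \<le> K * (2 ^ Suc n * (L * e) * BG)"
      using K(4)[OF jd(2) jsupp_jmul[OF supp] jbnd_jmul[OF lip[OF I(2,3)] BG(2)], of k] unfolding nuw e_def by blast
    have b3: "cmod (cp' - cm) \<le> (L * (2 * e) * BG) * (M - (- M))"
    proof -
      have gi: "(\<lambda>x. gj u 0 x * G 0 x) integrable_on {-M..M}" if "Im u \<noteq> 0" for u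
        by (intro integrable_continuous_interval continuous_intros continuous_on_subset[OF cG] continuous_on_subset[OF jet_continuous[OF jet_gj[OF that, of 0]]]) simp_all
      have "cp' - cm = integral {-M..M} (\<lambda>x. gj up 0 x * G 0 x - gj um 0 x * G 0 x)"
        unfolding cp'_def cm_def using gi[OF nz(3)] gi[OF nz(4)] by (rule integral_diff[symmetric])
      also have "cmod \<dots> \<le> (L * (2 * e) * BG) * (M - (- M))"
      proof (rule integral_bound)
        show "-M \<le> M" using M by simp
        show "continuous_on {-M..M} (\<lambda>x. gj up 0 x * G 0 x - gj um 0 x * G 0 x)"
          by (intro continuous_intros continuous_on_subset[OF cG] continuous_on_subset[OF jet_continuous[OF jet_gj[OF nz(3), of 0]]]
              continuous_on_subset[OF jet_continuous[OF jet_gj[OF nz(4), of 0]]]) simp_all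
        fix x assume "x \<in> {-M..M}"
        have "up - um = 2 * \<i> * of_real e" by (simp add: up_def um_def)
        then have "cmod (up - um) = 2 * e" using e by (simp add: norm_mult)
        then have 1: "cmod (gj up 0 x - gj um 0 x) \<le> L * (2 * e)" using lip[OF I(1,2)] by (simp add: jbnd_def)
        have 2: "cmod (G 0 x) \<le> BG" using BG(2) by (simp add: jbnd_def)
        have "cmod ((gj up 0 x - gj um 0 x) * G 0 x) \<le> (L * (2 * e)) * BG"
          unfolding norm_mult using L0 e by (intro mult_mono 1 2) simp_all
        then show "cmod (gj up 0 x * G 0 x - gj um 0 x * G 0 x) \<le> L * (2 * e) * BG" by (simp add: algebra_simps)
      qed
      finally show ?thesis .
    qed
    have eq: "(Res w o\<^sub>L stone M e G) - stone M e gw = (1 / (2 * pi * \<i>)) *\<^sub>C (trace M (- e) ?dp - trace M e ?dm - (cp' - cm) *\<^sub>C Res w)"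
      unfolding stone_def blinfun_compose_scaleC[OF resolvent_bounded_op[OF Im_off_real[OF w]]] blinfun_compose_diff_right t1 t2 d1 d2
        scaleC_diff_right[symmetric] scaleC_diff_left by (simp add: algebra_simps)
    have "norm ((Res w o\<^sub>L stone M e G) - stone M e gw) \<le> 1 * norm (trace M (- e) ?dp - trace M e ?dm - (cp' - cm) *\<^sub>C Res w)"
      unfolding eq norm_scaleC by (rule mult_right_mono[OF cmod_stone_factor norm_ge_zero])
    also have "\<dots> \<le> norm (trace M (- e) ?dp) + norm (trace M e ?dm) + norm ((cp' - cm) *\<^sub>C Res w)"
      unfolding mult_1 by (rule norm_diff_diff_le)
    also have "\<dots> \<le> K * (2 ^ Suc n * (L * e) * BG) + K * (2 ^ Suc n * (L * e) * BG) + ((L * (2 * e) * BG) * (M - (- M))) * norm (Res w)"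
      unfolding norm_scaleC by (intro add_mono b1 b2 mult_right_mono b3 norm_ge_zero)
    also have "\<dots> = E * e" by (simp add: E_def algebra_simps)
    finally show ?thesis by (simp add: e_def)
  qed
  have "eventually (\<lambda>k. eta k < b) sequentially" using order_tendstoD(2)[OF eta_tendsto b] .
  then have ev: "eventually (\<lambda>k. norm ((Res w o\<^sub>L stone M (eta k) G) - stone M (eta k) gw) \<le> E * eta k) sequentially"
    by eventually_elim (rule est, simp)
  have "(\<lambda>k. E * eta k) \<longlonglongrightarrow> 0" by (rule tendsto_mult_right_zero[OF eta_tendsto])
  then have z: "(\<lambda>k. (Res w o\<^sub>L stone M (eta k) G) - stone M (eta k) gw) \<longlonglongrightarrow> 0" by (rule Lim_null_comparison[OF ev])
  have l1: "(\<lambda>k. Res w o\<^sub>L stone M (eta k) G) \<longlonglongrightarrow> (Res w o\<^sub>L hs n \<psi> \<psi>' 1 G)"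
    by (intro bounded_bilinear.tendsto[OF bounded_bilinear_blinfun_compose] tendsto_const stone_tendsto_hs[OF cp n one M G supp])
  have l2: "(\<lambda>k. stone M (eta k) gw) \<longlonglongrightarrow> hs n \<psi> \<psi>' 1 gw" by (rule stone_tendsto_hs[OF cp n one M jgw sgw])
  have "(Res w o\<^sub>L hs n \<psi> \<psi>' 1 G) - hs n \<psi> \<psi>' 1 gw = 0"
    using LIMSEQ_unique[OF tendsto_diff[OF l1 l2] z] .
  then show ?thesis by (simp add: gw_def)
qed

end

section \<open>Multiplicativity\<close>

lemma continuous_gj_pair:
  assumes "y \<noteq> 0" "continuous_on A f" "continuous_on A g"
  shows "continuous_on A (\<lambda>p. gj (Complex (f p) y) r (g p))"
proof -
  have "Complex (f p) y - of_real (g p) \<noteq> 0" for p using assms(1) by (simp add: complex_eq_iff)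
  moreover have "continuous_on A (\<lambda>p. Complex (f p) y)" unfolding Complex_eq using assms by (intro continuous_intros)
  ultimately show ?thesis unfolding gj_def using assms by (intro continuous_intros) auto
qed

lemma continuous_pj_pair:
  assumes "\<epsilon> > 0" "continuous_on A f" "continuous_on A g"
  shows "continuous_on A (\<lambda>p. pj \<epsilon> (f p) r (g p))"
  unfolding pj_def using assms by (intro continuous_intros continuous_gj_pair) auto

lemma pj_dx: "\<epsilon> > 0 \<Longrightarrow> (pj \<epsilon> s r has_vector_derivative pj \<epsilon> s (Suc r) x) (at x)"
  unfolding pj_def[abs_def] by (intro has_vector_derivative_mult_right has_vector_derivative_diff gj_derivative) auto

lemma jet_pj: "\<epsilon> > 0 \<Longrightarrow> jet UNIV N (pj \<epsilon> s)"
  unfolding jet_def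
  by (auto intro: pj_dx has_vector_derivative_continuous simp: continuous_on_eq_continuous_within)

lemma pj_ds:
  assumes "\<epsilon> > 0" shows "((\<lambda>s. pj \<epsilon> s r x) has_vector_derivative - pj \<epsilon> s (Suc r) x) (at s)"
proof -
  have "((\<lambda>s. 1 / (2 * pi * \<i>) * (gj (Complex s (- \<epsilon>)) r x - gj (Complex s \<epsilon>) r x)) has_vector_derivative
     1 / (2 * pi * \<i>) * (- gj (Complex s (- \<epsilon>)) (Suc r) x - - gj (Complex s \<epsilon>) (Suc r) x)) (at s)"
    using assms by (intro has_vector_derivative_mult_right has_vector_derivative_diff gj_shift_derivative) auto
  then show ?thesis unfolding pj_def by (simp add: algebra_simps)
qed

text \<open>The Poisson mean of f restricted to [-M, M], as a jet in x. All derivatives fall on the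
  kernel, so a continuous f yields a jet of every order.\<close>

definition pconv :: "real \<Rightarrow> real \<Rightarrow> (real \<Rightarrow> complex) \<Rightarrow> nat \<Rightarrow> real \<Rightarrow> complex" where
  "pconv M \<epsilon> f r x = integral {-M..M} (\<lambda>s. f s * pj \<epsilon> s r x)"

lemma jet_pconv:
  assumes e: "\<epsilon> > 0" and f: "continuous_on UNIV f"
  shows "jet UNIV N (pconv M \<epsilon> f)"
proof -
  have c: "continuous_on A (\<lambda>p. f (snd p) * pj \<epsilon> (snd p) r (fst p))" for A :: "(real \<times> real) set" and r
    by (intro continuous_intros continuous_pj_pair e continuous_on_compose2[OF f]) auto
  have d: "(pconv M \<epsilon> f r has_vector_derivative pconv M \<epsilon> f (Suc r) x) (at x)" for r x
  proof -
    have "((\<lambda>x. integral (cbox (-M) M) (\<lambda>s. f s * pj \<epsilon> s r x)) has_vector_derivative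
       integral (cbox (-M) M) (\<lambda>s. f s * pj \<epsilon> s (Suc r) x)) (at x within UNIV)"
    proof (rule leibniz_rule_vector_derivative)
      show "((\<lambda>x. f s * pj \<epsilon> s r x) has_vector_derivative f s * pj \<epsilon> s (Suc r) x) (at x within UNIV)" for x s
        using has_vector_derivative_mult_right[OF pj_dx[OF e]] by simp
      show "(\<lambda>s. f s * pj \<epsilon> s r x) integrable_on cbox (-M) M" for x
        by (intro integrable_continuous continuous_intros continuous_pj_pair e continuous_on_subset[OF f]) auto
      show "continuous_on (UNIV \<times> cbox (-M) M) (\<lambda>(x, s). f s * pj \<epsilon> s (Suc r) x)"
        using c[of "UNIV \<times> cbox (-M) M" "Suc r"] by (simp add: case_prod_unfold)
    qed auto
    then show ?thesis by (simp add: pconv_def[abs_def])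
  qed
  then show ?thesis unfolding jet_def
    by (auto intro: has_vector_derivative_continuous simp: continuous_on_eq_continuous_within)
qed

text \<open>The kernel depends only on s - x, so its x-derivative is minus its s-derivative, and the
  boundary terms vanish with \<open>F\<close>. Moving derivatives to \<open>F\<close> turns the r-th
  derivative of the mean into the mean of the r-th derivative.\<close>

lemma pconv_by_parts:
  assumes e: "\<epsilon> > 0" and F: "jet UNIV N F" and supp: "jsupp N M F" and M: "M > 0"
  shows "r + k \<le> N \<Longrightarrow> integral {-M..M} (\<lambda>s. F r s * pj \<epsilon> s k x) = integral {-M..M} (\<lambda>s. F (r + k) s * pj \<epsilon> s 0 x)"
proof (induction k arbitrary: r)
  case (Suc k)
  have c: "(\<lambda>s. F j s * pj \<epsilon> s i x) integrable_on {-M..M}" if "j \<le> N" for i j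
    by (intro integrable_continuous_interval continuous_intros continuous_pj_pair e continuous_on_subset[OF jet_continuous[OF F that]]) auto
  have "((\<lambda>s. F r s * - pj \<epsilon> s (Suc k) x + F (Suc r) s * pj \<epsilon> s k x) has_integral (F r M * pj \<epsilon> M k x - F r (-M) * pj \<epsilon> (-M) k x)) {-M..M}"
  proof (rule fundamental_theorem_of_calculus)
    show "-M \<le> M" using M by simp
    fix s assume "s \<in> {-M..M}"
    have "(F r has_vector_derivative F (Suc r) s) (at s)" by (rule jetD_UNIV[OF F]) (use Suc.prems in simp)
    from has_vector_derivative_mult[OF this pj_ds[OF e]]
    show "((\<lambda>s. F r s * pj \<epsilon> s k x) has_vector_derivative F r s * - pj \<epsilon> s (Suc k) x + F (Suc r) s * pj \<epsilon> s k x) (at s within {-M..M})"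
      by (rule has_vector_derivative_at_within)
  qed
  moreover have "F r M = 0" "F r (-M) = 0" using supp Suc.prems M by (auto simp: jsupp_def)
  ultimately have "integral {-M..M} (\<lambda>s. F r s * - pj \<epsilon> s (Suc k) x + F (Suc r) s * pj \<epsilon> s k x) = 0"
    by (simp add: integral_unique)
  moreover have "integral {-M..M} (\<lambda>s. F (Suc r) s * pj \<epsilon> s k x - F r s * pj \<epsilon> s (Suc k) x)
     = integral {-M..M} (\<lambda>s. F (Suc r) s * pj \<epsilon> s k x) - integral {-M..M} (\<lambda>s. F r s * pj \<epsilon> s (Suc k) x)"
    using c[of r "Suc k"] c[of "Suc r" k] Suc.prems by (intro integral_diff) auto
  ultimately have "integral {-M..M} (\<lambda>s. F r s * pj \<epsilon> s (Suc k) x) = integral {-M..M} (\<lambda>s. F (Suc r) s * pj \<epsilon> s k x)"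
    by (simp add: algebra_simps)
  also have "\<dots> = integral {-M..M} (\<lambda>s. F (Suc r + k) s * pj \<epsilon> s 0 x)" using Suc.prems by (intro Suc.IH) simp
  finally show ?case by simp
qed simp

lemma pconv_eq:
  assumes "\<epsilon> > 0" "jet UNIV N F" "jsupp N M F" "M > 0" "r \<le> N"
  shows "pconv M \<epsilon> (F 0) r x = integral {-M..M} (\<lambda>s. F r s * of_real (poisson \<epsilon> (s - x)))"
  using pconv_by_parts[OF assms(1-4), of 0 r x] assms(1,5) by (simp add: pconv_def pj_0)

text \<open>By the previous identity this is \<open>poisson_approx\<close> for each derivative of
  \<open>F\<close> separately; the means run over [-(M+1), M+1] to leave the margin required
  there.\<close>

lemma pconv_tendsto:
  assumes F: "jet UNIV N F" and supp: "jsupp N M F" and M: "M > 0" and e: "e > 0"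
  shows "eventually (\<lambda>k. \<forall>r\<in>{..N}. \<forall>x. \<bar>x\<bar> \<le> M \<longrightarrow> cmod (pconv (M + 1) (eta k) (F 0) r x - F r x) \<le> e) sequentially"
proof -
  obtain B where B: "jbnd N B F" using compact_jet_bounded[OF F supp] by metis
  have supp': "jsupp N (M + 1) F" using jsupp_mono[OF supp] by simp
  show ?thesis
  proof (rule eventually_ball_finite)
    show "\<forall>r\<in>{..N}. \<forall>\<^sub>F k in sequentially. \<forall>x. \<bar>x\<bar> \<le> M \<longrightarrow> cmod (pconv (M + 1) (eta k) (F 0) r x - F r x) \<le> e"
    proof
      fix r assume r: "r \<in> {..N}"
      have eq: "pconv (M + 1) (eta k) (F 0) r x = integral {-(M+1)..M+1} (\<lambda>s. F r s * of_real (poisson (eta k) (s - x)))" for k x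
        using M r by (intro pconv_eq[OF eta_pos F supp']) auto
      show "\<forall>\<^sub>F k in sequentially. \<forall>x. \<bar>x\<bar> \<le> M \<longrightarrow> cmod (pconv (M + 1) (eta k) (F 0) r x - F r x) \<le> e"
        unfolding eq
      proof (rule poisson_approx[OF M _ _ e])
        show "continuous_on {-(M+1)..M+1} (F r)" using r by (intro continuous_on_subset[OF jet_continuous[OF F]]) auto
        show "cmod (F r x) \<le> B" for x using B r by (simp add: jbnd_def)
      qed
    qed
  qed simp
qed

section \<open>Composition with a Stone integral\<close>

context resolvent_growth
begin

lemma trace_pconv:
  assumes e: "\<epsilon> > 0" and z: "\<zeta> \<noteq> 0" and F: "continuous_on UNIV f" and G: "continuous_on UNIV (G 0)"
  shows "integral {-M..M} (\<lambda>s. f s *\<^sub>C trace M \<zeta> (jmul (pj \<epsilon> s) G)) = trace M \<zeta> (jmul (pconv M \<epsilon> f) G)"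
    and "(\<lambda>s. f s *\<^sub>C trace M \<zeta> (jmul (pj \<epsilon> s) G)) integrable_on {-M..M}"
proof -
  let ?H = "\<lambda>s x. (f s * pj \<epsilon> s 0 x * G 0 x) *\<^sub>C Res (Complex x \<zeta>)"
  have c2: "continuous_on A (\<lambda>p. ?H (fst p) (snd p))" for A :: "(real \<times> real) set"
    using z by (intro continuous_intros continuous_pj_pair e continuous_R_comp continuous_on_compose2[OF F] continuous_on_compose2[OF G]) auto
  have cx: "continuous_on A (\<lambda>x. (pj \<epsilon> s 0 x * G 0 x) *\<^sub>C Res (Complex x \<zeta>))" for A s
    using z by (intro continuous_intros continuous_pj_pair e continuous_R_comp continuous_on_subset[OF G]) auto
  have l: "f s *\<^sub>C trace M \<zeta> (jmul (pj \<epsilon> s) G) = integral (cbox (-M) M) (?H s)" for s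
  proof -
    have "f s *\<^sub>C trace M \<zeta> (jmul (pj \<epsilon> s) G) = integral {-M..M} (\<lambda>x. f s *\<^sub>C ((pj \<epsilon> s 0 x * G 0 x) *\<^sub>C Res (Complex x \<zeta>)))"
      unfolding trace_def jmul_0 by (intro integral_scaleC[symmetric] integrable_continuous_interval cx)
    then show ?thesis by (simp add: scaleC_scaleC mult.assoc)
  qed
  have "continuous_on (cbox (-M) M) (\<lambda>s. integral (cbox (-M) M) (?H s))"
    by (rule integral_continuous_on_param) (use c2 in \<open>simp add: case_prod_unfold\<close>)
  then show "(\<lambda>s. f s *\<^sub>C trace M \<zeta> (jmul (pj \<epsilon> s) G)) integrable_on {-M..M}"
    unfolding l using integrable_continuous by fastforce
  have "integral {-M..M} (\<lambda>s. f s *\<^sub>C trace M \<zeta> (jmul (pj \<epsilon> s) G)) = integral (cbox (-M) M) (\<lambda>s. integral (cbox (-M) M) (?H s))"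
    unfolding l by simp
  also have "\<dots> = integral (cbox (-M) M) (\<lambda>x. integral (cbox (-M) M) (\<lambda>s. ?H s x))"
    by (rule integral_swap_continuous) (use c2 in \<open>simp add: case_prod_unfold\<close>)
  also have "\<dots> = trace M \<zeta> (jmul (pconv M \<epsilon> f) G)"
    unfolding trace_def cbox_interval
  proof (rule integral_cong)
    fix x
    have i: "(\<lambda>s. f s * pj \<epsilon> s 0 x) integrable_on {-M..M}"
      by (intro integrable_continuous_interval continuous_intros continuous_pj_pair e continuous_on_subset[OF F]) auto
    then have i': "(\<lambda>s. f s * pj \<epsilon> s 0 x * G 0 x) integrable_on {-M..M}" by (rule integrable_on_mult_left)
    have "integral {-M..M} (\<lambda>s. ?H s x) = integral {-M..M} (\<lambda>s. f s * pj \<epsilon> s 0 x * G 0 x) *\<^sub>C Res (Complex x \<zeta>)"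
      by (rule integral_scaleC_right[OF i'])
    then show "integral {-M..M} (\<lambda>s. ?H s x) = jmul (pconv M \<epsilon> f) G 0 x *\<^sub>C Res (Complex x \<zeta>)"
      by (simp add: jmul_0 pconv_def)
  qed
  finally show "integral {-M..M} (\<lambda>s. f s *\<^sub>C trace M \<zeta> (jmul (pj \<epsilon> s) G)) = trace M \<zeta> (jmul (pconv M \<epsilon> f) G)" .
qed

lemma stone_pconv:
  assumes e: "\<epsilon> > 0" and z: "\<delta> > 0" and F: "continuous_on UNIV f" and G: "continuous_on UNIV (G 0)"
  shows "integral {-M..M} (\<lambda>s. f s *\<^sub>C stone M \<delta> (jmul (pj \<epsilon> s) G)) = stone M \<delta> (jmul (pconv M \<epsilon> f) G)"
    and "(\<lambda>s. f s *\<^sub>C stone M \<delta> (jmul (pj \<epsilon> s) G)) integrable_on {-M..M}"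
proof -
  have n: "- \<delta> \<noteq> 0" "\<delta> \<noteq> 0" using z by auto
  note A = trace_pconv[where G = G and M = M, OF e n(1) F G] and B = trace_pconv[where G = G and M = M, OF e n(2) F G]
  let ?c = "1 / (2 * pi * \<i>)"
  have eq: "f s *\<^sub>C stone M \<delta> (jmul (pj \<epsilon> s) G) = ?c *\<^sub>C (f s *\<^sub>C trace M (- \<delta>) (jmul (pj \<epsilon> s) G) - f s *\<^sub>C trace M \<delta> (jmul (pj \<epsilon> s) G))" for s
    unfolding stone_def by (simp add: scaleC_scaleC scaleC_diff_right mult.commute)
  show "(\<lambda>s. f s *\<^sub>C stone M \<delta> (jmul (pj \<epsilon> s) G)) integrable_on {-M..M}"
    unfolding eq by (intro integrable_scaleC integrable_diff A(2) B(2))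
  show "integral {-M..M} (\<lambda>s. f s *\<^sub>C stone M \<delta> (jmul (pj \<epsilon> s) G)) = stone M \<delta> (jmul (pconv M \<epsilon> f) G)"
  proof -
    have "integral {-M..M} (\<lambda>s. f s *\<^sub>C stone M \<delta> (jmul (pj \<epsilon> s) G)) =
       ?c *\<^sub>C integral {-M..M} (\<lambda>s. f s *\<^sub>C trace M (- \<delta>) (jmul (pj \<epsilon> s) G) - f s *\<^sub>C trace M \<delta> (jmul (pj \<epsilon> s) G))"
      unfolding eq by (rule integral_scaleC[OF integrable_diff[OF A(2) B(2)]])
    then show ?thesis unfolding integral_diff[OF A(2) B(2)] A(1) B(1) by (simp only: stone_def)
  qed
qed

text \<open>The composition with R(s - i\<epsilon>) and R(s + i\<epsilon>) turns the left side into
  the integral over s of F(s) times the calculus applied to the Poisson kernel in s times G. To pull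
  the s-integral inside, the calculus is replaced by Stone integrals with a second shift
  \<open>eta k\<close>, where Fubini concerns continuous functions on a square, and then
  \<open>eta k\<close> tends to 0.\<close>

lemma stone_compose_hs:
  assumes cp: "cutpair \<psi> \<psi>'" and n: "real n > \<alpha>" and M: "M > 0" and e: "\<epsilon> > 0"
    and F: "continuous_on UNIV (F 0)"
    and G: "jet UNIV (Suc n) G" and supp: "jsupp (Suc n) M G"
  shows "stone M \<epsilon> F o\<^sub>L hs n \<psi> \<psi>' 1 G = hs n \<psi> \<psi>' 1 (jmul (pconv M \<epsilon> (F 0)) G)"
proof -
  have one: "(1::real) \<le> 1" by simp
  obtain \<omega> K where K: "\<omega> \<longlonglongrightarrow> 0" "K > 0"
    "\<And>h B k. jet UNIV (Suc n) h \<Longrightarrow> jsupp (Suc n) M h \<Longrightarrow> jbnd (Suc n) B h \<Longrightarrow>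
       norm (stone M (eta k) h - hs n \<psi> \<psi>' 1 h) \<le> \<omega> k * B"
    "\<And>h B k. jet UNIV (Suc n) h \<Longrightarrow> jsupp (Suc n) M h \<Longrightarrow> jbnd (Suc n) B h \<Longrightarrow>
       norm (trace M (eta k) h) \<le> K * B \<and> norm (trace M (- eta k) h) \<le> K * B"
    by (rule stone_approx[OF cp n one M]) (rule that; assumption)
  obtain BG where BG: "BG > 0" "jbnd (Suc n) BG G" using compact_jet_bounded[OF G supp] by metis
  define T where "T = hs n \<psi> \<psi>' 1 G"
  define P where "P = (\<Sum>r\<le>Suc n. fact r / \<epsilon> ^ Suc r)"
  have P0: "P \<ge> 0" unfolding P_def using e by (intro sum_nonneg) simp
  define A where "A s = hs n \<psi> \<psi>' 1 (jmul (pj \<epsilon> s) G)" for s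
  let ?c = "1 / (2 * pi * \<i>)"
  have Ig: "Im (Complex s (- \<epsilon>)) \<noteq> 0" "Im (Complex s \<epsilon>) \<noteq> 0" for s using e by auto
  have jp: "jet UNIV (Suc n) (jmul (pj \<epsilon> s) G)" "jsupp (Suc n) M (jmul (pj \<epsilon> s) G)" for s
    by (rule jet_mult[OF jet_pj[OF e] G], rule jsupp_jmul[OF supp])
  have jg: "jet UNIV (Suc n) (jmul (gj w) G)" "jsupp (Suc n) M (jmul (gj w) G)" if "Im w \<noteq> 0" for w
    by (rule jet_mult[OF jet_gj[OF that] G], rule jsupp_jmul[OF supp])
  have W: "integrable lborel (wt n 1 h)" if "jet UNIV (Suc n) h" "jsupp (Suc n) M h" for h
    by (rule integrable_wt_jsupp[OF that]) simp
  \<comment> \<open>\<open>resolvent_compose_hs\<close> at s - i\<epsilon> and at s + i\<epsilon>,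
    combined by linearity into the Poisson jet.\<close>
  have Aeq: "?c *\<^sub>C ((Res (Complex s (- \<epsilon>)) o\<^sub>L T) - (Res (Complex s \<epsilon>) o\<^sub>L T)) = A s" for s
  proof -
    let ?u = "Complex s (- \<epsilon>)" and ?v = "Complex s \<epsilon>"
    have pe: "jmul (pj \<epsilon> s) G = (\<lambda>r x. ?c * (jmul (gj ?u) G r x - jmul (gj ?v) G r x))"
      unfolding pj_def[abs_def] jmul_cmult_left jmul_diff_left ..
    note ju = jg[OF Ig(1)[of s]] and jv = jg[OF Ig(2)[of s]]
    have "A s = ?c *\<^sub>C hs n \<psi> \<psi>' 1 (\<lambda>r x. jmul (gj ?u) G r x - jmul (gj ?v) G r x)"
      unfolding A_def pe
    proof (rule hs_cmult[OF cp n one jet_diff[OF ju(1) jv(1)]])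
      have "jsupp (Suc n) M (\<lambda>r x. jmul (gj ?u) G r x - jmul (gj ?v) G r x)" using ju(2) jv(2) by (simp add: jsupp_def)
      then show "integrable lborel (wt n 1 (\<lambda>r x. jmul (gj ?u) G r x - jmul (gj ?v) G r x))"
        by (rule W[OF jet_diff[OF ju(1) jv(1)]])
    qed
    also have "hs n \<psi> \<psi>' 1 (\<lambda>r x. jmul (gj ?u) G r x - jmul (gj ?v) G r x) = hs n \<psi> \<psi>' 1 (jmul (gj ?u) G) - hs n \<psi> \<psi>' 1 (jmul (gj ?v) G)"
      by (rule hs_diff[OF cp n one ju(1) W[OF ju] jv(1) W[OF jv]])
    finally show ?thesis
      unfolding T_def resolvent_compose_hs[OF cp n M Ig(1) G supp] resolvent_compose_hs[OF cp n M Ig(2) G supp] by simp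
  qed
  have cR: "continuous_on UNIV (\<lambda>s. Res (Complex s \<zeta>) o\<^sub>L T)" if "\<zeta> \<noteq> 0" for \<zeta>
    using that by (intro bounded_bilinear.continuous_on[OF bounded_bilinear_blinfun_compose] continuous_R_comp continuous_intros) auto
  have cA: "continuous_on UNIV A"
    unfolding Aeq[symmetric] using e by (intro bounded_linear.continuous_on[OF bounded_linear_scaleC_right] continuous_intros cR) auto
  have iA: "(\<lambda>s. F 0 s *\<^sub>C A s) integrable_on {-M..M}"
    by (rule integrable_continuous_interval[OF continuous_on_scaleC[OF continuous_on_subset[OF F] continuous_on_subset[OF cA]]]) simp_all
  have tc: "trace M \<zeta> F o\<^sub>L T = integral {-M..M} (\<lambda>s. F 0 s *\<^sub>C (Res (Complex s \<zeta>) o\<^sub>L T))"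
    and ti: "(\<lambda>s. F 0 s *\<^sub>C (Res (Complex s \<zeta>) o\<^sub>L T)) integrable_on {-M..M}" if z: "\<zeta> \<noteq> 0" for \<zeta>
  proof -
    have "trace M \<zeta> F o\<^sub>L T = integral {-M..M} ((\<lambda>S. S o\<^sub>L T) o (\<lambda>s. F 0 s *\<^sub>C Res (Complex s \<zeta>)))"
      unfolding trace_def
      by (rule integral_linear[symmetric, OF integrable_trace[OF F z] bounded_bilinear.bounded_linear_left[OF bounded_bilinear_blinfun_compose]])
    then show "trace M \<zeta> F o\<^sub>L T = integral {-M..M} (\<lambda>s. F 0 s *\<^sub>C (Res (Complex s \<zeta>) o\<^sub>L T))"
      by (simp add: o_def scaleC_blinfun_compose)
    show "(\<lambda>s. F 0 s *\<^sub>C (Res (Complex s \<zeta>) o\<^sub>L T)) integrable_on {-M..M}"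
      by (rule integrable_continuous_interval[OF continuous_on_scaleC[OF continuous_on_subset[OF F] continuous_on_subset[OF cR[OF z]]]]) simp_all
  qed
  have n0: "- \<epsilon> \<noteq> 0" "\<epsilon> \<noteq> 0" using e by auto
  have sc: "stone M \<epsilon> F o\<^sub>L T = integral {-M..M} (\<lambda>s. F 0 s *\<^sub>C A s)"
  proof -
    have "stone M \<epsilon> F o\<^sub>L T = ?c *\<^sub>C ((trace M (- \<epsilon>) F o\<^sub>L T) - (trace M \<epsilon> F o\<^sub>L T))"
      unfolding stone_def scaleC_blinfun_compose blinfun_compose_diff_left ..
    also have "\<dots> = integral {-M..M} (\<lambda>s. ?c *\<^sub>C (F 0 s *\<^sub>C (Res (Complex s (- \<epsilon>)) o\<^sub>L T) - F 0 s *\<^sub>C (Res (Complex s \<epsilon>) o\<^sub>L T)))"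
      unfolding tc[OF n0(1)] tc[OF n0(2)] integral_diff[OF ti[OF n0(1)] ti[OF n0(2)], symmetric]
        integral_scaleC[OF integrable_diff[OF ti[OF n0(1)] ti[OF n0(2)]]] ..
    also have "(\<lambda>s. ?c *\<^sub>C (F 0 s *\<^sub>C (Res (Complex s (- \<epsilon>)) o\<^sub>L T) - F 0 s *\<^sub>C (Res (Complex s \<epsilon>) o\<^sub>L T))) = (\<lambda>s. F 0 s *\<^sub>C A s)"
      unfolding Aeq[symmetric] scaleC_diff_right scaleC_scaleC by (simp add: mult.commute)
    finally show ?thesis .
  qed
  have bp: "jbnd (Suc n) P (pj \<epsilon> s)" for s
    unfolding jbnd_def
  proof (intro allI impI)
    fix r x assume r: "r \<le> Suc n"
    have g: "cmod (gj w r x) \<le> P" if "\<bar>Im w\<bar> \<ge> \<epsilon>" for w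
      using jbnd_gj[OF that e, of "Suc n"] r by (simp add: jbnd_def P_def)
    have "cmod (gj (Complex s (- \<epsilon>)) r x - gj (Complex s \<epsilon>) r x) \<le> 2 * P"
      using norm_triangle_ineq4[of "gj (Complex s (- \<epsilon>)) r x" "gj (Complex s \<epsilon>) r x"] g[of "Complex s (- \<epsilon>)"] g[of "Complex s \<epsilon>"] e by simp
    moreover have "cmod ?c \<le> 1 / 2" using pi_gt3 by (simp add: norm_divide norm_mult)
    ultimately have "cmod ?c * cmod (gj (Complex s (- \<epsilon>)) r x - gj (Complex s \<epsilon>) r x) \<le> 1 / 2 * (2 * P)"
      by (intro mult_mono) auto
    then show "cmod (pj \<epsilon> s r x) \<le> P" by (simp only: pj_def norm_mult)
  qed
  obtain BF where BF: "\<And>s. s \<in> {-M..M} \<Longrightarrow> cmod (F 0 s) \<le> BF" "BF > 0"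
  proof -
    have "bounded (F 0 ` {-M..M})" by (intro compact_imp_bounded compact_continuous_image continuous_on_subset[OF F]) auto
    then obtain b where "b > 0" "\<forall>y\<in>F 0 ` {-M..M}. norm y \<le> b" unfolding bounded_pos by blast
    then show ?thesis by (intro that[of b]) blast+
  qed
  \<comment> \<open>The approximant with two shifts. It tends to the left side because the error
    rate \<omega> is the same for all s, the Poisson jets being bounded by \<open>P\<close>
    uniformly in s; by Fubini it is also a Stone integral of the product of the Poisson mean with
    \<open>G\<close>.\<close>
  define S where "S k = integral {-M..M} (\<lambda>s. F 0 s *\<^sub>C stone M (eta k) (jmul (pj \<epsilon> s) G))" for k
  have cG: "continuous_on UNIV (G 0)" using jet_continuous[OF G, of 0] by simp
  note sp = stone_pconv[where G = G and M = M, OF e eta_pos F cG]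
  have diff: "norm (S k - (stone M \<epsilon> F o\<^sub>L T)) \<le> \<omega> k * (BF * (2 ^ Suc n * P * BG) * (M - - M))" for k
  proof -
    have b: "norm (F 0 s *\<^sub>C stone M (eta k) (jmul (pj \<epsilon> s) G) - F 0 s *\<^sub>C A s) \<le> BF * (\<omega> k * (2 ^ Suc n * P * BG))" if s: "s \<in> {-M..M}" for s
      unfolding scaleC_diff_right[symmetric] norm_scaleC A_def
      by (rule mult_mono[OF BF(1)[OF s] K(3)[OF jp jbnd_jmul[OF bp BG(2)]]]) (use BF(2) in auto)
    have "S k - (stone M \<epsilon> F o\<^sub>L T) = integral {-M..M} (\<lambda>s. F 0 s *\<^sub>C stone M (eta k) (jmul (pj \<epsilon> s) G) - F 0 s *\<^sub>C A s)"
      unfolding S_def sc using sp(2) iA by (rule integral_diff[symmetric])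
    then have "norm (S k - (stone M \<epsilon> F o\<^sub>L T)) \<le> integral {-M..M} (\<lambda>s. BF * (\<omega> k * (2 ^ Suc n * P * BG)))"
      using integral_norm_bound_integral[OF integrable_diff[OF sp(2) iA] integrable_const_ivl b] by simp
    also have "\<dots> = \<omega> k * (BF * (2 ^ Suc n * P * BG) * (M - - M))" using M by (simp add: mult_ac)
    finally show ?thesis .
  qed
  have "(\<lambda>k. \<omega> k * (BF * (2 ^ Suc n * P * BG) * (M - - M))) \<longlonglongrightarrow> 0" by (rule tendsto_mult_left_zero[OF K(1)])
  then have "(\<lambda>k. S k - (stone M \<epsilon> F o\<^sub>L T)) \<longlonglongrightarrow> 0"
    by (rule Lim_null_comparison[OF always_eventually[OF allI[OF diff]]])
  then have l1: "S \<longlonglongrightarrow> (stone M \<epsilon> F o\<^sub>L T)" by (rule LIM_zero_cancel)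
  have l2: "S \<longlonglongrightarrow> hs n \<psi> \<psi>' 1 (jmul (pconv M \<epsilon> (F 0)) G)"
    unfolding S_def[abs_def] sp(1)
    by (rule stone_tendsto_hs[OF cp n one M jet_mult[OF jet_pconv[OF e F] G] jsupp_jmul[OF supp]])
  show ?thesis using LIMSEQ_unique[OF l1 l2] by (simp add: T_def)
qed

text \<open>Both sides of \<open>stone_compose_hs\<close> converge as \<epsilon> tends to 0: the
  left one by the Stone formula, the right one because the Poisson means of \<open>F\<close>
  converge with n+1 derivatives uniformly on [-M, M], and outside this interval the factor
  \<open>G\<close> vanishes.\<close>

lemma hs_mult_compact:
  assumes cp: "cutpair \<psi> \<psi>'" and n: "real n > \<alpha>" and M: "M > 0"
    and F: "jet UNIV (Suc n) F" "jsupp (Suc n) M F" and G: "jet UNIV (Suc n) G" "jsupp (Suc n) M G"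
  shows "hs n \<psi> \<psi>' 1 F o\<^sub>L hs n \<psi> \<psi>' 1 G = hs n \<psi> \<psi>' 1 (jmul F G)"
proof -
  have one: "(1::real) \<le> 1" by simp
  have M1: "M + 1 > 0" using M by simp
  have s1: "jsupp (Suc n) (M + 1) F" "jsupp (Suc n) (M + 1) G" using F(2) G(2) by (auto intro: jsupp_mono)
  have cF: "continuous_on UNIV (F 0)" using jet_continuous[OF F(1), of 0] by simp
  obtain BG where BG: "BG > 0" "jbnd (Suc n) BG G" using compact_jet_bounded[OF G] by metis
  obtain K where K: "K > 0" "\<And>h B. jet UNIV (Suc n) h \<Longrightarrow> jsupp (Suc n) (M + 1) h \<Longrightarrow> jbnd (Suc n) B h \<Longrightarrow> norm (hs n \<psi> \<psi>' 1 h) \<le> K * B"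
    by (rule hs_jbnd_bound[OF cp n M1]) (rule that; assumption)
  define Q where "Q k = jmul (pconv (M + 1) (eta k) (F 0)) G" for k
  have jQ: "jet UNIV (Suc n) (Q k)" "jsupp (Suc n) (M + 1) (Q k)" for k
    unfolding Q_def by (rule jet_mult[OF jet_pconv[OF eta_pos cF] G(1)], rule jsupp_jmul[OF s1(2)])
  have jFG: "jet UNIV (Suc n) (jmul F G)" "jsupp (Suc n) (M + 1) (jmul F G)"
    by (rule jet_mult[OF F(1) G(1)], rule jsupp_jmul[OF s1(2)])
  have W: "integrable lborel (wt n 1 h)" if "jet UNIV (Suc n) h" "jsupp (Suc n) (M + 1) h" for h
    by (rule integrable_wt_jsupp[OF that]) simp
  have l1: "(\<lambda>k. stone (M + 1) (eta k) F o\<^sub>L hs n \<psi> \<psi>' 1 G) \<longlonglongrightarrow> (hs n \<psi> \<psi>' 1 F o\<^sub>L hs n \<psi> \<psi>' 1 G)"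
    by (intro bounded_bilinear.tendsto[OF bounded_bilinear_blinfun_compose] tendsto_const stone_tendsto_hs[OF cp n one M1 F(1) s1(1)])
  have l2: "(\<lambda>k. hs n \<psi> \<psi>' 1 (Q k)) \<longlonglongrightarrow> hs n \<psi> \<psi>' 1 (jmul F G)"
  proof (rule LIM_zero_cancel, rule tendstoI)
    fix e :: real assume e: "e > 0"
    \<comment> \<open>Makes the final error K 2^(n+1) d BG equal to e/2.\<close>
    define d where "d = e / (2 * (K * (2 ^ Suc n * BG)))"
    have d: "d > 0" using e K(1) BG(1) by (simp add: d_def)
    show "\<forall>\<^sub>F k in sequentially. dist (hs n \<psi> \<psi>' 1 (Q k) - hs n \<psi> \<psi>' 1 (jmul F G)) 0 < e"
      using pconv_tendsto[OF F M d]
    proof eventually_elim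
      case (elim k)
      let ?D = "\<lambda>r x. Q k r x - jmul F G r x"
      have De: "?D = jmul (\<lambda>r x. pconv (M + 1) (eta k) (F 0) r x - F r x) G" unfolding Q_def jmul_diff_left ..
      have bD: "jbnd (Suc n) (2 ^ Suc n * d * BG) ?D"
        unfolding jbnd_def
      proof (intro allI impI)
        fix r x assume r: "r \<le> Suc n"
        show "cmod (Q k r x - jmul F G r x) \<le> 2 ^ Suc n * d * BG"
        proof (cases "\<bar>x\<bar> \<le> M")
          case True
          have "cmod (jmul (\<lambda>r x. pconv (M + 1) (eta k) (F 0) r x - F r x) G r x) \<le> 2 ^ Suc n * d * BG"
            by (rule jmul_norm_le[OF _ _ r]) (use elim True BG(2) in \<open>auto simp: jbnd_def\<close>)
          then show ?thesis using fun_cong[OF fun_cong[OF De, of r], of x] by simp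
        next
          case False
          then have "G j x = 0" if "j \<le> Suc n" for j using G(2) that by (simp add: jsupp_def)
          then have "Q k r x = 0" "jmul F G r x = 0" using r by (simp_all add: Q_def jmul_def)
          then show ?thesis using d BG(1) by simp
        qed
      qed
      have "hs n \<psi> \<psi>' 1 (Q k) - hs n \<psi> \<psi>' 1 (jmul F G) = hs n \<psi> \<psi>' 1 ?D"
        by (rule hs_diff[symmetric, OF cp n one jQ(1) W[OF jQ] jFG(1) W[OF jFG]])
      moreover have "norm (hs n \<psi> \<psi>' 1 ?D) \<le> K * (2 ^ Suc n * d * BG)"
      proof (rule K(2)[OF jet_diff[OF jQ(1) jFG(1)] _ bD])
        show "jsupp (Suc n) (M + 1) ?D" using jQ(2)[of k] jFG(2) by (simp add: jsupp_def)
      qed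
      moreover have "K * (2 ^ Suc n * d * BG) = e / 2" using K(1) BG(1) by (simp add: d_def field_simps)
      ultimately show ?case using e by (simp add: dist_norm)
    qed
  qed
  have eq: "stone (M + 1) (eta k) F o\<^sub>L hs n \<psi> \<psi>' 1 G = hs n \<psi> \<psi>' 1 (Q k)" for k
    unfolding Q_def by (rule stone_compose_hs[where F = F, OF cp n M1 eta_pos cF G(1) s1(2)])
  show ?thesis using LIMSEQ_unique[OF l1[unfolded eq] l2] .
qed

end

section \<open>Normalisation\<close>

text \<open>Allows jets to be compared through their functions alone. Identities between products,
  such as associativity of \<open>jmul\<close>, then need no binomial calculation.\<close>

lemma jet_unique:
  assumes h: "jet UNIV N h" and k: "jet UNIV N k" and eq: "\<And>x. h 0 x = k 0 x" and r: "r \<le> N"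
  shows "h r x = k r x"
proof (cases "r = 0")
  case False
  have "(\<lambda>r x. h r x - k r x) r x = 0"
    by (rule jet_zero_on_open[OF jet_diff[OF h k], of UNIV 0]) (use False r eq in auto)
  then show ?thesis by simp
qed (simp add: eq)

lemma edbar_cong:
  assumes "\<And>r x. r \<le> Suc n \<Longrightarrow> h r x = k r x"
  shows "edbar n \<psi> \<psi>' s h p = edbar n \<psi> \<psi>' s k p"
proof -
  obtain x y where p: "p = (x, y)" by force
  have "taylor n h x y = taylor n k x y" unfolding taylor_def by (intro sum.cong) (simp_all add: assms)
  then show ?thesis by (simp add: p edbar_eq assms)
qed

text \<open>The scalar model: 1/(z + 1) is the resolvent of multiplication by -1 on the complex
  numbers, with \<alpha> = 0. A locale without parameters lets the instance be opened under its own
  prefix beside the operator calculus.\<close>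

locale scalar_pole
begin

sublocale hol_off_real "\<lambda>z. 1 / (z + 1)" "\<lambda>z. - 1 / (z + 1)\<^sup>2" 1 0
proof
  have nz: "z + 1 \<noteq> 0" if "Im z \<noteq> 0" for z using that by (auto simp: complex_eq_iff)
  have d: "((\<lambda>z. 1 / (z + 1)) has_field_derivative - 1 / (z + 1)\<^sup>2) (at z)" if "Im z \<noteq> 0" for z
    by (rule derivative_eq_intros refl nz[OF that])+ (simp add: power2_eq_square)
  show "((\<lambda>x. 1 / (Complex x y + 1)) has_vector_derivative - 1 / (Complex x y + 1)\<^sup>2) (at x)" if "y \<noteq> 0" for x y
  proof -
    have e: "Complex 0 y + of_real u = Complex u y" for u by (simp add: complex_eq_iff)
    have "((\<lambda>z. 1 / (z + 1)) has_field_derivative - 1 / (Complex 0 y + 1 * of_real x + 1)\<^sup>2) (at (Complex 0 y + 1 * of_real x))"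
      by (rule d) (use that in simp)
    from has_vector_derivative_of_complex_derivative[OF this] show ?thesis by (simp add: e)
  qed
  show "((\<lambda>y. 1 / (Complex x y + 1)) has_vector_derivative \<i> *\<^sub>C (- 1 / (Complex x y + 1)\<^sup>2)) (at y)" if "y \<noteq> 0" for x y
  proof -
    have e: "Complex x y = of_real x + \<i> * of_real y" for y by (simp add: complex_eq_iff)
    have "((\<lambda>z. 1 / (z + 1)) has_field_derivative - 1 / (of_real x + \<i> * of_real y + 1)\<^sup>2) (at (of_real x + \<i> * of_real y))"
      by (rule d) (use that in simp)
    from has_vector_derivative_of_complex_derivative[OF this] show ?thesis by (simp add: e scaleC_complex_def)
  qed
  show "continuous_on {z. Im z \<noteq> 0} (\<lambda>z. 1 / (z + 1))" "continuous_on {z. Im z \<noteq> 0} (\<lambda>z. - 1 / (z + 1)\<^sup>2)"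
    using nz by (auto intro!: continuous_intros)
  show "cmod (1 / (z + 1)) \<le> 1 * inverse \<bar>Im z\<bar> * (jbracket z / \<bar>Im z\<bar>) powr 0" if z: "Im z \<noteq> 0" for z
  proof -
    have "jbracket z > 0" by (simp add: jbracket_def add_pos_nonneg)
    moreover have "\<bar>Im z\<bar> \<le> cmod (z + 1)" using abs_Im_le_cmod[of "z + 1"] by simp
    ultimately show ?thesis using z by (simp add: norm_divide inverse_eq_divide frac_le)
  qed
qed auto

text \<open>The Cauchy-Pompeiu formula at -1, a point on the axis: the Stone integrals of 1/(z + 1)
  are the Poisson means of \<open>h\<close> at -1, and these tend to h(-1). The bound M >= 1 puts -1
  into the range of \<open>poisson_approx\<close>.\<close>

lemma scalar_hs:
  assumes cp: "cutpair \<psi> \<psi>'" and n: "n > 0" and s: "s \<ge> 1" and M: "M \<ge> 1" and h: "jet UNIV (Suc n) h" and supp: "jsupp (Suc n) M h"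
  shows "hs n \<psi> \<psi>' s h = h 0 (- 1)"
proof -
  have M0: "M > 0" "M + 1 > 0" using M by auto
  have n0: "real n > 0" using n by simp
  obtain B where B: "jbnd (Suc n) B h" using compact_jet_bounded[OF h supp] by metis
  have s1: "jsupp (Suc n) (M + 1) h" using jsupp_mono[OF supp] by simp
  have l1: "(\<lambda>k. stone (M + 1) (eta k) h) \<longlonglongrightarrow> hs n \<psi> \<psi>' s h"
    by (rule stone_tendsto_hs[OF cp n0 s M0(2) h s1])
  have ch: "continuous_on UNIV (h 0)" using jet_continuous[OF h, of 0] by simp
  have st: "stone (M + 1) (eta k) h = integral {-(M+1)..M+1} (\<lambda>x. h 0 x * of_real (poisson (eta k) (x - (- 1))))" for k
  proof -
    have e: "eta k > 0" by (rule eta_pos)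
    have i: "(\<lambda>x. h 0 x *\<^sub>C (1 / (Complex x v + 1))) integrable_on {-(M+1)..M+1}" if "v \<noteq> 0" for v
      by (rule integrable_trace[OF ch that])
    have "stone (M + 1) (eta k) h = (1 / (2 * pi * \<i>)) *\<^sub>C integral {-(M+1)..M+1} (\<lambda>x. h 0 x *\<^sub>C (1 / (Complex x (- eta k) + 1)) - h 0 x *\<^sub>C (1 / (Complex x (eta k) + 1)))"
      unfolding stone_def trace_def using e by (subst integral_diff[OF i i]) simp_all
    also have "\<dots> = integral {-(M+1)..M+1} (\<lambda>x. (1 / (2 * pi * \<i>)) *\<^sub>C (h 0 x *\<^sub>C (1 / (Complex x (- eta k) + 1)) - h 0 x *\<^sub>C (1 / (Complex x (eta k) + 1))))"
      using e by (intro integral_scaleC[symmetric] integrable_diff i) simp_all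
    also have "\<dots> = integral {-(M+1)..M+1} (\<lambda>x. h 0 x * of_real (poisson (eta k) (x - (- 1))))"
    proof (rule integral_cong)
      fix x
      have "of_real (poisson (eta k) (x - (- 1))) = pj (eta k) x 0 (- 1)" by (rule pj_0[OF e, symmetric])
      also have "\<dots> = 1 / (2 * pi * \<i>) * (1 / (Complex x (- eta k) + 1) - 1 / (Complex x (eta k) + 1))"
        by (simp add: pj_def gj_0)
      finally have p: "of_real (poisson (eta k) (x - (- 1))) = 1 / (2 * pi * \<i>) * (1 / (Complex x (- eta k) + 1) - 1 / (Complex x (eta k) + 1))" .
      show "(1 / (2 * pi * \<i>)) *\<^sub>C (h 0 x *\<^sub>C (1 / (Complex x (- eta k) + 1)) - h 0 x *\<^sub>C (1 / (Complex x (eta k) + 1))) = h 0 x * of_real (poisson (eta k) (x - (- 1)))"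
        unfolding p scaleC_complex_def by (simp only: algebra_simps)
    qed
    finally show ?thesis .
  qed
  have l2: "(\<lambda>k. stone (M + 1) (eta k) h) \<longlonglongrightarrow> h 0 (- 1)"
  proof (rule tendstoI)
    fix e :: real assume e: "e > 0"
    have "\<forall>\<^sub>F k in sequentially. \<forall>x. \<bar>x\<bar> \<le> M \<longrightarrow> cmod (integral {-(M+1)..M+1} (\<lambda>s. h 0 s * of_real (poisson (eta k) (s - x))) - h 0 x) \<le> e / 2"
      by (rule poisson_approx[OF M0(1) continuous_on_subset[OF ch], of B "e / 2"]) (use B e in \<open>auto simp: jbnd_def\<close>)
    then show "\<forall>\<^sub>F k in sequentially. dist (stone (M + 1) (eta k) h) (h 0 (- 1)) < e"
    proof eventually_elim
      case (elim k)
      then have "cmod (integral {-(M+1)..M+1} (\<lambda>s. h 0 s * of_real (poisson (eta k) (s - (- 1)))) - h 0 (- 1)) \<le> e / 2"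
        using M by (elim allE[of _ "- 1"]) simp
      then show ?case unfolding st dist_norm using e by linarith
    qed
  qed
  show ?thesis using LIMSEQ_unique[OF l1 l2] .
qed

end

context hol_off_real
begin

lemma hs_cong:
  assumes "jet UNIV (Suc n) h" "jet UNIV (Suc n) k" "\<And>x. h 0 x = k 0 x"
  shows "hs n \<psi> \<psi>' s h = hs n \<psi> \<psi>' s k"
proof -
  have "edbar n \<psi> \<psi>' s h p = edbar n \<psi> \<psi>' s k p" for p
    by (rule edbar_cong) (rule jet_unique[OF assms])
  then show ?thesis by (simp add: hs_def)
qed

end

context resolvent_growth
begin

text \<open>Both factors are truncated, and the truncations are removed one after the other. At each
  stage the product of truncations equals, as a function, a truncation of the product, so
  \<open>hs_cutk_tendsto\<close> applies to both sides.\<close>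

lemma hs_mult:
  assumes cp: "cutpair \<psi> \<psi>'" and n: "real n > \<alpha>"
    and F: "jet UNIV (Suc n) F" "dec UNIV (Suc n) \<beta>1 B1 F" "\<beta>1 < 0"
    and G: "jet UNIV (Suc n) G" "dec UNIV (Suc n) \<beta>2 B2 G" "\<beta>2 < 0"
  shows "hs n \<psi> \<psi>' 1 F o\<^sub>L hs n \<psi> \<psi>' 1 G = hs n \<psi> \<psi>' 1 (jmul F G)"
proof -
  obtain \<kappa> where cf: "cut_family (Suc n) \<kappa>" using cut_family_exists by blast
  interpret cf: cut_family "Suc n" \<kappa> by (rule cf)
  obtain C where C: "C > 0" "\<And>h \<beta> B k. dec UNIV (Suc n) \<beta> B h \<Longrightarrow> dec UNIV (Suc n) \<beta> (C * B) (cf.cutk k h)"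
    "\<And>h \<beta> B k. dec UNIV (Suc n) \<beta> B h \<Longrightarrow> \<beta> < 0 \<Longrightarrow> dec UNIV (Suc n) (\<beta> / 2) (C * B * real (Suc k) powr (\<beta> / 2)) (\<lambda>r x. h r x - cf.cutk k h r x)"
    by (rule cf.cutk_dec) (rule that; assumption)
  note lim = hs_cutk_tendsto[OF cp n cf order_refl]
  have step1: "hs n \<psi> \<psi>' 1 (cf.cutk k F) o\<^sub>L hs n \<psi> \<psi>' 1 G = hs n \<psi> \<psi>' 1 (jmul (cf.cutk k F) G)" for k
  proof -
    let ?Fk = "cf.cutk k F"
    have jF: "jet UNIV (Suc n) ?Fk" by (rule cf.jet_cutk[OF F(1)])
    have dF: "dec UNIV (Suc n) (\<beta>1 + \<beta>2) (2 ^ Suc n * (C * B1) * B2) (jmul ?Fk G)"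
      by (rule dec_jmul[OF C(2)[OF F(2)] G(2)]) simp
    have b: "\<beta>1 + \<beta>2 < 0" using F(3) G(3) by simp
    have "hs n \<psi> \<psi>' 1 ?Fk o\<^sub>L hs n \<psi> \<psi>' 1 (cf.cutk l G) = hs n \<psi> \<psi>' 1 (cf.cutk l (jmul ?Fk G))" for l
    proof -
      define M where "M = 2 * real (Suc (max k l))"
      have M: "M > 0" "2 * real (Suc k) \<le> M" "2 * real (Suc l) \<le> M" by (simp_all add: M_def)
      have jG: "jet UNIV (Suc n) (cf.cutk l G)" by (rule cf.jet_cutk[OF G(1)])
      have "hs n \<psi> \<psi>' 1 ?Fk o\<^sub>L hs n \<psi> \<psi>' 1 (cf.cutk l G) = hs n \<psi> \<psi>' 1 (jmul ?Fk (cf.cutk l G))"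
        by (rule hs_mult_compact[OF cp n M(1) jF jsupp_mono[OF cf.jsupp_cutk M(2)] jG jsupp_mono[OF cf.jsupp_cutk M(3)]])
      also have "\<dots> = hs n \<psi> \<psi>' 1 (cf.cutk l (jmul ?Fk G))"
        by (rule hs_cong[OF jet_mult[OF jF jG] cf.jet_cutk[OF jet_mult[OF jF G(1)]]]) (simp add: jmul_0 cf.cutk_0)
      finally show ?thesis .
    qed
    then have eq: "(\<lambda>l. hs n \<psi> \<psi>' 1 ?Fk o\<^sub>L hs n \<psi> \<psi>' 1 (cf.cutk l G)) = (\<lambda>l. hs n \<psi> \<psi>' 1 (cf.cutk l (jmul ?Fk G)))" by simp
    have l1: "(\<lambda>l. hs n \<psi> \<psi>' 1 ?Fk o\<^sub>L hs n \<psi> \<psi>' 1 (cf.cutk l G)) \<longlonglongrightarrow> (hs n \<psi> \<psi>' 1 ?Fk o\<^sub>L hs n \<psi> \<psi>' 1 G)"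
      by (intro bounded_bilinear.tendsto[OF bounded_bilinear_blinfun_compose] tendsto_const lim[OF G])
    show ?thesis using LIMSEQ_unique[OF l1[unfolded eq] lim[OF jet_mult[OF jF G(1)] dF b]] .
  qed
  have dFG: "dec UNIV (Suc n) (\<beta>1 + \<beta>2) (2 ^ Suc n * B1 * B2) (jmul F G)" by (rule dec_jmul[OF F(2) G(2)]) simp
  have b: "\<beta>1 + \<beta>2 < 0" using F(3) G(3) by simp
  have "hs n \<psi> \<psi>' 1 (jmul (cf.cutk k F) G) = hs n \<psi> \<psi>' 1 (cf.cutk k (jmul F G))" for k
    by (rule hs_cong[OF jet_mult[OF cf.jet_cutk[OF F(1)] G(1)] cf.jet_cutk[OF jet_mult[OF F(1) G(1)]]]) (simp add: jmul_0 cf.cutk_0)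
  then have eq: "(\<lambda>k. hs n \<psi> \<psi>' 1 (cf.cutk k F) o\<^sub>L hs n \<psi> \<psi>' 1 G) = (\<lambda>k. hs n \<psi> \<psi>' 1 (cf.cutk k (jmul F G)))"
    unfolding step1 by simp
  have l1: "(\<lambda>k. hs n \<psi> \<psi>' 1 (cf.cutk k F) o\<^sub>L hs n \<psi> \<psi>' 1 G) \<longlonglongrightarrow> (hs n \<psi> \<psi>' 1 F o\<^sub>L hs n \<psi> \<psi>' 1 G)"
    by (intro bounded_bilinear.tendsto[OF bounded_bilinear_blinfun_compose] tendsto_const lim[OF F])
  show ?thesis using LIMSEQ_unique[OF l1[unfolded eq] lim[OF jet_mult[OF F(1) G(1)] dFG b]] .
qed

text \<open>Off the axis R(z) R(-1) = (R(-1) - R(z)) / (z + 1). The first part integrates to the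
  scalar calculus at -1, where the cut-off equals 1, times R(-1). The second has the additional
  factor 1/(z + 1), of size at most 1/k on the support of the dbar derivative, and an otherwise
  bounded integral.\<close>

lemma hs_cut_compose_resolvent:
  assumes cp: "cutpair \<psi> \<psi>'" and n: "real n > \<alpha>" and cf: "cut_family (Suc n) \<kappa>" and m1: "-1 \<in> \<rho>"
  shows "(\<lambda>k. hs n \<psi> \<psi>' 1 (jscale (real (Suc k)) \<kappa>) o\<^sub>L Res (-1)) \<longlonglongrightarrow> Res (-1)"
proof -
  interpret cf: cut_family "Suc n" \<kappa> by (rule cf)
  interpret sp: scalar_pole .
  have n0: "n > 0" using n alpha by (cases n) auto
  obtain K where K: "K > 0"
    "\<And>h s. jet UNIV (Suc n) h \<Longrightarrow> s \<ge> 1 \<Longrightarrow> integrable lborel (wt n s h) \<Longrightarrow>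
       integral UNIV (\<lambda>p. norm (edbar n \<psi> \<psi>' s h p *\<^sub>C Res (Complex (fst p) (snd p)))) \<le> K * integral\<^sup>L lborel (wt n s h)"
    by (rule hs_bound[OF cp n]) (rule that; assumption)
  obtain B where B: "B > 0" "jbnd (Suc n) B \<kappa>"
  proof (rule compact_jet_bounded[OF cf.jet_cut])
    show "jsupp (Suc n) 2 \<kappa>" by (simp add: jsupp_def cf.cut_outside)
  qed (rule that; assumption)
  define E where "E = real (n + 2) * (B * 3 ^ Suc n)"
  have est: "norm ((hs n \<psi> \<psi>' 1 (jscale (real (Suc k)) \<kappa>) o\<^sub>L Res (-1)) - Res (-1)) \<le> K * (4 * E) * (1 / real k)" if k: "k \<ge> 1" for k
  proof -
    define s where "s = real (Suc k)"
    have s: "s \<ge> 1" "s > 1" using k by (auto simp: s_def)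
    have s0: "s > 0" using s by simp
    define h where "h = jscale s \<kappa>"
    have h: "jet UNIV (Suc n) h" unfolding h_def by (rule jet_jscale[OF cf.jet_cut])
    have sh: "jsupp (Suc n) (2 * s) h"
      unfolding jsupp_def h_def jscale_def using cf.cut_outside s0 by (simp add: field_simps)
    let ?D = "edbar n \<psi> \<psi>' s h"
    let ?F = "\<lambda>p. ?D p *\<^sub>C Res (Complex (fst p) (snd p))"
    let ?q = "\<lambda>p. ?D p *\<^sub>C (1 / (Complex (fst p) (snd p) + 1))"
    have W: "integrable lborel (wt n s h)" by (rule integrable_wt_jsupp[OF h sh s0])
    have iF: "?F integrable_on UNIV" by (rule edbar_R_integrable[OF cp n h s(1) W])
    have nF: "(\<lambda>p. norm (?F p)) integrable_on UNIV" by (rule norm_edbar_R_integrable[OF cp n h s(1) W])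
    have iq: "?q integrable_on UNIV" by (rule sp.edbar_R_integrable[OF cp _ h s(1) W]) (simp add: n0)
    \<comment> \<open>In the square |x|, |y| <= s the cut-off is constant in x, so its top
      derivative vanishes, and |y| <= tau s x, so \<psi>' vanishes as well. Hence the dbar
      derivative lives at |z| >= s.\<close>
    have nz: "s - 1 \<le> cmod (Complex x y + 1)" if "?D (x, y) \<noteq> 0" for x y
    proof -
      have "s \<le> cmod (Complex x y)"
      proof (rule ccontr)
        assume "\<not> s \<le> cmod (Complex x y)"
        then have xy: "\<bar>x\<bar> \<le> s" "\<bar>y\<bar> \<le> s" using abs_Re_le_cmod[of "Complex x y"] abs_Im_le_cmod[of "Complex x y"] by auto
        have "h (Suc n) x = 0" using cf.cut_deriv[of "Suc n" "x / s"] xy s0 by (simp add: h_def jscale_def)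
        moreover have "\<psi>' (y / tau s x) = 0"
          using xy tau_ge[OF s0, of x] s0 by (intro cutpair_deriv_0[OF cp]) (simp add: field_simps)
        ultimately show False using that by (simp add: edbar_eq)
      qed
      also have "cmod (Complex x y) \<le> cmod (Complex x y + 1) + 1" using norm_triangle_ineq4[of "Complex x y + 1" 1] by simp
      finally show ?thesis by simp
    qed
    define g where "g p = ?D p * (1 / (Complex (fst p) (snd p) + 1))" for p
    have gle: "norm (g p *\<^sub>C Res (Complex (fst p) (snd p))) \<le> (1 / real k) * norm (?F p)" for p
    proof (cases "?D p = 0")
      case True
      then show ?thesis by (simp add: g_def)
    next
      case False
      then have "real k \<le> cmod (Complex (fst p) (snd p) + 1)" using nz[of "fst p" "snd p"] by (simp add: s_def)
      then have "1 / cmod (Complex (fst p) (snd p) + 1) \<le> 1 / real k"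
        using k by (intro frac_le) auto
      then have "cmod (?D p) * (1 / cmod (Complex (fst p) (snd p) + 1)) \<le> cmod (?D p) * (1 / real k)" by (intro mult_left_mono) auto
      then have "cmod (g p) \<le> (1 / real k) * cmod (?D p)" by (simp add: g_def norm_mult norm_divide mult.commute)
      then have "cmod (g p) * norm (Res (Complex (fst p) (snd p))) \<le> ((1 / real k) * cmod (?D p)) * norm (Res (Complex (fst p) (snd p)))"
        by (rule mult_right_mono) simp
      then show ?thesis by (simp only: norm_scaleC mult.assoc)
    qed
    have ig0: "(\<lambda>p. (1 / real k) * norm (?F p)) integrable_on UNIV" using nF by (rule integrable_on_mult_right)
    have ig: "(\<lambda>p. g p *\<^sub>C Res (Complex (fst p) (snd p))) integrable_on UNIV"
    proof (rule integrable_on_UNIV_dominated[OF _ ig0 gle])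
      have "continuous_on {p. snd p \<noteq> 0} (\<lambda>p. 1 / (Complex (fst p) (snd p) + 1))"
        by (intro sp.continuous_R_comp continuous_intros) auto
      then show "continuous_on {p. snd p \<noteq> 0} (\<lambda>p. g p *\<^sub>C Res (Complex (fst p) (snd p)))"
        unfolding g_def by (intro continuous_on_scaleC continuous_on_mult continuous_edbar[OF h cp s0] continuous_R_comp continuous_on_fst continuous_on_snd continuous_on_id) auto
    qed
    have pt: "?F p o\<^sub>L Res (-1) = ?q p *\<^sub>C Res (-1) - g p *\<^sub>C Res (Complex (fst p) (snd p))" for p
    proof (cases "snd p = 0")
      case True
      then have "?D p = 0" using edbar_axis[OF cp n0, of s h "fst p"] by (cases p) simp
      then show ?thesis by (simp add: g_def scaleC_blinfun_compose)
    next
      case False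
      let ?z = "Complex (fst p) (snd p)"
      have ne: "?z \<noteq> -1" using False by (auto simp: complex_eq_iff)
      have "Res ?z o\<^sub>L Res (-1) = (1 / (?z - (-1))) *\<^sub>C (Res (-1) - Res ?z)"
        using False by (intro resolvent_compose Im_off_real m1 ne) simp
      then show ?thesis
        by (simp add: scaleC_blinfun_compose scaleC_diff_right scaleC_scaleC g_def scaleC_complex_def)
    qed
    \<comment> \<open>The estimate needs the scale \<open>s\<close> adapted to the support;
      independence of the scale carries it back to scale 1.\<close>
    have "hs n \<psi> \<psi>' 1 h = hs n \<psi> \<psi>' s h"
      using s0 by (intro hs_independent_compact[OF cp n _ cp n s(1) h sh]) simp_all
    then have "hs n \<psi> \<psi>' 1 h o\<^sub>L Res (-1) = - (1 / pi) *\<^sub>R (integral UNIV ?F o\<^sub>L Res (-1))"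
      by (simp add: hs_def bounded_bilinear.scaleR_left[OF bounded_bilinear_blinfun_compose]
          bounded_bilinear.minus_left[OF bounded_bilinear_blinfun_compose])
    also have "integral UNIV ?F o\<^sub>L Res (-1) = integral UNIV ((\<lambda>T. T o\<^sub>L Res (-1)) o ?F)"
      by (rule integral_linear[OF iF bounded_bilinear.bounded_linear_left[OF bounded_bilinear_blinfun_compose], symmetric])
    also have "\<dots> = integral UNIV (\<lambda>p. ?q p *\<^sub>C Res (-1) - g p *\<^sub>C Res (Complex (fst p) (snd p)))"
      unfolding o_def pt ..
    also have "\<dots> = integral UNIV ?q *\<^sub>C Res (-1) - integral UNIV (\<lambda>p. g p *\<^sub>C Res (Complex (fst p) (snd p)))"
    proof -
      have "(\<lambda>p. ?q p *\<^sub>C Res (-1)) integrable_on UNIV"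
        using integrable_linear[OF iq bounded_bilinear.bounded_linear_left[OF bounded_bilinear_scaleC, of "Res (-1)"]] by (simp add: o_def)
      from integral_diff[OF this ig] show ?thesis unfolding integral_scaleC_right[OF iq] .
    qed
    also have "integral UNIV ?q = of_real (- pi)"
    proof -
      have "sp.hs n \<psi> \<psi>' s h = h 0 (- 1)"
        using s by (intro sp.scalar_hs[OF cp n0 s(1) _ h sh]) simp
      also have "\<dots> = 1" using cf.cut_1[of "- 1 / s"] s by (simp add: h_def jscale_def)
      finally have "- (1 / pi) *\<^sub>R integral UNIV ?q = 1" by (simp add: sp.hs_def)
      then have "(- pi) *\<^sub>R (- (1 / pi) *\<^sub>R integral UNIV ?q) = (- pi) *\<^sub>R 1" by (rule arg_cong)
      then show ?thesis by (simp add: scaleR_conv_of_real)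
    qed
    finally have eq: "hs n \<psi> \<psi>' 1 h o\<^sub>L Res (-1) = - (1 / pi) *\<^sub>R (of_real (- pi) *\<^sub>C Res (-1) - integral UNIV (\<lambda>p. g p *\<^sub>C Res (Complex (fst p) (snd p))))" .
    have "(hs n \<psi> \<psi>' 1 h o\<^sub>L Res (-1)) - Res (-1) = (1 / pi) *\<^sub>R integral UNIV (\<lambda>p. g p *\<^sub>C Res (Complex (fst p) (snd p)))"
      unfolding eq by (simp add: scaleR_scaleC[symmetric] scaleR_diff_right del: of_real_minus)
    then have "norm ((hs n \<psi> \<psi>' 1 h o\<^sub>L Res (-1)) - Res (-1)) = (1 / pi) * norm (integral UNIV (\<lambda>p. g p *\<^sub>C Res (Complex (fst p) (snd p))))"
      by simp
    also have "\<dots> \<le> 1 * norm (integral UNIV (\<lambda>p. g p *\<^sub>C Res (Complex (fst p) (snd p))))"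
      using pi_gt3 by (intro mult_right_mono) auto
    also have "\<dots> \<le> integral UNIV (\<lambda>p. (1 / real k) * norm (?F p))"
      unfolding mult_1 by (rule integral_norm_bound_integral[OF ig ig0 gle])
    also have "\<dots> = (1 / real k) * integral UNIV (\<lambda>p. norm (?F p))" by simp
    also have "\<dots> \<le> (1 / real k) * (K * (4 * E))"
    proof (rule mult_left_mono)
      \<comment> \<open>On the support tau s x lies between s and 3s, and the r-th derivative of the
        rescaled cut-off is at most B s^(-r). So the weight is at most E/s on an interval of length
        4s, and its mass is bounded independently of k.\<close>
      have "wt n s h x \<le> (E / s) * indicator {- (2 * s)..2 * s} x" for x
      proof (cases "\<bar>x\<bar> \<le> 2 * s")
        case True
        have t: "s \<le> tau s x" "tau s x \<le> 3 * s"
        proof -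
          show "s \<le> tau s x" by (rule tau_ge[OF s0])
          have "x\<^sup>2 \<le> (2 * s)\<^sup>2" using True s0 by (metis abs_ge_zero abs_le_square_iff abs_of_pos mult_pos_pos zero_less_numeral)
          then have "x\<^sup>2 \<le> 4 * s\<^sup>2" by (simp add: power_mult_distrib)
          then have "s\<^sup>2 + x\<^sup>2 \<le> 9 * s\<^sup>2" using zero_le_power2[of s] by linarith
          then have "s\<^sup>2 + x\<^sup>2 \<le> (3 * s)\<^sup>2" by (simp add: power_mult_distrib)
          then show "tau s x \<le> 3 * s" unfolding tau_def using s0 by (intro real_le_lsqrt) auto
        qed
        have "wt n s h x \<le> (\<Sum>r\<le>Suc n. B * 3 ^ Suc n / s)"
          unfolding wt_def
        proof (rule sum_mono)
          fix r assume r: "r \<in> {..Suc n}"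
          have "cmod (h r x) = (1 / s) ^ r * cmod (\<kappa> r (x / s))" using s0 by (simp add: h_def jscale_def norm_mult norm_divide norm_power)
          also have "\<dots> \<le> (1 / s) ^ r * B" using B r s0 by (intro mult_left_mono) (auto simp: jbnd_def)
          finally have 1: "cmod (h r x) \<le> (1 / s) ^ r * B" .
          have "tau s x powr (real r - 1) = tau s x ^ r / tau s x" using t s0 by (simp add: powr_diff powr_realpow)
          also have "\<dots> \<le> (3 * s) ^ r / s" using t s0 by (intro frac_le power_mono) auto
          finally have 2: "tau s x powr (real r - 1) \<le> (3 * s) ^ r / s" .
          have "cmod (h r x) * tau s x powr (real r - 1) \<le> ((1 / s) ^ r * B) * ((3 * s) ^ r / s)"
            using 1 2 B s0 by (intro mult_mono) auto
          also have "\<dots> = B * 3 ^ r / s" using s0 by (simp add: power_mult_distrib power_divide)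
          also have "\<dots> \<le> B * 3 ^ Suc n / s" using r B s0 by (intro divide_right_mono mult_left_mono power_increasing) auto
          finally show "cmod (h r x) * tau s x powr (real r - 1) \<le> B * 3 ^ Suc n / s" .
        qed
        also have "\<dots> = E / s" by (simp add: E_def)
        finally show ?thesis using True by (auto simp: abs_le_iff indicator_def)
      next
        case False
        then have "\<bar>x\<bar> \<ge> 2 * s" by simp
        then have "wt n s h x = 0" using sh by (simp add: wt_def jsupp_def)
        then show ?thesis using False by (auto simp: indicator_def)
      qed
      moreover have "integrable lborel (\<lambda>x. (E / s) * indicator {- (2 * s)..2 * s} x)"
        by (intro integrable_mult_right integrable_real_indicator) (auto simp: emeasure_lborel_Icc_eq)
      ultimately have "integral\<^sup>L lborel (wt n s h) \<le> integral\<^sup>L lborel (\<lambda>x. (E / s) * indicator {- (2 * s)..2 * s} x)"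
        by (intro integral_mono W)
      also have "\<dots> = 4 * E" using s0 by simp
      finally have "K * integral\<^sup>L lborel (wt n s h) \<le> K * (4 * E)" using K(1) by (intro mult_left_mono) auto
      then show "integral UNIV (\<lambda>p. norm (?F p)) \<le> K * (4 * E)" using K(2)[OF h s(1) W] by linarith
    qed simp
    finally show ?thesis by (simp add: h_def s_def mult.commute)
  qed
  have "(\<lambda>k. 1 / real k) \<longlonglongrightarrow> 0" by (rule lim_1_over_n)
  then have l: "(\<lambda>k. K * (4 * E) * (1 / real k)) \<longlonglongrightarrow> 0" by (rule tendsto_mult_right_zero)
  have "eventually (\<lambda>k. norm ((hs n \<psi> \<psi>' 1 (jscale (real (Suc k)) \<kappa>) o\<^sub>L Res (-1)) - Res (-1)) \<le> K * (4 * E) * (1 / real k)) sequentially"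
    using eventually_ge_at_top[of 1] by eventually_elim (rule est)
  then have "(\<lambda>k. (hs n \<psi> \<psi>' 1 (jscale (real (Suc k)) \<kappa>) o\<^sub>L Res (-1)) - Res (-1)) \<longlonglongrightarrow> 0"
    using l by (rule Lim_null_comparison)
  then show ?thesis by (rule LIM_zero_cancel)
qed

text \<open>Composing the truncated integrals with R(-1) on the right gives two limits: the calculus
  at g_w times R(-1), and R(w) R(-1). Hence the two operators agree on the range of R(-1), which
  contains the domain, and by density and continuity everywhere.\<close>

lemma hs_resolvent:
  assumes cp: "cutpair \<psi> \<psi>'" and n: "real n > \<alpha>" and m1: "-1 \<in> \<rho>" and dense: "closure D = UNIV" and w: "Im w \<noteq> 0"
  shows "hs n \<psi> \<psi>' 1 (gj w) = Res w"
proof -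
  obtain \<kappa> where cf: "cut_family (Suc n) \<kappa>" using cut_family_exists by blast
  interpret cf: cut_family "Suc n" \<kappa> by (rule cf)
  let ?k = "\<lambda>k. jscale (real (Suc k)) \<kappa>"
  have jk: "jet UNIV (Suc n) (?k k)" for k by (rule jet_jscale[OF cf.jet_cut])
  have sk: "jsupp (Suc n) (2 * real (Suc k)) (?k k)" for k
    unfolding jsupp_def jscale_def using cf.cut_outside by (simp add: field_simps)
  obtain B where B: "dec UNIV (Suc n) (-1) B (gj w)" using dec_gj[OF w] by metis
  have eq: "Res w o\<^sub>L hs n \<psi> \<psi>' 1 (?k k) = hs n \<psi> \<psi>' 1 (cf.cutk k (gj w))" for k
  proof -
    have "Res w o\<^sub>L hs n \<psi> \<psi>' 1 (?k k) = hs n \<psi> \<psi>' 1 (jmul (gj w) (?k k))"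
      by (rule resolvent_compose_hs[OF cp n _ w jk sk]) simp
    also have "\<dots> = hs n \<psi> \<psi>' 1 (cf.cutk k (gj w))"
      by (rule hs_cong[OF jet_mult[OF jet_gj[OF w] jk] cf.jet_cutk[OF jet_gj[OF w]]]) (simp add: jmul_0 cf.cutk_0 jscale_def)
    finally show ?thesis .
  qed
  have "(\<lambda>k. hs n \<psi> \<psi>' 1 (cf.cutk k (gj w))) \<longlonglongrightarrow> hs n \<psi> \<psi>' 1 (gj w)"
    by (rule hs_cutk_tendsto[OF cp n cf order_refl jet_gj[OF w] B]) simp
  then have l1: "(\<lambda>k. hs n \<psi> \<psi>' 1 (cf.cutk k (gj w)) o\<^sub>L Res (-1)) \<longlonglongrightarrow> (hs n \<psi> \<psi>' 1 (gj w) o\<^sub>L Res (-1))"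
    by (intro bounded_bilinear.tendsto[OF bounded_bilinear_blinfun_compose] tendsto_const)
  have l2: "(\<lambda>k. Res w o\<^sub>L (hs n \<psi> \<psi>' 1 (?k k) o\<^sub>L Res (-1))) \<longlonglongrightarrow> (Res w o\<^sub>L Res (-1))"
    by (intro bounded_bilinear.tendsto[OF bounded_bilinear_blinfun_compose] tendsto_const hs_cut_compose_resolvent[OF cp n cf m1])
  have "Res w o\<^sub>L (hs n \<psi> \<psi>' 1 (?k k) o\<^sub>L Res (-1)) = hs n \<psi> \<psi>' 1 (cf.cutk k (gj w)) o\<^sub>L Res (-1)" for k
    unfolding eq[symmetric] by (rule blinfun_eqI) simp
  then have fe: "(\<lambda>k. Res w o\<^sub>L (hs n \<psi> \<psi>' 1 (?k k) o\<^sub>L Res (-1))) = (\<lambda>k. hs n \<psi> \<psi>' 1 (cf.cutk k (gj w)) o\<^sub>L Res (-1))" by simp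
  have c: "hs n \<psi> \<psi>' 1 (gj w) o\<^sub>L Res (-1) = Res w o\<^sub>L Res (-1)"
    using LIMSEQ_unique[OF l1 l2[unfolded fe]] .
  have onD: "blinfun_apply (hs n \<psi> \<psi>' 1 (gj w)) x = blinfun_apply (Res w) x" if x: "x \<in> D" for x
  proof -
    have "x = Res (-1) ((-1) *\<^sub>C x - H x)" using resolvent_left[OF m1 x] by simp
    then show ?thesis using arg_cong[OF c, of "\<lambda>T. blinfun_apply T ((-1) *\<^sub>C x - H x)"] by simp
  qed
  show ?thesis
  proof (rule blinfun_eqI)
    fix x
    have "closed {x. blinfun_apply (hs n \<psi> \<psi>' 1 (gj w)) x = blinfun_apply (Res w) x}"
      by (intro closed_Collect_eq) (auto intro!: linear_continuous_on blinfun.bounded_linear_right)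
    then have "closure D \<subseteq> {x. blinfun_apply (hs n \<psi> \<psi>' 1 (gj w)) x = blinfun_apply (Res w) x}"
      using onD by (intro closure_minimal) auto
    then show "blinfun_apply (hs n \<psi> \<psi>' 1 (gj w)) x = blinfun_apply (Res w) x" using dense by auto
  qed
qed

end

section \<open>Reflection\<close>

text \<open>The coefficients of the (N+1)-st finite difference over the nodes 1 - 2k, with the sign
  chosen so that the terms with k >= 1 reproduce the term k = 0. That node is 1, the identity on the
  half line; the other nodes are the reflections.\<close>

definition hcoef :: "nat \<Rightarrow> nat \<Rightarrow> real" where
  "hcoef N k = (-1) ^ Suc k * real (Suc N choose k)"

text \<open>For k >= 1 these are -1, -3, -5, and so on. All are at most -1, so reflected points are
  not closer to the origin than the original ones and no decay is lost.\<close>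

definition hslope :: "nat \<Rightarrow> real" where
  "hslope k = 1 - 2 * real k"

lemma hslope_le: "k \<in> {1..m} \<Longrightarrow> hslope k \<le> -1"
  by (simp add: hslope_def)

lemma hcoef_moments:
  assumes "r \<le> N" shows "(\<Sum>k=1..Suc N. hcoef N k * hslope k ^ r) = 1"
proof -
  have "0 = (\<Sum>k\<le>Suc N. (-1) ^ k * real (Suc N choose k) * (1 + (-2) * real k) ^ r)"
    using alternating_binomial_powers[of r "Suc N" 1 "-2"] assms by simp
  also have "\<dots> = 1 + (\<Sum>k=1..Suc N. (-1) ^ k * real (Suc N choose k) * (1 + (-2) * real k) ^ r)"
    by (simp add: atMost_atLeast0 sum.atLeast_Suc_atMost)
  also have "(\<Sum>k=1..Suc N. (-1) ^ k * real (Suc N choose k) * (1 + (-2) * real k) ^ r) = - (\<Sum>k=1..Suc N. hcoef N k * hslope k ^ r)"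
    unfolding sum_negf[symmetric] by (rule sum.cong) (simp_all add: hcoef_def hslope_def)
  finally show ?thesis by simp
qed

text \<open>Higher order reflection across \<open>0\<close> (Hestenes): the moment identities match all derivatives
  up to order \<open>N\<close> at the origin.\<close>

definition hext :: "nat \<Rightarrow> (nat \<Rightarrow> real \<Rightarrow> complex) \<Rightarrow> nat \<Rightarrow> real \<Rightarrow> complex" where
  "hext N h r x = (if 0 \<le> x then h r x else
     (\<Sum>k=1..Suc N. of_real (hcoef N k * hslope k ^ r) * h r (hslope k * x)))"

lemma jet_hext:
  assumes h: "jet {0..} N h"
  shows "jet UNIV N (hext N h)"
proof -
  define g where "g r x = (\<Sum>k=1..Suc N. of_real (hcoef N k * hslope k ^ r) * h r (hslope k * x))" for r x
  have im: "(\<lambda>x. hslope k * x) ` {..0} \<subseteq> {0..}" if "k \<in> {1..Suc N}" for k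
    using hslope_le[OF that] by (auto intro: mult_nonpos_nonpos)
  have g0: "g r 0 = h r 0" if "r \<le> N" for r
  proof -
    have "g r 0 = of_real (\<Sum>k=1..Suc N. hcoef N k * hslope k ^ r) * h r 0"
      unfolding g_def by (simp only: mult_zero_right of_real_sum sum_distrib_right)
    then show ?thesis unfolding hcoef_moments[OF that] by simp
  qed
  have dg: "(g r has_vector_derivative g (Suc r) x) (at x within {..0})" if r: "r < N" and x: "x \<le> 0" for r x
    unfolding g_def
  proof (rule has_vector_derivative_sum)
    fix k assume k: "k \<in> {1..Suc N}"
    have "((\<lambda>x. hslope k * x) has_vector_derivative hslope k) (at x within {..0})"
      by (auto intro!: derivative_eq_intros)
    moreover have "(h r has_vector_derivative h (Suc r) (hslope k * x)) (at (hslope k * x) within (\<lambda>x. hslope k * x) ` {..0})"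
    proof (rule has_vector_derivative_within_subset[OF _ im[OF k]])
      show "(h r has_vector_derivative h (Suc r) (hslope k * x)) (at (hslope k * x) within {0..})"
        using hslope_le[OF k] x r by (intro jetD[OF h]) (auto intro: mult_nonpos_nonpos)
    qed
    ultimately have "((h r o (\<lambda>x. hslope k * x)) has_vector_derivative hslope k *\<^sub>R h (Suc r) (hslope k * x)) (at x within {..0})"
      by (rule vector_diff_chain_within)
    then have "((\<lambda>x. of_real (hcoef N k * hslope k ^ r) * h r (hslope k * x)) has_vector_derivative of_real (hcoef N k * hslope k ^ r) * (hslope k *\<^sub>R h (Suc r) (hslope k * x))) (at x within {..0})"
      unfolding o_def by (rule has_vector_derivative_mult_right)
    then show "((\<lambda>x. of_real (hcoef N k * hslope k ^ r) * h r (hslope k * x)) has_vector_derivative of_real (hcoef N k * hslope k ^ Suc r) * h (Suc r) (hslope k * x)) (at x within {..0})"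
      by (simp add: scaleR_conv_of_real mult_ac)
  qed
  have he: "hext N h r = (\<lambda>x. if 0 \<le> x then h r x else g r x)" for r by (simp add: hext_def g_def fun_eq_iff)
  show ?thesis
    unfolding jet_def he
  proof (intro conjI allI impI ballI)
    fix r x assume r: "r < N"
    have "((\<lambda>x. if 0 \<le> x then h r x else g r x) has_vector_derivative (if 0 \<le> x then h (Suc r) x else g (Suc r) x)) (at x)"
    proof (rule has_vector_derivative_glue)
      show "(h r has_vector_derivative h (Suc r) x) (at x within {0..})" if "0 \<le> x" for x
        using jetD[OF h r] that by simp
      show "(g r has_vector_derivative g (Suc r) x) (at x within {..0})" if "x \<le> 0" for x by (rule dg[OF r that])
    qed (use g0[of r] g0[of "Suc r"] r in simp_all)
    then show "((\<lambda>x. if 0 \<le> x then h r x else g r x) has_vector_derivative (if 0 \<le> x then h (Suc r) x else g (Suc r) x)) (at x within UNIV)" by simp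
  next
    show "continuous_on UNIV (\<lambda>x. if 0 \<le> x then h N x else g N x)"
    proof (rule continuous_on_glue)
      show "continuous_on {0..} (h N)" using h by (simp add: jet_def)
      show "continuous_on {..0} (g N)"
        unfolding g_def
      proof (intro continuous_on_sum continuous_on_mult continuous_on_const)
        fix k assume k: "k \<in> {1..Suc N}"
        show "continuous_on {..0} (\<lambda>x. h N (hslope k * x))"
          by (rule continuous_on_compose2[OF _ _ im[OF k]]) (use h in \<open>auto simp: jet_def intro!: continuous_intros\<close>)
      qed
    qed (use g0 in simp)
  qed
qed

text \<open>The first comparison serves the decay and the weights with nonnegative exponent, the
  second the weight of exponent -1, which belongs to the function itself.\<close>

lemma jbracket_hslope:
  assumes "k \<in> {1..m}"
  shows "jbracket x \<le> jbracket (hslope k * x)" "jbracket (hslope k * x) \<le> \<bar>hslope k\<bar> * jbracket (x::real)"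
proof -
  have s: "hslope k \<le> -1" by (rule hslope_le[OF assms])
  have s2: "1 \<le> (hslope k)\<^sup>2" using s power_mono[of 1 "- hslope k" 2] by simp
  have "1 * x\<^sup>2 \<le> (hslope k)\<^sup>2 * x\<^sup>2" using s2 by (rule mult_right_mono) simp
  then show "jbracket x \<le> jbracket (hslope k * x)" by (simp add: jbracket_def power_mult_distrib abs_mult)
  have "1 + (hslope k * x)\<^sup>2 \<le> (\<bar>hslope k\<bar> * jbracket x)\<^sup>2"
    using s2 by (simp add: jbracket_def power_mult_distrib algebra_simps)
  then show "jbracket (hslope k * x) \<le> \<bar>hslope k\<bar> * jbracket x"
    unfolding jbracket_def[of "hslope k * x"] by (intro real_le_lsqrt) (auto simp: jbracket_real_ge(3) less_imp_le)
qed

text \<open>All exponents \<beta> - r are negative and the reflections do not decrease the bracket,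
  so each reflected term decays at least as fast at x as the estimate at x demands.\<close>

lemma dec_hext:
  assumes d: "dec {0..} N \<beta> B h" and b: "\<beta> < 0"
  obtains C where "dec UNIV N \<beta> C (hext N h)"
proof -
  have B: "B \<ge> 0" using dec_nonneg[OF d] by auto
  define A where "A = (\<Sum>r\<le>N. \<Sum>k=1..Suc N. \<bar>hcoef N k * hslope k ^ r\<bar>)"
  have A0: "(\<Sum>k=1..Suc N. \<bar>hcoef N k * hslope k ^ r\<bar>) \<le> A" if "r \<le> N" for r
    unfolding A_def using that by (intro member_le_sum) (auto intro: sum_nonneg)
  have A: "A \<ge> 0" unfolding A_def by (intro sum_nonneg) auto
  have "cmod (hext N h r x) \<le> ((1 + A) * B) * jbracket x powr (\<beta> - real r)" if r: "r \<le> N" for r x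
  proof (cases "0 \<le> x")
    case True
    have "cmod (hext N h r x) \<le> B * jbracket x powr (\<beta> - real r)" using decD[OF d r, of x] True by (simp add: hext_def)
    also have "\<dots> \<le> (1 + A) * B * jbracket x powr (\<beta> - real r)" using A B by (intro mult_right_mono) (auto simp: distrib_right)
    finally show ?thesis .
  next
    case False
    have "cmod (hext N h r x) \<le> (\<Sum>k=1..Suc N. \<bar>hcoef N k * hslope k ^ r\<bar> * (B * jbracket x powr (\<beta> - real r)))"
      unfolding hext_def if_not_P[OF False]
    proof (rule sum_norm_le)
      fix k assume k: "k \<in> {1..Suc N}"
      have p: "hslope k * x \<ge> 0" using hslope_le[OF k] False by (intro mult_nonpos_nonpos) auto
      have "cmod (h r (hslope k * x)) \<le> B * jbracket (hslope k * x) powr (\<beta> - real r)" using decD[OF d r] p by simp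
      also have "\<dots> \<le> B * jbracket x powr (\<beta> - real r)"
        using B b jbracket_hslope(1)[OF k, of x] jbracket_real_ge(3)[of x] by (intro mult_left_mono powr_mono2') auto
      finally show "cmod (of_real (hcoef N k * hslope k ^ r) * h r (hslope k * x)) \<le> \<bar>hcoef N k * hslope k ^ r\<bar> * (B * jbracket x powr (\<beta> - real r))"
        unfolding norm_mult norm_of_real by (rule mult_left_mono) simp
    qed
    also have "\<dots> = (\<Sum>k=1..Suc N. \<bar>hcoef N k * hslope k ^ r\<bar>) * (B * jbracket x powr (\<beta> - real r))" by (simp only: sum_distrib_right)
    also have "\<dots> \<le> (1 + A) * (B * jbracket x powr (\<beta> - real r))" using A0[OF r] B by (intro mult_right_mono) auto
    finally show ?thesis by (simp add: mult.assoc)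
  qed
  then have "dec UNIV N \<beta> ((1 + A) * B) (hext N h)" by (simp add: dec_def)
  then show ?thesis by (rule that)
qed

text \<open>Each reflected term is integrated by the substitution u = \<open>hslope k\<close> x,
  which returns it to the half line. This makes the reflection bounded for the norms of the theorem;
  the decay hypothesis only enters through convergence and not in the constant
  \<open>C\<close>.\<close>

lemma integral_wt_hext:
  obtains C where "C > 0" "\<And>h \<beta> B. jet {0..} (Suc n) h \<Longrightarrow> dec {0..} (Suc n) \<beta> B h \<Longrightarrow> \<beta> < 0 \<Longrightarrow>
     integral\<^sup>L lborel (wt n 1 (hext (Suc n) h)) \<le> C * (\<Sum>r\<le>Suc n. integral {0..} (\<lambda>x. cmod (h r x) * jbracket x powr (real r - 1)))"
proof -
  let ?N = "Suc n"
  define A where "A r = (\<Sum>k=1..Suc ?N. \<bar>hcoef ?N k\<bar> * \<bar>hslope k\<bar> ^ r)" for r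
  define C where "C = 1 + (\<Sum>r\<le>?N. A r)"
  have A0: "A r \<ge> 0" for r unfolding A_def by (intro sum_nonneg) auto
  have AC: "1 + A r \<le> C" if "r \<le> ?N" for r
    unfolding C_def using that A0 by (intro add_left_mono member_le_sum) auto
  have C: "C > 0" using A0 by (simp add: C_def sum_nonneg add_pos_nonneg)
  have main: "integral\<^sup>L lborel (wt n 1 (hext ?N h)) \<le> C * (\<Sum>r\<le>?N. integral {0..} (\<lambda>x. cmod (h r x) * jbracket x powr (real r - 1)))"
    if h: "jet {0..} ?N h" and d: "dec {0..} ?N \<beta> B h" and b: "\<beta> < 0" for h \<beta> B
  proof -
    define U where "U r x = (if x \<in> {0..} then cmod (h r x) * jbracket x powr (real r - 1) else 0)" for r x
    have U0: "U r x \<ge> 0" for r x by (simp add: U_def)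
    have Um: "U r \<in> borel_measurable borel" if "r \<le> ?N" for r
      unfolding U_def[abs_def]
    proof (rule borel_measurable_continuous_on_if)
      show "{0::real..} \<in> sets borel" by simp
      show "continuous_on {0..} (\<lambda>x. cmod (h r x) * jbracket x powr (real r - 1))"
        unfolding tau_one[symmetric] using tau_pos[of 1] by (intro continuous_intros jet_continuous[OF h that]) (auto simp: less_imp_neq[symmetric])
    qed auto
    have Ui: "integrable lborel (U r)" if r: "r \<le> ?N" for r
    proof (rule Bochner_Integration.integrable_bound)
      show "integrable lborel (\<lambda>x::real. B * jbracket x powr (\<beta> - 1))" by (intro integrable_mult_right integrable_jbracket_powr b)
      show "U r \<in> borel_measurable lborel" using Um[OF r] by simp
      have "U r x \<le> B * jbracket x powr (\<beta> - 1)" for x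
      proof (cases "x \<in> {0..}")
        case True
        have "cmod (h r x) * jbracket x powr (real r - 1) \<le> (B * jbracket x powr (\<beta> - real r)) * jbracket x powr (real r - 1)"
          by (intro mult_right_mono decD[OF d r True]) simp
        also have "\<dots> = B * jbracket x powr (\<beta> - 1)" using jbracket_real_ge(3)[of x] by (simp add: powr_add[symmetric])
        finally show ?thesis using True by (simp add: U_def)
      next
        case False
        then show ?thesis using dec_nonneg[OF d] by (simp add: U_def)
      qed
      then show "AE x in lborel. norm (U r x) \<le> norm (B * jbracket x powr (\<beta> - 1))"
        using U0 by (intro AE_I2) (metis abs_of_nonneg order_trans real_norm_def)
    qed
    have UI: "integral\<^sup>L lborel (U r) = integral {0..} (\<lambda>x. cmod (h r x) * jbracket x powr (real r - 1))" if r: "r \<le> ?N" for r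
      unfolding integral_lborel[OF Ui[OF r], symmetric] unfolding U_def[abs_def] by (rule integral_restrict_UNIV)
    have sc: "integrable lborel (\<lambda>x. U r (hslope k * x))" "integral\<^sup>L lborel (\<lambda>x. U r (hslope k * x)) = integral\<^sup>L lborel (U r) / \<bar>hslope k\<bar>"
      if r: "r \<le> ?N" and k: "k \<in> {1..Suc ?N}" for r k
    proof -
      have nz: "hslope k \<noteq> 0" using hslope_le[OF k] by auto
      show "integrable lborel (\<lambda>x. U r (hslope k * x))"
        using lborel_integrable_real_affine[OF Ui[OF r] nz, of 0] by simp
      show "integral\<^sup>L lborel (\<lambda>x. U r (hslope k * x)) = integral\<^sup>L lborel (U r) / \<bar>hslope k\<bar>"
        using lborel_integral_real_affine[OF nz, of "U r" 0] nz by (simp add: field_simps)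
    qed
    \<comment> \<open>The exponent \<open>Suc r\<close> contains one power of the slope beyond those
      of the chain rule. It pays for the comparison of the weights and is cancelled by the Jacobian
      of the substitution.\<close>
    define V where "V r x = U r x + (\<Sum>k=1..Suc ?N. (\<bar>hcoef ?N k\<bar> * \<bar>hslope k\<bar> ^ Suc r) * U r (hslope k * x))" for r x
    have Vi: "integrable lborel (V r)" if "r \<le> ?N" for r
      unfolding V_def[abs_def] using that by (intro Bochner_Integration.integrable_add Bochner_Integration.integrable_sum integrable_mult_right Ui sc)
    have VI: "integral\<^sup>L lborel (V r) = (1 + A r) * integral\<^sup>L lborel (U r)" if r: "r \<le> ?N" for r
    proof -
      have "integral\<^sup>L lborel (V r) = integral\<^sup>L lborel (U r) + (\<Sum>k=1..Suc ?N. (\<bar>hcoef ?N k\<bar> * \<bar>hslope k\<bar> ^ Suc r) * integral\<^sup>L lborel (\<lambda>x. U r (hslope k * x)))"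
        unfolding V_def[abs_def]
      proof (subst Bochner_Integration.integral_add)
        show "integrable lborel (U r)" by (rule Ui[OF r])
        show "integrable lborel (\<lambda>x. \<Sum>k=1..Suc ?N. (\<bar>hcoef ?N k\<bar> * \<bar>hslope k\<bar> ^ Suc r) * U r (hslope k * x))"
          by (intro Bochner_Integration.integrable_sum integrable_mult_right sc r)
        have "integral\<^sup>L lborel (\<lambda>x. \<Sum>k=1..Suc ?N. (\<bar>hcoef ?N k\<bar> * \<bar>hslope k\<bar> ^ Suc r) * U r (hslope k * x)) =
          (\<Sum>k=1..Suc ?N. integral\<^sup>L lborel (\<lambda>x. (\<bar>hcoef ?N k\<bar> * \<bar>hslope k\<bar> ^ Suc r) * U r (hslope k * x)))"
          by (intro Bochner_Integration.integral_sum integrable_mult_right sc r)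
        then show "integral\<^sup>L lborel (U r) + integral\<^sup>L lborel (\<lambda>x. \<Sum>k=1..Suc ?N. (\<bar>hcoef ?N k\<bar> * \<bar>hslope k\<bar> ^ Suc r) * U r (hslope k * x)) =
          integral\<^sup>L lborel (U r) + (\<Sum>k=1..Suc ?N. (\<bar>hcoef ?N k\<bar> * \<bar>hslope k\<bar> ^ Suc r) * integral\<^sup>L lborel (\<lambda>x. U r (hslope k * x)))"
          by (simp only: integral_mult_right_zero)
      qed
      also have "(\<Sum>k=1..Suc ?N. (\<bar>hcoef ?N k\<bar> * \<bar>hslope k\<bar> ^ Suc r) * integral\<^sup>L lborel (\<lambda>x. U r (hslope k * x))) = A r * integral\<^sup>L lborel (U r)"
        unfolding A_def sum_distrib_right
      proof (rule sum.cong[OF refl])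
        fix k assume k: "k \<in> {1..Suc ?N}"
        have "hslope k \<noteq> 0" using hslope_le[OF k] by auto
        then show "\<bar>hcoef ?N k\<bar> * \<bar>hslope k\<bar> ^ Suc r * integral\<^sup>L lborel (\<lambda>x. U r (hslope k * x)) = \<bar>hcoef ?N k\<bar> * \<bar>hslope k\<bar> ^ r * integral\<^sup>L lborel (U r)"
          unfolding sc(2)[OF r k] by simp
      qed
      finally show ?thesis by (simp add: distrib_right)
    qed
    have le: "cmod (hext ?N h r x) * tau 1 x powr (real r - 1) \<le> V r x" if r: "r \<le> ?N" for r x
    proof (cases "0 \<le> x")
      case True
      have "V r x \<ge> U r x" unfolding V_def using U0 by (simp add: sum_nonneg)
      then show ?thesis using True by (simp add: hext_def U_def tau_one)
    next
      case False
      have "cmod (hext ?N h r x) \<le> (\<Sum>k=1..Suc ?N. (\<bar>hcoef ?N k\<bar> * \<bar>hslope k\<bar> ^ r) * cmod (h r (hslope k * x)))"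
        unfolding hext_def if_not_P[OF False]
        by (rule sum_norm_le) (simp add: norm_mult norm_power abs_mult power_abs)
      then have "cmod (hext ?N h r x) * jbracket x powr (real r - 1) \<le> (\<Sum>k=1..Suc ?N. (\<bar>hcoef ?N k\<bar> * \<bar>hslope k\<bar> ^ r) * cmod (h r (hslope k * x))) * jbracket x powr (real r - 1)"
        by (rule mult_right_mono) simp
      also have "\<dots> \<le> (\<Sum>k=1..Suc ?N. (\<bar>hcoef ?N k\<bar> * \<bar>hslope k\<bar> ^ Suc r) * U r (hslope k * x))"
        unfolding sum_distrib_right
      proof (rule sum_mono)
        fix k assume k: "k \<in> {1..Suc ?N}"
        have s: "\<bar>hslope k\<bar> \<ge> 1" using hslope_le[OF k] by linarith
        have p: "hslope k * x \<in> {0..}" using hslope_le[OF k] False by (auto intro: mult_nonpos_nonpos)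
        have j: "jbracket x > 0" "jbracket (hslope k * x) > 0" by (rule jbracket_real_ge)+
        \<comment> \<open>The exponent r - 1 is negative exactly for r = 0; there the upper
          comparison of the brackets is used, and its factor is the extra power of the slope. For r
          >= 1 the lower comparison is enough.\<close>
        have w: "jbracket x powr (real r - 1) \<le> \<bar>hslope k\<bar> * jbracket (hslope k * x) powr (real r - 1)"
        proof (cases "r = 0")
          case True
          have "jbracket (hslope k * x) \<le> \<bar>hslope k\<bar> * jbracket x" by (rule jbracket_hslope(2)[OF k])
          then show ?thesis using True j by (simp add: powr_minus field_simps)
        next
          case False
          have "jbracket x powr (real r - 1) \<le> jbracket (hslope k * x) powr (real r - 1)"
            using False j jbracket_hslope(1)[OF k, of x] by (intro powr_mono2) auto
          also have "\<dots> \<le> \<bar>hslope k\<bar> * jbracket (hslope k * x) powr (real r - 1)" using s by (simp add: mult_le_cancel_right1)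
          finally show ?thesis .
        qed
        have "(\<bar>hcoef ?N k\<bar> * \<bar>hslope k\<bar> ^ r * cmod (h r (hslope k * x))) * jbracket x powr (real r - 1)
           \<le> (\<bar>hcoef ?N k\<bar> * \<bar>hslope k\<bar> ^ r * cmod (h r (hslope k * x))) * (\<bar>hslope k\<bar> * jbracket (hslope k * x) powr (real r - 1))"
          by (rule mult_left_mono[OF w]) simp
        also have "\<dots> = (\<bar>hcoef ?N k\<bar> * \<bar>hslope k\<bar> ^ Suc r) * U r (hslope k * x)" using p by (simp add: U_def mult_ac)
        finally show "(\<bar>hcoef ?N k\<bar> * \<bar>hslope k\<bar> ^ r * cmod (h r (hslope k * x))) * jbracket x powr (real r - 1) \<le> (\<bar>hcoef ?N k\<bar> * \<bar>hslope k\<bar> ^ Suc r) * U r (hslope k * x)" .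
      qed
      also have "\<dots> \<le> V r x" unfolding V_def using U0 by simp
      finally show ?thesis by (simp add: tau_one)
    qed
    obtain C' where C': "dec UNIV ?N \<beta> C' (hext ?N h)" using dec_hext[OF d b] by metis
    have "integral\<^sup>L lborel (wt n 1 (hext ?N h)) \<le> integral\<^sup>L lborel (\<lambda>x. \<Sum>r\<le>?N. V r x)"
    proof (rule integral_mono)
      show "integrable lborel (wt n 1 (hext ?N h))" by (rule integrable_wt_dec[OF jet_hext[OF h] C' b])
      show "integrable lborel (\<lambda>x. \<Sum>r\<le>?N. V r x)" by (intro Bochner_Integration.integrable_sum Vi) simp
      show "wt n 1 (hext ?N h) x \<le> (\<Sum>r\<le>?N. V r x)" for x unfolding wt_def by (intro sum_mono le) simp
    qed
    also have "\<dots> = (\<Sum>r\<le>?N. (1 + A r) * integral\<^sup>L lborel (U r))"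
    proof -
      have "integral\<^sup>L lborel (\<lambda>x. \<Sum>r\<le>?N. V r x) = (\<Sum>r\<le>?N. integral\<^sup>L lborel (V r))"
        by (intro Bochner_Integration.integral_sum Vi) simp
      also have "\<dots> = (\<Sum>r\<le>?N. (1 + A r) * integral\<^sup>L lborel (U r))"
        by (intro sum.cong refl VI) simp
      finally show ?thesis .
    qed
    also have "\<dots> \<le> (\<Sum>r\<le>?N. C * integral\<^sup>L lborel (U r))"
      using U0 by (intro sum_mono mult_right_mono AC) auto
    also have "\<dots> = C * (\<Sum>r\<le>?N. integral\<^sup>L lborel (U r))" by (simp only: sum_distrib_left)
    also have "(\<Sum>r\<le>?N. integral\<^sup>L lborel (U r)) = (\<Sum>r\<le>?N. integral {0..} (\<lambda>x. cmod (h r x) * jbracket x powr (real r - 1)))"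
      by (intro sum.cong UI) simp_all
    finally show ?thesis .
  qed
  show ?thesis by (rule that[OF C main])
qed

section \<open>The functional calculus\<close>

lemma jet_subset_UNIV: "jet UNIV N h \<Longrightarrow> jet S N h"
  unfolding jet_def by (auto intro: has_vector_derivative_at_within continuous_on_subset)

lemma dec_subset_UNIV: "dec UNIV N \<beta> B h \<Longrightarrow> dec S N \<beta> B h"
  by (simp add: dec_def)

lemma jet_cong: "jet S N h \<Longrightarrow> (\<And>r x. r \<le> N \<Longrightarrow> x \<in> S \<Longrightarrow> k r x = h r x) \<Longrightarrow> jet S N k"
  unfolding jet_def
  by (auto intro: has_vector_derivative_transform continuous_on_eq)

lemma dec_cong: "dec S N \<beta> B h \<Longrightarrow> (\<And>r x. r \<le> N \<Longrightarrow> x \<in> S \<Longrightarrow> k r x = h r x) \<Longrightarrow> dec S N \<beta> B k"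
  unfolding dec_def by simp

lemma cutoff_cutpair: "cutoff \<psi> \<Longrightarrow> cutpair \<psi> (nderiv UNIV 1 \<psi>)"
proof -
  assume c: "cutoff \<psi>"
  then have j: "jet UNIV 1 (\<lambda>r. nderiv UNIV r \<psi>)" by (intro jet_nderiv) (simp add: cutoff_def)
  then show ?thesis using c jetD_UNIV[OF j, of 0] jet_continuous[OF j, of 1]
    unfolding cutpair_def cutoff_def by simp
qed

lemma cutjet_cutpair: "cut_family N \<kappa> \<Longrightarrow> 1 \<le> N \<Longrightarrow> cutpair (\<kappa> 0) (\<kappa> 1)"
proof -
  assume "cut_family N \<kappa>" and N: "1 \<le> N"
  then interpret cut_family N \<kappa> by simp
  have j: "jet UNIV 1 \<kappa>" by (rule jet_mono[OF jet_cut N])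
  show ?thesis unfolding cutpair_def using jetD_UNIV[OF j, of 0] jet_continuous[OF j, of 1] cut_1 cut_0 by simp
qed

lemma alg_plus_dec:
  assumes "f \<in> alg_plus"
  obtains \<beta> B where "\<beta> < 0" "jet {0..} N (\<lambda>r. nderiv {0..} r f)" "dec {0..} N \<beta> B (\<lambda>r. nderiv {0..} r f)" "\<And>x. x < 0 \<Longrightarrow> f x = 0"
proof -
  obtain \<beta> where b: "\<beta> < 0" "symb {0..} \<beta> f" "\<And>x. x < 0 \<Longrightarrow> f x = 0" using assms by (auto simp: alg_plus_def)
  have s: "smooth_on {0..} f" using b(2) by (simp add: symb_def)
  obtain B where "dec {0..} N \<beta> B (\<lambda>r. nderiv {0..} r f)" using symb_dec[OF b(2), of N] by auto
  then show ?thesis using that[OF b(1) jet_nderiv[OF s] _ b(3)] by blast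
qed

lemma alg_dec:
  assumes "f \<in> alg"
  obtains \<beta> B where "\<beta> < 0" "jet UNIV N (\<lambda>r. nderiv UNIV r f)" "dec UNIV N \<beta> B (\<lambda>r. nderiv UNIV r f)"
proof -
  obtain \<beta> where b: "\<beta> < 0" "symb UNIV \<beta> f" using assms by (auto simp: alg_def)
  have s: "smooth_on UNIV f" using b(2) by (simp add: symb_def)
  obtain B where "dec UNIV N \<beta> B (\<lambda>r. nderiv UNIV r f)" using symb_dec[OF b(2), of N] by auto
  then show ?thesis using that[OF b(1) jet_nderiv[OF s]] by blast
qed

lemma nderiv_restr:
  assumes "smooth_on UNIV f" "x \<ge> 0"
  shows "nderiv {0..} r (restr f) x = nderiv UNIV r f x"
proof (rule nderiv_jet[OF jet_subset_UNIV[OF jet_nderiv[OF assms(1), of r]] at_within_atLeast_neq_bot])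
  show "restr f x = nderiv UNIV 0 f x" if "x \<in> {0..}" for x using that by (simp add: restr_def)
qed (use assms in auto)

lemma restr_alg:
  assumes "f \<in> alg" shows "restr f \<in> alg_plus"
proof -
  obtain \<beta> where b: "\<beta> < 0" "symb UNIV \<beta> f" using assms by (auto simp: alg_def)
  have s: "smooth_on UNIV f" using b(2) by (simp add: symb_def)
  have "symb {0..} \<beta> (restr f)"
    unfolding symb_def smooth_on_def
  proof (intro conjI allI ballI)
    fix n and x :: real assume x: "x \<in> {0..}"
    have j: "jet UNIV (Suc n) (\<lambda>r. nderiv UNIV r f)" by (rule jet_nderiv[OF s])
    have "(nderiv {0..} n (restr f) has_vector_derivative nderiv UNIV (Suc n) f x) (at x within {0..})"
      by (rule has_vector_derivative_transform[OF x _ jetD[OF jet_subset_UNIV[OF j] _ x]]) (auto simp: nderiv_restr[OF s])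
    then show "nderiv {0..} n (restr f) differentiable at x within {0..}" by (rule differentiableI_vector)
  next
    fix n
    obtain c where "c > 0" "\<And>x. cmod (nderiv UNIV n f x) \<le> c * jbracket x powr (\<beta> - real n)"
      using b(2) unfolding symb_def by auto
    then show "\<exists>c>0. \<forall>x\<in>{0..}. cmod (nderiv {0..} n (restr f) x) \<le> c * jbracket x powr (\<beta> - real n)"
      by (intro exI[of _ c]) (simp add: nderiv_restr[OF s])
  qed
  then show ?thesis using b(1) by (auto simp: alg_plus_def restr_def intro!: bexI[of _ \<beta>])
qed

lemma alg_plus_norm_mono: "m \<le> n \<Longrightarrow> alg_plus_norm m f \<le> alg_plus_norm n f"
  unfolding alg_plus_norm_def
proof (rule sum_mono2)
  show "0 \<le> integral {0..} (\<lambda>x. cmod (nderiv {0..} r f x) * jbracket x powr (real r - 1))" for r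
    \<comment> \<open>If the integrand is not integrable, the integral is 0 by convention, so the
      summand is nonnegative in either case.\<close>
    by (cases "(\<lambda>x. cmod (nderiv {0..} r f x) * jbracket x powr (real r - 1)) integrable_on {0..}")
       (auto intro: integral_nonneg simp: not_integrable_integral)
qed auto

text \<open>Links the derivative in the statement, formed by \<open>vector_derivative\<close> along
  both axes, to the closed form at scale 1.\<close>

lemma dbar_aa_ext:
  assumes c: "cutpair \<psi> \<psi>'" and j: "jet UNIV (Suc n) (\<lambda>r. nderiv UNIV r f)"
  shows "dbar (aa_ext \<psi> n f) (Complex x y) = edbar n \<psi> \<psi>' 1 (\<lambda>r. nderiv UNIV r f) (x, y)"
proof -
  have e: "aa_ext \<psi> n f = ext n \<psi> 1 (\<lambda>r. nderiv UNIV r f)"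
    by (simp add: fun_eq_iff aa_ext_def ext_def taylor_def tau_one)
  show ?thesis
    unfolding dbar_def e edbar_def
    using vector_derivative_at[OF ext_has_dx[OF j c, of 1 y x]] vector_derivative_at[OF ext_has_dy[OF c, of 1 n "\<lambda>r. nderiv UNIV r f" x y]]
    by simp
qed

text \<open>One order n0 is fixed, the least integer above \<alpha>. The norm bounds for larger n
  follow since the norms increase with n, and the integral of order n is compared with that of order
  n0 on jets of order n+1, which contain those of order n0+1.\<close>

locale hs_calculus = resolvent_growth D H c \<alpha>
  for D :: "'b::complex_banach set" and H :: "'b \<Rightarrow> 'b" and c \<alpha> :: real +
  fixes \<psi>0 \<psi>0' :: "real \<Rightarrow> complex" and n0 :: nat
  assumes spectrum_nonneg: "spectrum D H \<subseteq> complex_of_real ` {0..}"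
    and dense: "closure D = UNIV"
    and cut0: "cutpair \<psi>0 \<psi>0'"
    and n0: "real n0 > \<alpha>" and n0_least: "\<And>n::nat. real n > \<alpha> \<Longrightarrow> n0 \<le> n"
begin

definition gam :: "(real \<Rightarrow> complex) \<Rightarrow> 'b \<Rightarrow>\<^sub>L 'b" where
  "gam f = hs n0 \<psi>0 \<psi>0' 1 (hext (Suc n0) (\<lambda>r. nderiv {0..} r f))"

lemma neg_resolvent: "t < 0 \<Longrightarrow> complex_of_real t \<in> \<rho>"
  using spectrum_nonneg by (auto simp: spectrum_def)

text \<open>Two decaying extensions of the same function differ by a jet that vanishes on the half
  line, where all derivatives are determined by f; its integral is 0 by \<open>hs_zero\<close>. Each
  algebraic property can therefore be checked on the most convenient extension, such as a sum, a
  product or \<open>gj z\<close>.\<close>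

lemma gam_eq:
  assumes G: "jet UNIV (Suc n0) G" "dec UNIV (Suc n0) \<beta> B G" and b: "\<beta> < 0" and f: "\<And>x. x \<ge> 0 \<Longrightarrow> f x = G 0 x"
  shows "gam f = hs n0 \<psi>0 \<psi>0' 1 G"
proof -
  let ?d = "\<lambda>r. nderiv {0..} r f"
  have eq: "?d r x = G r x" if "r \<le> Suc n0" "x \<in> {0..}" for r x
    by (rule nderiv_jet[OF jet_subset_UNIV[OF G(1)] at_within_atLeast_neq_bot _ that]) (use f in auto)
  have jd: "jet {0..} (Suc n0) ?d" by (rule jet_cong[OF jet_subset_UNIV[OF G(1)] eq])
  have dd: "dec {0..} (Suc n0) \<beta> B ?d" by (rule dec_cong[OF dec_subset_UNIV[OF G(2)] eq])
  obtain C where C: "dec UNIV (Suc n0) \<beta> C (hext (Suc n0) ?d)" using dec_hext[OF dd b] by metis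
  have jh: "jet UNIV (Suc n0) (hext (Suc n0) ?d)" by (rule jet_hext[OF jd])
  have "hs n0 \<psi>0 \<psi>0' 1 (\<lambda>r x. hext (Suc n0) ?d r x - G r x) = 0"
  proof (rule hs_zero[OF neg_resolvent cut0 n0 jet_diff[OF jh G(1)] dec_diff[OF C G(2)] b])
    show "hext (Suc n0) ?d r x - G r x = 0" if "r \<le> Suc n0" "x \<ge> 0" for r x
      using eq[of r x] that by (simp add: hext_def)
  qed
  moreover have "hs n0 \<psi>0 \<psi>0' 1 (\<lambda>r x. hext (Suc n0) ?d r x - G r x) = gam f - hs n0 \<psi>0 \<psi>0' 1 G"
    unfolding gam_def
    by (rule hs_diff[OF cut0 n0 order_refl jh integrable_wt_dec[OF jh C b] G(1) integrable_wt_dec[OF G b]])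
  ultimately show ?thesis by simp
qed

lemma gam_ext:
  assumes "f \<in> alg_plus"
  obtains G \<beta> B where "jet UNIV (Suc n0) G" "\<beta> < 0" "dec UNIV (Suc n0) \<beta> B G" "\<And>x. x \<ge> 0 \<Longrightarrow> G 0 x = f x"
    "gam f = hs n0 \<psi>0 \<psi>0' 1 G"
proof -
  obtain \<beta> B where f: "\<beta> < 0" "jet {0..} (Suc n0) (\<lambda>r. nderiv {0..} r f)" "dec {0..} (Suc n0) \<beta> B (\<lambda>r. nderiv {0..} r f)"
    using alg_plus_dec[OF assms] by metis
  obtain C where C: "dec UNIV (Suc n0) \<beta> C (hext (Suc n0) (\<lambda>r. nderiv {0..} r f))" using dec_hext[OF f(3,1)] by metis
  show ?thesis by (rule that[OF jet_hext[OF f(2)] f(1) C]) (simp_all add: hext_def gam_def)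
qed

lemma gam_bounded_op: "f \<in> alg_plus \<Longrightarrow> gam f \<in> bounded_ops"
proof -
  assume "f \<in> alg_plus"
  from gam_ext[OF this] obtain G \<beta> B where G: "jet UNIV (Suc n0) G" "\<beta> < 0" "dec UNIV (Suc n0) \<beta> B G"
    "gam f = hs n0 \<psi>0 \<psi>0' 1 G" by metis
  show ?thesis unfolding G(4)
    by (rule hs_bounded_op[OF cut0 n0 G(1) order_refl integrable_wt_dec[OF G(1,3,2)]])
qed

lemma gam_add:
  assumes f: "f \<in> alg_plus" and g: "g \<in> alg_plus"
  shows "gam (\<lambda>x. f x + g x) = gam f + gam g"
proof -
  obtain F \<beta>1 B1 where F: "jet UNIV (Suc n0) F" "\<beta>1 < 0" "dec UNIV (Suc n0) \<beta>1 B1 F" "\<And>x. x \<ge> 0 \<Longrightarrow> F 0 x = f x"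
    "gam f = hs n0 \<psi>0 \<psi>0' 1 F" by (rule gam_ext[OF f]) (rule that; assumption)
  obtain G \<beta>2 B2 where G: "jet UNIV (Suc n0) G" "\<beta>2 < 0" "dec UNIV (Suc n0) \<beta>2 B2 G" "\<And>x. x \<ge> 0 \<Longrightarrow> G 0 x = g x"
    "gam g = hs n0 \<psi>0 \<psi>0' 1 G" by (rule gam_ext[OF g]) (rule that; assumption)
  define \<beta> where "\<beta> = max \<beta>1 \<beta>2"
  have b: "\<beta> < 0" "\<beta>1 \<le> \<beta>" "\<beta>2 \<le> \<beta>" using F(2) G(2) by (auto simp: \<beta>_def)
  have d: "dec UNIV (Suc n0) \<beta> B1 F" "dec UNIV (Suc n0) \<beta> B2 G"
    by (rule dec_weaken[OF F(3) b(2) order_refl order_refl], simp, rule dec_weaken[OF G(3) b(3) order_refl order_refl], simp)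
  have "gam (\<lambda>x. f x + g x) = hs n0 \<psi>0 \<psi>0' 1 (\<lambda>r x. F r x + G r x)"
    by (rule gam_eq[OF jet_add[OF F(1) G(1)] dec_add[OF d] b(1)]) (simp add: F(4) G(4))
  also have "\<dots> = hs n0 \<psi>0 \<psi>0' 1 F + hs n0 \<psi>0 \<psi>0' 1 G"
    by (rule hs_add[OF cut0 n0 order_refl F(1) integrable_wt_dec[OF F(1,3,2)] G(1) integrable_wt_dec[OF G(1,3,2)]])
  finally show ?thesis by (simp add: F(5) G(5))
qed

lemma gam_cmult:
  assumes f: "f \<in> alg_plus"
  shows "gam (\<lambda>x. a * f x) = a *\<^sub>C gam f"
proof -
  obtain F \<beta>1 B1 where F: "jet UNIV (Suc n0) F" "\<beta>1 < 0" "dec UNIV (Suc n0) \<beta>1 B1 F" "\<And>x. x \<ge> 0 \<Longrightarrow> F 0 x = f x"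
    "gam f = hs n0 \<psi>0 \<psi>0' 1 F" by (rule gam_ext[OF f]) (rule that; assumption)
  have "gam (\<lambda>x. a * f x) = hs n0 \<psi>0 \<psi>0' 1 (\<lambda>r x. a * F r x)"
    by (rule gam_eq[OF jet_cmult[OF F(1)] dec_cmult[OF F(3)] F(2)]) (simp add: F(4))
  also have "\<dots> = a *\<^sub>C hs n0 \<psi>0 \<psi>0' 1 F"
    by (rule hs_cmult[OF cut0 n0 order_refl F(1) integrable_wt_dec[OF F(1,3,2)]])
  finally show ?thesis by (simp add: F(5))
qed

lemma gam_mult:
  assumes f: "f \<in> alg_plus" and g: "g \<in> alg_plus"
  shows "gam (\<lambda>x. f x * g x) = gam f o\<^sub>L gam g"
proof -
  obtain F \<beta>1 B1 where F: "jet UNIV (Suc n0) F" "\<beta>1 < 0" "dec UNIV (Suc n0) \<beta>1 B1 F" "\<And>x. x \<ge> 0 \<Longrightarrow> F 0 x = f x"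
    "gam f = hs n0 \<psi>0 \<psi>0' 1 F" by (rule gam_ext[OF f]) (rule that; assumption)
  obtain G \<beta>2 B2 where G: "jet UNIV (Suc n0) G" "\<beta>2 < 0" "dec UNIV (Suc n0) \<beta>2 B2 G" "\<And>x. x \<ge> 0 \<Longrightarrow> G 0 x = g x"
    "gam g = hs n0 \<psi>0 \<psi>0' 1 G" by (rule gam_ext[OF g]) (rule that; assumption)
  have b: "\<beta>1 + \<beta>2 < 0" using F(2) G(2) by simp
  have "gam (\<lambda>x. f x * g x) = hs n0 \<psi>0 \<psi>0' 1 (jmul F G)"
    by (rule gam_eq[OF jet_mult[OF F(1) G(1)] dec_jmul[OF F(3) G(3)] b]) (simp_all add: jmul_0 F(4) G(4))
  also have "\<dots> = hs n0 \<psi>0 \<psi>0' 1 F o\<^sub>L hs n0 \<psi>0 \<psi>0' 1 G"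
    by (rule hs_mult[OF cut0 n0 F(1,3,2) G(1,3,2), symmetric])
  finally show ?thesis by (simp add: F(5) G(5))
qed

lemma gam_norm:
  assumes n: "real n > \<alpha>"
  shows "\<exists>C. \<forall>f\<in>alg_plus. norm (gam f) \<le> C * alg_plus_norm (n + 1) f"
proof -
  obtain K where K: "K > 0" "\<And>h s. jet UNIV (Suc n0) h \<Longrightarrow> s \<ge> 1 \<Longrightarrow> integrable lborel (wt n0 s h) \<Longrightarrow>
       norm (hs n0 \<psi>0 \<psi>0' s h) \<le> K * integral\<^sup>L lborel (wt n0 s h)"
    by (rule hs_bound[OF cut0 n0]) (rule that; assumption)
  obtain C where C: "C > 0" "\<And>h \<beta> B. jet {0..} (Suc n0) h \<Longrightarrow> dec {0..} (Suc n0) \<beta> B h \<Longrightarrow> \<beta> < 0 \<Longrightarrow>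
     integral\<^sup>L lborel (wt n0 1 (hext (Suc n0) h)) \<le> C * (\<Sum>r\<le>Suc n0. integral {0..} (\<lambda>x. cmod (h r x) * jbracket x powr (real r - 1)))"
    by (rule integral_wt_hext[of n0]) (rule that; assumption)
  have "norm (gam f) \<le> (K * C) * alg_plus_norm (n + 1) f" if f: "f \<in> alg_plus" for f
  proof -
    let ?d = "\<lambda>r. nderiv {0..} r f"
    obtain \<beta> B where b: "\<beta> < 0" "jet {0..} (Suc n0) ?d" "dec {0..} (Suc n0) \<beta> B ?d" using alg_plus_dec[OF f] by metis
    obtain C' where C': "dec UNIV (Suc n0) \<beta> C' (hext (Suc n0) ?d)" using dec_hext[OF b(3,1)] by metis
    have j: "jet UNIV (Suc n0) (hext (Suc n0) ?d)" by (rule jet_hext[OF b(2)])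
    have "norm (gam f) \<le> K * integral\<^sup>L lborel (wt n0 1 (hext (Suc n0) ?d))"
      unfolding gam_def by (rule K(2)[OF j order_refl integrable_wt_dec[OF j C' b(1)]])
    also have "\<dots> \<le> K * (C * alg_plus_norm (Suc n0) f)"
      using C(2)[OF b(2,3,1)] K(1) by (intro mult_left_mono) (simp_all only: alg_plus_norm_def less_imp_le)
    also have "\<dots> \<le> K * (C * alg_plus_norm (n + 1) f)"
      using n0_least[OF n] K(1) C(1) by (intro mult_left_mono alg_plus_norm_mono) auto
    finally show ?thesis by (simp add: mult.assoc)
  qed
  then show ?thesis by blast
qed

text \<open>This uses the reflected extension itself, since its support is explicit: the support of
  f and its images under the inverse reflections. The images are on the nonpositive axis, so the
  whole set avoids the spectrum and the Stone integrals tend to 0.\<close>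

lemma gam_support:
  assumes f: "f \<in> alg_plus" and K: "compact (closure {x. f x \<noteq> 0})"
    and disj: "complex_of_real ` closure {x. f x \<noteq> 0} \<inter> spectrum D H = {}"
  shows "gam f = 0"
proof -
  let ?d = "\<lambda>r. nderiv {0..} r f"
  define S where "S = closure {x. f x \<noteq> 0}"
  obtain \<beta> B where b: "\<beta> < 0" "jet {0..} (Suc n0) ?d" "dec {0..} (Suc n0) \<beta> B ?d" "\<And>x. x < 0 \<Longrightarrow> f x = 0"
    by (rule alg_plus_dec[OF f, of "Suc n0"]) (rule that; assumption)
  define F where "F = hext (Suc n0) ?d"
  have jF: "jet UNIV (Suc n0) F" unfolding F_def by (rule jet_hext[OF b(2)])
  have S0: "x \<in> S" if "f x \<noteq> 0" for x unfolding S_def using that closure_subset[of "{x. f x \<noteq> 0}"] by auto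
  have Spos: "S \<subseteq> {0..}" unfolding S_def using b(4) by (intro closure_minimal) (auto simp: not_less[symmetric])
  define K' where "K' = S \<union> (\<Union>k\<in>{1..Suc (Suc n0)}. (\<lambda>x. x / hslope k) ` S)"
  have hs0: "hslope k \<noteq> 0" if "k \<in> {1..Suc (Suc n0)}" for k using hslope_le[OF that] by linarith
  have cK: "compact K'"
    unfolding K'_def S_def by (intro compact_Un compact_UN K finite_atLeastAtMost compact_continuous_image continuous_intros)
       (use hs0 in auto)
  have F0: "F 0 x = 0" if x: "x \<notin> K'" for x
  proof (cases "0 \<le> x")
    case True
    then show ?thesis using x S0[of x] by (auto simp: F_def hext_def K'_def)
  next
    case False
    have "f (hslope k * x) = 0" if k: "k \<in> {1..Suc (Suc n0)}" for k
    proof (rule ccontr)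
      assume "f (hslope k * x) \<noteq> 0"
      then have "hslope k * x \<in> S" by (rule S0)
      moreover have "x = (hslope k * x) / hslope k" using hslope_le[OF k] by simp
      ultimately have "x \<in> K'" unfolding K'_def using k by blast
      then show False using x by simp
    qed
    then show ?thesis using False unfolding F_def hext_def by (simp del: sum.cl_ivl_Suc)
  qed
  have Krho: "complex_of_real ` K' \<subseteq> \<rho>"
  proof -
    have S\<rho>: "complex_of_real x \<in> \<rho>" if "x \<in> S" for x
      using disj that by (auto simp: spectrum_def S_def)
    have "complex_of_real (x / hslope k) \<in> \<rho>" if x: "x \<in> S" and k: "k \<in> {1..Suc (Suc n0)}" for x k
    \<comment> \<open>A nonzero x is sent to the negative axis, which is free of spectrum. The point
      0 is fixed by the reflections, and if it belongs to the support of f it is outside the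
      spectrum by hypothesis.\<close>
    proof (cases "x = 0")
      case True
      then show ?thesis using S\<rho>[OF x] by simp
    next
      case False
      then have "x / hslope k < 0" using x Spos hslope_le[OF k] by (intro divide_pos_neg) auto
      then show ?thesis by (rule neg_resolvent)
    qed
    then show ?thesis using S\<rho> unfolding K'_def by blast
  qed
  obtain M0 where M0: "M0 > 0" "\<And>x. x \<in> K' \<Longrightarrow> \<bar>x\<bar> \<le> M0"
    using compact_imp_bounded[OF cK] unfolding bounded_pos by auto
  have supp: "jsupp (Suc n0) (M0 + 1) F"
    unfolding jsupp_def
  proof (intro allI impI)
    fix r x assume r: "r \<le> Suc n0" and x: "M0 + 1 \<le> \<bar>x\<bar>"
    have z: "F 0 u = 0" if "u \<in> {u. \<bar>u\<bar> > M0}" for u using F0[of u] M0(2)[of u] that by auto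
    have o: "open {u::real. \<bar>u\<bar> > M0}" by (intro open_Collect_less continuous_intros)
    show "F r x = 0"
      using jet_zero_on_open[OF jF o z, of r x] z[of x] r x by (cases "r = 0") auto
  qed
  have M1: "M0 + 1 > 0" using M0(1) by simp
  have cF: "continuous_on UNIV (F 0)" using jet_continuous[OF jF, of 0] by simp
  have l1: "(\<lambda>k. stone (M0 + 1) (eta k) F) \<longlonglongrightarrow> hs n0 \<psi>0 \<psi>0' 1 F"
    by (rule stone_tendsto_hs[OF cut0 n0 order_refl M1 jF supp])
  have l2: "(\<lambda>k. stone (M0 + 1) (eta k) F) \<longlonglongrightarrow> 0"
    by (rule stone_tendsto_0[where h = F and K = K', OF M1 cF cK Krho F0])
  show ?thesis using LIMSEQ_unique[OF l1 l2] by (simp add: gam_def F_def)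
qed

lemma gam_resolvent:
  assumes "z \<notin> \<real>" shows "gam (restr (\<lambda>x. 1 / (z - complex_of_real x))) = Res z"
proof -
  have z: "Im z \<noteq> 0" using assms by (simp add: complex_is_Real_iff)
  obtain B where B: "dec UNIV (Suc n0) (-1) B (gj z)" using dec_gj[OF z] by metis
  have "gam (restr (\<lambda>x. 1 / (z - complex_of_real x))) = hs n0 \<psi>0 \<psi>0' 1 (gj z)"
    by (rule gam_eq[OF jet_gj[OF z] B]) (simp_all add: restr_def gj_0)
  also have "\<dots> = Res z"
    using neg_resolvent[of "-1"] by (intro hs_resolvent[OF cut0 n0 _ dense z]) simp
  finally show ?thesis .
qed

text \<open>On the whole line f is its own extension, so \<open>gam_eq\<close> applies to its jet,
  and \<open>hs_independent\<close> passes from the fixed order and cut-off to the given ones. The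
  integral is then carried back from pairs of reals to the complex plane.\<close>

lemma gam_alg:
  assumes f: "f \<in> alg" and n: "real n > \<alpha>" and cp: "cutoff \<psi>"
  shows "norm_convergent (hs_integrand D H \<psi> n f)"
    and "gam (restr f) = - (1 / pi) *\<^sub>R integral UNIV (hs_integrand D H \<psi> n f)"
proof -
  let ?d = "\<lambda>r. nderiv UNIV r f"
  let ?\<psi>' = "nderiv UNIV 1 \<psi>"
  have c: "cutpair \<psi> ?\<psi>'" by (rule cutoff_cutpair[OF cp])
  obtain \<beta> B where d: "\<beta> < 0" "jet UNIV (Suc n) ?d" "dec UNIV (Suc n) \<beta> B ?d" using alg_dec[OF f] by metis
  have n0n: "Suc n0 \<le> Suc n" using n0_least[OF n] by simp
  have W: "integrable lborel (wt n 1 ?d)" by (rule integrable_wt_dec[OF d(2,3,1)])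
  let ?F = "\<lambda>p. edbar n \<psi> ?\<psi>' 1 ?d p *\<^sub>C Res (Complex (fst p) (snd p))"
  have eq: "hs_integrand D H \<psi> n f (Complex (fst p) (snd p)) = ?F p" for p
    unfolding hs_integrand_def using dbar_aa_ext[OF c d(2), of "fst p" "snd p"] by simp
  have "?F integrable_on UNIV" by (rule edbar_R_integrable[OF c n d(2) order_refl W])
  then have "((\<lambda>p. hs_integrand D H \<psi> n f (Complex (fst p) (snd p))) has_integral integral UNIV ?F) UNIV"
    unfolding eq by (rule integrable_integral)
  then have i: "(hs_integrand D H \<psi> n f has_integral integral UNIV ?F) UNIV" by (simp only: has_integral_complex_iff)
  have "(\<lambda>p. norm (?F p)) integrable_on UNIV" by (rule norm_edbar_R_integrable[OF c n d(2) order_refl W])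
  then have "((\<lambda>p. norm (hs_integrand D H \<psi> n f (Complex (fst p) (snd p)))) has_integral integral UNIV (\<lambda>p. norm (?F p))) UNIV"
    unfolding eq by (rule integrable_integral)
  then have "((\<lambda>z. norm (hs_integrand D H \<psi> n f z)) has_integral integral UNIV (\<lambda>p. norm (?F p))) UNIV"
    by (simp only: has_integral_complex_iff[of "\<lambda>z. norm (hs_integrand D H \<psi> n f z)"])
  then show "norm_convergent (hs_integrand D H \<psi> n f)" using i by (auto simp: norm_convergent_def)
  have "gam (restr f) = hs n0 \<psi>0 \<psi>0' 1 ?d"
  proof (rule gam_eq[OF jet_mono[OF d(2) n0n] _ d(1)])
    show "dec UNIV (Suc n0) \<beta> B ?d" by (rule dec_weaken[OF d(3) order_refl order_refl n0n]) simp
  qed (simp add: restr_def)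
  also have "\<dots> = hs n \<psi> ?\<psi>' 1 ?d" by (rule hs_independent[OF cut0 n0 c n d(2,3,1) n0n order_refl])
  also have "\<dots> = - (1 / pi) *\<^sub>R integral UNIV (hs_integrand D H \<psi> n f)"
    unfolding hs_def using integral_unique[OF i] by simp
  finally show "gam (restr f) = - (1 / pi) *\<^sub>R integral UNIV (hs_integrand D H \<psi> n f)" .
qed

lemma gam_functional_calculus: "functional_calculus D H \<alpha> gam"
  unfolding functional_calculus_def
proof (intro conjI ballI allI impI)
  show "gam f = 0" if "f \<in> alg_plus"
    "compact (closure {x. f x \<noteq> 0}) \<and> complex_of_real ` closure {x. f x \<noteq> 0} \<inter> spectrum D H = {}" for f
    using that by (intro gam_support) simp_all
qed (rule gam_bounded_op gam_add gam_cmult gam_mult gam_norm gam_resolvent; assumption)+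

end

theorem theorem2p11:
  fixes D :: "'b::complex_banach set" and H :: "'b \<Rightarrow> 'b" and c \<alpha> :: real
  assumes "linear_operator D H" and "closed_operator D H" and "densely_defined D"
    and "spectrum D H \<subseteq> complex_of_real ` {0..}"
    and "\<And>z. z \<notin> \<real> \<Longrightarrow> z \<in> resolvent_set D H"
    and "c > 0" and "\<alpha> \<ge> 0"
    and "\<And>z. z \<notin> \<real> \<Longrightarrow>
           norm (resolvent D H z) \<le> c * inverse \<bar>Im z\<bar> * (jbracket z / \<bar>Im z\<bar>) powr \<alpha>"
  shows "\<exists>\<gamma>. functional_calculus D H \<alpha> \<gamma> \<and>
           (\<forall>f\<in>alg. restr f \<in> alg_plus \<and>
              (\<forall>n \<psi>. real n > \<alpha> \<longrightarrow> cutoff \<psi> \<longrightarrow>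
                 norm_convergent (hs_integrand D H \<psi> n f) \<and>
                 \<gamma> (restr f) = - (1 / pi) *\<^sub>R integral UNIV (hs_integrand D H \<psi> n f)))"
proof -
  obtain \<kappa> where cf: "cut_family 1 \<kappa>" using cut_family_exists by blast
  \<comment> \<open>The least integer strictly above \<alpha>, also when \<alpha> is itself an
    integer.\<close>
  define n0 where "n0 = nat \<lfloor>\<alpha>\<rfloor> + 1"
  have least: "n0 \<le> n" if "real n > \<alpha>" for n
    using assms(7) that unfolding n0_def by linarith
  have n0: "real n0 > \<alpha>" using assms(7) unfolding n0_def by linarith
  interpret hs_calculus D H c \<alpha> "\<kappa> 0" "\<kappa> 1" n0
    using assms cutjet_cutpair[OF cf] n0 least by unfold_locales (auto simp: densely_defined_def)
  show ?thesis
  proof (intro exI[of _ gam] conjI ballI allI impI)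
    show "functional_calculus D H \<alpha> gam" by (rule gam_functional_calculus)
  qed (rule restr_alg gam_alg; assumption)+
qed

end
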